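(* The following hold. (i) $\ker\rho'=(G_1)$ in $U'$, and $\ker\rho=(G_1)$ in $U$. (ii) $\ker\rho_s'=(0)$ in $U_s'$, and $\ker\rho_s=(0)$ in $U_s$.
   Context: The base field is $\mathbb C$ and $n$ is a fixed positive integer. $E_{ij}$ are the elementary matrices; indices run over $1,\dots,n$ for $\mathfrak{gl}(n)$ and over $0,\dots,n$ for $\mathfrak{gl}(n+1)$. Write $U=U(\mathfrak{gl}(n+1))$, $U_s=U(\mathfrak{sl}(n+1))\subset U$, and $G_1=\sum_{i=0}^nE_{ii}$. For an element $r$ of a ring, $(r)$ is the two-sided ideal it generates. $\mathcal D'(n)$ is the subalgebra of the algebra of differential operators on $\mathbb C[t_0^{\pm1},t_1,\dots,t_n]$ generated by $\frac{t_i}{t_0}$ ($1\le i\le n$) and $t_0\partial_j$ ($0\le j\le n$), where $\partial_j=\partial/\partial t_j$; $\mathcal E=\sum_{i=0}^n t_i\partial_i$. Put $R_1=-\frac1{n+1}\left(\mathcal E\otimes1+1\otimes\sum_{i=1}^nE_{ii}\right)$. The map $\rho:U\to\mathcal D'(n)\otimes U(\mathfrak{gl}(n))$ is the homomorphism of associative unital algebras determined by $E_{ab}\mapsto t_a\partial_b\otimes1+1\otimes E_{ab}+\delta_{ab}R_1$ for $a,b>0$; $E_{a0}\mapsto t_a\partial_0\otimes1-\sum_{i>0}\frac{t_i}{t_0}\otimes E_{ai}$ for $a>0$; $E_{0b}\mapsto t_0\partial_b\otimes1$ for $b>0$; $E_{00}\mapsto t_0\partial_0\otimes1+R_1$. The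 map $\rho_s:U_s\to\mathcal D'(n)\otimes U(\mathfrak{gl}(n))$ is the restriction of $\rho$ to $U_s$. For a central variable $T$, $C_{n+1}(T)$ is the column determinant of the $(n+1)\times(n+1)$ matrix $A$ with entries $A_{ij}=E_{ij}-\delta_{ij}(T+i)$, $0\le i,j\le n$, i.e. $C_{n+1}(T)=\sum_\sigma\operatorname{sgn}(\sigma)A_{\sigma(0)0}A_{\sigma(1)1}\cdots A_{\sigma(n)n}$ over permutations $\sigma$ of $\{0,\dots,n\}$; its coefficients are central in $U$. $U'=U[X]/(C_{n+1}(X))$ with $X$ a central variable; $U$ embeds naturally in $U'$. $\rho':U'\to\mathcal D'(n)\otimes U(\mathfrak{gl}(n))$ is the (well-defined) algebra homomorphism with $\rho'(w)=\rho(w)$ for $w\in U$ and $\rho'(X)=\mathcal E\otimes1+R_1$. $\pi_g:U\to U_s$ is the algebra homomorphism with $\pi_g(B)=B-\frac1{n+1}\operatorname{tr}(B)G_1$ for $B\in\mathfrak{gl}(n+1)$ (where $G_1$ is the identity matrix). $\pi_g':U'\to U'$ is the algebra homomorphism with $\pi_g'(w)=\pi_g(w)$ for $w\in U$ and $\pi_g'(X)=X-\frac1{n+1}G_1$. $U_s'\subset U'$ is the image of $\pi_g'$, and $\rho_s':U_s'\to\mathcal D'(n)\otimes U(\mathfrak{gl}(n))$ is the restriction of $\rho'$ to $U_s'$. *)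

theory Defs
  imports "HOL-Algebra.Algebra" "HOL-Library.Poly_Mapping" "HOL-Combinatorics.Permutations"
begin

section \<open>Associative unital algebras over the complex numbers\<close>

text \<open>
  A (not necessarily commutative) complex algebra is represented by a record of type
  \<open>(complex, 'a) module\<close>: a ring together with a scalar multiplication. The library locale
  \<^locale>\<open>algebra\<close> is not used because it requires commutativity.
\<close>

text \<open>Homomorphisms are extensional, so that a homomorphism determined by its values on
  generators is unique as a HOL function.\<close>

definition alg_hom :: "(complex, 'a, 'x) module_scheme \<Rightarrow> (complex, 'b, 'y) module_scheme \<Rightarrow> ('a \<Rightarrow> 'b) set"
  where "alg_hom A B =
    {h \<in> ring_hom A B \<inter> extensional (carrier A).
       \<forall>c. \<forall>x\<in>carrier A. h (c \<odot>\<^bsub>A\<^esub> x) = c \<odot>\<^bsub>B\<^esub> h x}"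

definition subalg :: "(complex, 'a) module \<Rightarrow> 'a set \<Rightarrow> (complex, 'a) module"
  where "subalg A S = A\<lparr>carrier :=
    \<Inter>{B. S \<subseteq> B \<and> subring B A \<and> (\<forall>c. \<forall>x\<in>B. c \<odot>\<^bsub>A\<^esub> x \<in> B)}\<rparr>"

text \<open>The quotient ring \<^term>\<open>A Quot I\<close> with the induced scalar multiplication.\<close>

definition alg_quot :: "(complex, 'a) module \<Rightarrow> 'a set \<Rightarrow> (complex, 'a set) module"
  where "alg_quot A I = \<lparr>
    carrier = carrier (A Quot I),
    monoid.mult = monoid.mult (A Quot I),
    monoid.one = monoid.one (A Quot I),
    ring.zero = ring.zero (A Quot I),
    ring.add = ring.add (A Quot I),
    smult = (\<lambda>c K. \<Union>x\<in>K. I +>\<^bsub>A\<^esub> (c \<odot>\<^bsub>A\<^esub> x))\<rparr>"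

text \<open>The algebra $A[X]$ with $X$ central; the library's \<^const>\<open>UP\<close> only provides scalars
  from \<open>A\<close> itself.\<close>

definition poly_alg :: "(complex, 'a) module \<Rightarrow> (complex, nat \<Rightarrow> 'a) module"
  where "poly_alg A = \<lparr>
    carrier = carrier (UP A),
    monoid.mult = monoid.mult (UP A),
    monoid.one = monoid.one (UP A),
    ring.zero = ring.zero (UP A),
    ring.add = ring.add (UP A),
    smult = (\<lambda>c p i. c \<odot>\<^bsub>A\<^esub> p i)\<rparr>"

definition pm_scale :: "complex \<Rightarrow> ('a \<Rightarrow>\<^sub>0 complex) \<Rightarrow> ('a \<Rightarrow>\<^sub>0 complex)"
  where "pm_scale c f = Poly_Mapping.map (\<lambda>z. c * z) f"

definition monoid_alg :: "('m, 'z) monoid_scheme \<Rightarrow> (complex, 'm \<Rightarrow>\<^sub>0 complex) module"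
  where "monoid_alg M = \<lparr>
    carrier = {f. Poly_Mapping.keys f \<subseteq> carrier M},
    monoid.mult = (\<lambda>f g. \<Sum>x\<in>Poly_Mapping.keys f. \<Sum>y\<in>Poly_Mapping.keys g.
      Poly_Mapping.single (x \<otimes>\<^bsub>M\<^esub> y) (Poly_Mapping.lookup f x * Poly_Mapping.lookup g y)),
    monoid.one = Poly_Mapping.single \<one>\<^bsub>M\<^esub> 1,
    ring.zero = 0,
    ring.add = (+),
    smult = pm_scale\<rparr>"

definition free_alg :: "'a set \<Rightarrow> (complex, 'a list \<Rightarrow>\<^sub>0 complex) module"
  where "free_alg S = monoid_alg \<lparr>carrier = lists S, monoid.mult = (@), monoid.one = []\<rparr>"

text \<open>
  The vector space underlying the monoid algebra of \<^term>\<open>A \<times>\<times> B\<close> is the free vector space on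
  pairs, with $(a,b)(a',b') = (aa',bb')$. The span of the bilinearity relations is a two-sided
  ideal in it, so the quotient below is the usual tensor product with its usual multiplication.
\<close>

definition tensor_rels :: "(complex, 'a) module \<Rightarrow> (complex, 'b) module \<Rightarrow> ('a \<times> 'b \<Rightarrow>\<^sub>0 complex) set"
  where "tensor_rels A B =
    (let p = (\<lambda>a b. Poly_Mapping.single (a, b) (1::complex)) in
      {p (a \<oplus>\<^bsub>A\<^esub> a') b - p a b - p a' b | a a' b.
         a \<in> carrier A \<and> a' \<in> carrier A \<and> b \<in> carrier B} \<union>
      {p a (b \<oplus>\<^bsub>B\<^esub> b') - p a b - p a b' | a b b'.
         a \<in> carrier A \<and> b \<in> carrier B \<and> b' \<in> carrier B} \<union>
      {p (c \<odot>\<^bsub>A\<^esub> a) b - pm_scale c (p a b) | c a b. a \<in> carrier A \<and> b \<in> carrier B} \<union>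
      {p a (c \<odot>\<^bsub>B\<^esub> b) - pm_scale c (p a b) | c a b. a \<in> carrier A \<and> b \<in> carrier B})"

definition tensor_ideal :: "(complex, 'a) module \<Rightarrow> (complex, 'b) module \<Rightarrow> ('a \<times> 'b \<Rightarrow>\<^sub>0 complex) set"
  where "tensor_ideal A B = Idl\<^bsub>monoid_alg (A \<times>\<times> B)\<^esub> (tensor_rels A B)"

definition tensor_alg ::
    "(complex, 'a) module \<Rightarrow> (complex, 'b) module \<Rightarrow> (complex, ('a \<times> 'b \<Rightarrow>\<^sub>0 complex) set) module"
  where "tensor_alg A B = alg_quot (monoid_alg (A \<times>\<times> B)) (tensor_ideal A B)"

definition tens ::
    "(complex, 'a) module \<Rightarrow> (complex, 'b) module \<Rightarrow> 'a \<Rightarrow> 'b \<Rightarrow> ('a \<times> 'b \<Rightarrow>\<^sub>0 complex) set"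
  where "tens A B a b =
    tensor_ideal A B +>\<^bsub>monoid_alg (A \<times>\<times> B)\<^esub> Poly_Mapping.single (a, b) 1"


section \<open>Lie algebras and universal enveloping algebras\<close>

record 'a lie_algebra = "'a partial_object" +
  lie_add :: "'a \<Rightarrow> 'a \<Rightarrow> 'a"
  lie_scale :: "complex \<Rightarrow> 'a \<Rightarrow> 'a"
  lie_bracket :: "'a \<Rightarrow> 'a \<Rightarrow> 'a"

text \<open>
  The tensor algebra on $\mathfrak g$ is presented as the free algebra on the set $\mathfrak g$
  modulo the relations expressing that the generators depend linearly on $\mathfrak g$.
\<close>

definition uea_rels :: "'a lie_algebra \<Rightarrow> ('a list \<Rightarrow>\<^sub>0 complex) set"
  where "uea_rels g =
    (let x = (\<lambda>a. Poly_Mapping.single [a] (1::complex)); F = free_alg (carrier g) in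
      {x (lie_add g a b) - x a - x b | a b. a \<in> carrier g \<and> b \<in> carrier g} \<union>
      {x (lie_scale g c a) - pm_scale c (x a) | c a. a \<in> carrier g} \<union>
      {x a \<otimes>\<^bsub>F\<^esub> x b - x b \<otimes>\<^bsub>F\<^esub> x a - x (lie_bracket g a b) | a b.
         a \<in> carrier g \<and> b \<in> carrier g})"

definition uea_ideal :: "'a lie_algebra \<Rightarrow> ('a list \<Rightarrow>\<^sub>0 complex) set"
  where "uea_ideal g = Idl\<^bsub>free_alg (carrier g)\<^esub> (uea_rels g)"

definition uea :: "'a lie_algebra \<Rightarrow> (complex, ('a list \<Rightarrow>\<^sub>0 complex) set) module"
  where "uea g = alg_quot (free_alg (carrier g)) (uea_ideal g)"

definition uea_gen :: "'a lie_algebra \<Rightarrow> 'a \<Rightarrow> ('a list \<Rightarrow>\<^sub>0 complex) set"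
  where "uea_gen g a = uea_ideal g +>\<^bsub>free_alg (carrier g)\<^esub> Poly_Mapping.single [a] 1"

text \<open>
  Matrices with rows and columns indexed by a finite set \<open>I\<close> are functions vanishing outside
  \<open>I \<times> I\<close>, so that both $\mathfrak{gl}(n)$ (indices $1,\dots,n$) and $\mathfrak{gl}(n+1)$
  (indices $0,\dots,n$) keep their own index sets.
\<close>

type_synonym cmat = "nat \<Rightarrow> nat \<Rightarrow> complex"

definition gl :: "nat set \<Rightarrow> cmat lie_algebra"
  where "gl I = \<lparr>
    carrier = {B. \<forall>i j. B i j \<noteq> 0 \<longrightarrow> i \<in> I \<and> j \<in> I},
    lie_add = (\<lambda>B C i j. B i j + C i j),
    lie_scale = (\<lambda>c B i j. c * B i j),
    lie_bracket = (\<lambda>B C i j. (\<Sum>k\<in>I. B i k * C k j) - (\<Sum>k\<in>I. C i k * B k j))\<rparr>"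

definition mtrace :: "nat set \<Rightarrow> cmat \<Rightarrow> complex"
  where "mtrace I B = (\<Sum>i\<in>I. B i i)"

definition sl :: "nat set \<Rightarrow> cmat lie_algebra"
  where "sl I = (gl I)\<lparr>carrier := {B \<in> carrier (gl I). mtrace I B = 0}\<rparr>"

definition emat :: "nat \<Rightarrow> nat \<Rightarrow> cmat"
  where "emat i j = (\<lambda>k l. if k = i \<and> l = j then 1 else 0)"

definition idmat :: "nat set \<Rightarrow> cmat"
  where "idmat I = (\<lambda>k l. if k = l \<and> k \<in> I then 1 else 0)"

type_synonym Uelem = "(cmat list \<Rightarrow>\<^sub>0 complex) set"

abbreviation gl1 :: "nat \<Rightarrow> cmat lie_algebra" where "gl1 n \<equiv> gl {0..n}"
abbreviation gl0 :: "nat \<Rightarrow> cmat lie_algebra" where "gl0 n \<equiv> gl {1..n}"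
abbreviation sl1 :: "nat \<Rightarrow> cmat lie_algebra" where "sl1 n \<equiv> sl {0..n}"

abbreviation U :: "nat \<Rightarrow> (complex, Uelem) module" where "U n \<equiv> uea (gl1 n)"
abbreviation Us :: "nat \<Rightarrow> (complex, Uelem) module" where "Us n \<equiv> uea (sl1 n)"
abbreviation Ugl :: "nat \<Rightarrow> (complex, Uelem) module" where "Ugl n \<equiv> uea (gl0 n)"

abbreviation E :: "nat \<Rightarrow> nat \<Rightarrow> nat \<Rightarrow> Uelem" where "E n i j \<equiv> uea_gen (gl1 n) (emat i j)"
abbreviation E0 :: "nat \<Rightarrow> nat \<Rightarrow> nat \<Rightarrow> Uelem" where "E0 n i j \<equiv> uea_gen (gl0 n) (emat i j)"

definition G1 :: "nat \<Rightarrow> Uelem"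
  where "G1 n = (\<Oplus>\<^bsub>U n\<^esub>i\<in>{0..n}. E n i i)"

text \<open>The inclusion of $U(\mathfrak{sl}(n+1))$ in $U(\mathfrak{gl}(n+1))$.\<close>

definition Us_incl :: "nat \<Rightarrow> Uelem \<Rightarrow> Uelem"
  where "Us_incl n = (THE h. h \<in> alg_hom (Us n) (U n) \<and>
    (\<forall>B\<in>carrier (sl1 n). h (uea_gen (sl1 n) B) = uea_gen (gl1 n) B))"


section \<open>Differential operators on $\mathbb C[t_0^{\pm1},t_1,\dots,t_n]$\<close>

text \<open>
  Exponent vectors are finitely supported integer-valued functions, so that \<open>laurent n\<close> is a
  subring of a library ring. A linear operator on it is an extensional function.
\<close>

type_synonym laur = "(nat \<Rightarrow>\<^sub>0 int) \<Rightarrow>\<^sub>0 complex"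

definition laurent :: "nat \<Rightarrow> laur set"
  where "laurent n = {f. \<forall>e\<in>Poly_Mapping.keys f. Poly_Mapping.keys e \<subseteq> {0..n} \<and> (\<forall>i\<in>{1..n}. 0 \<le> Poly_Mapping.lookup e i)}"

definition lin_ops :: "nat \<Rightarrow> (complex, laur \<Rightarrow> laur) module"
  where "lin_ops n = \<lparr>
    carrier = {D \<in> laurent n \<rightarrow>\<^sub>E laurent n.
      (\<forall>f\<in>laurent n. \<forall>g\<in>laurent n. D (f + g) = D f + D g) \<and>
      (\<forall>c. \<forall>f\<in>laurent n. D (pm_scale c f) = pm_scale c (D f))},
    monoid.mult = compose (laurent n),
    monoid.one = (\<lambda>f\<in>laurent n. f),
    ring.zero = (\<lambda>f\<in>laurent n. 0),
    ring.add = (\<lambda>D D'. \<lambda>f\<in>laurent n. D f + D' f),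
    smult = (\<lambda>c D. \<lambda>f\<in>laurent n. pm_scale c (D f))\<rparr>"

definition mul_op :: "nat \<Rightarrow> laur \<Rightarrow> (laur \<Rightarrow> laur)"
  where "mul_op n f = (\<lambda>g\<in>laurent n. f * g)"

definition partial :: "nat \<Rightarrow> nat \<Rightarrow> (laur \<Rightarrow> laur)"
  where "partial n j = (\<lambda>f\<in>laurent n. \<Sum>e\<in>Poly_Mapping.keys f.
    Poly_Mapping.single (e - Poly_Mapping.single j 1) (of_int (Poly_Mapping.lookup e j) * Poly_Mapping.lookup f e))"

definition tvar :: "nat \<Rightarrow> laur"
  where "tvar i = Poly_Mapping.single (Poly_Mapping.single i 1) 1"

text \<open>The quotient $t_i/t_0$.\<close>

definition tquot :: "nat \<Rightarrow> laur"
  where "tquot i = Poly_Mapping.single (Poly_Mapping.single i 1 - Poly_Mapping.single 0 1) 1"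

text \<open>In characteristic zero the differential operators on a (localized) polynomial ring are
  generated by the multiplication operators and the partial derivatives.\<close>

definition diffops :: "nat \<Rightarrow> (complex, laur \<Rightarrow> laur) module"
  where "diffops n = subalg (lin_ops n) (mul_op n ` laurent n \<union> partial n ` {0..n})"

definition t_partial :: "nat \<Rightarrow> nat \<Rightarrow> nat \<Rightarrow> (laur \<Rightarrow> laur)"
  where "t_partial n i j = mul_op n (tvar i) \<otimes>\<^bsub>diffops n\<^esub> partial n j"

definition Dprime :: "nat \<Rightarrow> (complex, laur \<Rightarrow> laur) module"
  where "Dprime n = subalg (diffops n)
    ((\<lambda>i. mul_op n (tquot i)) ` {1..n} \<union> (\<lambda>j. t_partial n 0 j) ` {0..n})"

definition euler :: "nat \<Rightarrow> (laur \<Rightarrow> laur)"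
  where "euler n = (\<Oplus>\<^bsub>diffops n\<^esub>i\<in>{0..n}. t_partial n i i)"


section \<open>The homomorphism $\rho$\<close>

type_synonym Telem = "((laur \<Rightarrow> laur) \<times> Uelem \<Rightarrow>\<^sub>0 complex) set"

abbreviation Tgt :: "nat \<Rightarrow> (complex, Telem) module"
  where "Tgt n \<equiv> tensor_alg (Dprime n) (Ugl n)"

abbreviation tns :: "nat \<Rightarrow> (laur \<Rightarrow> laur) \<Rightarrow> Uelem \<Rightarrow> Telem"
  where "tns n \<equiv> tens (Dprime n) (Ugl n)"

definition R1 :: "nat \<Rightarrow> Telem"
  where "R1 n = (- 1 / (of_nat n + 1)) \<odot>\<^bsub>Tgt n\<^esub>
    (tns n (euler n) \<one>\<^bsub>Ugl n\<^esub> \<oplus>\<^bsub>Tgt n\<^esub> tns n \<one>\<^bsub>Dprime n\<^esub> (\<Oplus>\<^bsub>Ugl n\<^esub>i\<in>{1..n}. E0 n i i))"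

definition rho :: "nat \<Rightarrow> Uelem \<Rightarrow> Telem"
  where "rho n = (THE h. h \<in> alg_hom (U n) (Tgt n) \<and>
    (\<forall>a\<in>{1..n}. \<forall>b\<in>{1..n}. h (E n a b) =
       tns n (t_partial n a b) \<one>\<^bsub>Ugl n\<^esub> \<oplus>\<^bsub>Tgt n\<^esub> tns n \<one>\<^bsub>Dprime n\<^esub> (E0 n a b)
       \<oplus>\<^bsub>Tgt n\<^esub> (if a = b then R1 n else \<zero>\<^bsub>Tgt n\<^esub>)) \<and>
    (\<forall>a\<in>{1..n}. h (E n a 0) =
       tns n (t_partial n a 0) \<one>\<^bsub>Ugl n\<^esub>
       \<ominus>\<^bsub>Tgt n\<^esub> (\<Oplus>\<^bsub>Tgt n\<^esub>i\<in>{1..n}. tns n (mul_op n (tquot i)) (E0 n a i))) \<and>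
    (\<forall>b\<in>{1..n}. h (E n 0 b) = tns n (t_partial n 0 b) \<one>\<^bsub>Ugl n\<^esub>) \<and>
    h (E n 0 0) = tns n (t_partial n 0 0) \<one>\<^bsub>Ugl n\<^esub> \<oplus>\<^bsub>Tgt n\<^esub> R1 n)"

definition rho_s :: "nat \<Rightarrow> Uelem \<Rightarrow> Telem"
  where "rho_s n = compose (carrier (Us n)) (rho n) (Us_incl n)"


section \<open>The extension $U' = U[X]/(C_{n+1}(X))$\<close>

type_synonym Upelem = "(nat \<Rightarrow> Uelem) set"

abbreviation UX :: "nat \<Rightarrow> (complex, nat \<Rightarrow> Uelem) module" where "UX n \<equiv> poly_alg (U n)"

abbreviation cpoly :: "nat \<Rightarrow> Uelem \<Rightarrow> (nat \<Rightarrow> Uelem)"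
  where "cpoly n w \<equiv> up_ring.monom (UP (U n)) w 0"

abbreviation Xpoly :: "nat \<Rightarrow> (nat \<Rightarrow> Uelem)"
  where "Xpoly n \<equiv> up_ring.monom (UP (U n)) \<one>\<^bsub>U n\<^esub> 1"

definition col_det :: "(complex, 'a) module \<Rightarrow> nat \<Rightarrow> (nat \<Rightarrow> nat \<Rightarrow> 'a) \<Rightarrow> 'a"
  where "col_det R n A = (\<Oplus>\<^bsub>R\<^esub>\<sigma>\<in>{\<sigma>. \<sigma> permutes {0..n}}.
    of_int (sign \<sigma>) \<odot>\<^bsub>R\<^esub> foldr (\<lambda>j p. A (\<sigma> j) j \<otimes>\<^bsub>R\<^esub> p) [0..<Suc n] \<one>\<^bsub>R\<^esub>)"

definition Cpoly :: "nat \<Rightarrow> (nat \<Rightarrow> Uelem)"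
  where "Cpoly n = col_det (UX n) n (\<lambda>i j. cpoly n (E n i j) \<ominus>\<^bsub>UX n\<^esub>
    (if i = j then Xpoly n \<oplus>\<^bsub>UX n\<^esub> of_nat i \<odot>\<^bsub>UX n\<^esub> \<one>\<^bsub>UX n\<^esub> else \<zero>\<^bsub>UX n\<^esub>))"

definition Up_ideal :: "nat \<Rightarrow> (nat \<Rightarrow> Uelem) set"
  where "Up_ideal n = Idl\<^bsub>UX n\<^esub> {Cpoly n}"

definition Up :: "nat \<Rightarrow> (complex, Upelem) module"
  where "Up n = alg_quot (UX n) (Up_ideal n)"

text \<open>The natural embedding of \<open>U\<close> in \<open>U'\<close>, and the class of \<open>X\<close>.\<close>

definition Up_emb :: "nat \<Rightarrow> Uelem \<Rightarrow> Upelem"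
  where "Up_emb n w = Up_ideal n +>\<^bsub>UX n\<^esub> cpoly n w"

definition Up_X :: "nat \<Rightarrow> Upelem"
  where "Up_X n = Up_ideal n +>\<^bsub>UX n\<^esub> Xpoly n"

definition rho' :: "nat \<Rightarrow> Upelem \<Rightarrow> Telem"
  where "rho' n = (THE h. h \<in> alg_hom (Up n) (Tgt n) \<and>
    (\<forall>w\<in>carrier (U n). h (Up_emb n w) = rho n w) \<and>
    h (Up_X n) = tns n (euler n) \<one>\<^bsub>Ugl n\<^esub> \<oplus>\<^bsub>Tgt n\<^esub> R1 n)"

definition pi_g :: "nat \<Rightarrow> Uelem \<Rightarrow> Uelem"
  where "pi_g n = (THE h. h \<in> alg_hom (U n) (Us n) \<and>
    (\<forall>B\<in>carrier (gl1 n). h (uea_gen (gl1 n) B) =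
       uea_gen (sl1 n) (\<lambda>i j. B i j - mtrace {0..n} B / (of_nat n + 1) * idmat {0..n} i j)))"

definition pi_g' :: "nat \<Rightarrow> Upelem \<Rightarrow> Upelem"
  where "pi_g' n = (THE h. h \<in> alg_hom (Up n) (Up n) \<and>
    (\<forall>w\<in>carrier (U n). h (Up_emb n w) = Up_emb n (Us_incl n (pi_g n w))) \<and>
    h (Up_X n) = Up_X n \<ominus>\<^bsub>Up n\<^esub> (1 / (of_nat n + 1)) \<odot>\<^bsub>Up n\<^esub> Up_emb n (G1 n))"

definition Usp :: "nat \<Rightarrow> (complex, Upelem) module"
  where "Usp n = (Up n)\<lparr>carrier := pi_g' n ` carrier (Up n)\<rparr>"

definition rho_s' :: "nat \<Rightarrow> Upelem \<Rightarrow> Telem"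
  where "rho_s' n = restrict (rho' n) (carrier (Usp n))"

end

theory Submission
  imports Defs "Jordan_Normal_Form.Char_Poly"
begin

text \<open>
All four statements rest on one fact. Let \<open>\<theta>\<close> be the image of the central variable under
  \<open>rho'\<close>. If \<open>v\<^sub>0, \<dots>, v\<^sub>n\<close> lie in the enveloping algebra of the special linear Lie algebra
  and \<open>\<Sum>\<^sub>k rho\<^sub>s(v\<^sub>k) \<theta>\<^sup>k = 0\<close>, then every \<open>v\<^sub>k\<close> is zero (\<open>power_independence\<close>).

  The reduction to this fact has two ingredients. The characteristic polynomial is monic up to
  sign, so every element of the extension is \<open>\<Sum>\<^sub>k u\<^sub>k X\<^sup>k\<close> with \<open>k \<le> n\<close> (\<open>Up_normal_form\<close>). And
  \<open>u\<close> differs from its projection \<open>pi_g u\<close> by an element of the ideal of \<open>G1\<close>, while \<open>rho\<close>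
  annihilates \<open>G1\<close> (\<open>proj_mod\<close>, \<open>rho_G1\<close>). Hence the coefficients \<open>u\<^sub>k\<close> of an element of the kernel
  have projection zero, that is, they lie in the ideal of \<open>G1\<close>. The image of the projection
  meets this ideal trivially, since the projection is idempotent and kills \<open>G1\<close>.

  Independence is proved with leading symbols. The tensor product acts on functions of an exponent
  vector \<open>e\<close> and a matrix \<open>g\<close>: differential operators by transposing their action on Laurent
  monomials, matrix units by shifts of \<open>g\<close>. Along points tending to infinity, with \<open>e / s\<close> tending
  to \<open>a\<close> and \<open>g / s\<close> to \<open>c\<close>, the generators act on functions of growth \<open>\<tau>\<^sup>e s\<^sup>d\<close> by numbers times a
  power of \<open>s\<close>. In the limit \<open>rho(E\<^sub>i\<^sub>j)\<close> becomes, up to a multiple of the identity, an entry of a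
  matrix \<open>A\<close> for which \<open>\<tau>\<close> is an eigenvector with eigenvalue \<open>\<lambda> = \<Sum>\<^sub>j a\<^sub>j\<close>, and \<open>\<theta>\<close> becomes
  \<open>\<lambda> - tr A / (n + 1)\<close>. If \<open>f\<^sub>k\<close> denotes the leading form of \<open>v\<^sub>k\<close>, a polynomial function of matrices, then a relation
  \<open>\<Sum>\<^sub>k rho\<^sub>s(v\<^sub>k) \<theta>\<^sup>k = 0\<close> yields
  \<open>\<Sum>\<^sub>k f\<^sub>k(A) (\<lambda> - tr A / (n + 1))\<^sup>k = 0\<close>. As a polynomial identity this extends to every matrix
  \<open>A\<close> and every eigenvalue \<open>\<lambda>\<close> of \<open>A\<close> with an eigenvector of first coordinate one
  (\<open>eigen_identity\<close>).
  Matrices near a suitable bidiagonal one have \<open>n + 1\<close> such eigenvalues (\<open>eigen_pairs\<close>). There the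
  relation is a polynomial of degree at most \<open>n\<close> with \<open>n + 1\<close> zeros, so each \<open>f\<^sub>k\<close> vanishes, first near
  that matrix and then everywhere (\<open>lead_poly_zero\<close>). Thus the \<open>v\<^sub>k\<close> have lower filtration degree
  than assumed, and induction applies. Of the Poincare-Birkhoff-Witt theorem this uses the spanning
  half, \<open>fil_has_lead\<close>; the leading forms are compared coefficientwise in \<open>kappa_zero\<close>.

  The homomorphisms themselves are obtained from universal properties. For \<open>rho\<close> one checks the
  relations of the general linear Lie algebra (\<open>r0_gl\<close>). For \<open>rho'\<close> the characteristic polynomial
  must vanish at \<open>\<theta>\<close>: the shifted matrix annihilates the column of the \<open>t\<^sub>b / t\<^sub>0\<close>, and since the
  column determinant with shifts is alternating in its columns, Cramer's rule applies (\<open>D_null\<close>).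
\<close>

section \<open>Complex algebras\<close>

text \<open>Associative algebras, not necessarily commutative: a scalar may be moved past either factor of a product.\<close>

locale calg = ring A for A :: "(complex, 'a) module" (structure) +
  assumes smult_closed [simp, intro]: "x \<in> carrier A \<Longrightarrow> c \<odot> x \<in> carrier A"
    and smult_l_distr: "x \<in> carrier A \<Longrightarrow> (c + d) \<odot> x = c \<odot> x \<oplus> d \<odot> x"
    and smult_r_distr: "\<lbrakk>x \<in> carrier A; y \<in> carrier A\<rbrakk> \<Longrightarrow> c \<odot> (x \<oplus> y) = c \<odot> x \<oplus> c \<odot> y"
    and smult_assoc: "x \<in> carrier A \<Longrightarrow> c \<odot> (d \<odot> x) = (c * d) \<odot> x"
    and smult_one [simp]: "x \<in> carrier A \<Longrightarrow> 1 \<odot> x = x"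
    and smult_mult_l: "\<lbrakk>x \<in> carrier A; y \<in> carrier A\<rbrakk> \<Longrightarrow> (c \<odot> x) \<otimes> y = c \<odot> (x \<otimes> y)"
    and smult_mult_r: "\<lbrakk>x \<in> carrier A; y \<in> carrier A\<rbrakk> \<Longrightarrow> x \<otimes> (c \<odot> y) = c \<odot> (x \<otimes> y)"
begin

lemma smult_zero_r [simp]: "c \<odot> \<zero> = \<zero>"
  by (metis smult_closed smult_r_distr add.l_cancel_one' zero_closed r_zero)

lemma smult_zero_l [simp]: "x \<in> carrier A \<Longrightarrow> 0 \<odot> x = \<zero>"
  by (metis smult_closed smult_l_distr add.l_cancel_one' add_0)

lemma smult_uminus_l: "x \<in> carrier A \<Longrightarrow> (- c) \<odot> x = \<ominus> (c \<odot> x)"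
  by (metis smult_closed smult_l_distr smult_zero_l add.right_inverse minus_equality add.left_inverse)

lemma smult_uminus_r: "x \<in> carrier A \<Longrightarrow> c \<odot> (\<ominus> x) = \<ominus> (c \<odot> x)"
  by (metis smult_closed smult_r_distr smult_zero_r a_inv_closed l_neg minus_equality)

lemma smult_minus1 [simp]: "x \<in> carrier A \<Longrightarrow> (- 1) \<odot> x = \<ominus> x"
  by (simp add: smult_uminus_l)

lemma smult_diff: "\<lbrakk>x \<in> carrier A; y \<in> carrier A\<rbrakk> \<Longrightarrow> c \<odot> (x \<ominus> y) = c \<odot> x \<ominus> c \<odot> y"
  by (simp add: minus_eq smult_r_distr smult_uminus_r)

lemma smult_finsum:
  "f \<in> I \<rightarrow> carrier A \<Longrightarrow> c \<odot> (\<Oplus>i\<in>I. f i) = (\<Oplus>i\<in>I. c \<odot> f i)"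
  by (induction I rule: infinite_finite_induct) (auto simp: smult_r_distr Pi_def)

lemma finsum_smult_scalar:
  "\<lbrakk>finite I; x \<in> carrier A\<rbrakk> \<Longrightarrow> (\<Oplus>i\<in>I. f i \<odot> x) = (\<Sum>i\<in>I. f i) \<odot> x"
  by (induction I rule: finite_induct) (auto simp: smult_l_distr)

lemma finsum_swap:
  assumes "finite I" "finite J" "\<And>i j. \<lbrakk>i \<in> I; j \<in> J\<rbrakk> \<Longrightarrow> f i j \<in> carrier A"
  shows "(\<Oplus>i\<in>I. \<Oplus>j\<in>J. f i j) = (\<Oplus>j\<in>J. \<Oplus>i\<in>I. f i j)"
  using assms(1,3)
proof (induction I rule: finite_induct)
  case empty
  then show ?case by simp
next
  case (insert x F)
  then have "(\<Oplus>j\<in>J. \<Oplus>i\<in>insert x F. f i j) = (\<Oplus>j\<in>J. f x j \<oplus> (\<Oplus>i\<in>F. f i j))"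
    by (intro finsum_cong') (auto simp: Pi_def)
  with insert show ?case by (simp add: Pi_def finsum_addf)
qed

lemma ideal_smult_closed:
  assumes "ideal I A" "x \<in> I"
  shows "c \<odot> x \<in> I"
proof -
  interpret I: ideal I A by fact
  have x: "x \<in> carrier A" using assms(2) by (rule I.a_Hcarr)
  have "(c \<odot> \<one>) \<otimes> x \<in> I" by (rule I.I_l_closed) (use assms in auto)
  then show ?thesis using x by (simp add: smult_mult_l)
qed

lemma diff_zero_iff: "\<lbrakk>x \<in> carrier A; y \<in> carrier A\<rbrakk> \<Longrightarrow> x \<ominus> y = \<zero> \<longleftrightarrow> x = y"
  by (metis minus_eq r_neg r_right_minus_eq)

end

lemma alg_homI:
  assumes "\<And>x. x \<in> carrier A \<Longrightarrow> h x \<in> carrier B"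
    and "\<And>x y. \<lbrakk>x \<in> carrier A; y \<in> carrier A\<rbrakk> \<Longrightarrow> h (x \<oplus>\<^bsub>A\<^esub> y) = h x \<oplus>\<^bsub>B\<^esub> h y"
    and "\<And>x y. \<lbrakk>x \<in> carrier A; y \<in> carrier A\<rbrakk> \<Longrightarrow> h (x \<otimes>\<^bsub>A\<^esub> y) = h x \<otimes>\<^bsub>B\<^esub> h y"
    and "h \<one>\<^bsub>A\<^esub> = \<one>\<^bsub>B\<^esub>"
    and "\<And>c x. x \<in> carrier A \<Longrightarrow> h (c \<odot>\<^bsub>A\<^esub> x) = c \<odot>\<^bsub>B\<^esub> h x"
    and "h \<in> extensional (carrier A)"
  shows "h \<in> alg_hom A B"
  using assms unfolding alg_hom_def by (auto intro!: ring_hom_memI)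

locale calg_hom = A: calg A + B: calg B
  for A :: "(complex, 'a) module" (structure) and B :: "(complex, 'b) module" (structure) +
  fixes h
  assumes hom: "h \<in> alg_hom A B"
begin

lemma ring_hom: "h \<in> Ring.ring_hom A B"
  using hom by (simp add: alg_hom_def)

sublocale ring_hom_ring A B h
  by (rule ring_hom_ringI2) (auto intro: ring_hom A.ring_axioms B.ring_axioms)

lemma hom_smult [simp]: "x \<in> carrier A \<Longrightarrow> h (c \<odot>\<^bsub>A\<^esub> x) = c \<odot>\<^bsub>B\<^esub> h x"
  using hom by (auto simp: alg_hom_def)

lemma ext: "h \<in> extensional (carrier A)"
  using hom by (simp add: alg_hom_def)

lemma hom_diff: "\<lbrakk>x \<in> carrier A; y \<in> carrier A\<rbrakk> \<Longrightarrow> h (x \<ominus>\<^bsub>A\<^esub> y) = h x \<ominus>\<^bsub>B\<^esub> h y"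
  by (simp add: A.minus_eq B.minus_eq)

end

lemma calg_hom_comp:
  assumes "calg_hom A B f" "calg_hom B C g"
  shows "calg_hom A C (compose (carrier A) g f)"
proof -
  interpret f: calg_hom A B f by fact
  interpret g: calg_hom B C g by fact
  show ?thesis
  proof
    show "compose (carrier A) g f \<in> alg_hom A C"
      by (rule alg_homI) (auto simp: compose_def)
  qed
qed

lemma alg_hom_eqI:
  assumes "h \<in> alg_hom A B" "h' \<in> alg_hom A B" "\<And>x. x \<in> carrier A \<Longrightarrow> h x = h' x"
  shows "h = h'"
  using assms by (auto simp: alg_hom_def intro: extensionalityI)

section \<open>Monoid algebras\<close>

lemma lookup_pm_scale [simp]: "Poly_Mapping.lookup (pm_scale c f) x = c * Poly_Mapping.lookup f x"
  unfolding pm_scale_def by (simp add: Poly_Mapping.map.rep_eq when_def)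

lemma pm_scale_single [simp]: "pm_scale c (Poly_Mapping.single x d) = Poly_Mapping.single x (c * d)"
  by (rule poly_mapping_eqI) (simp add: lookup_single when_def)

lemma pm_scale_add: "pm_scale c (f + g) = pm_scale c f + pm_scale c g"
  by (rule poly_mapping_eqI) (simp add: lookup_add algebra_simps)

lemma pm_scale_zero [simp]: "pm_scale c 0 = 0"
  by (rule poly_mapping_eqI) simp

lemma keys_pm_scale: "Poly_Mapping.keys (pm_scale c f) \<subseteq> Poly_Mapping.keys f"
  by (auto simp: in_keys_iff)

lemma sum_single_keys:
  fixes f :: "'a \<Rightarrow>\<^sub>0 'b::comm_monoid_add"
  shows "(\<Sum>x\<in>Poly_Mapping.keys f. Poly_Mapping.single x (Poly_Mapping.lookup f x)) = f"
  by (rule poly_mapping_eqI)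
     (auto simp: lookup_sum lookup_single when_def sum.delta' in_keys_iff)

lemma pm_induct [consumes 1, case_names zero single add]:
  fixes f :: "'a \<Rightarrow>\<^sub>0 complex"
  assumes "Poly_Mapping.keys f \<subseteq> S"
    and "P 0"
    and "\<And>x c. x \<in> S \<Longrightarrow> P (Poly_Mapping.single x c)"
    and "\<And>f g. \<lbrakk>Poly_Mapping.keys f \<subseteq> S; Poly_Mapping.keys g \<subseteq> S; P f; P g\<rbrakk> \<Longrightarrow> P (f + g)"
  shows "P f"
proof -
  have "Poly_Mapping.keys (\<Sum>x\<in>T. Poly_Mapping.single x (Poly_Mapping.lookup f x)) \<subseteq> S \<and>
      P (\<Sum>x\<in>T. Poly_Mapping.single x (Poly_Mapping.lookup f x))" if "finite T" "T \<subseteq> S" for T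
    using that
  proof (induction T rule: finite_induct)
    case empty
    then show ?case using assms(2) by simp
  next
    case (insert x F)
    let ?s = "Poly_Mapping.single x (Poly_Mapping.lookup f x)"
    have "Poly_Mapping.keys ?s \<subseteq> S" using insert by simp
    with insert show ?case
      using assms(3)[of x] assms(4)[of ?s "\<Sum>x\<in>F. Poly_Mapping.single x (Poly_Mapping.lookup f x)"]
        keys_add[of ?s "\<Sum>x\<in>F. Poly_Mapping.single x (Poly_Mapping.lookup f x)"]
      by auto
  qed
  from this[of "Poly_Mapping.keys f"] assms(1) show ?thesis
    by (simp add: sum_single_keys)
qed

definition pm_mult :: "('m, 'z) monoid_scheme \<Rightarrow> ('m \<Rightarrow>\<^sub>0 complex) \<Rightarrow> ('m \<Rightarrow>\<^sub>0 complex) \<Rightarrow> ('m \<Rightarrow>\<^sub>0 complex)"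
  where "pm_mult M f g = (\<Sum>x\<in>Poly_Mapping.keys f. \<Sum>y\<in>Poly_Mapping.keys g.
      Poly_Mapping.single (x \<otimes>\<^bsub>M\<^esub> y) (Poly_Mapping.lookup f x * Poly_Mapping.lookup g y))"

lemma pm_mult_supset:
  assumes "finite S" "finite T" "Poly_Mapping.keys f \<subseteq> S" "Poly_Mapping.keys g \<subseteq> T"
  shows "pm_mult M f g = (\<Sum>x\<in>S. \<Sum>y\<in>T.
      Poly_Mapping.single (x \<otimes>\<^bsub>M\<^esub> y) (Poly_Mapping.lookup f x * Poly_Mapping.lookup g y))"
proof -
  have "pm_mult M f g = (\<Sum>x\<in>Poly_Mapping.keys f. \<Sum>y\<in>T.
      Poly_Mapping.single (x \<otimes>\<^bsub>M\<^esub> y) (Poly_Mapping.lookup f x * Poly_Mapping.lookup g y))"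
    unfolding pm_mult_def
    by (intro sum.cong refl sum.mono_neutral_left) (use assms in \<open>auto simp: in_keys_iff\<close>)
  also have "\<dots> = (\<Sum>x\<in>S. \<Sum>y\<in>T.
      Poly_Mapping.single (x \<otimes>\<^bsub>M\<^esub> y) (Poly_Mapping.lookup f x * Poly_Mapping.lookup g y))"
    by (intro sum.mono_neutral_left) (use assms in \<open>auto simp: in_keys_iff\<close>)
  finally show ?thesis .
qed

lemma pm_mult_add_l: "pm_mult M (f + f') g = pm_mult M f g + pm_mult M f' g"
proof -
  let ?S = "Poly_Mapping.keys f \<union> Poly_Mapping.keys f'" and ?T = "Poly_Mapping.keys g"
  show ?thesis
    by (subst (1 2 3) pm_mult_supset[of ?S ?T])
       (use keys_add[of f f'] in \<open>auto simp: lookup_add single_add algebra_simps sum.distrib\<close>)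
qed

lemma pm_mult_add_r: "pm_mult M f (g + g') = pm_mult M f g + pm_mult M f g'"
proof -
  let ?T = "Poly_Mapping.keys g \<union> Poly_Mapping.keys g'" and ?S = "Poly_Mapping.keys f"
  show ?thesis
    by (subst (1 2 3) pm_mult_supset[of ?S ?T])
       (use keys_add[of g g'] in \<open>auto simp: lookup_add single_add algebra_simps sum.distrib\<close>)
qed

lemma pm_mult_single [simp]:
  "pm_mult M (Poly_Mapping.single x c) (Poly_Mapping.single y d) = Poly_Mapping.single (x \<otimes>\<^bsub>M\<^esub> y) (c * d)"
  by (subst pm_mult_supset[of "{x}" "{y}"]) auto

lemma pm_mult_zero [simp]: "pm_mult M 0 g = 0" "pm_mult M f 0 = 0"
  by (simp_all add: pm_mult_def)

lemma pm_mult_scale_l: "pm_mult M (pm_scale c f) g = pm_scale c (pm_mult M f g)"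
  by (rule pm_induct[of f UNIV]; (rule pm_induct[of g UNIV])?)
     (simp_all add: pm_scale_add pm_mult_add_l pm_mult_add_r mult_ac)

lemma pm_mult_scale_r: "pm_mult M f (pm_scale c g) = pm_scale c (pm_mult M f g)"
  by (rule pm_induct[of f UNIV]; (rule pm_induct[of g UNIV])?)
     (simp_all add: pm_scale_add pm_mult_add_l pm_mult_add_r mult_ac)

lemma monoid_alg_simps [simp]:
  "carrier (monoid_alg M) = {f. Poly_Mapping.keys f \<subseteq> carrier M}"
  "monoid.mult (monoid_alg M) = pm_mult M"
  "\<one>\<^bsub>monoid_alg M\<^esub> = Poly_Mapping.single \<one>\<^bsub>M\<^esub> 1"
  "\<zero>\<^bsub>monoid_alg M\<^esub> = 0"
  "ring.add (monoid_alg M) = (+)"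
  "module.smult (monoid_alg M) = pm_scale"
  by (simp_all add: monoid_alg_def pm_mult_def [abs_def])

lemma keys_pm_mult:
  assumes "monoid M" "Poly_Mapping.keys f \<subseteq> carrier M" "Poly_Mapping.keys g \<subseteq> carrier M"
  shows "Poly_Mapping.keys (pm_mult M f g) \<subseteq> carrier M"
proof -
  interpret monoid M by fact
  show ?thesis unfolding pm_mult_def
  proof (rule order_trans[OF keys_sum], rule UN_least, rule order_trans[OF keys_sum], rule UN_least)
    fix x y assume "x \<in> Poly_Mapping.keys f" "y \<in> Poly_Mapping.keys g"
    then show "Poly_Mapping.keys (Poly_Mapping.single (x \<otimes>\<^bsub>M\<^esub> y)
        (Poly_Mapping.lookup f x * Poly_Mapping.lookup g y)) \<subseteq> carrier M"
      using assms by auto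
  qed
qed

lemma calg_monoid_alg:
  assumes "monoid M"
  shows "calg (monoid_alg M)"
proof -
  interpret monoid M by fact
  have assoc: "pm_mult M (pm_mult M f g) k = pm_mult M f (pm_mult M g k)"
    if f: "Poly_Mapping.keys f \<subseteq> carrier M" and g: "Poly_Mapping.keys g \<subseteq> carrier M"
      and k: "Poly_Mapping.keys k \<subseteq> carrier M" for f g k
    using f
  proof (induction f rule: pm_induct)
    case (single x c)
    show ?case using g
    proof (induction g rule: pm_induct)
      case (single y d)
      show ?case using k
        by (induction k rule: pm_induct)
           (use \<open>x \<in> carrier M\<close> \<open>y \<in> carrier M\<close> in \<open>auto simp: pm_mult_add_r m_assoc mult_ac\<close>)
    qed (auto simp: pm_mult_add_l pm_mult_add_r)
  qed (auto simp: pm_mult_add_l)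
  have one_l: "pm_mult M (Poly_Mapping.single \<one>\<^bsub>M\<^esub> 1) f = f"
    and one_r: "pm_mult M f (Poly_Mapping.single \<one>\<^bsub>M\<^esub> 1) = f"
    if "Poly_Mapping.keys f \<subseteq> carrier M" for f
    using that by (induction f rule: pm_induct; auto simp: pm_mult_add_l pm_mult_add_r)+
  have "\<exists>y. Poly_Mapping.keys y \<subseteq> carrier M \<and> y + x = 0" if "Poly_Mapping.keys x \<subseteq> carrier M"
    for x :: "'a \<Rightarrow>\<^sub>0 complex"
    by (rule exI[of _ "- x"]) (use that in auto)
  then have "ring (monoid_alg M)"
    by (intro ringI abelian_groupI monoidI)
       (auto simp: keys_pm_mult[OF assms] assoc one_l one_r pm_mult_add_l pm_mult_add_r algebra_simps
         dest!: subsetD[OF keys_add])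
  then show ?thesis
    by (intro calg.intro calg_axioms.intro)
       (auto simp: pm_mult_scale_l pm_mult_scale_r pm_scale_add dest!: subsetD[OF keys_pm_scale]
         intro!: poly_mapping_eqI simp: lookup_add algebra_simps)
qed

definition lin_ext :: "(complex, 'b) module \<Rightarrow> ('m \<Rightarrow> 'b) \<Rightarrow> ('m \<Rightarrow>\<^sub>0 complex) \<Rightarrow> 'b"
  where "lin_ext B \<phi> f = (\<Oplus>\<^bsub>B\<^esub>x\<in>Poly_Mapping.keys f. Poly_Mapping.lookup f x \<odot>\<^bsub>B\<^esub> \<phi> x)"

context calg
begin

lemma lin_ext_supset:
  assumes "finite S" "Poly_Mapping.keys f \<subseteq> S" "\<phi> \<in> S \<rightarrow> carrier A"
  shows "lin_ext A \<phi> f = (\<Oplus>x\<in>S. Poly_Mapping.lookup f x \<odot> \<phi> x)"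
  unfolding lin_ext_def
  by (rule add.finprod_mono_neutral_cong_left) (use assms in \<open>auto simp: in_keys_iff Pi_def\<close>)

lemma lin_ext_closed:
  "\<lbrakk>Poly_Mapping.keys f \<subseteq> S; \<phi> \<in> S \<rightarrow> carrier A\<rbrakk> \<Longrightarrow> lin_ext A \<phi> f \<in> carrier A"
  unfolding lin_ext_def by (rule finsum_closed) auto

lemma lin_ext_add:
  assumes "Poly_Mapping.keys f \<subseteq> S" "Poly_Mapping.keys g \<subseteq> S" "\<phi> \<in> S \<rightarrow> carrier A"
  shows "lin_ext A \<phi> (f + g) = lin_ext A \<phi> f \<oplus> lin_ext A \<phi> g"
proof -
  let ?T = "Poly_Mapping.keys f \<union> Poly_Mapping.keys g"
  have T: "\<phi> \<in> ?T \<rightarrow> carrier A" using assms by auto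
  have "(\<Oplus>x\<in>?T. Poly_Mapping.lookup (f + g) x \<odot> \<phi> x) =
      (\<Oplus>x\<in>?T. Poly_Mapping.lookup f x \<odot> \<phi> x \<oplus> Poly_Mapping.lookup g x \<odot> \<phi> x)"
    by (rule finsum_cong') (use T in \<open>auto simp: lookup_add smult_l_distr Pi_iff\<close>)
  also have "\<dots> = (\<Oplus>x\<in>?T. Poly_Mapping.lookup f x \<odot> \<phi> x) \<oplus> (\<Oplus>x\<in>?T. Poly_Mapping.lookup g x \<odot> \<phi> x)"
    by (rule finsum_addf) (use T in auto)
  finally show ?thesis
    using T keys_add[of f g] by (simp add: lin_ext_supset[of ?T])
qed

lemma lin_ext_single [simp]:
  "\<phi> x \<in> carrier A \<Longrightarrow> lin_ext A \<phi> (Poly_Mapping.single x c) = c \<odot> \<phi> x"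
  by (subst lin_ext_supset[of "{x}"]) auto

lemma lin_ext_zero [simp]: "lin_ext A \<phi> 0 = \<zero>"
  by (simp add: lin_ext_def)

lemma lin_ext_scale:
  assumes "Poly_Mapping.keys f \<subseteq> S" "\<phi> \<in> S \<rightarrow> carrier A"
  shows "lin_ext A \<phi> (pm_scale c f) = c \<odot> lin_ext A \<phi> f"
  using assms(1)
proof (induction f rule: pm_induct)
  case (single x d)
  then have "\<phi> x \<in> carrier A" using assms(2) by auto
  then show ?case by (simp add: smult_assoc)
next
  case (add f g)
  have "Poly_Mapping.keys (pm_scale c f) \<subseteq> S" "Poly_Mapping.keys (pm_scale c g) \<subseteq> S"
    using add(1,2) keys_pm_scale[of c f] keys_pm_scale[of c g] by auto
  then have "lin_ext A \<phi> (pm_scale c (f + g)) = c \<odot> lin_ext A \<phi> f \<oplus> c \<odot> lin_ext A \<phi> g"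
    unfolding pm_scale_add add(3,4)[symmetric] using assms(2) by (rule lin_ext_add)
  also have "\<dots> = c \<odot> lin_ext A \<phi> (f + g)"
    unfolding lin_ext_add[OF add(1,2) assms(2)]
    by (rule smult_r_distr[symmetric]) (rule lin_ext_closed[OF add(1) assms(2)] lin_ext_closed[OF add(2) assms(2)])+
  finally show ?case .
qed simp

end

text \<open>A map that is multiplicative on the monoid extends linearly; multiplicativity of the extension has to be checked on monomials only, because both sides are bilinear.\<close>

lemma monoid_alg_hom_exists:
  assumes "monoid M" "calg B" and \<phi>: "\<phi> \<in> carrier M \<rightarrow> carrier B"
    and mult: "\<And>x y. \<lbrakk>x \<in> carrier M; y \<in> carrier M\<rbrakk> \<Longrightarrow> \<phi> (x \<otimes>\<^bsub>M\<^esub> y) = \<phi> x \<otimes>\<^bsub>B\<^esub> \<phi> y"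
    and one: "\<phi> \<one>\<^bsub>M\<^esub> = \<one>\<^bsub>B\<^esub>"
  shows "\<exists>h\<in>alg_hom (monoid_alg M) B. \<forall>x\<in>carrier M. h (Poly_Mapping.single x 1) = \<phi> x"
proof -
  interpret M: monoid M by fact
  interpret B: calg B by fact
  interpret MA: calg "monoid_alg M" by (rule calg_monoid_alg) fact
  define h where "h = restrict (lin_ext B \<phi>) (carrier (monoid_alg M))"
  have phi: "\<phi> x \<in> carrier B" if "x \<in> carrier M" for x using that \<phi> by auto
  have c: "lin_ext B \<phi> f \<in> carrier B" if "Poly_Mapping.keys f \<subseteq> carrier M" for f
    using that \<phi> by (rule B.lin_ext_closed)
  have m: "lin_ext B \<phi> (pm_mult M f g) = lin_ext B \<phi> f \<otimes>\<^bsub>B\<^esub> lin_ext B \<phi> g"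
    if "Poly_Mapping.keys f \<subseteq> carrier M" and g: "Poly_Mapping.keys g \<subseteq> carrier M" for f g
    using that(1)
  proof (induction f rule: pm_induct)
    case (single x a)
    show ?case using g
    proof (induction g rule: pm_induct)
      case (single y b)
      then show ?case using \<open>x \<in> carrier M\<close>
        by (simp add: phi mult B.smult_mult_l B.smult_mult_r B.smult_assoc mult.commute)
    next
      case (add f g)
      then show ?case using \<open>x \<in> carrier M\<close>
        by (simp add: pm_mult_add_r B.lin_ext_add[of _ "carrier M"] keys_pm_mult M.monoid_axioms \<phi> B.r_distr c phi)
    next
      case zero
      then show ?case using \<open>x \<in> carrier M\<close> by (simp add: phi)
    qed
  next
    case (add f f')
    then show ?case using g
        by (simp add: pm_mult_add_l B.lin_ext_add[of _ "carrier M"] keys_pm_mult M.monoid_axioms \<phi> B.l_distr c)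
  next
    case zero
    then show ?case by (simp add: c g)
  qed
  have "h \<in> alg_hom (monoid_alg M) B"
  proof (rule alg_homI)
    fix f g assume "f \<in> carrier (monoid_alg M)" "g \<in> carrier (monoid_alg M)"
    then show "h (f \<oplus>\<^bsub>monoid_alg M\<^esub> g) = h f \<oplus>\<^bsub>B\<^esub> h g"
      using MA.a_closed[of f g] by (simp add: h_def B.lin_ext_add[OF _ _ \<phi>])
  next
    fix f g assume "f \<in> carrier (monoid_alg M)" "g \<in> carrier (monoid_alg M)"
    then show "h (f \<otimes>\<^bsub>monoid_alg M\<^esub> g) = h f \<otimes>\<^bsub>B\<^esub> h g"
      using MA.m_closed[of f g] by (simp add: h_def m)
  next
    fix a f assume "f \<in> carrier (monoid_alg M)"
    then show "h (a \<odot>\<^bsub>monoid_alg M\<^esub> f) = a \<odot>\<^bsub>B\<^esub> h f"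
      using MA.smult_closed[of f a] by (simp add: h_def B.lin_ext_scale[OF _ \<phi>])
  qed (auto simp: h_def c phi one)
  moreover have "h (Poly_Mapping.single x 1) = \<phi> x" if "x \<in> carrier M" for x
    using that by (simp add: h_def phi)
  ultimately show ?thesis by blast
qed

section \<open>Universal properties of quotients\<close>

lemma (in calg) coset_eq_iff:
  assumes "ideal I A" "x \<in> carrier A" "y \<in> carrier A"
  shows "I +> x = I +> y \<longleftrightarrow> x \<ominus> y \<in> I"
  using quotient_eq_iff_same_a_r_cos[OF assms] by simp

lemma alg_quot_ring_simps:
  "carrier (alg_quot A I) = carrier (A Quot I)"
  "monoid.mult (alg_quot A I) = monoid.mult (A Quot I)"
  "\<one>\<^bsub>alg_quot A I\<^esub> = \<one>\<^bsub>A Quot I\<^esub>"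
  "\<zero>\<^bsub>alg_quot A I\<^esub> = \<zero>\<^bsub>A Quot I\<^esub>"
  "ring.add (alg_quot A I) = ring.add (A Quot I)"
  by (simp_all add: alg_quot_def)

locale calg_ideal = calg A + I: ideal I A for A :: "(complex, 'a) module" (structure) and I
begin

lemma ideal_I: "ideal I A" by (rule I.is_ideal)

lemma carrier_quot: "carrier (alg_quot A I) = (\<lambda>x. I +> x) ` carrier A"
  by (auto simp: alg_quot_ring_simps FactRing_def A_RCOSETS_def')

lemma coset_closed [simp]: "x \<in> carrier A \<Longrightarrow> I +> x \<in> carrier (alg_quot A I)"
  by (simp add: carrier_quot)

lemma coset_mult: "\<lbrakk>x \<in> carrier A; y \<in> carrier A\<rbrakk> \<Longrightarrow> (I +> x) \<otimes>\<^bsub>alg_quot A I\<^esub> (I +> y) = I +> (x \<otimes> y)"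
  using ring_hom_mult[OF I.rcos_ring_hom] by (simp add: alg_quot_ring_simps)

lemma coset_add: "\<lbrakk>x \<in> carrier A; y \<in> carrier A\<rbrakk> \<Longrightarrow> (I +> x) \<oplus>\<^bsub>alg_quot A I\<^esub> (I +> y) = I +> (x \<oplus> y)"
  using ring_hom_add[OF I.rcos_ring_hom] by (simp add: alg_quot_ring_simps)

lemma coset_one: "\<one>\<^bsub>alg_quot A I\<^esub> = I +> \<one>"
  using ring_hom_one[OF I.rcos_ring_hom] by (simp add: alg_quot_ring_simps)

lemma coset_zero: "\<zero>\<^bsub>alg_quot A I\<^esub> = I +> \<zero>"
  using ring_hom_zero[OF I.rcos_ring_hom ring_axioms I.quotient_is_ring] by (simp add: alg_quot_ring_simps)

text \<open>The union in the definition of the scalar action is a single coset, since an ideal is closed under scalar multiples.\<close>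

lemma coset_smult:
  assumes x: "x \<in> carrier A"
  shows "c \<odot>\<^bsub>alg_quot A I\<^esub> (I +> x) = I +> (c \<odot> x)"
proof -
  have eq: "I +> (c \<odot> y) = I +> (c \<odot> x)" if y: "y \<in> I +> x" for y
  proof -
    have yA: "y \<in> carrier A" using y x a_r_coset_subset_G[OF I.a_subset x] by blast
    have "I +> y = I +> x" using a_repr_independence[OF y x I.a_subgroup] by simp
    then have "y \<ominus> x \<in> I" using coset_eq_iff[OF ideal_I yA x] by simp
    then have "c \<odot> (y \<ominus> x) \<in> I" by (rule ideal_smult_closed[OF ideal_I])
    then show ?thesis using x yA by (simp add: coset_eq_iff[OF ideal_I] smult_diff)
  qed
  have "x \<in> I +> x" using I.a_rcos_self x by blast
  then have "(\<Union>y\<in>I +> x. I +> (c \<odot> y)) = I +> (c \<odot> x)"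
    by (subst SUP_cong[OF refl eq]) auto
  then show ?thesis by (simp add: alg_quot_def)
qed

lemma calg_quot: "calg (alg_quot A I)"
proof -
  have "ring (alg_quot A I)"
    by (intro ringI abelian_groupI monoidI)
      (auto simp: carrier_quot coset_mult coset_add coset_one coset_zero m_assoc a_ac
        l_distr r_distr r_neg intro!: bexI[of _ "\<ominus> _"])
  then show ?thesis
    by (intro calg.intro calg_axioms.intro)
       (auto simp: carrier_quot coset_mult coset_add coset_one coset_zero coset_smult
          smult_l_distr smult_r_distr smult_assoc smult_mult_l smult_mult_r)
qed

lemma quot_hom_exists:
  assumes "calg_hom A B h" and ker: "\<And>x. x \<in> I \<Longrightarrow> h x = \<zero>\<^bsub>B\<^esub>"
  shows "\<exists>h'\<in>alg_hom (alg_quot A I) B. \<forall>x\<in>carrier A. h' (I +> x) = h x"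
proof -
  interpret h: calg_hom A B h by fact
  define h' where "h' = (\<lambda>K\<in>carrier (alg_quot A I). h (SOME x. x \<in> carrier A \<and> I +> x = K))"
  have eq: "h' (I +> x) = h x" if x: "x \<in> carrier A" for x
  proof -
    define y where "y = (SOME y. y \<in> carrier A \<and> I +> y = I +> x)"
    have y: "y \<in> carrier A \<and> I +> y = I +> x"
      unfolding y_def by (rule someI[of _ x]) (use x in simp)
    then have "y \<ominus> x \<in> I" using coset_eq_iff[OF ideal_I, of y x] x by simp
    then have "h y \<ominus>\<^bsub>B\<^esub> h x = \<zero>\<^bsub>B\<^esub>" using ker x y h.hom_diff by metis
    then have "h y = h x" using x y by (simp add: h.B.diff_zero_iff)
    then show ?thesis using x by (simp add: h'_def y_def)
  qed
  have "h' \<in> alg_hom (alg_quot A I) B"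
    by (rule alg_homI)
       (auto simp: carrier_quot coset_mult coset_add coset_one coset_smult eq,
        auto simp: h'_def carrier_quot)
  with eq show ?thesis by blast
qed

end

subsection \<open>Universal enveloping algebras\<close>

lemma (in calg) add_diff_diff:
  assumes "x \<in> carrier A" "y \<in> carrier A"
  shows "x \<oplus> y \<ominus> x \<ominus> y = \<zero>"
proof -
  have "x \<oplus> y \<ominus> x = y" using assms by (simp add: minus_eq a_comm[of x y] a_assoc r_neg)
  then show ?thesis using assms by (simp add: diff_zero_iff)
qed

lemma monoid_lists: "monoid \<lparr>carrier = lists S, monoid.mult = (@), monoid.one = []\<rparr>"
  by (rule monoidI) auto

lemma calg_free_alg: "calg (free_alg S)"
  unfolding free_alg_def by (rule calg_monoid_alg, rule monoid_lists)

text \<open>Closure of the carrier puts the defining relations of the enveloping algebra into the free algebra, so that they generate an ideal there.\<close>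

locale lie_closed =
  fixes g :: "'a lie_algebra"
  assumes closed: "\<lbrakk>a \<in> carrier g; b \<in> carrier g\<rbrakk> \<Longrightarrow> lie_add g a b \<in> carrier g"
    "\<lbrakk>a \<in> carrier g; b \<in> carrier g\<rbrakk> \<Longrightarrow> lie_bracket g a b \<in> carrier g"
    "a \<in> carrier g \<Longrightarrow> lie_scale g c a \<in> carrier g"
begin

abbreviation "F \<equiv> free_alg (carrier g)"

lemma free_simps:
  "carrier F = {f. Poly_Mapping.keys f \<subseteq> lists (carrier g)}"
  "\<one>\<^bsub>F\<^esub> = Poly_Mapping.single [] 1"  "\<zero>\<^bsub>F\<^esub> = 0"
  "ring.add F = (+)" "module.smult F = pm_scale"
  "Poly_Mapping.single v a \<otimes>\<^bsub>F\<^esub> Poly_Mapping.single w b = Poly_Mapping.single (v @ w) (a * b)"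
  by (simp_all add: free_alg_def)

sublocale F: calg F by (rule calg_free_alg)

lemma free_uminus: "f \<in> carrier F \<Longrightarrow> \<ominus>\<^bsub>F\<^esub> f = - f"
  by (rule F.minus_equality) (auto simp: free_simps)

lemma free_minus: "f \<in> carrier F \<Longrightarrow> k \<in> carrier F \<Longrightarrow> f \<ominus>\<^bsub>F\<^esub> k = f - k"
  by (simp add: a_minus_def free_uminus, simp add: free_simps)

abbreviation "x a \<equiv> Poly_Mapping.single [a] (1::complex)"

lemma x_closed: "a \<in> carrier g \<Longrightarrow> x a \<in> carrier F"
  by (simp add: free_simps)

lemma rels_eq: "uea_rels g =
   {x (lie_add g a b) \<ominus>\<^bsub>F\<^esub> x a \<ominus>\<^bsub>F\<^esub> x b | a b. a \<in> carrier g \<and> b \<in> carrier g} \<union>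
   {x (lie_scale g c a) \<ominus>\<^bsub>F\<^esub> c \<odot>\<^bsub>F\<^esub> x a | c a. a \<in> carrier g} \<union>
   {x a \<otimes>\<^bsub>F\<^esub> x b \<ominus>\<^bsub>F\<^esub> x b \<otimes>\<^bsub>F\<^esub> x a \<ominus>\<^bsub>F\<^esub> x (lie_bracket g a b) | a b.
         a \<in> carrier g \<and> b \<in> carrier g}"
proof -
  have 1: "x (lie_add g a b) \<ominus>\<^bsub>F\<^esub> x a \<ominus>\<^bsub>F\<^esub> x b = x (lie_add g a b) - x a - x b"
    if "a \<in> carrier g" "b \<in> carrier g" for a b
    using that F.minus_closed by (simp add: free_minus x_closed closed flip: free_minus)
  have 2: "x (lie_scale g c a) \<ominus>\<^bsub>F\<^esub> c \<odot>\<^bsub>F\<^esub> x a = x (lie_scale g c a) - pm_scale c (x a)"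
    if "a \<in> carrier g" for a c
    using that by (subst free_minus) (auto simp: x_closed closed F.smult_closed free_simps)
  have 3: "x a \<otimes>\<^bsub>F\<^esub> x b \<ominus>\<^bsub>F\<^esub> x b \<otimes>\<^bsub>F\<^esub> x a \<ominus>\<^bsub>F\<^esub> x (lie_bracket g a b) =
     x a \<otimes>\<^bsub>F\<^esub> x b - x b \<otimes>\<^bsub>F\<^esub> x a - x (lie_bracket g a b)"
    if "a \<in> carrier g" "b \<in> carrier g" for a b
    using that x_closed[of a] x_closed[of b] x_closed[OF closed(2), of a b]
    by (metis F.m_closed F.minus_closed free_minus)
  show ?thesis unfolding uea_rels_def Let_def
    by (simp add: 1 2 3 cong: rev_conj_cong)
qed

lemma rels_carrier: "uea_rels g \<subseteq> carrier F"
  unfolding rels_eq by (auto intro!: F.minus_closed F.m_closed F.smult_closed x_closed closed)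

sublocale I: calg_ideal F "uea_ideal g"
  unfolding calg_ideal_def uea_ideal_def
  using F.genideal_ideal[OF rels_carrier] calg_free_alg by blast

sublocale U: calg "uea g"
  unfolding uea_def by (rule I.calg_quot)

lemma gen_closed [simp]: "a \<in> carrier g \<Longrightarrow> uea_gen g a \<in> carrier (uea g)"
  unfolding uea_gen_def uea_def by (rule I.coset_closed, rule x_closed)

lemma rel_in: "r \<in> uea_rels g \<Longrightarrow> r \<in> uea_ideal g"
  unfolding uea_ideal_def using F.genideal_self[OF rels_carrier] by blast

lemma gen_add:
  assumes "a \<in> carrier g" "b \<in> carrier g"
  shows "uea_gen g (lie_add g a b) = uea_gen g a \<oplus>\<^bsub>uea g\<^esub> uea_gen g b"
proof -
  have "x (lie_add g a b) \<ominus>\<^bsub>F\<^esub> x a \<ominus>\<^bsub>F\<^esub> x b \<in> uea_ideal g"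
    by (rule rel_in) (use assms in \<open>auto simp: rels_eq\<close>)
  also have "x (lie_add g a b) \<ominus>\<^bsub>F\<^esub> x a \<ominus>\<^bsub>F\<^esub> x b = x (lie_add g a b) \<ominus>\<^bsub>F\<^esub> (x a \<oplus>\<^bsub>F\<^esub> x b)"
    using assms x_closed closed by (simp add: F.minus_eq F.minus_add F.a_assoc)
  finally show ?thesis using assms
    by (simp add: uea_gen_def uea_def I.coset_add x_closed closed F.coset_eq_iff[OF I.ideal_I])
qed

lemma gen_scale:
  assumes "a \<in> carrier g"
  shows "uea_gen g (lie_scale g c a) = c \<odot>\<^bsub>uea g\<^esub> uea_gen g a"
proof -
  have "x (lie_scale g c a) \<ominus>\<^bsub>F\<^esub> c \<odot>\<^bsub>F\<^esub> x a \<in> uea_ideal g"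
    by (rule rel_in) (use assms in \<open>auto simp: rels_eq\<close>)
  then show ?thesis using assms
    by (simp add: uea_gen_def uea_def I.coset_smult x_closed closed F.coset_eq_iff[OF I.ideal_I])
qed

lemma gen_bracket:
  assumes "a \<in> carrier g" "b \<in> carrier g"
  shows "uea_gen g (lie_bracket g a b) =
    uea_gen g a \<otimes>\<^bsub>uea g\<^esub> uea_gen g b \<ominus>\<^bsub>uea g\<^esub> uea_gen g b \<otimes>\<^bsub>uea g\<^esub> uea_gen g a"
proof -
  let ?ab = "x a \<otimes>\<^bsub>F\<^esub> x b" and ?ba = "x b \<otimes>\<^bsub>F\<^esub> x a" and ?c = "x (lie_bracket g a b)"
  have c: "?ab \<in> carrier F" "?ba \<in> carrier F" "?c \<in> carrier F"
    using assms x_closed closed by auto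
  have "?ab \<ominus>\<^bsub>F\<^esub> ?ba \<ominus>\<^bsub>F\<^esub> ?c \<in> uea_ideal g"
    by (rule rel_in) (use assms in \<open>auto simp: rels_eq\<close>)
  also have "?ab \<ominus>\<^bsub>F\<^esub> ?ba \<ominus>\<^bsub>F\<^esub> ?c = ?ab \<ominus>\<^bsub>F\<^esub> (?c \<oplus>\<^bsub>F\<^esub> ?ba)"
    using c by (simp add: F.minus_eq F.minus_add F.a_ac)
  finally have "uea_gen g a \<otimes>\<^bsub>uea g\<^esub> uea_gen g b = uea_gen g (lie_bracket g a b) \<oplus>\<^bsub>uea g\<^esub> uea_gen g b \<otimes>\<^bsub>uea g\<^esub> uea_gen g a"
    using assms c
    by (simp add: uea_gen_def uea_def I.coset_add I.coset_mult x_closed closed F.coset_eq_iff[OF I.ideal_I])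
  then show ?thesis using assms gen_closed closed
    by (simp add: U.minus_eq U.a_assoc U.r_neg)
qed

lemma uea_induct [consumes 1, case_names one gen add mult smult]:
  assumes "u \<in> carrier (uea g)"
    and one: "P \<one>\<^bsub>uea g\<^esub>"
    and gen: "\<And>a. a \<in> carrier g \<Longrightarrow> P (uea_gen g a)"
    and add: "\<And>u v. \<lbrakk>u \<in> carrier (uea g); v \<in> carrier (uea g); P u; P v\<rbrakk> \<Longrightarrow> P (u \<oplus>\<^bsub>uea g\<^esub> v)"
    and mult: "\<And>u v. \<lbrakk>u \<in> carrier (uea g); v \<in> carrier (uea g); P u; P v\<rbrakk> \<Longrightarrow> P (u \<otimes>\<^bsub>uea g\<^esub> v)"
    and smult: "\<And>c u. \<lbrakk>u \<in> carrier (uea g); P u\<rbrakk> \<Longrightarrow> P (c \<odot>\<^bsub>uea g\<^esub> u)"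
  shows "P u"
proof -
  let ?q = "\<lambda>f. uea_ideal g +>\<^bsub>F\<^esub> f"
  have w: "P (?q (Poly_Mapping.single w 1))" if "w \<in> lists (carrier g)" for w
    using that
  proof (induction w)
    case Nil
    then show ?case using one by (simp add: uea_def I.coset_one free_simps)
  next
    case (Cons a w)
    have s: "Poly_Mapping.single (a # w) (1::complex) = x a \<otimes>\<^bsub>F\<^esub> Poly_Mapping.single w 1"
      by (simp add: free_simps)
    have c: "x a \<in> carrier F" "Poly_Mapping.single w 1 \<in> carrier F"
      using Cons by (simp_all add: free_simps)
    have "?q (Poly_Mapping.single (a # w) 1) = uea_gen g a \<otimes>\<^bsub>uea g\<^esub> ?q (Poly_Mapping.single w 1)"
      unfolding s uea_gen_def uea_def using c by (simp add: I.coset_mult)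
    moreover have "?q (Poly_Mapping.single w 1) \<in> carrier (uea g)"
      unfolding uea_def using c by simp
    ultimately show ?case using Cons mult gen by simp
  qed
  obtain f where f: "f \<in> carrier F" "u = ?q f"
    using assms(1) by (auto simp: uea_def I.carrier_quot)
  from f(1) have "Poly_Mapping.keys f \<subseteq> lists (carrier g)" by (simp add: free_simps)
  then have "P (?q f)"
  proof (induction f rule: pm_induct)
    case zero
    have "?q 0 = 0 \<odot>\<^bsub>uea g\<^esub> \<one>\<^bsub>uea g\<^esub>"
      using I.coset_zero by (simp add: uea_def[symmetric] free_simps)
    then show ?case using smult[OF _ one, of 0] by simp
  next
    case (single w c)
    have s: "Poly_Mapping.single w c = c \<odot>\<^bsub>F\<^esub> Poly_Mapping.single w 1"
      by (simp add: free_simps)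
    have cl: "Poly_Mapping.single w 1 \<in> carrier F"
      using single by (simp add: free_simps)
    show ?case unfolding s I.coset_smult[OF cl, symmetric] uea_def[symmetric]
      by (rule smult[OF _ w[OF single]]) (use cl in \<open>simp add: uea_def\<close>)
  next
    case (add f f')
    then have c: "f \<in> carrier F" "f' \<in> carrier F" by (simp_all add: free_simps)
    have "?q (f + f') = ?q f \<oplus>\<^bsub>uea g\<^esub> ?q f'"
      using c by (simp add: uea_def I.coset_add) (simp add: free_simps)
    then show ?case using add c assms(4)[of "?q f" "?q f'"] by (simp add: uea_def)
  qed
  with f show ?thesis by simp
qed

text \<open>The map extends from letters to words. That it respects sum, scalar multiple and bracket says that the extension kills the three families of relations.\<close>

lemma uea_hom_exists:
  assumes "calg B"
    and cl: "\<And>a. a \<in> carrier g \<Longrightarrow> \<phi> a \<in> carrier B"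
    and add: "\<And>a b. \<lbrakk>a \<in> carrier g; b \<in> carrier g\<rbrakk> \<Longrightarrow> \<phi> (lie_add g a b) = \<phi> a \<oplus>\<^bsub>B\<^esub> \<phi> b"
    and scale: "\<And>c a. a \<in> carrier g \<Longrightarrow> \<phi> (lie_scale g c a) = c \<odot>\<^bsub>B\<^esub> \<phi> a"
    and bracket: "\<And>a b. \<lbrakk>a \<in> carrier g; b \<in> carrier g\<rbrakk> \<Longrightarrow>
       \<phi> (lie_bracket g a b) = \<phi> a \<otimes>\<^bsub>B\<^esub> \<phi> b \<ominus>\<^bsub>B\<^esub> \<phi> b \<otimes>\<^bsub>B\<^esub> \<phi> a"
  shows "\<exists>h\<in>alg_hom (uea g) B. \<forall>a\<in>carrier g. h (uea_gen g a) = \<phi> a"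
proof -
  interpret B: calg B by fact
  define \<psi> where "\<psi> = (\<lambda>w. foldr (\<lambda>a r. \<phi> a \<otimes>\<^bsub>B\<^esub> r) w \<one>\<^bsub>B\<^esub>)"
  have psi_cl: "\<psi> w \<in> carrier B" if "w \<in> lists (carrier g)" for w
    using that by (induction w) (auto simp: \<psi>_def cl)
  have psi_mult: "\<psi> (v @ w) = \<psi> v \<otimes>\<^bsub>B\<^esub> \<psi> w"
    if "v \<in> lists (carrier g)" "w \<in> lists (carrier g)" for v w
    using that(1)
  proof (induction v)
    case Nil then show ?case using psi_cl[OF that(2)] by (simp add: \<psi>_def)
  next
    case (Cons a v)
    then show ?case using psi_cl[OF that(2)] psi_cl[of v] cl[of a]
      by (simp add: \<psi>_def B.m_assoc)
  qed
  obtain h where h: "h \<in> alg_hom F B" "\<And>w. w \<in> lists (carrier g) \<Longrightarrow> h (Poly_Mapping.single w 1) = \<psi> w"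
    using monoid_alg_hom_exists[OF monoid_lists assms(1), of \<psi> "carrier g"] psi_cl psi_mult
    unfolding free_alg_def by (auto simp: \<psi>_def)
  interpret h: calg_hom F B h by unfold_locales fact
  have hx: "h (x a) = \<phi> a" if "a \<in> carrier g" for a
    using h(2)[of "[a]"] that cl by (simp add: \<psi>_def)
  have "uea_rels g \<subseteq> a_kernel F B h"
  proof
    fix r assume r: "r \<in> uea_rels g"
    have "h r = \<zero>\<^bsub>B\<^esub>"
      using r unfolding rels_eq
      by (elim UnE CollectE exE conjE)
         (simp_all add: h.hom_diff x_closed closed hx add scale bracket cl B.add_diff_diff B.diff_zero_iff)
    with subsetD[OF rels_carrier r] show "r \<in> a_kernel F B h"
      unfolding a_kernel_def' by (intro CollectI conjI)
  qed
  then have "uea_ideal g \<subseteq> a_kernel F B h"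
    unfolding uea_ideal_def by (rule F.genideal_minimal[OF h.kernel_is_ideal])
  then have "\<And>r. r \<in> uea_ideal g \<Longrightarrow> h r = \<zero>\<^bsub>B\<^esub>" unfolding a_kernel_def' by blast
  from I.quot_hom_exists[OF h.calg_hom_axioms this]
  obtain h' where h': "h' \<in> alg_hom (uea g) B" "\<And>r. r \<in> carrier F \<Longrightarrow> h' (uea_ideal g +>\<^bsub>F\<^esub> r) = h r"
    unfolding uea_def by blast
  show ?thesis
    by (rule bexI[OF _ h'(1)]) (simp add: uea_gen_def h'(2) x_closed hx)
qed

lemma uea_hom_eqI:
  assumes "calg B" "h \<in> alg_hom (uea g) B" "h' \<in> alg_hom (uea g) B"
    and "\<And>a. a \<in> carrier g \<Longrightarrow> h (uea_gen g a) = h' (uea_gen g a)"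
  shows "h = h'"
proof (rule alg_hom_eqI[OF assms(2,3)])
  interpret h: calg_hom "uea g" B h using U.calg_axioms assms by (simp add: calg_hom_def calg_hom_axioms_def)
  interpret h': calg_hom "uea g" B h' using U.calg_axioms assms by (simp add: calg_hom_def calg_hom_axioms_def)
  fix u assume "u \<in> carrier (uea g)"
  then show "h u = h' u"
    by (induction rule: uea_induct) (simp_all add: assms(4))
qed

end

subsection \<open>Tensor products\<close>

locale calg_pair = A: calg A + B: calg B
  for A :: "(complex, 'a) module" (structure) and B :: "(complex, 'b) module"
begin

abbreviation "M \<equiv> monoid_alg (A \<times>\<times> B)"
abbreviation "p a b \<equiv> Poly_Mapping.single (a, b) (1::complex)"

lemma monoid_prod: "monoid (A \<times>\<times> B)"
  by (rule DirProd_monoid) (rule A.monoid_axioms B.monoid_axioms)+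

sublocale M: calg M by (rule calg_monoid_alg, rule monoid_prod)

lemma carrier_prod [simp]: "carrier (A \<times>\<times> B) = carrier A \<times> carrier B"
  by (simp add: DirProd_def)

lemma p_closed: "\<lbrakk>a \<in> carrier A; b \<in> carrier B\<rbrakk> \<Longrightarrow> p a b \<in> carrier M"
  by simp

lemma M_uminus: "f \<in> carrier M \<Longrightarrow> \<ominus>\<^bsub>M\<^esub> f = - f"
  by (rule M.minus_equality) auto

lemma M_minus: "f \<in> carrier M \<Longrightarrow> k \<in> carrier M \<Longrightarrow> f \<ominus>\<^bsub>M\<^esub> k = f - k"
  by (simp only: a_minus_def M_uminus) simp

lemma M_minus3: "f \<in> carrier M \<Longrightarrow> k \<in> carrier M \<Longrightarrow> l \<in> carrier M \<Longrightarrow> f - k - l = f \<ominus>\<^bsub>M\<^esub> (k \<oplus>\<^bsub>M\<^esub> l)"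
  by (subst M_minus) (use M.a_closed in \<open>auto simp: diff_diff_eq\<close>)

lemma rels_eq: "tensor_rels A B =
      {p (a \<oplus>\<^bsub>A\<^esub> a') b \<ominus>\<^bsub>M\<^esub> (p a b \<oplus>\<^bsub>M\<^esub> p a' b) | a a' b.
         a \<in> carrier A \<and> a' \<in> carrier A \<and> b \<in> carrier B} \<union>
      {p a (b \<oplus>\<^bsub>B\<^esub> b') \<ominus>\<^bsub>M\<^esub> (p a b \<oplus>\<^bsub>M\<^esub> p a b') | a b b'.
         a \<in> carrier A \<and> b \<in> carrier B \<and> b' \<in> carrier B} \<union>
      {p (c \<odot>\<^bsub>A\<^esub> a) b \<ominus>\<^bsub>M\<^esub> c \<odot>\<^bsub>M\<^esub> (p a b) | c a b. a \<in> carrier A \<and> b \<in> carrier B} \<union>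
      {p a (c \<odot>\<^bsub>B\<^esub> b) \<ominus>\<^bsub>M\<^esub> c \<odot>\<^bsub>M\<^esub> (p a b) | c a b. a \<in> carrier A \<and> b \<in> carrier B}"
proof -
  have s: "pm_scale c (p a b) = c \<odot>\<^bsub>M\<^esub> p a b" for c a b by simp
  show ?thesis unfolding tensor_rels_def Let_def s
    by (simp only: M_minus3 M_minus p_closed A.a_closed B.a_closed A.smult_closed B.smult_closed M.smult_closed
       cong: rev_conj_cong)
qed

lemma rels_carrier: "tensor_rels A B \<subseteq> carrier M"
  unfolding rels_eq
  by (intro Un_least subsetI; elim CollectE exE conjE; simp only:)
    (intro M.minus_closed M.a_closed M.smult_closed p_closed A.a_closed B.a_closed A.smult_closed B.smult_closed; assumption)+

sublocale I: calg_ideal M "tensor_ideal A B"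
  unfolding calg_ideal_def tensor_ideal_def
  using M.genideal_ideal[OF rels_carrier] M.calg_axioms by blast

sublocale T: calg "tensor_alg A B"
  unfolding tensor_alg_def by (rule I.calg_quot)

lemma rel_in: "r \<in> tensor_rels A B \<Longrightarrow> r \<in> tensor_ideal A B"
  unfolding tensor_ideal_def using M.genideal_self[OF rels_carrier] by blast

lemma tens_closed [simp]: "\<lbrakk>a \<in> carrier A; b \<in> carrier B\<rbrakk> \<Longrightarrow> tens A B a b \<in> carrier (tensor_alg A B)"
  unfolding tens_def tensor_alg_def by (rule I.coset_closed, rule p_closed)

lemma eqI: "\<lbrakk>f \<ominus>\<^bsub>M\<^esub> k \<in> tensor_rels A B; f \<in> carrier M; k \<in> carrier M\<rbrakk> \<Longrightarrow>
    tensor_ideal A B +>\<^bsub>M\<^esub> f = tensor_ideal A B +>\<^bsub>M\<^esub> k"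
  by (subst M.coset_eq_iff[OF I.ideal_I]) (auto intro: rel_in)

lemma tens_add_l:
  assumes "a \<in> carrier A" "a' \<in> carrier A" "b \<in> carrier B"
  shows "tens A B (a \<oplus>\<^bsub>A\<^esub> a') b = tens A B a b \<oplus>\<^bsub>tensor_alg A B\<^esub> tens A B a' b"
  unfolding tens_def tensor_alg_def I.coset_add[OF p_closed[OF assms(1,3)] p_closed[OF assms(2,3)]]
  by (rule eqI, (unfold rels_eq, use assms in blast)[1])
    (intro p_closed A.a_closed B.a_closed A.smult_closed B.smult_closed M.a_closed M.smult_closed assms)+

lemma tens_add_r:
  assumes "a \<in> carrier A" "b \<in> carrier B" "b' \<in> carrier B"
  shows "tens A B a (b \<oplus>\<^bsub>B\<^esub> b') = tens A B a b \<oplus>\<^bsub>tensor_alg A B\<^esub> tens A B a b'"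
  unfolding tens_def tensor_alg_def I.coset_add[OF p_closed[OF assms(1,2)] p_closed[OF assms(1,3)]]
  by (rule eqI, (unfold rels_eq, use assms in blast)[1])
    (intro p_closed A.a_closed B.a_closed A.smult_closed B.smult_closed M.a_closed M.smult_closed assms)+

lemma tens_smult_l:
  assumes "a \<in> carrier A" "b \<in> carrier B"
  shows "tens A B (c \<odot>\<^bsub>A\<^esub> a) b = c \<odot>\<^bsub>tensor_alg A B\<^esub> tens A B a b"
  unfolding tens_def tensor_alg_def I.coset_smult[OF p_closed[OF assms]]
  by (rule eqI, (unfold rels_eq, use assms in blast)[1])
    (intro p_closed A.a_closed B.a_closed A.smult_closed B.smult_closed M.a_closed M.smult_closed assms)+

lemma tens_smult_r:
  assumes "a \<in> carrier A" "b \<in> carrier B"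
  shows "tens A B a (c \<odot>\<^bsub>B\<^esub> b) = c \<odot>\<^bsub>tensor_alg A B\<^esub> tens A B a b"
  unfolding tens_def tensor_alg_def I.coset_smult[OF p_closed[OF assms]]
  by (rule eqI, (unfold rels_eq, use assms in blast)[1])
    (intro p_closed A.a_closed B.a_closed A.smult_closed B.smult_closed M.a_closed M.smult_closed assms)+

lemma tens_mult:
  assumes "a \<in> carrier A" "b \<in> carrier B" "a' \<in> carrier A" "b' \<in> carrier B"
  shows "tens A B a b \<otimes>\<^bsub>tensor_alg A B\<^esub> tens A B a' b' = tens A B (a \<otimes>\<^bsub>A\<^esub> a') (b \<otimes>\<^bsub>B\<^esub> b')"
  unfolding tens_def tensor_alg_def I.coset_mult[OF p_closed[OF assms(1,2)] p_closed[OF assms(3,4)]]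
  by (simp add: DirProd_def)

lemma tens_one: "\<one>\<^bsub>tensor_alg A B\<^esub> = tens A B \<one>\<^bsub>A\<^esub> \<one>\<^bsub>B\<^esub>"
  unfolding tens_def tensor_alg_def I.coset_one by (simp add: DirProd_def)

lemma tens_zero_l: "b \<in> carrier B \<Longrightarrow> tens A B \<zero>\<^bsub>A\<^esub> b = \<zero>\<^bsub>tensor_alg A B\<^esub>"
  using tens_smult_l[of "\<zero>\<^bsub>A\<^esub>" b 0] by simp

lemma tens_zero_r: "a \<in> carrier A \<Longrightarrow> tens A B a \<zero>\<^bsub>B\<^esub> = \<zero>\<^bsub>tensor_alg A B\<^esub>"
  using tens_smult_r[of a "\<zero>\<^bsub>B\<^esub>" 0] by simp

lemma tens_diff_l:
  assumes "a \<in> carrier A" "a' \<in> carrier A" "b \<in> carrier B"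
  shows "tens A B (a \<ominus>\<^bsub>A\<^esub> a') b = tens A B a b \<ominus>\<^bsub>tensor_alg A B\<^esub> tens A B a' b"
  using assms tens_smult_l[of a' b "-1"] by (simp add: A.minus_eq T.minus_eq tens_add_l)

lemma tens_diff_r:
  assumes "a \<in> carrier A" "b \<in> carrier B" "b' \<in> carrier B"
  shows "tens A B a (b \<ominus>\<^bsub>B\<^esub> b') = tens A B a b \<ominus>\<^bsub>tensor_alg A B\<^esub> tens A B a b'"
  using assms tens_smult_r[of a b' "-1"] by (simp add: B.minus_eq T.minus_eq tens_add_r)

lemma tens_finsum_l:
  assumes "finite S" "f \<in> S \<rightarrow> carrier A" "b \<in> carrier B"
  shows "tens A B (\<Oplus>\<^bsub>A\<^esub>i\<in>S. f i) b = (\<Oplus>\<^bsub>tensor_alg A B\<^esub>i\<in>S. tens A B (f i) b)"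
  using assms by (induction S rule: finite_induct) (auto simp: tens_zero_l tens_add_l Pi_def)

lemma tens_finsum_r:
  assumes "finite S" "f \<in> S \<rightarrow> carrier B" "a \<in> carrier A"
  shows "tens A B a (\<Oplus>\<^bsub>B\<^esub>i\<in>S. f i) = (\<Oplus>\<^bsub>tensor_alg A B\<^esub>i\<in>S. tens A B a (f i))"
  using assms by (induction S rule: finite_induct) (auto simp: tens_zero_r tens_add_r Pi_def)

text \<open>Since the two images commute, the product of the values is multiplicative on pairs; it is bilinear and therefore kills the relations.\<close>

lemma tensor_hom_exists:
  assumes "calg_hom A C f" "calg_hom B C g"
    and comm: "\<And>a b. \<lbrakk>a \<in> carrier A; b \<in> carrier B\<rbrakk> \<Longrightarrow> g b \<otimes>\<^bsub>C\<^esub> f a = f a \<otimes>\<^bsub>C\<^esub> g b"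
  shows "\<exists>h\<in>alg_hom (tensor_alg A B) C. \<forall>a\<in>carrier A. \<forall>b\<in>carrier B. h (tens A B a b) = f a \<otimes>\<^bsub>C\<^esub> g b"
proof -
  interpret f: calg_hom A C f by fact
  interpret g: calg_hom B C g by fact
  define \<phi> where "\<phi> = (\<lambda>(a, b). f a \<otimes>\<^bsub>C\<^esub> g b)"
  have m: "f (a \<otimes>\<^bsub>A\<^esub> a') \<otimes>\<^bsub>C\<^esub> g (b \<otimes>\<^bsub>B\<^esub> b') = (f a \<otimes>\<^bsub>C\<^esub> g b) \<otimes>\<^bsub>C\<^esub> (f a' \<otimes>\<^bsub>C\<^esub> g b')"
    if "a \<in> carrier A" "b \<in> carrier B" "a' \<in> carrier A" "b' \<in> carrier B" for a b a' b'
  proof -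
    have "f (a \<otimes>\<^bsub>A\<^esub> a') \<otimes>\<^bsub>C\<^esub> g (b \<otimes>\<^bsub>B\<^esub> b') = f a \<otimes>\<^bsub>C\<^esub> ((f a' \<otimes>\<^bsub>C\<^esub> g b) \<otimes>\<^bsub>C\<^esub> g b')"
      using that by (simp add: f.B.m_assoc)
    also have "\<dots> = (f a \<otimes>\<^bsub>C\<^esub> g b) \<otimes>\<^bsub>C\<^esub> (f a' \<otimes>\<^bsub>C\<^esub> g b')"
      using that by (simp only: comm[OF that(3,2), symmetric]) (simp add: f.B.m_assoc)
    finally show ?thesis .
  qed
  have "\<exists>h\<in>alg_hom M C. \<forall>x\<in>carrier (A \<times>\<times> B). h (Poly_Mapping.single x 1) = \<phi> x"
    by (rule monoid_alg_hom_exists[OF monoid_prod f.B.calg_axioms])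
       (use m in \<open>auto simp: \<phi>_def DirProd_def simp del: f.hom_mult g.hom_mult\<close>)
  then obtain h where h: "h \<in> alg_hom M C"
    and hp: "\<And>a b. a \<in> carrier A \<Longrightarrow> b \<in> carrier B \<Longrightarrow> h (p a b) = f a \<otimes>\<^bsub>C\<^esub> g b"
    by (auto simp: \<phi>_def)
  interpret h: calg_hom M C h by unfold_locales fact
  have z: "h (u \<ominus>\<^bsub>M\<^esub> v) = \<zero>\<^bsub>C\<^esub>" if "u \<in> carrier M" "v \<in> carrier M" "h u = h v" for u v
    using that by (simp add: h.hom_diff f.B.diff_zero_iff del: monoid_alg_simps)
  have "h r = \<zero>\<^bsub>C\<^esub>" if r: "r \<in> tensor_rels A B" for r
    using r unfolding rels_eq
    by (elim UnE CollectE exE conjE)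
       (simp_all only:, (rule z;
         simp add: h.hom_add hp f.B.l_distr f.B.r_distr f.B.smult_mult_l f.B.smult_mult_r h.hom_smult p_closed M.a_closed M.smult_closed del: monoid_alg_simps)+)
  then have "tensor_rels A B \<subseteq> a_kernel M C h"
    using rels_carrier unfolding a_kernel_def' by blast
  then have "tensor_ideal A B \<subseteq> a_kernel M C h"
    unfolding tensor_ideal_def by (rule M.genideal_minimal[OF h.kernel_is_ideal])
  then have "\<And>r. r \<in> tensor_ideal A B \<Longrightarrow> h r = \<zero>\<^bsub>C\<^esub>" unfolding a_kernel_def' by blast
  from I.quot_hom_exists[OF h.calg_hom_axioms this]
  obtain h' where h': "h' \<in> alg_hom (tensor_alg A B) C"
    "\<And>r. r \<in> carrier M \<Longrightarrow> h' (tensor_ideal A B +>\<^bsub>M\<^esub> r) = h r"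
    unfolding tensor_alg_def by blast
  show ?thesis
    by (rule bexI[OF _ h'(1)]) (simp add: tens_def h'(2) hp del: monoid_alg_simps add: p_closed)
qed

end

subsection \<open>Subalgebras\<close>

lemma (in calg) subalg_props:
  assumes "S \<subseteq> carrier A"
  shows calg_subalg: "calg (subalg A S)"
    and subalg_subset: "carrier (subalg A S) \<subseteq> carrier A"
    and subalg_gen: "S \<subseteq> carrier (subalg A S)"
proof -
  let ?C = "{B. S \<subseteq> B \<and> subring B A \<and> (\<forall>c. \<forall>x\<in>B. c \<odot> x \<in> B)}"
  have ne: "carrier A \<in> ?C" using assms carrier_is_subring by auto
  have sr: "subring (\<Inter>?C) A" by (rule subring_Inter) (use ne in auto)
  have r: "ring (subalg A S)" unfolding subalg_def by (rule subring_is_ring[OF sr])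
  show sub: "carrier (subalg A S) \<subseteq> carrier A" unfolding subalg_def using ne by auto
  show "S \<subseteq> carrier (subalg A S)" unfolding subalg_def by auto
  have cl: "c \<odot> x \<in> carrier (subalg A S)" if "x \<in> carrier (subalg A S)" for c x
    using that by (auto simp: subalg_def)
  have mem: "x \<in> carrier A" if "x \<in> carrier (subalg A S)" for x using sub that by blast
  have ops: "monoid.mult (subalg A S) = monoid.mult A" "ring.add (subalg A S) = ring.add A"
    "module.smult (subalg A S) = module.smult A" by (simp_all add: subalg_def)
  show "calg (subalg A S)"
    by (intro calg.intro r calg_axioms.intro)
       (auto simp: cl ops mem smult_l_distr smult_r_distr smult_assoc smult_mult_l smult_mult_r)
qed

lemma subalg_simps [simp]:
  "monoid.mult (subalg A S) = monoid.mult A" "ring.add (subalg A S) = ring.add A"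
  "module.smult (subalg A S) = module.smult A" "\<one>\<^bsub>subalg A S\<^esub> = \<one>\<^bsub>A\<^esub>" "\<zero>\<^bsub>subalg A S\<^esub> = \<zero>\<^bsub>A\<^esub>"
  by (simp_all add: subalg_def)

subsection \<open>Polynomials in a central variable\<close>

lemma poly_alg_simps [simp]:
  "carrier (poly_alg A) = carrier (UP A)"
  "monoid.mult (poly_alg A) = monoid.mult (UP A)"
  "\<one>\<^bsub>poly_alg A\<^esub> = \<one>\<^bsub>UP A\<^esub>"
  "\<zero>\<^bsub>poly_alg A\<^esub> = \<zero>\<^bsub>UP A\<^esub>"
  "ring.add (poly_alg A) = ring.add (UP A)"
  "c \<odot>\<^bsub>poly_alg A\<^esub> p = (\<lambda>i. c \<odot>\<^bsub>A\<^esub> p i)"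
  by (simp_all add: poly_alg_def)

locale calg_poly = calg A for A :: "(complex, 'a) module" (structure)
begin

sublocale UPA: UP_ring A "UP A"
  by unfold_locales auto

abbreviation "PA \<equiv> poly_alg A"
abbreviation mon :: "'a \<Rightarrow> nat \<Rightarrow> nat \<Rightarrow> 'a" where "mon \<equiv> up_ring.monom (UP A)"

lemma coeff_eq: "p \<in> carrier (UP A) \<Longrightarrow> up_ring.coeff (UP A) p = p"
  unfolding UP_def by simp

lemma coeff_in: "p \<in> carrier (UP A) \<Longrightarrow> p i \<in> carrier A"
  using UPA.coeff_closed[of p i] by (simp add: coeff_eq)

lemma poly_eqI: "\<lbrakk>p \<in> carrier (UP A); q \<in> carrier (UP A); \<And>i. p i = q i\<rbrakk> \<Longrightarrow> p = q"
  by blast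

lemma mon_at: "a \<in> carrier A \<Longrightarrow> mon a i j = (if i = j then a else \<zero>)"
  using UPA.coeff_monom[of a i j] coeff_eq[of "mon a i"] UPA.monom_closed[of a i] by simp

lemma add_at: "\<lbrakk>p \<in> carrier (UP A); q \<in> carrier (UP A)\<rbrakk> \<Longrightarrow> (p \<oplus>\<^bsub>UP A\<^esub> q) i = p i \<oplus> q i"
  using UPA.coeff_add[of p q i] by (simp add: coeff_eq)

lemma uminus_at: "p \<in> carrier (UP A) \<Longrightarrow> (\<ominus>\<^bsub>UP A\<^esub> p) i = \<ominus> p i"
  using UPA.coeff_a_inv[of p i] by (simp add: coeff_eq)

lemma mult_at: "\<lbrakk>p \<in> carrier (UP A); q \<in> carrier (UP A)\<rbrakk> \<Longrightarrow>
    (p \<otimes>\<^bsub>UP A\<^esub> q) n = (\<Oplus>i\<in>{..n}. p i \<otimes> q (n - i))"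
  using UPA.coeff_mult[of p q n] by (simp add: coeff_eq)

lemma smult_poly_closed:
  assumes "p \<in> carrier (UP A)" shows "(\<lambda>i. c \<odot> p i) \<in> carrier (UP A)"
proof -
  from assms have p: "p \<in> up A" unfolding UP_def by simp
  then obtain n where "bound \<zero> n p" by blast
  then have "bound \<zero> n (\<lambda>i. c \<odot> p i)" by (auto simp: bound_def)
  then have "(\<lambda>i. c \<odot> p i) \<in> up A" using mem_upD[OF p] by (intro mem_upI exI[of _ n]) auto
  then show ?thesis unfolding UP_def by simp
qed

lemma calg_poly: "calg PA"
proof -
  have r: "ring PA"
    by (intro ringI abelian_groupI monoidI)
       (auto simp: UPA.P.m_assoc UPA.P.a_ac UPA.P.l_distr UPA.P.r_distr UPA.P.l_neg intro!: bexI[of _ "\<ominus>\<^bsub>UP A\<^esub> _"])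
  show ?thesis
  proof (intro calg.intro r calg_axioms.intro, goal_cases)
    case (1 p c) then show ?case by (simp add: smult_poly_closed)
  next
    case (2 p c d)
    then have p: "p \<in> carrier (UP A)" by simp
    show ?case unfolding poly_alg_simps
      by (rule poly_eqI[OF smult_poly_closed[OF p] UPA.P.a_closed[OF smult_poly_closed[OF p] smult_poly_closed[OF p]]])
        (simp add: p add_at smult_poly_closed smult_l_distr coeff_in)
  next
    case (3 p q c)
    then have p: "p \<in> carrier (UP A)" and q: "q \<in> carrier (UP A)" by simp_all
    show ?case unfolding poly_alg_simps
      by (rule poly_eqI[OF smult_poly_closed[OF UPA.P.a_closed[OF p q]]
            UPA.P.a_closed[OF smult_poly_closed[OF p] smult_poly_closed[OF q]]])
        (simp add: p q add_at smult_poly_closed smult_r_distr coeff_in)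
  next
    case (4 p c d) then show ?case
      by (auto simp: smult_assoc coeff_in)
  next
    case (5 p) then show ?case by (auto simp: coeff_in)
  next
    case (6 p q c)
    then have p: "p \<in> carrier (UP A)" and q: "q \<in> carrier (UP A)" by simp_all
    show ?case unfolding poly_alg_simps
      by (rule poly_eqI[OF UPA.P.m_closed[OF smult_poly_closed[OF p] q] smult_poly_closed[OF UPA.P.m_closed[OF p q]]])
        (simp add: p q mult_at smult_poly_closed smult_finsum smult_mult_l coeff_in Pi_def)
  next
    case (7 p q c)
    then have p: "p \<in> carrier (UP A)" and q: "q \<in> carrier (UP A)" by simp_all
    show ?case unfolding poly_alg_simps
      by (rule poly_eqI[OF UPA.P.m_closed[OF p smult_poly_closed[OF q]] smult_poly_closed[OF UPA.P.m_closed[OF p q]]])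
        (simp add: p q mult_at smult_poly_closed smult_finsum smult_mult_r coeff_in Pi_def)
  qed
qed

sublocale PA: calg PA by (rule calg_poly)

lemma poly_minus [simp]: "p \<ominus>\<^bsub>PA\<^esub> q = p \<ominus>\<^bsub>UP A\<^esub> q"
  by (simp add: a_minus_def a_inv_def m_inv_def)

lemma mon_smult: "a \<in> carrier A \<Longrightarrow> (\<lambda>j. c \<odot> mon a i j) = mon (c \<odot> a) i"
  by (rule poly_eqI[OF smult_poly_closed[OF UPA.monom_closed]]) (auto simp: mon_at)

lemma poly_induct [consumes 1, case_names mon add]:
  assumes "p \<in> carrier (UP A)"
    and mon: "\<And>a i. a \<in> carrier A \<Longrightarrow> P (mon a i)"
    and add: "\<And>p q. \<lbrakk>p \<in> carrier (UP A); q \<in> carrier (UP A); P p; P q\<rbrakk> \<Longrightarrow> P (p \<oplus>\<^bsub>UP A\<^esub> q)"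
  shows "P p"
proof -
  have "P (\<Oplus>\<^bsub>UP A\<^esub> i \<in> {..N}. mon (p i) i)" for N
  proof (induction N)
    case 0
    then show ?case using mon[of "p 0" 0] assms(1) coeff_in by simp
  next
    case (Suc N)
    have "(\<Oplus>\<^bsub>UP A\<^esub> i \<in> {..N}. mon (p i) i) \<in> carrier (UP A)"
      using assms(1) coeff_in by (intro UPA.P.finsum_closed) auto
    with Suc show ?case using mon[of "p (Suc N)" "Suc N"] assms(1) coeff_in add
      by (simp add: Pi_def)
  qed
  from this[of "deg A p"] show ?thesis
    using UPA.up_repr[OF assms(1)] assms(1) by (simp add: coeff_eq)
qed

text \<open>Evaluation at an element that commutes with the image of the coefficients is multiplicative.\<close>

lemma poly_hom_exists:
  assumes "calg_hom A B h" and T: "T \<in> carrier B"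
    and comm: "\<And>a. a \<in> carrier A \<Longrightarrow> T \<otimes>\<^bsub>B\<^esub> h a = h a \<otimes>\<^bsub>B\<^esub> T"
  shows "\<exists>H\<in>alg_hom PA B. \<forall>a\<in>carrier A. \<forall>i. H (mon a i) = h a \<otimes>\<^bsub>B\<^esub> T [^]\<^bsub>B\<^esub> i"
proof -
  interpret h: calg_hom A B h by fact
  define ev where "ev p N = (\<Oplus>\<^bsub>B\<^esub>i\<in>{..N::nat}. h (p i) \<otimes>\<^bsub>B\<^esub> T [^]\<^bsub>B\<^esub> i)" for p N
  define H where "H = (\<lambda>p\<in>carrier (UP A). ev p (deg A p))"
  have H: "H p = ev p N" if p: "p \<in> carrier (UP A)" and N: "\<And>i. i > N \<Longrightarrow> p i = \<zero>" for p N
  proof -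
    have z: "p i = \<zero>" if "i > deg A p" for i
      using UPA.deg_aboveD[OF that p] p by (simp add: coeff_eq)
    have "ev p K = ev p (min K N)" if "\<And>i. i > K \<Longrightarrow> p i = \<zero>" for K
      unfolding ev_def
      by (rule h.B.add.finprod_mono_neutral_cong_right)
         (use p coeff_in T N that in \<open>auto simp: not_le min_def split: if_splits\<close>)
    note this[of "deg A p"]
    moreover have "ev p N = ev p (min K N)" if "\<And>i. i > K \<Longrightarrow> p i = \<zero>" for K
      unfolding ev_def
      by (rule h.B.add.finprod_mono_neutral_cong_right)
         (use p coeff_in T N that in \<open>auto simp: not_le min_def split: if_splits\<close>)
    note this[of "deg A p"]
    ultimately show ?thesis using z p by (simp add: H_def)
  qed
  have bd: "\<exists>N. \<forall>i>N. p i = \<zero>" if p: "p \<in> carrier (UP A)" for p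
    using UPA.deg_aboveD[OF _ p] p by (auto simp: coeff_eq)
  have evc: "ev p N \<in> carrier B" if "p \<in> carrier (UP A)" for p N
    unfolding ev_def using that coeff_in T by (intro h.B.finsum_closed) auto
  have Hadd: "H (p \<oplus>\<^bsub>UP A\<^esub> q) = H p \<oplus>\<^bsub>B\<^esub> H q"
    if p: "p \<in> carrier (UP A)" and q: "q \<in> carrier (UP A)" for p q
  proof -
    obtain N1 N2 where N: "\<forall>i>N1. p i = \<zero>" "\<forall>i>N2. q i = \<zero>" using bd p q by meson
    let ?N = "max N1 N2"
    have "ev (p \<oplus>\<^bsub>UP A\<^esub> q) ?N = (\<Oplus>\<^bsub>B\<^esub>i\<in>{..?N}. h (p i) \<otimes>\<^bsub>B\<^esub> T [^]\<^bsub>B\<^esub> i \<oplus>\<^bsub>B\<^esub> h (q i) \<otimes>\<^bsub>B\<^esub> T [^]\<^bsub>B\<^esub> i)"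
      unfolding ev_def
      by (rule h.B.finsum_cong') (use p q T coeff_in in \<open>auto simp: add_at h.B.l_distr\<close>)
    also have "\<dots> = ev p ?N \<oplus>\<^bsub>B\<^esub> ev q ?N"
      unfolding ev_def by (rule h.B.finsum_addf) (use p q T coeff_in in auto)
    finally show ?thesis using H[of p ?N] H[of q ?N] H[of "p \<oplus>\<^bsub>UP A\<^esub> q" ?N] p q N
      by (simp add: add_at)
  qed
  have mn: "H (mon a i) = h a \<otimes>\<^bsub>B\<^esub> T [^]\<^bsub>B\<^esub> i" if a: "a \<in> carrier A" for a i
  proof -
    have "H (mon a i) = ev (mon a i) i" by (rule H) (auto simp: a mon_at)
    also have "\<dots> = (\<Oplus>\<^bsub>B\<^esub>j\<in>{..i}. if i = j then h a \<otimes>\<^bsub>B\<^esub> T [^]\<^bsub>B\<^esub> j else \<zero>\<^bsub>B\<^esub>)"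
      unfolding ev_def by (rule h.B.finsum_cong') (use a T in \<open>auto simp: mon_at\<close>)
    also have "\<dots> = h a \<otimes>\<^bsub>B\<^esub> T [^]\<^bsub>B\<^esub> i"
      using h.B.finsum_singleton[of i "{..i}" "\<lambda>j. h a \<otimes>\<^bsub>B\<^esub> T [^]\<^bsub>B\<^esub> j"] a T by auto
    finally show ?thesis .
  qed
  have cl: "H p \<in> carrier B" if "p \<in> carrier (UP A)" for p using evc that by (simp add: H_def)
  have pc: "T [^]\<^bsub>B\<^esub> (i::nat) \<otimes>\<^bsub>B\<^esub> h a = h a \<otimes>\<^bsub>B\<^esub> T [^]\<^bsub>B\<^esub> i" if a: "a \<in> carrier A" for a i
  proof (induction i)
    case 0 then show ?case using a by simp
  next
    case (Suc i)
    have "T [^]\<^bsub>B\<^esub> Suc i \<otimes>\<^bsub>B\<^esub> h a = T [^]\<^bsub>B\<^esub> i \<otimes>\<^bsub>B\<^esub> (h a \<otimes>\<^bsub>B\<^esub> T)"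
      using a T by (simp add: h.B.m_assoc comm)
    also have "\<dots> = h a \<otimes>\<^bsub>B\<^esub> T [^]\<^bsub>B\<^esub> Suc i"
      using a T Suc by (simp add: h.B.m_assoc[symmetric])
    finally show ?case .
  qed
  have mult: "H (p \<otimes>\<^bsub>UP A\<^esub> q) = H p \<otimes>\<^bsub>B\<^esub> H q"
    if "p \<in> carrier (UP A)" and q: "q \<in> carrier (UP A)" for p q
    using that(1)
  proof (induction p rule: poly_induct)
    case (mon a i)
    show ?case using q
    proof (induction q rule: poly_induct)
      case (mon b j)
      have "H (mon a i \<otimes>\<^bsub>UP A\<^esub> mon b j) = H (mon (a \<otimes> b) (i + j))"
        using mon \<open>a \<in> carrier A\<close> by simp
      also have "\<dots> = h a \<otimes>\<^bsub>B\<^esub> (h b \<otimes>\<^bsub>B\<^esub> T [^]\<^bsub>B\<^esub> i) \<otimes>\<^bsub>B\<^esub> T [^]\<^bsub>B\<^esub> j"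
        using mon \<open>a \<in> carrier A\<close> T by (simp add: mn h.B.nat_pow_mult[symmetric] h.B.m_assoc del: UPA.monom_mult)
      also have "\<dots> = H (mon a i) \<otimes>\<^bsub>B\<^esub> H (mon b j)"
        using mon \<open>a \<in> carrier A\<close> T by (simp only: pc[OF mon(1), symmetric]) (simp add: mn h.B.m_assoc)
      finally show ?case .
    next
      case (add p q)
      then show ?case using \<open>a \<in> carrier A\<close>
        by (simp add: UPA.P.r_distr h.B.r_distr cl Hadd)
    qed
  next
    case (add p p')
    then show ?case using q
      by (simp add: UPA.P.l_distr h.B.l_distr cl Hadd)
  qed
  have sm: "H (\<lambda>i. c \<odot> p i) = c \<odot>\<^bsub>B\<^esub> H p" if p: "p \<in> carrier (UP A)" for p c
  proof -
    obtain N where N: "\<forall>i>N. p i = \<zero>" using bd p by meson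
    have "ev (\<lambda>i. c \<odot> p i) N = c \<odot>\<^bsub>B\<^esub> ev p N"
      unfolding ev_def by (subst h.B.smult_finsum)
        (use p T coeff_in in \<open>auto intro!: h.B.finsum_cong' simp: h.B.smult_mult_l\<close>)
    then show ?thesis using H[of p N] H[of "\<lambda>i. c \<odot> p i" N] p N smult_poly_closed by simp
  qed
  have "H \<in> alg_hom PA B"
    by (rule alg_homI)
       (use mn[of \<one> 0] in \<open>simp_all add: cl Hadd mult sm\<close>, simp add: H_def)
  then show ?thesis using mn by blast
qed

lemma mon_eq: "a \<in> carrier A \<Longrightarrow> mon a i = mon a 0 \<otimes>\<^bsub>UP A\<^esub> mon \<one> i"
  using UPA.monom_mult[of a \<one> 0 i] by simp

lemma X_comm: "a \<in> carrier A \<Longrightarrow> mon \<one> 1 \<otimes>\<^bsub>UP A\<^esub> mon a i = mon a i \<otimes>\<^bsub>UP A\<^esub> mon \<one> 1"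
  using UPA.monom_mult[of a \<one> i 1] UPA.monom_mult[of \<one> a 1 i] by simp

end

section \<open>Commutation relations behind the homomorphism\<close>

context ring
begin

definition comm :: "'a \<Rightarrow> 'a \<Rightarrow> 'a"
  where "comm a b = a \<otimes> b \<ominus> b \<otimes> a"

lemma comm_closed [simp]: "\<lbrakk>a \<in> carrier R; b \<in> carrier R\<rbrakk> \<Longrightarrow> comm a b \<in> carrier R"
  by (simp add: comm_def)

lemma comm_zero_iff: "\<lbrakk>a \<in> carrier R; b \<in> carrier R\<rbrakk> \<Longrightarrow> comm a b = \<zero> \<longleftrightarrow> a \<otimes> b = b \<otimes> a"
  by (simp add: comm_def)

lemma comm_antisym: "\<lbrakk>a \<in> carrier R; b \<in> carrier R\<rbrakk> \<Longrightarrow> comm a b = \<ominus> comm b a"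
  unfolding comm_def by algebra

lemma comm_add_l: "\<lbrakk>a \<in> carrier R; b \<in> carrier R; c \<in> carrier R\<rbrakk> \<Longrightarrow> comm (a \<oplus> b) c = comm a c \<oplus> comm b c"
  unfolding comm_def by algebra

lemma comm_add_r: "\<lbrakk>a \<in> carrier R; b \<in> carrier R; c \<in> carrier R\<rbrakk> \<Longrightarrow> comm c (a \<oplus> b) = comm c a \<oplus> comm c b"
  unfolding comm_def by algebra

lemma comm_uminus_l: "\<lbrakk>a \<in> carrier R; b \<in> carrier R\<rbrakk> \<Longrightarrow> comm (\<ominus> a) b = \<ominus> comm a b"
  unfolding comm_def by algebra

lemma comm_uminus_r: "\<lbrakk>a \<in> carrier R; b \<in> carrier R\<rbrakk> \<Longrightarrow> comm a (\<ominus> b) = \<ominus> comm a b"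
  unfolding comm_def by algebra

lemma comm_mult_l: "\<lbrakk>a \<in> carrier R; b \<in> carrier R; c \<in> carrier R\<rbrakk> \<Longrightarrow> comm (a \<otimes> b) c = a \<otimes> comm b c \<oplus> comm a c \<otimes> b"
  unfolding comm_def by algebra

lemma comm_mult_r: "\<lbrakk>a \<in> carrier R; b \<in> carrier R; c \<in> carrier R\<rbrakk> \<Longrightarrow> comm c (a \<otimes> b) = a \<otimes> comm c b \<oplus> comm c a \<otimes> b"
  unfolding comm_def by algebra

lemma comm_zero [simp]: "a \<in> carrier R \<Longrightarrow> comm \<zero> a = \<zero>" "a \<in> carrier R \<Longrightarrow> comm a \<zero> = \<zero>"
  "a \<in> carrier R \<Longrightarrow> comm \<one> a = \<zero>" "a \<in> carrier R \<Longrightarrow> comm a \<one> = \<zero>" "a \<in> carrier R \<Longrightarrow> comm a a = \<zero>"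
  by (simp_all add: comm_def)

lemma comm_finsum_l:
  "\<lbrakk>finite I; f \<in> I \<rightarrow> carrier R; c \<in> carrier R\<rbrakk> \<Longrightarrow> comm (\<Oplus>i\<in>I. f i) c = (\<Oplus>i\<in>I. comm (f i) c)"
  by (induction I rule: finite_induct) (auto simp: comm_add_l Pi_def)

lemma comm_finsum_r:
  "\<lbrakk>finite I; f \<in> I \<rightarrow> carrier R; c \<in> carrier R\<rbrakk> \<Longrightarrow> comm c (\<Oplus>i\<in>I. f i) = (\<Oplus>i\<in>I. comm c (f i))"
  by (induction I rule: finite_induct) (auto simp: comm_add_r Pi_def)

lemma finsum_uminus: "\<lbrakk>finite I; f \<in> I \<rightarrow> carrier R\<rbrakk> \<Longrightarrow> (\<Oplus>i\<in>I. \<ominus> f i) = \<ominus> (\<Oplus>i\<in>I. f i)"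
  by (induction I rule: finite_induct) (auto simp: minus_add Pi_def)

lemma finsum_single_if:
  assumes "finite I" "k \<in> I" "f k \<in> carrier R" "\<And>i. i \<in> I \<Longrightarrow> i \<noteq> k \<Longrightarrow> f i = \<zero>"
  shows "(\<Oplus>i\<in>I. f i) = f k"
proof -
  have "(\<Oplus>i\<in>I. f i) = (\<Oplus>i\<in>{k}. f i)"
    by (rule add.finprod_mono_neutral_cong_right) (use assms in \<open>auto, metis zero_closed\<close>)
  then show ?thesis using assms(3) by simp
qed

text \<open>The commutation relations of matrix units, for a family of elements of an arbitrary ring.\<close>

definition gl_rel :: "nat set \<Rightarrow> (nat \<Rightarrow> nat \<Rightarrow> 'a) \<Rightarrow> bool"
  where "gl_rel I r \<longleftrightarrow> (\<forall>i\<in>I. \<forall>j\<in>I. r i j \<in> carrier R) \<and>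
    (\<forall>i\<in>I. \<forall>j\<in>I. \<forall>k\<in>I. \<forall>l\<in>I. comm (r i j) (r k l) =
       (if j = k then r i l else \<zero>) \<ominus> (if i = l then r k j else \<zero>))"

lemma gl_relD:
  assumes "gl_rel I r"
  shows "\<lbrakk>i \<in> I; j \<in> I\<rbrakk> \<Longrightarrow> r i j \<in> carrier R"
    "\<lbrakk>i \<in> I; j \<in> I; k \<in> I; l \<in> I\<rbrakk> \<Longrightarrow> comm (r i j) (r k l) =
       (if j = k then r i l else \<zero>) \<ominus> (if i = l then r k j else \<zero>)"
  using assms by (auto simp: gl_rel_def)

lemma gl_trace_central:
  assumes r: "gl_rel I r" and "finite I" "k \<in> I" "l \<in> I"
  shows "comm (\<Oplus>i\<in>I. r i i) (r k l) = \<zero>"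
proof -
  note [simp] = gl_relD[OF r]
  have "comm (\<Oplus>i\<in>I. r i i) (r k l) = (\<Oplus>i\<in>I. (if i = k then r i l else \<zero>) \<oplus> \<ominus> (if i = l then r k i else \<zero>))"
    using assms by (subst comm_finsum_l) (auto intro!: finsum_cong' simp: minus_eq simp del: finsum_addf)
  also have "\<dots> = (\<Oplus>i\<in>I. if i = k then r i l else \<zero>) \<oplus> (\<Oplus>i\<in>I. \<ominus> (if i = l then r k i else \<zero>))"
    by (rule finsum_addf) (use assms in auto)
  also have "(\<Oplus>i\<in>I. if i = k then r i l else \<zero>) = r k l"
    using finsum_single_if[OF assms(2,3), of "\<lambda>i. if i = k then r i l else \<zero>"] assms by simp
  also have "(\<Oplus>i\<in>I. \<ominus> (if i = l then r k i else \<zero>)) = \<ominus> r k l"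
    using finsum_single_if[OF assms(2,4), of "\<lambda>i. \<ominus> (if i = l then r k i else \<zero>)"] assms by simp
  finally show ?thesis using assms by (simp add: r_neg)
qed

end

lemma (in calg) comm_smult_l: "\<lbrakk>a \<in> carrier A; b \<in> carrier A\<rbrakk> \<Longrightarrow> comm (c \<odot> a) b = c \<odot> comm a b"
  by (simp add: comm_def smult_mult_l smult_mult_r smult_diff)

lemma (in calg) comm_smult_r: "\<lbrakk>a \<in> carrier A; b \<in> carrier A\<rbrakk> \<Longrightarrow> comm a (c \<odot> b) = c \<odot> comm a b"
  by (simp add: comm_def smult_mult_l smult_mult_r smult_diff)

text \<open>In the intended instance \<open>x a\<close> is \<open>t\<^sub>a / t\<^sub>0\<close>, \<open>y b\<close> is \<open>t\<^sub>0 \<partial>\<^sub>b\<close> and \<open>e i j\<close> is a matrix unit of the smaller Lie algebra. The relations below determine all commutators that enter the images of the generators.\<close>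

locale rho_data = calg R for R :: "(complex, 'a) module" (structure) +
  fixes n :: nat and x y :: "nat \<Rightarrow> 'a" and e :: "nat \<Rightarrow> nat \<Rightarrow> 'a"
  assumes X_cl [simp]: "a \<le> n \<Longrightarrow> x a \<in> carrier R"
    and Y_cl [simp]: "a \<le> n \<Longrightarrow> y a \<in> carrier R"
    and X0: "x 0 = \<one>"
    and XX: "\<lbrakk>a \<le> n; b \<le> n\<rbrakk> \<Longrightarrow> comm (x a) (x b) = \<zero>"
    and YX: "\<lbrakk>a \<le> n; b \<le> n\<rbrakk> \<Longrightarrow> comm (y b) (x a) = (if a = b then \<one> else \<zero>) \<ominus> (if b = 0 then x a else \<zero>)"
    and YY: "\<lbrakk>b \<le> n; c \<le> n\<rbrakk> \<Longrightarrow> comm (y b) (y c) = (if b = 0 then y c else \<zero>) \<ominus> (if c = 0 then y b else \<zero>)"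
    and ee: "gl_rel {1..n} e"
    and Xe: "\<lbrakk>a \<le> n; i \<in> {1..n}; j \<in> {1..n}\<rbrakk> \<Longrightarrow> comm (x a) (e i j) = \<zero>"
    and Ye: "\<lbrakk>a \<le> n; i \<in> {1..n}; j \<in> {1..n}\<rbrakk> \<Longrightarrow> comm (y a) (e i j) = \<zero>"
begin

lemma e_cl [simp]: "\<lbrakk>1 \<le> i; i \<le> n; 1 \<le> j; j \<le> n\<rbrakk> \<Longrightarrow> e i j \<in> carrier R"
  using gl_relD(1)[OF ee] by auto

definition "P a b = x a \<otimes> y b"

lemma P_cl [simp]: "\<lbrakk>a \<le> n; b \<le> n\<rbrakk> \<Longrightarrow> P a b \<in> carrier R"
  by (simp add: P_def)

lemma XY: "\<lbrakk>a \<le> n; b \<le> n\<rbrakk> \<Longrightarrow> comm (x a) (y b) = \<ominus> ((if a = b then \<one> else \<zero>) \<ominus> (if b = 0 then x a else \<zero>))"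
  by (subst comm_antisym) (simp_all add: YX)

lemma P_gl: "gl_rel {0..n} P"
  unfolding gl_rel_def
proof (intro conjI ballI)
  fix a b c d assume "a \<in> {0..n}" "b \<in> {0..n}" "c \<in> {0..n}" "d \<in> {0..n}"
  then have le: "a \<le> n" "b \<le> n" "c \<le> n" "d \<le> n" by auto
  have cl: "x a \<in> carrier R" "x c \<in> carrier R" "y b \<in> carrier R" "y d \<in> carrier R" using le by auto
  have xx: "x c \<otimes> x a = x a \<otimes> x c" using XX[OF le(3,1)] cl by (simp add: comm_zero_iff)
  then have xx': "x c \<otimes> (x a \<otimes> y b) = x a \<otimes> (x c \<otimes> y b)"
    using cl by (simp flip: m_assoc)
  have "comm (P a b) (P c d) =
      x a \<otimes> (x c \<otimes> comm (y b) (y d) \<oplus> comm (y b) (x c) \<otimes> y d) \<oplus>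
      (x c \<otimes> comm (x a) (y d) \<oplus> comm (x a) (x c) \<otimes> y d) \<otimes> y b"
    unfolding P_def using cl
    by (subst comm_mult_l) (simp_all add: comm_mult_r[of "x c" "y d" "x a"] comm_mult_r[of "x c" "y d" "y b"])
  also have "\<dots> = x a \<otimes> (x c \<otimes> ((if b = 0 then y d else \<zero>) \<ominus> (if d = 0 then y b else \<zero>)) \<oplus>
       ((if c = b then \<one> else \<zero>) \<ominus> (if b = 0 then x c else \<zero>)) \<otimes> y d) \<ominus>
      x c \<otimes> ((if a = d then \<one> else \<zero>) \<ominus> (if d = 0 then x a else \<zero>)) \<otimes> y b"
    using cl le by (simp add: XX YX YY XY l_minus r_minus minus_eq)
  also have "\<dots> = (if b = c then P a d else \<zero>) \<ominus> (if a = d then P c b else \<zero>)"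
    using cl xx' unfolding P_def
    by (cases "b = 0"; cases "d = 0"; cases "b = c"; cases "a = d")
       (simp_all add: minus_eq minus_add r_distr l_distr m_assoc l_minus r_minus a_ac r_neg r_neg1 r_neg2 X0)
  finally show "comm (P a b) (P c d) = (if b = c then P a d else \<zero>) \<ominus> (if a = d then P c b else \<zero>)" .
qed auto

text \<open>The coefficient of \<open>e a i\<close> in the matrix part \<open>Q a b\<close> of the image of a generator. It equals the commutator of \<open>y b\<close> and \<open>x i\<close> (\<open>YX_w\<close>), so that the column with index zero need not be separated from the others.\<close>

definition "w b i = (if b = 0 then \<ominus> x i else if b = i then \<one> else \<zero>)"

definition "Q a b = (if a = 0 then \<zero> else \<Oplus>i\<in>{1..n}. w b i \<otimes> e a i)"

lemma w_cl [simp]: "i \<le> n \<Longrightarrow> w b i \<in> carrier R" by (auto simp: w_def)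

lemma Q_cl [simp]: "\<lbrakk>a \<le> n; b \<le> n\<rbrakk> \<Longrightarrow> Q a b \<in> carrier R"
  unfolding Q_def by (auto intro!: finsum_closed)

lemma Q_0 [simp]: "Q 0 b = \<zero>" by (simp add: Q_def)

lemma Q_pos: "\<lbrakk>1 \<le> a; a \<le> n; 1 \<le> b; b \<le> n\<rbrakk> \<Longrightarrow> Q a b = e a b"
  unfolding Q_def by (subst finsum_single_if[of _ b]) (auto simp: w_def)

lemma Q_col0: "\<lbrakk>1 \<le> a; a \<le> n\<rbrakk> \<Longrightarrow> Q a 0 = \<ominus> (\<Oplus>i\<in>{1..n}. x i \<otimes> e a i)"
  unfolding Q_def by (subst finsum_uminus[symmetric]) (auto intro!: finsum_cong' simp: w_def l_minus)

lemma YX_w: "\<lbrakk>b \<le> n; 1 \<le> i; i \<le> n\<rbrakk> \<Longrightarrow> comm (y b) (x i) = w b i"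
  by (auto simp: YX w_def minus_eq)

lemma XQ:
  assumes "a \<le> n" "c \<le> n" "d \<le> n"
  shows "comm (x a) (Q c d) = \<zero>"
proof -
  have "comm (x a) (w d i) = \<zero>" if "i \<le> n" for i
    using that assms by (auto simp: w_def comm_uminus_r XX)
  then show ?thesis using assms
    by (cases "c = 0") (auto simp: Q_def comm_finsum_r comm_mult_r Xe intro!: add.finprod_one_eqI)
qed

lemma eP:
  assumes "a \<le> n" "b \<le> n" "i \<in> {1..n}" "j \<in> {1..n}"
  shows "comm (P a b) (e i j) = \<zero>"
  using assms by (simp add: P_def comm_mult_l Xe Ye)

text \<open>The mixed commutators: \<open>P a b\<close> sees \<open>Q c d\<close> only through the functions \<open>x i\<close> in its column with index zero.\<close>

lemma PQ:
  assumes "a \<le> n" "b \<le> n" "c \<le> n" "d \<le> n"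
  shows "comm (P a b) (Q c d) = (if d = 0 then \<ominus> (x a \<otimes> Q c b) else \<zero>)"
proof (cases "c = 0")
  case True
  then show ?thesis using assms by simp
next
  case c: False
  show ?thesis
  proof (cases "d = 0")
    case False
    then show ?thesis using assms c by (simp add: Q_pos eP)
  next
    case True
    have "comm (P a b) (x i \<otimes> e c i) = x a \<otimes> (w b i \<otimes> e c i)" if "i \<in> {1..n}" for i
      using that assms c by (simp add: comm_mult_r eP, simp add: P_def comm_mult_l XX YX_w m_assoc)
    then have "(\<Oplus>i\<in>{1..n}. comm (P a b) (x i \<otimes> e c i)) = (\<Oplus>i\<in>{1..n}. x a \<otimes> (w b i \<otimes> e c i))"
      using assms c by (intro finsum_cong') auto
    then have "comm (P a b) (Q c 0) = \<ominus> (\<Oplus>i\<in>{1..n}. x a \<otimes> (w b i \<otimes> e c i))"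
      using assms c by (simp add: Q_col0 comm_uminus_r comm_finsum_r Pi_def)
    also have "\<dots> = \<ominus> (x a \<otimes> Q c b)"
      using assms c by (simp add: Q_def finsum_rdistr Pi_def)
    finally show ?thesis using True by simp
  qed
qed

lemma eQ0:
  assumes "1 \<le> a" "a \<le> n" "1 \<le> b" "b \<le> n" "1 \<le> c" "c \<le> n"
  shows "comm (e a b) (Q c 0) = (if b = c then Q a 0 else \<zero>) \<oplus> x a \<otimes> e c b"
proof -
  have 1: "comm (e a b) (x i \<otimes> e c i) = (if b = c then x i \<otimes> e a i else \<zero>) \<oplus> \<ominus> (if a = i then x i \<otimes> e c b else \<zero>)"
    if "i \<in> {1..n}" for i
    using that assms comm_antisym[of "e a b" "x i"] Xe[of i a b]
    by (simp add: comm_mult_r gl_relD(2)[OF ee] minus_eq r_distr r_minus)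
  have "comm (e a b) (Q c 0) = \<ominus> (\<Oplus>i\<in>{1..n}. comm (e a b) (x i \<otimes> e c i))"
    using assms by (simp add: Q_col0 comm_uminus_r comm_finsum_r Pi_def)
  also have "(\<Oplus>i\<in>{1..n}. comm (e a b) (x i \<otimes> e c i)) =
     (\<Oplus>i\<in>{1..n}. (if b = c then x i \<otimes> e a i else \<zero>) \<oplus> \<ominus> (if a = i then x i \<otimes> e c b else \<zero>))"
    by (rule finsum_cong') (use 1 assms in auto)
  also have "\<dots> = (\<Oplus>i\<in>{1..n}. if b = c then x i \<otimes> e a i else \<zero>) \<oplus> (\<Oplus>i\<in>{1..n}. \<ominus> (if a = i then x i \<otimes> e c b else \<zero>))"
    by (rule finsum_addf) (use assms in auto)
  also have "(\<Oplus>i\<in>{1..n}. \<ominus> (if a = i then x i \<otimes> e c b else \<zero>)) = \<ominus> (x a \<otimes> e c b)"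
    by (subst finsum_single_if[of _ a]) (use assms in auto)
  finally show ?thesis using assms by (auto simp: Q_col0 minus_add Pi_def)
qed

text \<open>The matrix part satisfies the relations only up to an error in the column with index zero; the error is the negative of the contribution of the mixed commutators.\<close>

lemma QQ:
  assumes "a \<le> n" "b \<le> n" "c \<le> n" "d \<le> n"
  shows "comm (Q a b) (Q c d) =
    ((if b = c then Q a d else \<zero>) \<ominus> (if a = d then Q c b else \<zero>)) \<oplus>
    ((if d = 0 then x a \<otimes> Q c b else \<zero>) \<ominus> (if b = 0 then x c \<otimes> Q a d else \<zero>))"
proof -
  have QQ0: "comm (Q a b) (Q c 0) = (if b = c then Q a 0 else \<zero>) \<oplus> x a \<otimes> Q c b"
    if "1 \<le> a" "a \<le> n" "1 \<le> b" "b \<le> n" "1 \<le> c" "c \<le> n" for a b c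
    using that eQ0 by (simp add: Q_pos)
  have Q00: "comm (Q a 0) (Q c 0) = \<ominus> (x c \<otimes> Q a 0) \<oplus> x a \<otimes> Q c 0"
    if a: "1 \<le> a" "a \<le> n" and c: "1 \<le> c" "c \<le> n" for a c
  proof -
    have 1: "comm (x i \<otimes> e a i) (Q c 0) = (if i = c then x i \<otimes> Q a 0 else \<zero>) \<oplus> x a \<otimes> (x i \<otimes> e c i)"
      if i: "i \<in> {1..n}" for i
    proof -
      have "x i \<otimes> (x a \<otimes> e c i) = x a \<otimes> (x i \<otimes> e c i)"
        using XX[of i a] i a c by (simp add: comm_zero_iff flip: m_assoc)
      then show ?thesis using i a c by (simp add: comm_mult_l XQ eQ0 r_distr)
    qed
    have "comm (Q a 0) (Q c 0) = \<ominus> (\<Oplus>i\<in>{1..n}. comm (x i \<otimes> e a i) (Q c 0))"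
      using a c by (subst Q_col0[of a]) (simp_all add: comm_uminus_l comm_finsum_l Pi_def)
    also have "(\<Oplus>i\<in>{1..n}. comm (x i \<otimes> e a i) (Q c 0)) =
      (\<Oplus>i\<in>{1..n}. (if i = c then x i \<otimes> Q a 0 else \<zero>) \<oplus> x a \<otimes> (x i \<otimes> e c i))"
      by (rule finsum_cong') (use 1 a c in auto)
    also have "\<dots> = (\<Oplus>i\<in>{1..n}. if i = c then x i \<otimes> Q a 0 else \<zero>) \<oplus> (\<Oplus>i\<in>{1..n}. x a \<otimes> (x i \<otimes> e c i))"
      by (rule finsum_addf) (use a c in auto)
    also have "(\<Oplus>i\<in>{1..n}. if i = c then x i \<otimes> Q a 0 else \<zero>) = x c \<otimes> Q a 0"
      by (subst finsum_single_if[of _ c]) (use a c in auto)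
    also have "(\<Oplus>i\<in>{1..n}. x a \<otimes> (x i \<otimes> e c i)) = \<ominus> (x a \<otimes> Q c 0)"
      using a c by (simp add: Q_col0 finsum_rdistr Pi_def r_minus)
    finally show ?thesis using a c by (simp add: minus_add)
  qed
  consider "a = 0" | "c = 0" | "1 \<le> a" "1 \<le> c" by linarith
  then show ?thesis
  proof cases
    case 1
    then show ?thesis using assms by (auto simp: X0 minus_eq r_neg l_neg)
  next
    case 2
    then show ?thesis using assms by (auto simp: X0 minus_eq r_neg l_neg)
  next
    case 3
    consider "b = 0" "d = 0" | "b = 0" "1 \<le> d" | "1 \<le> b" "d = 0" | "1 \<le> b" "1 \<le> d" by linarith
    then show ?thesis
    proof cases
      case 1
      then show ?thesis using 3 assms by (simp add: Q00 minus_eq a_ac)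
    next
      case 2
      have "comm (Q a b) (Q c d) = \<ominus> comm (Q c d) (Q a b)" using assms by (simp add: comm_antisym[of "Q a b"])
      then show ?thesis using 2 3 assms by (auto simp: QQ0 minus_eq minus_add a_ac)
    next
      assume "1 \<le> b" "d = 0"
      then show ?thesis using 3 assms by (simp add: QQ0 minus_eq a_ac)
    next
      case 4
      then show ?thesis using 3 assms by (simp add: Q_pos gl_relD[OF ee] minus_eq)
    qed
  qed
qed

definition "r0 a b = P a b \<oplus> Q a b"

lemma r0_cl [simp]: "\<lbrakk>a \<le> n; b \<le> n\<rbrakk> \<Longrightarrow> r0 a b \<in> carrier R"
  by (simp add: r0_def)

lemma cancel_aux:
  assumes "p \<in> carrier R" "q \<in> carrier R" "s \<in> carrier R" "t \<in> carrier R" "u \<in> carrier R" "v \<in> carrier R"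
  shows "((p \<ominus> q) \<oplus> \<ominus> s) \<oplus> (t \<oplus> ((u \<ominus> v) \<oplus> (s \<ominus> t))) = (p \<oplus> u) \<ominus> (q \<oplus> v)"
  using assms by algebra

text \<open>The differential part satisfies the relations by itself (\<open>P_gl\<close>), and the errors of \<open>QQ\<close> cancel against those of \<open>PQ\<close>.\<close>

lemma r0_gl: "gl_rel {0..n} r0"
  unfolding gl_rel_def
proof (intro conjI ballI)
  fix a b c d assume "a \<in> {0..n}" "b \<in> {0..n}" "c \<in> {0..n}" "d \<in> {0..n}"
  then have le: "a \<le> n" "b \<le> n" "c \<le> n" "d \<le> n" by auto
  have "comm (r0 a b) (r0 c d) = (comm (P a b) (P c d) \<oplus> comm (P a b) (Q c d)) \<oplus>
     (comm (Q a b) (P c d) \<oplus> comm (Q a b) (Q c d))"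
    using le by (simp add: r0_def comm_add_l[of "P a b" "Q a b"] comm_add_r[of "P c d" "Q c d"] a_ac)
  also have "comm (Q a b) (P c d) = \<ominus> comm (P c d) (Q a b)"
    using le by (simp add: comm_antisym[of "Q a b"])
  also have "\<dots> = (if b = 0 then x c \<otimes> Q a d else \<zero>)" using le by (simp add: PQ)
  also have "comm (P a b) (Q c d) = \<ominus> (if d = 0 then x a \<otimes> Q c b else \<zero>)" using le by (simp add: PQ)
  also have "comm (P a b) (P c d) = (if b = c then P a d else \<zero>) \<ominus> (if a = d then P c b else \<zero>)"
    using le gl_relD(2)[OF P_gl] by simp
  also note QQ[OF le]
  also note cancel_aux
  finally have "comm (r0 a b) (r0 c d) =
      ((if b = c then P a d else \<zero>) \<oplus> (if b = c then Q a d else \<zero>)) \<ominus>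
      ((if a = d then P c b else \<zero>) \<oplus> (if a = d then Q c b else \<zero>))"
    using le by simp
  then show "comm (r0 a b) (r0 c d) = (if b = c then r0 a d else \<zero>) \<ominus> (if a = d then r0 c b else \<zero>)"
    using le by (simp add: r0_def)
qed auto

definition "Eu = (\<Oplus>i\<in>{0..n}. P i i)"

lemma Eu_cl [simp]: "Eu \<in> carrier R"
  by (simp add: Eu_def Pi_def)

text \<open>The functions \<open>t\<^sub>a / t\<^sub>0\<close> are homogeneous of degree zero.\<close>

lemma Eu_X: "a \<le> n \<Longrightarrow> comm Eu (x a) = \<zero>"
proof -
  assume a: "a \<le> n"
  have "comm (P i i) (x a) = (if i = a then x i else \<zero>) \<oplus> \<ominus> (if i = 0 then x a else \<zero>)" if "i \<le> n" for i
    using a that by (auto simp: P_def comm_mult_l XX YX minus_eq r_distr r_minus X0)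
  then have "comm Eu (x a) = (\<Oplus>i\<in>{0..n}. (if i = a then x i else \<zero>) \<oplus> \<ominus> (if i = 0 then x a else \<zero>))"
    unfolding Eu_def using a
    by (subst comm_finsum_l) (auto intro!: finsum_cong' simp del: finsum_addf add.finprod_multf)
  also have "\<dots> = (\<Oplus>i\<in>{0..n}. if i = a then x i else \<zero>) \<oplus> (\<Oplus>i\<in>{0..n}. \<ominus> (if i = 0 then x a else \<zero>))"
    by (rule finsum_addf) (use a in auto)
  also have "(\<Oplus>i\<in>{0..n}. if i = a then x i else \<zero>) = x a"
    by (subst finsum_single_if[of _ a]) (use a in auto)
  also have "(\<Oplus>i\<in>{0..n}. \<ominus> (if i = 0 then x a else \<zero>)) = \<ominus> x a"
    by (subst finsum_single_if[of _ 0]) (use a in auto)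
  finally show ?thesis using a by (simp add: r_neg)
qed

lemma Eu_P: "\<lbrakk>a \<le> n; b \<le> n\<rbrakk> \<Longrightarrow> comm Eu (P a b) = \<zero>"
  unfolding Eu_def using gl_trace_central[OF P_gl] by simp

lemma Eu_e: "\<lbrakk>i \<in> {1..n}; j \<in> {1..n}\<rbrakk> \<Longrightarrow> comm Eu (e i j) = \<zero>"
  unfolding Eu_def by (subst comm_finsum_l) (auto simp: eP intro!: add.finprod_one_eqI)

lemma Eu_Q: "\<lbrakk>a \<le> n; b \<le> n\<rbrakk> \<Longrightarrow> comm Eu (Q a b) = \<zero>"
proof -
  assume a: "a \<le> n" "b \<le> n"
  have "comm Eu (w b i) = \<zero>" if "i \<le> n" for i
    using that by (auto simp: w_def comm_uminus_r Eu_X)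
  then show ?thesis using a
    by (cases "a = 0") (auto simp: Q_def comm_finsum_r comm_mult_r Eu_e intro!: add.finprod_one_eqI)
qed

lemma Eu_r0: "\<lbrakk>a \<le> n; b \<le> n\<rbrakk> \<Longrightarrow> comm Eu (r0 a b) = \<zero>"
  by (simp add: r0_def comm_add_r Eu_P Eu_Q)

text \<open>The column of the \<open>t\<^sub>b / t\<^sub>0\<close> is an eigenvector. The matrix parts cancel in the row sum, and moving \<open>x b\<close> to the left past \<open>y b\<close> contributes one for each \<open>b > 0\<close>.\<close>

lemma col_sum:
  assumes a: "a \<le> n"
  shows "(\<Oplus>b\<in>{0..n}. r0 a b \<otimes> x b) = x a \<otimes> (Eu \<oplus> of_nat n \<odot> \<one>)"
proof -
  have P: "P a b \<otimes> x b = x a \<otimes> (P b b \<oplus> (if b = 0 then 0 else 1) \<odot> \<one>)" if b: "b \<le> n" for b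
  proof -
    have "y b \<otimes> x b = x b \<otimes> y b \<oplus> comm (y b) (x b)"
      using b unfolding comm_def by (simp add: minus_eq a_comm[of "y b \<otimes> x b"] r_neg1 r_neg2)
    also have "comm (y b) (x b) = (if b = 0 then 0 else 1) \<odot> \<one>"
      using b by (auto simp: YX X0 minus_eq r_neg)
    finally show ?thesis using a b unfolding P_def by (simp add: m_assoc)
  qed
  have Qs: "(\<Oplus>b\<in>{0..n}. Q a b \<otimes> x b) = \<zero>"
  proof (cases "a = 0")
    case True
    then show ?thesis by (auto intro!: add.finprod_one_eqI)
  next
    case False
    have "(\<Oplus>b\<in>{0..n}. Q a b \<otimes> x b) = Q a 0 \<otimes> x 0 \<oplus> (\<Oplus>b\<in>{1..n}. Q a b \<otimes> x b)"
      using a by (simp add: atLeast0AtMost[symmetric] atLeastAtMost_insertL[symmetric, of 0 n] Pi_def)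
    also have "(\<Oplus>b\<in>{1..n}. Q a b \<otimes> x b) = (\<Oplus>b\<in>{1..n}. x b \<otimes> e a b)"
    proof (rule finsum_cong')
      fix b assume b: "b \<in> {1..n}"
      have "x b \<otimes> e a b = e a b \<otimes> x b"
        using Xe[of b a b] b a False by (simp add: comm_zero_iff)
      then show "Q a b \<otimes> x b = x b \<otimes> e a b" using a b False by (simp add: Q_pos)
    qed (use a False in auto)
    finally show ?thesis using a False by (simp add: X0 Q_col0 Pi_def l_neg)
  qed
  have one: "(\<Oplus>b\<in>{0..n}. (if b = 0 then 0 else 1) \<odot> \<one>) = of_nat n \<odot> \<one>"
  proof -
    have "(\<Sum>b\<in>{0..n}. (if b = 0 then 0 else 1)) = (of_nat n :: complex)"
      by (induction n) auto
    then show ?thesis by (subst finsum_smult_scalar) auto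
  qed
  have "(\<Oplus>b\<in>{0..n}. r0 a b \<otimes> x b) = (\<Oplus>b\<in>{0..n}. x a \<otimes> (P b b \<oplus> (if b = 0 then 0 else 1) \<odot> \<one>) \<oplus> Q a b \<otimes> x b)"
    by (rule finsum_cong') (use a P in \<open>auto simp: r0_def l_distr\<close>)
  also have "\<dots> = (\<Oplus>b\<in>{0..n}. x a \<otimes> (P b b \<oplus> (if b = 0 then 0 else 1) \<odot> \<one>)) \<oplus> (\<Oplus>b\<in>{0..n}. Q a b \<otimes> x b)"
    by (rule finsum_addf) (use a in auto)
  also have "\<dots> = x a \<otimes> (\<Oplus>b\<in>{0..n}. P b b \<oplus> (if b = 0 then 0 else 1) \<odot> \<one>)"
    unfolding Qs using a by (subst finsum_rdistr) (auto intro!: r_zero finsum_closed simp del: finsum_addf add.finprod_multf)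
  also have "(\<Oplus>b\<in>{0..n}. P b b \<oplus> (if b = 0 then 0 else 1) \<odot> \<one>) = (\<Oplus>b\<in>{0..n}. P b b) \<oplus> (\<Oplus>b\<in>{0..n}. (if b = 0 then 0 else 1) \<odot> \<one>)"
    by (rule finsum_addf) auto
  finally show ?thesis unfolding one Eu_def .
qed

end

section \<open>Column determinants\<close>

context calg
begin

definition pl :: "('j \<Rightarrow> 'a) \<Rightarrow> 'j list \<Rightarrow> 'a"
  where "pl f js = foldr (\<lambda>j p. f j \<otimes> p) js \<one>"

lemma pl_closed: "(\<And>j. j \<in> set js \<Longrightarrow> f j \<in> carrier A) \<Longrightarrow> pl f js \<in> carrier A"
  by (induction js) (auto simp: pl_def)

lemma pl_append:
  "(\<And>j. j \<in> set js \<union> set ks \<Longrightarrow> f j \<in> carrier A) \<Longrightarrow> pl f (js @ ks) = pl f js \<otimes> pl f ks"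
proof (induction js)
  case Nil
  then show ?case using pl_closed[of ks f] by (simp add: pl_def)
next
  case (Cons j js)
  then show ?case using pl_closed[of ks f] pl_closed[of js f] by (simp add: pl_def m_assoc)
qed

lemma pl_cong: "(\<And>j. j \<in> set js \<Longrightarrow> f j = g j) \<Longrightarrow> pl f js = pl g js"
  by (induction js) (auto simp: pl_def)

end

text \<open>Capelli's determinant: entries of a matrix with the commutation relations of matrix units, where the diagonal of the column in position \<open>k\<close> is shifted by \<open>k\<close>. The shifts compensate for the commutators that arise when columns change places.\<close>

locale capelli = calg R for R :: "(complex, 'a) module" (structure) +
  fixes n :: nat and r :: "nat \<Rightarrow> nat \<Rightarrow> 'a" and t :: 'a
  assumes r: "gl_rel {0..n} r" and t [simp]: "t \<in> carrier R"
    and tr: "\<lbrakk>i \<le> n; j \<le> n\<rbrakk> \<Longrightarrow> comm t (r i j) = \<zero>"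
begin

lemma r_cl [simp]: "\<lbrakk>i \<le> n; j \<le> n\<rbrakk> \<Longrightarrow> r i j \<in> carrier R"
  using gl_relD(1)[OF r] by simp

definition "M k i j = r i j \<ominus> (if i = j then t \<oplus> of_nat k \<odot> \<one> else \<zero>)"

lemma M_cl [simp]: "\<lbrakk>i \<le> n; j \<le> n\<rbrakk> \<Longrightarrow> M k i j \<in> carrier R"
  by (simp add: M_def)

lemma quad_aux:
  assumes le: "a \<le> n" "b \<le> n" "j \<le> n" "l \<le> n"
  shows "M k a j \<otimes> M (Suc k) b l \<ominus> M k b l \<otimes> M (Suc k) a j =
     (if b = j then M k a l else \<zero>) \<ominus> (if a = l then M k b j else \<zero>)
      \<oplus> ((if a = j then M k b l else \<zero>) \<ominus> (if b = l then M k a j else \<zero>))"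
proof -
  define u where "u = t \<oplus> of_nat k \<odot> \<one>"
  define p where "p = r a j \<ominus> (if a = j then u else \<zero>)"
  define q where "q = r b l \<ominus> (if b = l then u else \<zero>)"
  have ucl: "u \<in> carrier R" by (simp add: u_def)
  have pcl: "p \<in> carrier R" "q \<in> carrier R" using le ucl by (auto simp: p_def q_def)
  have ur: "comm u (r i j) = \<zero>" if "i \<le> n" "j \<le> n" for i j
    using that unfolding u_def by (simp add: comm_add_l comm_smult_l tr)
  have ur': "comm (r i j) u = \<zero>" if "i \<le> n" "j \<le> n" for i j
    using that ucl ur by (simp add: comm_antisym[of "r i j"])
  have uif: "(if P then u else \<zero>) \<in> carrier R" for P using ucl by simp
  have S: "t \<oplus> of_nat (Suc k) \<odot> \<one> = u \<oplus> \<one>"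
    unfolding u_def by (simp add: smult_l_distr a_ac add.commute)
  have M1: "M k a j = p" "M k b l = q" by (simp_all add: M_def p_def q_def u_def)
  have M2: "M (Suc k) b l = q \<ominus> (if b = l then \<one> else \<zero>)"
    "M (Suc k) a j = p \<ominus> (if a = j then \<one> else \<zero>)"
    unfolding M_def S p_def q_def using le ucl by (simp_all add: minus_eq minus_add a_assoc)
  have comm_pq: "comm p q = (if j = b then r a l else \<zero>) \<ominus> (if a = l then r b j else \<zero>)"
  proof -
    have "comm p q = comm (r a j) (r b l)"
      unfolding p_def q_def using le ucl uif
      by (auto simp: minus_eq comm_add_l comm_add_r comm_uminus_l comm_uminus_r ur ur')
    then show ?thesis using gl_relD(2)[OF r] le by simp
  qed
  have "M k a j \<otimes> M (Suc k) b l \<ominus> M k b l \<otimes> M (Suc k) a j =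
     comm p q \<oplus> ((if a = j then q else \<zero>) \<ominus> (if b = l then p else \<zero>))"
    unfolding M1 M2 comm_def using pcl
    by (simp add: minus_eq r_distr r_minus minus_add a_ac)
  also have "comm p q = (if b = j then r a l \<ominus> (if a = l then u else \<zero>) else \<zero>) \<ominus>
      (if a = l then r b j \<ominus> (if b = j then u else \<zero>) else \<zero>)"
    unfolding comm_pq using le ucl by (auto simp: minus_eq minus_add a_ac r_neg r_neg1 r_neg2 l_neg)
  finally show ?thesis unfolding M_def p_def q_def u_def[symmetric] by simp
qed

text \<open>The error in interchanging the two factors consists of a commutator and of the effect of moving the shift. By \<open>quad_aux\<close> it changes sign when \<open>j\<close> and \<open>l\<close> are exchanged, so it cancels after symmetrising in the columns.\<close>

lemma quad:
  assumes le: "a \<le> n" "b \<le> n" "j \<le> n" "l \<le> n"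
  shows "(M k a j \<otimes> M (Suc k) b l \<oplus> M k a l \<otimes> M (Suc k) b j) =
    (M k b j \<otimes> M (Suc k) a l \<oplus> M k b l \<otimes> M (Suc k) a j)"
proof -
  have "(M k a j \<otimes> M (Suc k) b l \<oplus> M k a l \<otimes> M (Suc k) b j) \<ominus>
    (M k b j \<otimes> M (Suc k) a l \<oplus> M k b l \<otimes> M (Suc k) a j) =
    (M k a j \<otimes> M (Suc k) b l \<ominus> M k b l \<otimes> M (Suc k) a j) \<oplus>
    (M k a l \<otimes> M (Suc k) b j \<ominus> M k b j \<otimes> M (Suc k) a l)"
    using le by (simp add: minus_eq minus_add a_ac)
  also have "\<dots> = \<zero>"
    unfolding quad_aux[OF le] quad_aux[OF le(1,2,4,3)] using le
    by (cases "b = j"; cases "a = l"; cases "a = j"; cases "b = l")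
       (simp_all add: minus_eq minus_add a_ac r_neg r_neg1 r_neg2 l_neg)
  finally show ?thesis using le by (simp add: diff_zero_iff)
qed

abbreviation "Per \<equiv> {sg. sg permutes {0..n}}"

definition "T sg c = pl (\<lambda>j. M j (sg j) (c j)) [0..<Suc n]"

text \<open>The determinant whose column in position \<open>j\<close> is the column \<open>c j\<close> of the matrix. The shift stays with the position, which is what makes this function of \<open>c\<close> alternating.\<close>

definition "D c = (\<Oplus>sg\<in>Per. of_int (sign sg) \<odot> T sg c)"

abbreviation cols :: "(nat \<Rightarrow> nat) set" where "cols \<equiv> {c. \<forall>j\<le>n. c j \<le> n}"

lemma per_le: "\<lbrakk>sg \<in> Per; j \<le> n\<rbrakk> \<Longrightarrow> sg j \<le> n"
  using permutes_in_image[of sg "{0..n}" j] by simp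

lemma T_cl [simp]: "\<lbrakk>sg \<in> cols; c \<in> cols\<rbrakk> \<Longrightarrow> T sg c \<in> carrier R"
  unfolding T_def by (rule pl_closed) (simp add: less_Suc_eq_le del: upt_Suc)

lemma Per_cols: "Per \<subseteq> cols" using per_le by auto

lemma finite_Per: "finite Per" by (rule finite_permutations) simp

lemma D_cl [simp]: "c \<in> cols \<Longrightarrow> D c \<in> carrier R"
  unfolding D_def using Per_cols by (intro finsum_closed) auto

lemma T_quad:
  assumes s: "sg \<in> cols" and c: "c \<in> cols" and k: "Suc k \<le> n"
  defines "s \<equiv> Transposition.transpose k (Suc k)"
  shows "T sg c \<oplus> T sg (c \<circ> s) = T (sg \<circ> s) c \<oplus> T (sg \<circ> s) (c \<circ> s)"
proof -
  have split: "[0..<Suc n] = [0..<k] @ ([k, Suc k] @ [Suc (Suc k)..<Suc n])"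
    using k upt_add_eq_append[of 0 k "Suc n - k"] by (simp add: upt_conv_Cons del: upt_Suc)
  define L where "L = pl (\<lambda>j. M j (sg j) (c j)) [0..<k]"
  define Q where "Q = pl (\<lambda>j. M j (sg j) (c j)) [Suc (Suc k)..<Suc n]"
  have cl: "L \<in> carrier R" "Q \<in> carrier R" unfolding L_def Q_def by (rule pl_closed, use s c k in \<open>simp add: less_Suc_eq_le del: upt_Suc\<close>)+
  have T: "T sg' c' = L \<otimes> ((M k (sg' k) (c' k) \<otimes> M (Suc k) (sg' (Suc k)) (c' (Suc k))) \<otimes> Q)"
    if "sg' \<in> {sg, sg \<circ> s}" "c' \<in> {c, c \<circ> s}" for sg' c'
  proof -
    have eq: "sg' j = sg j" "c' j = c j" if "j \<noteq> k" "j \<noteq> Suc k" for j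
      using that \<open>sg' \<in> _\<close> \<open>c' \<in> _\<close> by (auto simp: s_def)
    have sj: "s j \<le> n" if "j \<le> n" for j using that k by (auto simp: s_def transpose_def)
    have le: "sg' j \<le> n" "c' j \<le> n" if j: "j \<le> n" for j
    proof -
      have "sg' j = sg j \<or> sg' j = sg (s j)" "c' j = c j \<or> c' j = c (s j)"
        using \<open>sg' \<in> _\<close> \<open>c' \<in> _\<close> by auto
      moreover have "sg j \<le> n" "sg (s j) \<le> n" "c j \<le> n" "c (s j) \<le> n"
        using s c j sj[OF j] by blast+
      ultimately show "sg' j \<le> n" "c' j \<le> n" by metis+
    qed
    have "T sg' c' = pl (\<lambda>j. M j (sg' j) (c' j)) [0..<k] \<otimes>
       (pl (\<lambda>j. M j (sg' j) (c' j)) [k, Suc k] \<otimes> pl (\<lambda>j. M j (sg' j) (c' j)) [Suc (Suc k)..<Suc n])"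
    proof -
      have f: "M j (sg' j) (c' j) \<in> carrier R" if "j \<le> n" for j using le[OF that] by simp
      have 1: "M j (sg' j) (c' j) \<in> carrier R" if "j \<in> set [k, Suc k] \<union> set [Suc (Suc k)..<Suc n]" for j
        by (rule f) (use that k in \<open>auto simp del: upt_Suc\<close>)
      have 2: "M j (sg' j) (c' j) \<in> carrier R" if "j \<in> set [0..<k] \<union> set ([k, Suc k] @ [Suc (Suc k)..<Suc n])" for j
        by (rule f) (use that k in \<open>auto simp del: upt_Suc\<close>)
      show ?thesis unfolding T_def split
        by (simp only: pl_append[where f="\<lambda>j. M j (sg' j) (c' j)", OF 2] pl_append[where f="\<lambda>j. M j (sg' j) (c' j)", OF 1])
    qed
    also have "pl (\<lambda>j. M j (sg' j) (c' j)) [0..<k] = L" unfolding L_def by (rule pl_cong) (auto simp: eq)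
    also have "pl (\<lambda>j. M j (sg' j) (c' j)) [Suc (Suc k)..<Suc n] = Q" unfolding Q_def by (rule pl_cong) (auto simp: eq)
    finally show ?thesis using le k by (simp add: pl_def)
  qed
  have le: "sg k \<le> n" "sg (Suc k) \<le> n" "c k \<le> n" "c (Suc k) \<le> n" using s c k by auto
  have "T sg c \<oplus> T sg (c \<circ> s) = L \<otimes> ((M k (sg k) (c k) \<otimes> M (Suc k) (sg (Suc k)) (c (Suc k)) \<oplus>
      M k (sg k) (c (Suc k)) \<otimes> M (Suc k) (sg (Suc k)) (c k)) \<otimes> Q)"
    using cl le by (simp add: T s_def r_distr l_distr)
  also note quad[OF le]
  also have "L \<otimes> ((M k (sg (Suc k)) (c k) \<otimes> M (Suc k) (sg k) (c (Suc k)) \<oplus>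
      M k (sg (Suc k)) (c (Suc k)) \<otimes> M (Suc k) (sg k) (c k)) \<otimes> Q) = T (sg \<circ> s) c \<oplus> T (sg \<circ> s) (c \<circ> s)"
    using cl le by (simp add: T s_def r_distr l_distr)
  finally show ?thesis .
qed

lemma half: "\<lbrakk>x \<in> carrier R; x = \<ominus> x\<rbrakk> \<Longrightarrow> x = \<zero>"
proof -
  assume x: "x \<in> carrier R" "x = \<ominus> x"
  have "(1/2 + 1/2) \<odot> x = (1/2) \<odot> x \<oplus> (1/2) \<odot> x" using x(1) by (rule smult_l_distr)
  also have "\<dots> = (1/2) \<odot> (x \<oplus> x)" using x by (simp add: smult_r_distr)
  also have "x \<oplus> x = \<zero>" using x by (metis r_neg)
  finally show "x = \<zero>" using x by simp
qed

lemma comp_cols: "\<lbrakk>c \<in> cols; s permutes {0..n}\<rbrakk> \<Longrightarrow> c \<circ> s \<in> cols"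
  using permutes_in_image[of s "{0..n}"] by auto

text \<open>By \<open>T_quad\<close> the sum \<open>D c \<oplus> D (c \<circ> s)\<close> is unchanged if every permutation is composed with \<open>s\<close>. As this changes all signs, the sum is its own negative.\<close>

lemma D_adjacent:
  assumes c: "c \<in> cols" and k: "Suc k \<le> n"
  shows "D (c \<circ> Transposition.transpose k (Suc k)) = \<ominus> D c"
proof -
  define s where "s = Transposition.transpose k (Suc k)"
  have sp: "s permutes {0..n}" unfolding s_def by (rule permutes_swap_id) (use k in auto)
  have cs: "c \<circ> s \<in> cols" by (rule comp_cols[OF c sp])
  have sgn: "sign (sg \<circ> s) = - sign sg" if "sg \<in> Per" for sg
  proof -
    have "permutation sg" "permutation s" using that sp permutation_permutes by auto
    then have "sign (sg \<circ> s) = sign sg * sign s" by (rule sign_compose)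
    then show ?thesis by (simp add: s_def sign_swap_id)
  qed
  have Pcl: "\<And>sg. sg \<in> Per \<Longrightarrow> sg \<in> cols" using Per_cols by blast
  have bij: "bij_betw (\<lambda>sg. sg \<circ> s) Per Per"
    by (intro bij_betw_byWitness[where f' = "\<lambda>sg. sg \<circ> s"])
       (auto simp: comp_assoc s_def intro!: permutes_compose[OF sp[unfolded s_def]])
  define W where "W sg = T sg c \<oplus> T sg (c \<circ> s)" for sg
  have Wcl: "W sg \<in> carrier R" if "sg \<in> Per" for sg unfolding W_def using Pcl[OF that] c cs by simp
  have "D c \<oplus> D (c \<circ> s) = (\<Oplus>sg\<in>Per. of_int (sign sg) \<odot> T sg c \<oplus> of_int (sign sg) \<odot> T sg (c \<circ> s))"
    unfolding D_def by (rule finsum_addf[symmetric]) (use Pcl c cs in auto)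
  also have "\<dots> = (\<Oplus>sg\<in>Per. of_int (sign sg) \<odot> W sg)"
    unfolding W_def by (rule finsum_cong') (use Pcl c cs in \<open>auto simp: smult_r_distr simp del: finsum_addf\<close>)
  finally have 1: "D c \<oplus> D (c \<circ> s) = (\<Oplus>sg\<in>Per. of_int (sign sg) \<odot> W sg)" .
  have "(\<Oplus>sg\<in>Per. of_int (sign sg) \<odot> W sg) = (\<Oplus>sg\<in>(\<lambda>sg. sg \<circ> s) ` Per. of_int (sign sg) \<odot> W sg)"
    using bij by (simp add: bij_betw_def)
  also have "\<dots> = (\<Oplus>sg\<in>Per. of_int (sign (sg \<circ> s)) \<odot> W (sg \<circ> s))"
    by (rule finsum_reindex) (use bij Wcl in \<open>auto simp: bij_betw_def\<close>)
  also have "\<dots> = (\<Oplus>sg\<in>Per. \<ominus> (of_int (sign sg) \<odot> W sg))"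
  proof (rule finsum_cong')
    fix sg assume sg: "sg \<in> Per"
    have "W (sg \<circ> s) = W sg"
      unfolding W_def s_def using T_quad[OF Pcl[OF sg] c k] by simp
    then show "of_int (sign (sg \<circ> s)) \<odot> W (sg \<circ> s) = \<ominus> (of_int (sign sg) \<odot> W sg)"
      using Wcl[OF sg] by (simp add: sgn[OF sg] smult_uminus_l)
  qed (use Wcl in auto)
  also have "\<dots> = \<ominus> (\<Oplus>sg\<in>Per. of_int (sign sg) \<odot> W sg)"
    by (rule finsum_uminus[OF finite_Per]) (use Wcl in auto)
  finally have "(\<Oplus>sg\<in>Per. of_int (sign sg) \<odot> W sg) = \<zero>"
    using Wcl by (intro half finsum_closed) auto
  with 1 have "D (c \<circ> s) \<oplus> D c = \<zero>" using c cs by (simp add: a_comm)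
  then show ?thesis using c cs unfolding s_def by (intro minus_equality[symmetric]) auto
qed

lemma D_transpose:
  assumes "c \<in> cols" "i + Suc d \<le> n"
  shows "D (c \<circ> Transposition.transpose i (i + Suc d)) = \<ominus> D c"
  using assms
proof (induction d arbitrary: c)
  case 0
  then show ?case using D_adjacent[of c i] by (simp add: comp_def)
next
  case (Suc d)
  let ?j = "i + Suc d"
  let ?s = "Transposition.transpose ?j (Suc ?j)" and ?t = "Transposition.transpose i ?j"
  have perm: "?s permutes {0..n}" "?t permutes {0..n}"
    by (rule permutes_swap_id; use Suc.prems in simp)+
  have cc: "c \<circ> ?s \<in> cols" "c \<circ> ?s \<circ> ?t \<in> cols"
    using comp_cols[OF Suc.prems(1) perm(1)] comp_cols[OF comp_cols[OF Suc.prems(1) perm(1)] perm(2)] by blast+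
  have "Transposition.transpose i (i + Suc (Suc d)) = ?s \<circ> ?t \<circ> ?s"
    by (auto simp: fun_eq_iff transpose_def)
  then have "D (c \<circ> Transposition.transpose i (i + Suc (Suc d))) = D (((c \<circ> ?s) \<circ> ?t) \<circ> ?s)"
    by (simp add: comp_assoc)
  also have "\<dots> = \<ominus> D ((c \<circ> ?s) \<circ> ?t)"
    by (rule D_adjacent[OF cc(2)]) (use Suc.prems(2) in simp)
  also have "D ((c \<circ> ?s) \<circ> ?t) = \<ominus> D (c \<circ> ?s)"
    by (rule Suc.IH[OF cc(1)]) (use Suc.prems(2) in simp)
  also have "D (c \<circ> ?s) = \<ominus> D c"
    by (rule D_adjacent[OF Suc.prems(1)]) (use Suc.prems(2) in simp)
  finally show ?case using D_cl[OF Suc.prems(1)] by simp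
qed

lemma D_repeated:
  assumes "c \<in> cols" "i < j" "j \<le> n" "c i = c j"
  shows "D c = \<zero>"
proof -
  obtain d where d: "j = i + Suc d" using assms(2) less_iff_Suc_add by auto
  have "c \<circ> Transposition.transpose i j = c" using assms(4) by (auto simp: fun_eq_iff transpose_def)
  then have "D c = \<ominus> D c" using D_transpose[OF assms(1), of i d] assms(3) unfolding d by simp
  then show ?thesis by (rule half[OF D_cl[OF assms(1)]])
qed

text \<open>Cramer's rule. A column combination can be formed by right multiplication only in the last position, so the columns with index zero and \<open>n\<close> are exchanged first and the last one is replaced by the combination with coefficients \<open>x b\<close>, which is zero. All summands except \<open>b = 0\<close> have a repeated column.\<close>

lemma D_null:
  assumes n: "n \<ge> 1" and x: "\<And>b. b \<le> n \<Longrightarrow> x b \<in> carrier R" and x0: "x 0 = \<one>"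
    and null: "\<And>a. a \<le> n \<Longrightarrow> (\<Oplus>b\<in>{0..n}. M n a b \<otimes> x b) = \<zero>"
  shows "D (\<lambda>j. j) = \<zero>"
proof -
  \<comment> \<open>the order of columns in which column 0 stands in the last position\<close>
  let ?c = "Transposition.transpose 0 n"
  have perm: "?c permutes {0..n}" by (rule permutes_swap_id) auto
  have ccol: "?c(n := b) \<in> cols" if "b \<le> n" for b
    using that by (auto simp: transpose_def)
  have Pcl: "\<And>sg. sg \<in> Per \<Longrightarrow> sg \<in> cols" using Per_cols by blast
  define L where "L sg = pl (\<lambda>j. M j (sg j) (?c j)) [0..<n]" for sg
  have Lcl: "L sg \<in> carrier R" if "sg \<in> Per" for sg
    unfolding L_def by (rule pl_closed) (use Pcl[OF that] in \<open>auto simp: transpose_def\<close>)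
  have T: "T sg (?c(n := b)) = L sg \<otimes> M n (sg n) b" if "sg \<in> Per" "b \<le> n" for sg b
  proof -
    have le: "sg j \<le> n" "(?c(n := b)) j \<le> n" if "j \<le> n" for j
      using Pcl[OF \<open>sg \<in> Per\<close>] ccol[OF \<open>b \<le> n\<close>] that by auto
    have "T sg (?c(n := b)) = pl (\<lambda>j. M j (sg j) ((?c(n := b)) j)) [0..<n] \<otimes> pl (\<lambda>j. M j (sg j) ((?c(n := b)) j)) [n]"
    proof -
      have 1: "M j (sg j) ((?c(n := b)) j) \<in> carrier R" if "j \<in> set [0..<n] \<union> set [n]" for j
        by (rule M_cl; rule le) (use that in auto)
      have u: "[0..<Suc n] = [0..<n] @ [n]" by simp
      show ?thesis unfolding T_def u
        by (simp only: pl_append[where f="\<lambda>j. M j (sg j) ((?c(n := b)) j)", OF 1])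
    qed
    also have "pl (\<lambda>j. M j (sg j) ((?c(n := b)) j)) [0..<n] = L sg"
      unfolding L_def by (rule pl_cong) auto
    also have "pl (\<lambda>j. M j (sg j) ((?c(n := b)) j)) [n] = M n (sg n) b"
      using le[of n] that by (simp add: pl_def)
    finally show ?thesis .
  qed
  have Mcl: "M n (sg n) b \<in> carrier R" if "sg \<in> Per" "b \<le> n" for sg b
    using per_le[OF that(1)] that(2) by simp
  have D: "D (?c(n := b)) \<otimes> x b = (\<Oplus>sg\<in>Per. (of_int (sign sg) \<odot> L sg) \<otimes> (M n (sg n) b \<otimes> x b))" if "b \<le> n" for b
    unfolding D_def using that x Lcl Mcl ccol[OF that] Pcl
    by (subst finsum_ldistr[OF finite_Per]) (auto intro!: finsum_cong' simp: T smult_mult_l m_assoc simp del: fun_upd_apply)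
  have "(\<Oplus>b\<in>{0..n}. D (?c(n := b)) \<otimes> x b) = (\<Oplus>b\<in>{0..n}. \<Oplus>sg\<in>Per. (of_int (sign sg) \<odot> L sg) \<otimes> (M n (sg n) b \<otimes> x b))"
    by (rule finsum_cong') (use D x Lcl Mcl in \<open>auto intro!: finsum_closed\<close>)
  also have "\<dots> = (\<Oplus>sg\<in>Per. \<Oplus>b\<in>{0..n}. (of_int (sign sg) \<odot> L sg) \<otimes> (M n (sg n) b \<otimes> x b))"
    by (rule finsum_swap) (use x Lcl Mcl finite_Per in auto)
  also have "\<dots> = (\<Oplus>sg\<in>Per. \<zero>)"
  proof (rule finsum_cong')
    fix sg assume sg: "sg \<in> Per"
    have "(\<Oplus>b\<in>{0..n}. (of_int (sign sg) \<odot> L sg) \<otimes> (M n (sg n) b \<otimes> x b)) =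
        (of_int (sign sg) \<odot> L sg) \<otimes> (\<Oplus>b\<in>{0..n}. M n (sg n) b \<otimes> x b)"
      by (rule finsum_rdistr[symmetric]) (use x Lcl[OF sg] Mcl[OF sg] in auto)
    then show "(\<Oplus>b\<in>{0..n}. (of_int (sign sg) \<odot> L sg) \<otimes> (M n (sg n) b \<otimes> x b)) = \<zero>"
      using null[OF per_le[OF sg]] Lcl[OF sg] by simp
  qed auto
  finally have sum0: "(\<Oplus>b\<in>{0..n}. D (?c(n := b)) \<otimes> x b) = \<zero>" by simp
  have rep: "D (?c(n := b)) = \<zero>" if "b \<le> n" "b \<noteq> 0" for b
  proof (cases "b = n")
    case True
    then show ?thesis using n ccol[OF that(1)] D_repeated[of "?c(n := b)" 0 n] by simp
  next
    case False
    then show ?thesis using n ccol[OF that(1)] that D_repeated[of "?c(n := b)" b n] by simp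
  qed
  have "(\<Oplus>b\<in>{0..n}. D (?c(n := b)) \<otimes> x b) = D (?c(n := 0)) \<otimes> x 0"
    by (rule finsum_single_if) (use rep x ccol in \<open>auto simp del: fun_upd_apply\<close>)
  with sum0 have "D (?c(n := 0)) = \<zero>" using ccol[of 0] by (simp add: x0)
  moreover have "?c(n := 0) = ?c" by (auto simp: fun_eq_iff)
  ultimately have "D ?c = \<zero>" by simp
  moreover have "D ?c = \<ominus> D (\<lambda>j. j)"
    using D_transpose[of "\<lambda>j. j" 0 "n - 1"] n by (simp add: comp_def)
  moreover have "D (\<lambda>j. j) \<in> carrier R" by (rule D_cl) simp
  ultimately show ?thesis using minus_minus[of "D (\<lambda>j. j)"] by simp
qed

end

section \<open>Matrix Lie algebras\<close>

lemma gl_simps: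
  "carrier (gl I) = {B. \<forall>i j. B i j \<noteq> 0 \<longrightarrow> i \<in> I \<and> j \<in> I}"
  "lie_add (gl I) B C = (\<lambda>i j. B i j + C i j)"
  "lie_scale (gl I) c B = (\<lambda>i j. c * B i j)"
  "lie_bracket (gl I) B C = (\<lambda>i j. (\<Sum>k\<in>I. B i k * C k j) - (\<Sum>k\<in>I. C i k * B k j))"
  by (simp_all add: gl_def)

lemma sl_simps:
  "carrier (sl I) = {B \<in> carrier (gl I). mtrace I B = 0}"
  "lie_add (sl I) = lie_add (gl I)"
  "lie_scale (sl I) = lie_scale (gl I)"
  "lie_bracket (sl I) = lie_bracket (gl I)"
  by (simp_all add: sl_def gl_def)

lemma gl_bracket_closed:
  assumes "B \<in> carrier (gl I)" "C \<in> carrier (gl I)"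
  shows "lie_bracket (gl I) B C \<in> carrier (gl I)"
proof -
  have z: "B i j = 0" "C i j = 0" if "i \<notin> I \<or> j \<notin> I" for i j
    using that assms by (auto simp: gl_simps)
  have "lie_bracket (gl I) B C i j = 0" if "i \<notin> I \<or> j \<notin> I" for i j
    using that z by (auto simp: gl_simps)
  then show ?thesis by (auto simp: gl_simps(1))
qed

lemma gl_add_closed:
  assumes "B \<in> carrier (gl I)" "C \<in> carrier (gl I)"
  shows "lie_add (gl I) B C \<in> carrier (gl I)"
proof -
  have z: "B i j = 0" "C i j = 0" if "i \<notin> I \<or> j \<notin> I" for i j
    using that assms by (auto simp: gl_simps)
  have "lie_add (gl I) B C i j = 0" if "i \<notin> I \<or> j \<notin> I" for i j
    using that z by (auto simp: gl_simps)
  then show ?thesis by (auto simp: gl_simps(1))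
qed

lemma gl_scale_closed: "B \<in> carrier (gl I) \<Longrightarrow> lie_scale (gl I) c B \<in> carrier (gl I)"
  unfolding gl_simps by auto

lemma lie_closed_gl: "lie_closed (gl I)"
  by (unfold_locales) (auto intro: gl_bracket_closed gl_add_closed gl_scale_closed)

lemma mtrace_bracket: "finite I \<Longrightarrow> mtrace I (lie_bracket (gl I) B C) = 0"
proof -
  assume "finite I"
  have "(\<Sum>i\<in>I. \<Sum>k\<in>I. B i k * C k i) = (\<Sum>k\<in>I. \<Sum>i\<in>I. C k i * B i k)"
    by (subst sum.swap) (simp add: mult.commute)
  then show ?thesis by (simp add: mtrace_def gl_simps sum_subtractf)
qed

lemma lie_closed_sl: "finite I \<Longrightarrow> lie_closed (sl I)"
  by (unfold_locales)
     (auto simp: sl_simps mtrace_bracket intro: gl_bracket_closed gl_add_closed gl_scale_closed,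
      auto simp: mtrace_def gl_simps sum.distrib simp flip: sum_distrib_left)

lemma emat_closed: "\<lbrakk>i \<in> I; j \<in> I\<rbrakk> \<Longrightarrow> emat i j \<in> carrier (gl I)"
  by (simp add: gl_simps emat_def)

lemma emat_bracket:
  assumes "finite I" "i \<in> I" "j \<in> I" "k \<in> I" "l \<in> I"
  shows "lie_bracket (gl I) (emat i j) (emat k l) =
    lie_add (gl I) (lie_scale (gl I) (if j = k then 1 else 0) (emat i l))
      (lie_scale (gl I) (if i = l then - 1 else 0) (emat k j))"
proof (intro ext)
  fix p q
  have "(\<Sum>m\<in>I. emat i j p m * emat k l m q) = (\<Sum>m\<in>I. if m = j then (if p = i \<and> j = k \<and> q = l then 1 else 0) else 0)"
    by (rule sum.cong) (auto simp: emat_def)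
  also have "\<dots> = (if p = i \<and> j = k \<and> q = l then 1 else 0)" using assms by simp
  finally have 1: "(\<Sum>m\<in>I. emat i j p m * emat k l m q) = (if p = i \<and> j = k \<and> q = l then 1 else 0)" .
  have "(\<Sum>m\<in>I. emat k l p m * emat i j m q) = (\<Sum>m\<in>I. if m = l then (if p = k \<and> l = i \<and> q = j then 1 else 0) else 0)"
    by (rule sum.cong) (auto simp: emat_def)
  also have "\<dots> = (if p = k \<and> l = i \<and> q = j then 1 else 0)" using assms by simp
  finally have 2: "(\<Sum>m\<in>I. emat k l p m * emat i j m q) = (if p = k \<and> l = i \<and> q = j then 1 else 0)" .
  show "lie_bracket (gl I) (emat i j) (emat k l) p q =
    lie_add (gl I) (lie_scale (gl I) (if j = k then 1 else 0) (emat i l))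
      (lie_scale (gl I) (if i = l then - 1 else 0) (emat k j)) p q"
    unfolding gl_simps 1 2 by (auto simp: emat_def)
qed

lemma gl_induct [consumes 2, case_names zero emat add scale]:
  assumes "finite I" "B \<in> carrier (gl I)"
    and zero: "P (\<lambda>i j. 0)"
    and emat: "\<And>i j. \<lbrakk>i \<in> I; j \<in> I\<rbrakk> \<Longrightarrow> P (emat i j)"
    and add: "\<And>B C. \<lbrakk>B \<in> carrier (gl I); C \<in> carrier (gl I); P B; P C\<rbrakk> \<Longrightarrow> P (lie_add (gl I) B C)"
    and scale: "\<And>c B. \<lbrakk>B \<in> carrier (gl I); P B\<rbrakk> \<Longrightarrow> P (lie_scale (gl I) c B)"
  shows "P B"
proof -
  have "finite S \<Longrightarrow> S \<subseteq> I \<times> I \<Longrightarrow> P (\<lambda>i j. if (i, j) \<in> S then B i j else 0)" for S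
  proof (induction S rule: finite_induct)
    case empty then show ?case using zero by simp
  next
    case (insert p S)
    obtain k l where p: "p = (k, l)" by (cases p)
    have kl: "k \<in> I" "l \<in> I" using insert.prems p by auto
    have "(\<lambda>i j. if (i, j) \<in> insert p S then B i j else 0) =
      lie_add (gl I) (lie_scale (gl I) (B k l) (emat k l)) (\<lambda>i j. if (i, j) \<in> S then B i j else 0)"
      using insert.hyps by (auto simp: p gl_simps emat_def fun_eq_iff)
    moreover have "(\<lambda>i j. if (i, j) \<in> S then B i j else 0) \<in> carrier (gl I)"
      using insert.prems by (auto simp: gl_simps)
    ultimately show ?case
      using insert add[OF gl_scale_closed[OF emat_closed[OF kl]] _ scale[OF emat_closed[OF kl] emat[OF kl]]]
      by simp
  qed
  from this[of "I \<times> I"] have "P (\<lambda>i j. if (i, j) \<in> I \<times> I then B i j else 0)" using assms(1) by simp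
  also have "(\<lambda>i j. if (i, j) \<in> I \<times> I then B i j else 0) = B"
    using assms(2) by (force simp: gl_simps fun_eq_iff)
  finally show ?thesis .
qed

locale gl_fin =
  fixes I :: "nat set"
  assumes finite_I: "finite I"
begin

sublocale lie_closed "gl I" by (rule lie_closed_gl)

abbreviation "Eg i j \<equiv> uea_gen (gl I) (emat i j)"

lemma Eg_closed [simp]: "\<lbrakk>i \<in> I; j \<in> I\<rbrakk> \<Longrightarrow> Eg i j \<in> carrier (uea (gl I))"
  by (simp add: emat_closed)

lemma Eg_gl: "ring.gl_rel (uea (gl I)) I Eg"
  unfolding U.gl_rel_def
proof (intro conjI ballI)
  fix i j k l assume m: "i \<in> I" "j \<in> I" "k \<in> I" "l \<in> I"
  have "U.comm (Eg i j) (Eg k l) = uea_gen (gl I) (lie_bracket (gl I) (emat i j) (emat k l))"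
    using m by (simp add: U.comm_def gen_bracket emat_closed)
  also have "\<dots> = (if j = k then Eg i l else \<zero>\<^bsub>uea (gl I)\<^esub>) \<ominus>\<^bsub>uea (gl I)\<^esub> (if i = l then Eg k j else \<zero>\<^bsub>uea (gl I)\<^esub>)"
    unfolding emat_bracket[OF finite_I m]
    using m by (simp add: gen_add gen_scale emat_closed gl_scale_closed U.minus_eq)
  finally show "U.comm (Eg i j) (Eg k l) =
    (if j = k then Eg i l else \<zero>\<^bsub>uea (gl I)\<^esub>) \<ominus>\<^bsub>uea (gl I)\<^esub> (if i = l then Eg k j else \<zero>\<^bsub>uea (gl I)\<^esub>)" .
qed simp

text \<open>Both sides of the relations are bilinear in the matrices, so they follow from those between matrix units.\<close>

lemma gl_hom_exists:
  assumes "calg B" and r: "ring.gl_rel B I r"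
  shows "\<exists>h\<in>alg_hom (uea (gl I)) B. \<forall>i\<in>I. \<forall>j\<in>I. h (Eg i j) = r i j"
proof -
  interpret B: calg B by fact
  have rc [simp]: "r i j \<in> carrier B" if "i \<in> I" "j \<in> I" for i j using B.gl_relD(1)[OF r] that by blast
  define \<phi> where "\<phi> M = (\<Oplus>\<^bsub>B\<^esub>p\<in>I \<times> I. M (fst p) (snd p) \<odot>\<^bsub>B\<^esub> r (fst p) (snd p))" for M
  have fin: "finite (I \<times> I)" using finite_I by simp
  have cl [simp]: "\<phi> M \<in> carrier B" for M unfolding \<phi>_def by (rule B.finsum_closed) auto
  have add: "\<phi> (lie_add (gl I) M N) = \<phi> M \<oplus>\<^bsub>B\<^esub> \<phi> N" for M N
  proof -
    have "\<phi> (lie_add (gl I) M N) = (\<Oplus>\<^bsub>B\<^esub>p\<in>I \<times> I. M (fst p) (snd p) \<odot>\<^bsub>B\<^esub> r (fst p) (snd p) \<oplus>\<^bsub>B\<^esub> N (fst p) (snd p) \<odot>\<^bsub>B\<^esub> r (fst p) (snd p))"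
      unfolding \<phi>_def by (rule B.finsum_cong') (auto simp: gl_simps B.smult_l_distr)
    also have "\<dots> = \<phi> M \<oplus>\<^bsub>B\<^esub> \<phi> N" unfolding \<phi>_def by (rule B.finsum_addf) auto
    finally show ?thesis .
  qed
  have scale: "\<phi> (lie_scale (gl I) c M) = c \<odot>\<^bsub>B\<^esub> \<phi> M" for c M
    unfolding \<phi>_def by (subst B.smult_finsum) (auto intro!: B.finsum_cong' simp: gl_simps B.smult_assoc)
  have em: "\<phi> (emat i j) = r i j" if "i \<in> I" "j \<in> I" for i j
    unfolding \<phi>_def by (subst B.finsum_single_if[OF fin, of "(i, j)"]) (use that in \<open>auto simp: emat_def\<close>)
  have z: "\<phi> (\<lambda>i j. 0) = \<zero>\<^bsub>B\<^esub>"
    using scale[of 0 "\<lambda>i j. 0"] by (simp add: gl_simps)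
  have br_add: "lie_bracket (gl I) (lie_add (gl I) M M') N = lie_add (gl I) (lie_bracket (gl I) M N) (lie_bracket (gl I) M' N)"
     "lie_bracket (gl I) N (lie_add (gl I) M M') = lie_add (gl I) (lie_bracket (gl I) N M) (lie_bracket (gl I) N M')" for M M' N
    by (auto simp: gl_simps fun_eq_iff algebra_simps sum.distrib)
  have br_sc: "lie_bracket (gl I) (lie_scale (gl I) c M) N = lie_scale (gl I) c (lie_bracket (gl I) M N)"
     "lie_bracket (gl I) N (lie_scale (gl I) c M) = lie_scale (gl I) c (lie_bracket (gl I) N M)" for M N c
    by (auto simp: gl_simps fun_eq_iff algebra_simps sum_distrib_left)
  have br_z: "lie_bracket (gl I) (\<lambda>i j. 0) N = (\<lambda>i j. 0)" "lie_bracket (gl I) N (\<lambda>i j. 0) = (\<lambda>i j. 0)" for N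
    by (auto simp: gl_simps)
  have br: "\<phi> (lie_bracket (gl I) M N) = B.comm (\<phi> M) (\<phi> N)"
    if M: "M \<in> carrier (gl I)" and N: "N \<in> carrier (gl I)" for M N
    using finite_I M
  proof (induction M rule: gl_induct)
    case zero then show ?case by (simp add: br_z z)
  next
    case (emat i j)
    show ?case using finite_I N
    proof (induction N rule: gl_induct)
      case zero then show ?case by (simp add: br_z z)
    next
      case (emat k l)
      then show ?case using \<open>i \<in> I\<close> \<open>j \<in> I\<close>
        by (simp add: emat_bracket[OF finite_I] add scale em B.gl_relD(2)[OF r] B.minus_eq)
    next
      case (add M N) then show ?case by (simp add: br_add \<open>\<And>N M. \<phi> (lie_add (gl I) M N) = \<phi> M \<oplus>\<^bsub>B\<^esub> \<phi> N\<close> B.comm_add_r)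
    next
      case (scale c M) then show ?case by (simp add: br_sc \<open>\<And>c M. \<phi> (lie_scale (gl I) c M) = c \<odot>\<^bsub>B\<^esub> \<phi> M\<close> B.comm_smult_r)
    qed
  next
    case (add M M') then show ?case by (simp add: br_add \<open>\<And>N M. \<phi> (lie_add (gl I) M N) = \<phi> M \<oplus>\<^bsub>B\<^esub> \<phi> N\<close> B.comm_add_l)
  next
    case (scale c M) then show ?case by (simp add: br_sc \<open>\<And>c M. \<phi> (lie_scale (gl I) c M) = c \<odot>\<^bsub>B\<^esub> \<phi> M\<close> B.comm_smult_l)
  qed
  have "\<exists>h\<in>alg_hom (uea (gl I)) B. \<forall>a\<in>carrier (gl I). h (uea_gen (gl I) a) = \<phi> a"
    by (rule uea_hom_exists[OF assms(1)]) (simp_all add: add scale br B.comm_def)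
  then obtain h where "h \<in> alg_hom (uea (gl I)) B" "\<And>a. a \<in> carrier (gl I) \<Longrightarrow> h (uea_gen (gl I) a) = \<phi> a" by blast
  then show ?thesis using em emat_closed by (intro bexI[of _ h]) simp_all
qed

lemma gl_hom_eqI:
  assumes "calg B" "h \<in> alg_hom (uea (gl I)) B" "h' \<in> alg_hom (uea (gl I)) B"
    and "\<And>i j. \<lbrakk>i \<in> I; j \<in> I\<rbrakk> \<Longrightarrow> h (Eg i j) = h' (Eg i j)"
  shows "h = h'"
proof (rule uea_hom_eqI[OF assms(1-3)])
  interpret h: calg_hom "uea (gl I)" B h using U.calg_axioms assms by (simp add: calg_hom_def calg_hom_axioms_def)
  interpret h': calg_hom "uea (gl I)" B h' using U.calg_axioms assms by (simp add: calg_hom_def calg_hom_axioms_def)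
  have z: "(\<lambda>i j. 0) = lie_scale (gl I) 0 (\<lambda>i j. 0)" "(\<lambda>i j. 0) \<in> carrier (gl I)" by (simp_all add: gl_simps)
  fix a assume "a \<in> carrier (gl I)"
  with finite_I show "h (uea_gen (gl I) a) = h' (uea_gen (gl I) a)"
    by (induction a rule: gl_induct)
       (simp_all add: assms(4) gen_add gen_scale, subst (1 2) z(1), simp add: gen_scale[OF z(2)] z(2))
qed

end

section \<open>Differential operators\<close>

abbreviation lk where "lk \<equiv> Poly_Mapping.lookup"
abbreviation sg where "sg \<equiv> Poly_Mapping.single"

definition vexp :: "nat \<Rightarrow> (nat \<Rightarrow>\<^sub>0 int) \<Rightarrow> bool"
  where "vexp n e \<longleftrightarrow> Poly_Mapping.keys e \<subseteq> {0..n} \<and> (\<forall>i\<in>{1..n}. 0 \<le> lk e i)"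

lemma laurent_eq: "laurent n = {f. Poly_Mapping.keys f \<subseteq> Collect (vexp n)}"
  unfolding laurent_def vexp_def by blast

lemma vexp_add: "\<lbrakk>vexp n e; vexp n e'\<rbrakk> \<Longrightarrow> vexp n (e + e')"
  using keys_add[of e e'] by (auto simp: vexp_def lookup_add)

lemma laurent_0 [simp]: "0 \<in> laurent n" by (simp add: laurent_eq)

lemma laurent_add: "\<lbrakk>f \<in> laurent n; g \<in> laurent n\<rbrakk> \<Longrightarrow> f + g \<in> laurent n"
  using keys_add[of f g] by (auto simp: laurent_eq)

lemma laurent_scale: "f \<in> laurent n \<Longrightarrow> pm_scale c f \<in> laurent n"
  using keys_pm_scale[of c f] by (auto simp: laurent_eq)

lemma laurent_single: "vexp n e \<Longrightarrow> sg e c \<in> laurent n"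
  by (simp add: laurent_eq)

lemma laurent_mult: "\<lbrakk>f \<in> laurent n; g \<in> laurent n\<rbrakk> \<Longrightarrow> f * g \<in> laurent n"
  using keys_mult[of f g] vexp_add[of n] unfolding laurent_eq by blast

lemma uminus_scale: "- f = pm_scale (- 1) f"
  by (rule poly_mapping_eqI) simp

lemma laurent_uminus: "f \<in> laurent n \<Longrightarrow> - f \<in> laurent n"
  by (simp add: uminus_scale laurent_scale)

lemma laurent_induct [consumes 1, case_names zero single add]:
  assumes "f \<in> laurent n" "P 0" "\<And>e c. vexp n e \<Longrightarrow> P (sg e c)"
    "\<And>f g. \<lbrakk>f \<in> laurent n; g \<in> laurent n; P f; P g\<rbrakk> \<Longrightarrow> P (f + g)"
  shows "P f"
  using assms(1)[unfolded laurent_eq mem_Collect_eq]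
  by (rule pm_induct) (use assms in \<open>simp_all add: laurent_eq\<close>)

lemma pm_scale_sum: "pm_scale c (\<Sum>i\<in>I. f i) = (\<Sum>i\<in>I. pm_scale c (f i))"
  by (induction I rule: infinite_finite_induct) (simp_all add: pm_scale_add)

lemma pm_scale_0 [simp]: "pm_scale 0 f = 0"
  by (rule poly_mapping_eqI) simp

lemma pm_scale_assoc: "pm_scale c (pm_scale d f) = pm_scale (c * d) f"
  by (rule poly_mapping_eqI) simp

lemma pm_scale_one [simp]: "pm_scale 1 f = f"
  by (rule poly_mapping_eqI) simp

lemma pm_scale_l: "pm_scale (c + d) f = pm_scale c f + pm_scale d f"
  by (rule poly_mapping_eqI) (simp add: lookup_add algebra_simps)

lemma lin_ops_simps:
  "monoid.mult (lin_ops n) = compose (laurent n)"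
  "\<one>\<^bsub>lin_ops n\<^esub> = (\<lambda>f\<in>laurent n. f)"
  "\<zero>\<^bsub>lin_ops n\<^esub> = (\<lambda>f\<in>laurent n. 0)"
  "D \<oplus>\<^bsub>lin_ops n\<^esub> D' = (\<lambda>f\<in>laurent n. D f + D' f)"
  "c \<odot>\<^bsub>lin_ops n\<^esub> D = (\<lambda>f\<in>laurent n. pm_scale c (D f))"
  by (simp_all add: lin_ops_def)

lemma lin_opsI:
  assumes "\<And>f. f \<in> laurent n \<Longrightarrow> D f \<in> laurent n"
    "\<And>f g. \<lbrakk>f \<in> laurent n; g \<in> laurent n\<rbrakk> \<Longrightarrow> D (f + g) = D f + D g"
    "\<And>c f. f \<in> laurent n \<Longrightarrow> D (pm_scale c f) = pm_scale c (D f)"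
    "D \<in> extensional (laurent n)"
  shows "D \<in> carrier (lin_ops n)"
  using assms by (auto simp: lin_ops_def PiE_def)

lemma lin_opsD:
  assumes "D \<in> carrier (lin_ops n)"
  shows "f \<in> laurent n \<Longrightarrow> D f \<in> laurent n"
    "\<lbrakk>f \<in> laurent n; g \<in> laurent n\<rbrakk> \<Longrightarrow> D (f + g) = D f + D g"
    "f \<in> laurent n \<Longrightarrow> D (pm_scale c f) = pm_scale c (D f)"
    "D \<in> extensional (laurent n)"
  using assms by (auto simp: lin_ops_def PiE_def)

lemma lin_ops_zero: "D \<in> carrier (lin_ops n) \<Longrightarrow> D 0 = 0"
  using lin_opsD(3)[of D n 0 0] by simp

lemma lin_ops_eqI:
  assumes D: "D \<in> carrier (lin_ops n)" and D': "D' \<in> carrier (lin_ops n)"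
    and eq: "\<And>e. vexp n e \<Longrightarrow> D (sg e 1) = D' (sg e 1)"
  shows "D = D'"
proof (rule extensionalityI[OF lin_opsD(4)[OF D] lin_opsD(4)[OF D']])
  fix f assume "f \<in> laurent n"
  then show "D f = D' f"
  proof (induction f rule: laurent_induct)
    case zero then show ?case using D D' by (simp add: lin_ops_zero)
  next
    case (single e c)
    have "D (pm_scale c (sg e 1)) = D' (pm_scale c (sg e 1))"
      using lin_opsD(3)[OF D laurent_single[OF single]] lin_opsD(3)[OF D' laurent_single[OF single]] eq[OF single] by metis
    then show ?case by simp
  next
    case (add f g) then show ?case using lin_opsD(2)[OF D] lin_opsD(2)[OF D'] by simp
  qed
qed

lemma calg_lin_ops: "calg (lin_ops n)"
proof -
  let ?L = "laurent n"
  have e: "D f = undefined" if "D \<in> carrier (lin_ops n)" "f \<notin> ?L" for D f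
    using lin_opsD(4)[OF that(1)] that(2) by (auto simp: extensional_def)
  have "ring (lin_ops n)"
  proof (intro ringI abelian_groupI monoidI, goal_cases)
    case (1 x y) then show ?case
      by (intro lin_opsI) (auto simp: lin_ops_simps laurent_add lin_opsD laurent_scale pm_scale_add)
  next
    case 2 show ?case by (intro lin_opsI) (auto simp: lin_ops_simps laurent_add laurent_scale)
  next
    case (3 x y z) then show ?case by (auto simp: lin_ops_simps fun_eq_iff lin_opsD add.assoc)
  next
    case (4 x y) then show ?case by (auto simp: lin_ops_simps fun_eq_iff add.commute)
  next
    case (5 x) then show ?case by (auto simp: lin_ops_simps fun_eq_iff e)
  next
    case (6 x)
    have "(\<lambda>f\<in>?L. - x f) \<in> carrier (lin_ops n)"
      using 6 by (intro lin_opsI) (auto simp: laurent_add lin_opsD laurent_scale laurent_uminus uminus_scale pm_scale_assoc pm_scale_add)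
    then show ?case by (rule bexI[rotated]) (auto simp: lin_ops_simps fun_eq_iff)
  next
    case (7 x y) then show ?case
      by (intro lin_opsI) (auto simp: lin_ops_simps compose_def laurent_add lin_opsD laurent_scale)
  next
    case 8 show ?case by (intro lin_opsI) (auto simp: lin_ops_simps laurent_add laurent_scale)
  next
    case (9 x y z) then show ?case by (auto simp: lin_ops_simps compose_def fun_eq_iff lin_opsD)
  next
    case (10 x) then show ?case by (auto simp: lin_ops_simps compose_def fun_eq_iff lin_opsD e)
  next
    case (11 x) then show ?case by (auto simp: lin_ops_simps compose_def fun_eq_iff lin_opsD e)
  next
    case (12 x y z) then show ?case by (auto simp: lin_ops_simps compose_def fun_eq_iff lin_opsD)
  next
    case (13 x y z) then show ?case by (auto simp: lin_ops_simps compose_def fun_eq_iff lin_opsD)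
  qed
  then show ?thesis
  proof (rule calg.intro, intro calg_axioms.intro, goal_cases)
    case (1 x c) then show ?case
      by (intro lin_opsI) (auto simp: lin_ops_simps laurent_add lin_opsD laurent_scale pm_scale_add pm_scale_assoc mult.commute)
  next
    case (2 x c d) then show ?case by (auto simp: lin_ops_simps fun_eq_iff pm_scale_l)
  next
    case (3 x y c) then show ?case by (auto simp: lin_ops_simps fun_eq_iff pm_scale_add)
  next
    case (4 x c d) then show ?case by (auto simp: lin_ops_simps fun_eq_iff pm_scale_assoc)
  next
    case (5 x) then show ?case by (auto simp: lin_ops_simps fun_eq_iff e)
  next
    case (6 x y c) then show ?case by (auto simp: lin_ops_simps compose_def fun_eq_iff lin_opsD)
  next
    case (7 x y c) then show ?case by (auto simp: lin_ops_simps compose_def fun_eq_iff lin_opsD)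
  qed
qed

interpretation lo: calg "lin_ops n" for n by (rule calg_lin_ops)

lemma lin_ops_uminus: "D \<in> carrier (lin_ops n) \<Longrightarrow> f \<in> laurent n \<Longrightarrow> (\<ominus>\<^bsub>lin_ops n\<^esub> D) f = - D f"
  using lo.smult_minus1[of D n] by (metis lin_ops_simps(5) restrict_apply' uminus_scale)

lemma lin_ops_minus: "\<lbrakk>D \<in> carrier (lin_ops n); D' \<in> carrier (lin_ops n); f \<in> laurent n\<rbrakk> \<Longrightarrow>
    (D \<ominus>\<^bsub>lin_ops n\<^esub> D') f = D f - D' f"
  by (simp add: a_minus_def lin_ops_simps lin_ops_uminus)

lemma lin_ops_comm: "\<lbrakk>D \<in> carrier (lin_ops n); D' \<in> carrier (lin_ops n); f \<in> laurent n\<rbrakk> \<Longrightarrow>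
    (lo.comm n D D') f = D (D' f) - D' (D f)"
  unfolding lo.comm_def by (simp add: lin_ops_minus lo.m_closed del: lo.comm_def) (simp add: lin_ops_simps compose_def)

lemma pm_scale_times: "pm_scale c (f * g) = f * pm_scale c (g::laur)"
proof -
  have "pm_scale c h = sg 0 c * h" for h :: laur
    by (simp add: pm_scale_def mult_map_scale_conv_mult)
  then show ?thesis by (simp add: mult_ac)
qed

lemma mul_op_lin: "f \<in> laurent n \<Longrightarrow> mul_op n f \<in> carrier (lin_ops n)"
  by (intro lin_opsI)
     (auto simp: mul_op_def laurent_mult laurent_add laurent_scale pm_scale_times distrib_left)

abbreviation dl :: "nat \<Rightarrow> nat \<Rightarrow>\<^sub>0 int" where "dl i \<equiv> sg i 1"

lemma partial_supset:
  assumes "f \<in> laurent n" "finite S" "Poly_Mapping.keys f \<subseteq> S"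
  shows "partial n j f = (\<Sum>e\<in>S. sg (e - dl j) (of_int (lk e j) * lk f e))"
  unfolding partial_def restrict_apply'[OF assms(1)]
  by (rule sum.mono_neutral_left) (use assms in \<open>auto simp: in_keys_iff\<close>)

lemma partial_single: "vexp n e \<Longrightarrow> partial n j (sg e c) = sg (e - dl j) (of_int (lk e j) * c)"
  by (subst partial_supset[of _ _ "{e}"]) (auto simp: laurent_single)

lemma vexp_partial:
  assumes "vexp n e" "j \<le> n" "lk e j \<noteq> 0"
  shows "vexp n (e - dl j)"
  using assms by (auto simp: vexp_def lookup_minus lookup_single when_def in_keys_iff subset_iff split: if_splits)
     (smt (verit, best) atLeastAtMost_iff)

lemma partial_lin:
  assumes j: "j \<le> n"
  shows "partial n j \<in> carrier (lin_ops n)"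
proof -
  have add: "partial n j (f + g) = partial n j f + partial n j g" if "f \<in> laurent n" "g \<in> laurent n" for f g
  proof -
    let ?S = "Poly_Mapping.keys f \<union> Poly_Mapping.keys g"
    have S: "Poly_Mapping.keys (f + g) \<subseteq> ?S" "finite ?S" using keys_add[of f g] by auto
    show ?thesis using that S
      by (simp add: partial_supset[of _ n ?S] laurent_add lookup_add algebra_simps single_add sum.distrib)
  qed
  show ?thesis
  proof (rule lin_opsI)
    fix f assume "f \<in> laurent n"
    then show "partial n j f \<in> laurent n"
    proof (induction f rule: laurent_induct)
      case zero then show ?case by (simp add: partial_def)
    next
      case (single e c) then show ?case
        by (cases "lk e j = 0") (auto simp: partial_single intro: laurent_single vexp_partial j)
    next
      case (add f g) then show ?case by (simp add: \<open>\<And>g f. \<lbrakk>f \<in> laurent n; g \<in> laurent n\<rbrakk> \<Longrightarrow> partial n j (f + g) = partial n j f + partial n j g\<close> laurent_add)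
    qed
  next
    fix c f assume f: "f \<in> laurent n"
    show "partial n j (pm_scale c f) = pm_scale c (partial n j f)"
      using f keys_pm_scale[of c f]
      by (simp add: partial_supset[of _ n "Poly_Mapping.keys f"] laurent_scale pm_scale_sum mult_ac)
  qed (auto simp: add, simp add: partial_def)
qed

lemma lk_dl: "lk (dl i) j = (if i = j then 1 else 0)"
  by (simp add: lookup_single when_def)

lemma vexp_dl: "i \<le> n \<Longrightarrow> vexp n (dl i)"
  by (auto simp: vexp_def lookup_single when_def)

lemma vexp_quot: "i \<le> n \<Longrightarrow> vexp n (dl i - dl 0)"
  by (auto simp: vexp_def lookup_minus lk_dl lookup_one when_def in_keys_iff subset_iff split: if_splits)

lemma diffops_gens: "mul_op n ` laurent n \<union> partial n ` {0..n} \<subseteq> carrier (lin_ops n)"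
  by (auto intro: mul_op_lin partial_lin)

lemma diffops_simps [simp]:
  "monoid.mult (diffops n) = monoid.mult (lin_ops n)" "ring.add (diffops n) = ring.add (lin_ops n)"
  "module.smult (diffops n) = module.smult (lin_ops n)" "\<one>\<^bsub>diffops n\<^esub> = \<one>\<^bsub>lin_ops n\<^esub>" "\<zero>\<^bsub>diffops n\<^esub> = \<zero>\<^bsub>lin_ops n\<^esub>"
  by (simp_all add: diffops_def)

lemma calg_diffops: "calg (diffops n)"
  unfolding diffops_def by (rule lo.calg_subalg[OF diffops_gens])

interpretation dif: calg "diffops n" for n by (rule calg_diffops)

lemma diffops_sub: "carrier (diffops n) \<subseteq> carrier (lin_ops n)"
  unfolding diffops_def by (rule lo.subalg_subset[OF diffops_gens])

lemma diffops_mem: "f \<in> laurent n \<Longrightarrow> mul_op n f \<in> carrier (diffops n)" "j \<le> n \<Longrightarrow> partial n j \<in> carrier (diffops n)"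
  using lo.subalg_gen[OF diffops_gens, of n] unfolding diffops_def by auto

lemma tvar_laurent: "i \<le> n \<Longrightarrow> tvar i \<in> laurent n"
  by (simp add: tvar_def laurent_single vexp_dl)

lemma tquot_laurent: "i \<le> n \<Longrightarrow> tquot i \<in> laurent n"
  unfolding tquot_def by (rule laurent_single, rule vexp_quot)

lemma t_partial_diffops: "\<lbrakk>i \<le> n; j \<le> n\<rbrakk> \<Longrightarrow> t_partial n i j \<in> carrier (diffops n)"
  unfolding t_partial_def by (rule dif.m_closed) (auto intro: diffops_mem tvar_laurent)

lemma Dprime_gens: "(\<lambda>i. mul_op n (tquot i)) ` {1..n} \<union> (\<lambda>j. t_partial n 0 j) ` {0..n} \<subseteq> carrier (diffops n)"
  by (intro Un_least image_subsetI t_partial_diffops diffops_mem(1) tquot_laurent) simp_all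

lemma Dprime_simps [simp]:
  "monoid.mult (Dprime n) = monoid.mult (lin_ops n)" "ring.add (Dprime n) = ring.add (lin_ops n)"
  "module.smult (Dprime n) = module.smult (lin_ops n)" "\<one>\<^bsub>Dprime n\<^esub> = \<one>\<^bsub>lin_ops n\<^esub>" "\<zero>\<^bsub>Dprime n\<^esub> = \<zero>\<^bsub>lin_ops n\<^esub>"
  by (simp_all add: Dprime_def)

lemma calg_Dprime: "calg (Dprime n)"
  unfolding Dprime_def by (rule dif.calg_subalg[OF Dprime_gens])

interpretation Dp: calg "Dprime n" for n by (rule calg_Dprime)

lemma Dprime_sub: "D \<in> carrier (Dprime n) \<Longrightarrow> D \<in> carrier (lin_ops n)"
  using dif.subalg_subset[OF Dprime_gens, of n] diffops_sub[of n] unfolding Dprime_def by blast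

lemma Dprime_comm:
  assumes "D \<in> carrier (Dprime n)" "D' \<in> carrier (Dprime n)"
  shows "Dp.comm n D D' = lo.comm n D D'"
proof -
  have "\<ominus>\<^bsub>Dprime n\<^esub> (D' \<otimes>\<^bsub>Dprime n\<^esub> D) = \<ominus>\<^bsub>lin_ops n\<^esub> (D' \<otimes>\<^bsub>lin_ops n\<^esub> D)"
    using Dp.smult_minus1[OF Dp.m_closed[OF assms(2,1)]] lo.smult_minus1[OF lo.m_closed[OF assms(2,1)[THEN Dprime_sub]]]
    by simp
  then show ?thesis by (simp add: Dp.comm_def lo.comm_def a_minus_def)
qed

abbreviation "xop n a \<equiv> mul_op n (tquot a)"
abbreviation "yop n b \<equiv> t_partial n 0 b"

lemma xop_0: "xop n 0 = \<one>\<^bsub>Dprime n\<^esub>"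
  by (auto simp: mul_op_def tquot_def lin_ops_simps fun_eq_iff)

lemma xop_Dp: "a \<le> n \<Longrightarrow> xop n a \<in> carrier (Dprime n)"
  using dif.subalg_gen[OF Dprime_gens, of n] xop_0[of n] Dp.one_closed[of n] unfolding Dprime_def[symmetric]
  by (cases "a = 0") auto

lemma yop_Dp: "b \<le> n \<Longrightarrow> yop n b \<in> carrier (Dprime n)"
  using dif.subalg_gen[OF Dprime_gens, of n] unfolding Dprime_def[symmetric] by auto

lemma vexp_shift: "vexp n e \<Longrightarrow> a \<le> n \<Longrightarrow> vexp n (e + (dl a - dl 0))"
  by (intro vexp_add vexp_quot)

lemma xop_single: "vexp n e \<Longrightarrow> xop n a (sg e c) = sg (e + dl a - dl 0) c"
  by (simp add: mul_op_def tquot_def laurent_single mult_single algebra_simps)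

lemma t_partial_single:
  assumes "vexp n e" "a \<le> n" "b \<le> n"
  shows "t_partial n a b (sg e c) = sg (e + dl a - dl b) (of_int (lk e b) * c)"
proof (cases "lk e b = 0")
  case True
  then show ?thesis using assms
    by (simp add: t_partial_def lin_ops_simps compose_def laurent_single partial_single mul_op_def)
next
  case False
  then show ?thesis using assms vexp_partial[OF assms(1,3)]
    by (simp add: t_partial_def lin_ops_simps compose_def laurent_single partial_single mul_op_def tvar_def mult_single algebra_simps)
qed

lemma vexp_t: "\<lbrakk>vexp n e; a \<le> n; b \<le> n; lk e b \<noteq> 0\<rbrakk> \<Longrightarrow> vexp n (e + dl a - dl b)"
  using vexp_add[OF vexp_partial[of n e b] vexp_dl[of a n]] by (simp add: algebra_simps)

lemma t_partial_eq:
  assumes "a \<le> n" "b \<le> n"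
  shows "t_partial n a b = xop n a \<otimes>\<^bsub>Dprime n\<^esub> yop n b"
proof (rule lin_ops_eqI)
  show "t_partial n a b \<in> carrier (lin_ops n)" using t_partial_diffops[OF assms] diffops_sub by blast
  show "xop n a \<otimes>\<^bsub>Dprime n\<^esub> yop n b \<in> carrier (lin_ops n)"
    using assms xop_Dp yop_Dp Dp.m_closed Dprime_sub by blast
  fix e assume e: "vexp n e"
  show "t_partial n a b (sg e 1) = (xop n a \<otimes>\<^bsub>Dprime n\<^esub> yop n b) (sg e 1)"
  proof (cases "lk e b = 0")
    case True
    then show ?thesis using assms e
      by (simp add: lin_ops_simps compose_def laurent_single t_partial_single mul_op_def)
  next
    case False
    then show ?thesis using assms e vexp_t[of n e 0 b]
      by (simp add: lin_ops_simps compose_def laurent_single t_partial_single xop_single algebra_simps)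
  qed
qed

lemma sg_diff_same: "sg e a - sg e b = sg e (a - b)"
  by (simp add: single_diff)

lemma sg_cancel: "sg e x + sg e (- x :: complex) = 0"
  by (simp add: single_uminus)

lemma Dp_XX: "\<lbrakk>a \<le> n; b \<le> n\<rbrakk> \<Longrightarrow> Dp.comm n (xop n a) (xop n b) = \<zero>\<^bsub>Dprime n\<^esub>"
proof -
  assume ab: "a \<le> n" "b \<le> n"
  note l = xop_Dp[OF ab(1), THEN Dprime_sub] xop_Dp[OF ab(2), THEN Dprime_sub]
  have "lo.comm n (xop n a) (xop n b) = \<zero>\<^bsub>lin_ops n\<^esub>"
  proof (rule lin_ops_eqI)
    fix e assume e: "vexp n e"
    then show "lo.comm n (xop n a) (xop n b) (sg e 1) = \<zero>\<^bsub>lin_ops n\<^esub> (sg e 1)"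
      using l ab vexp_shift[OF e ab(1)] vexp_shift[OF e ab(2)]
      by (simp add: lin_ops_comm laurent_single xop_single add_diff_eq del: single_one)
        (simp add: lin_ops_simps laurent_single algebra_simps)
  qed (use l in auto)
  then show ?thesis using ab by (simp add: Dprime_comm xop_Dp)
qed

lemma yop_single': "\<lbrakk>vexp n e; b \<le> n\<rbrakk> \<Longrightarrow> yop n b (sg e c) = sg (e + dl 0 - dl b) (of_int (lk e b) * c)"
  by (simp add: t_partial_single)

lemma yop_zero: "b \<le> n \<Longrightarrow> yop n b 0 = 0"
  using lin_ops_zero[OF Dprime_sub[OF yop_Dp]] .

lemma xop_zero: "b \<le> n \<Longrightarrow> xop n b 0 = 0"
  using lin_ops_zero[OF Dprime_sub[OF xop_Dp]] .

lemma x_y_single: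
  assumes "vexp n e" "a \<le> n" "b \<le> n"
  shows "xop n a (yop n b (sg e 1)) = sg (e + dl a - dl b) (of_int (lk e b))"
  using assms vexp_t[of n e 0 b]
  by (cases "lk e b = 0") (simp_all add: yop_single' xop_zero xop_single algebra_simps)

lemma y_x_single:
  assumes "vexp n e" "a \<le> n" "b \<le> n"
  shows "yop n b (xop n a (sg e 1)) = sg (e + dl a - dl b) (of_int (lk e b + lk (dl a) b - lk (dl 0) b))"
  using assms vexp_shift[of n e a]
  by (simp add: xop_single yop_single' algebra_simps lookup_add lookup_minus)

lemma y_y_single:
  assumes "vexp n e" "b \<le> n" "c \<le> n"
  shows "yop n b (yop n c (sg e 1)) = sg (e + dl 0 + dl 0 - dl b - dl c)
     (of_int (lk e c) * of_int (lk e b + lk (dl 0) b - lk (dl c) b))"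
  using assms vexp_t[of n e 0 c]
  by (cases "lk e c = 0") (simp_all add: yop_single' yop_zero algebra_simps lookup_add lookup_minus)

lemma Dp_YX:
  assumes "a \<le> n" "b \<le> n"
  shows "Dp.comm n (yop n b) (xop n a) =
    (if a = b then \<one>\<^bsub>Dprime n\<^esub> else \<zero>\<^bsub>Dprime n\<^esub>) \<oplus>\<^bsub>Dprime n\<^esub> (if b = 0 then - 1 else 0) \<odot>\<^bsub>Dprime n\<^esub> xop n a"
proof -
  note l = xop_Dp[OF assms(1), THEN Dprime_sub] yop_Dp[OF assms(2), THEN Dprime_sub]
  have "lo.comm n (yop n b) (xop n a) = (if a = b then \<one>\<^bsub>Dprime n\<^esub> else \<zero>\<^bsub>Dprime n\<^esub>) \<oplus>\<^bsub>Dprime n\<^esub> (if b = 0 then - 1 else 0) \<odot>\<^bsub>Dprime n\<^esub> xop n a"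
    (is "_ = ?r")
  proof (rule lin_ops_eqI)
    show "?r \<in> carrier (lin_ops n)" using l by auto
    fix e assume e: "vexp n e"
    have "lo.comm n (yop n b) (xop n a) (sg e 1) = sg (e + dl a - dl b) (of_int (lk (dl a) b - lk (dl 0) b))"
      using l assms e by (simp add: lin_ops_comm laurent_single x_y_single y_x_single sg_diff_same)
    also have "\<dots> = ?r (sg e 1)"
      using e assms by (auto simp: lin_ops_simps laurent_single xop_single lk_dl sg_cancel simp del: single_one)
    finally show "lo.comm n (yop n b) (xop n a) (sg e 1) = ?r (sg e 1)" .
  qed (use l in auto)
  then show ?thesis using assms by (simp only: Dprime_comm xop_Dp yop_Dp)
qed

lemma Dp_YY:
  assumes "b \<le> n" "c \<le> n"
  shows "Dp.comm n (yop n b) (yop n c) =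
    (if b = 0 then 1 else 0) \<odot>\<^bsub>Dprime n\<^esub> yop n c \<oplus>\<^bsub>Dprime n\<^esub> (if c = 0 then - 1 else 0) \<odot>\<^bsub>Dprime n\<^esub> yop n b"
proof -
  note l = yop_Dp[OF assms(1), THEN Dprime_sub] yop_Dp[OF assms(2), THEN Dprime_sub]
  have "lo.comm n (yop n b) (yop n c) = (if b = 0 then 1 else 0) \<odot>\<^bsub>Dprime n\<^esub> yop n c \<oplus>\<^bsub>Dprime n\<^esub> (if c = 0 then - 1 else 0) \<odot>\<^bsub>Dprime n\<^esub> yop n b"
    (is "_ = ?r")
  proof (rule lin_ops_eqI)
    show "?r \<in> carrier (lin_ops n)" using l by auto
    fix e assume e: "vexp n e"
    have eq: "e + dl 0 + dl 0 - dl b - dl c = e + dl 0 + dl 0 - dl c - dl b" by (simp add: algebra_simps)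
    have "lo.comm n (yop n b) (yop n c) (sg e 1) = sg (e + dl 0 + dl 0 - dl b - dl c)
      (of_int (lk e c) * of_int (lk e b + lk (dl 0) b - lk (dl c) b) - of_int (lk e b) * of_int (lk e c + lk (dl 0) c - lk (dl b) c))"
      using l assms e by (simp only: lin_ops_comm laurent_single y_y_single eq sg_diff_same)
    also have "\<dots> = ?r (sg e 1)"
      using e assms by (auto simp: lin_ops_simps laurent_single yop_single' lk_dl algebra_simps sg_cancel simp del: single_one)
    finally show "lo.comm n (yop n b) (yop n c) (sg e 1) = ?r (sg e 1)" .
  qed (use l in auto)
  then show ?thesis using assms by (simp only: Dprime_comm xop_Dp yop_Dp)
qed

section \<open>Existence of the homomorphisms\<close>

declare Dprime_simps [simp del] One_nat_def [simp del] xop_Dp [simp] yop_Dp [simp]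

lemma (in calg) finsum_subalg:
  assumes S: "S \<subseteq> carrier A" and f: "f \<in> I \<rightarrow> carrier (subalg A S)" and fin: "finite I"
  shows "finsum (subalg A S) f I = finsum A f I"
proof -
  interpret sub: calg "subalg A S" by (rule calg_subalg[OF S])
  show ?thesis using fin f
  proof (induction I rule: finite_induct)
    case empty
    then show ?case by simp
  next
    case (insert x I)
    then have "f x \<in> carrier A" "f \<in> I \<rightarrow> carrier A" using subalg_subset[OF S] by auto
    with insert show ?case by simp
  qed
qed

text \<open>A central element added to the diagonal cancels from the difference on the right of the relations.\<close>

lemma (in calg) gl_rel_shift:
  assumes r: "gl_rel I r" and z: "z \<in> carrier A" "\<And>i j. \<lbrakk>i \<in> I; j \<in> I\<rbrakk> \<Longrightarrow> comm z (r i j) = \<zero>"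
  shows "gl_rel I (\<lambda>i j. r i j \<oplus> (if i = j then z else \<zero>))"
  unfolding gl_rel_def
proof (intro conjI ballI)
  note rc [simp] = gl_relD(1)[OF r]
  fix i j k l assume m: "i \<in> I" "j \<in> I" "k \<in> I" "l \<in> I"
  have z': "comm (r i j) z = \<zero>" if "i \<in> I" "j \<in> I" for i j
    using z that by (simp add: comm_antisym[of "r i j"])
  have "comm (r i j \<oplus> (if i = j then z else \<zero>)) (r k l \<oplus> (if k = l then z else \<zero>)) = comm (r i j) (r k l)"
    using m z z' by (auto simp: comm_add_l comm_add_r)
  also have "\<dots> = (if j = k then r i l else \<zero>) \<ominus> (if i = l then r k j else \<zero>)"
    using m gl_relD(2)[OF r] by simp
  also have "\<dots> = (if j = k then r i l \<oplus> (if i = l then z else \<zero>) else \<zero>) \<ominus>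
      (if i = l then r k j \<oplus> (if k = j then z else \<zero>) else \<zero>)"
    using m z by (auto simp: minus_eq minus_add a_ac r_neg r_neg1 r_neg2)
  finally show "comm (r i j \<oplus> (if i = j then z else \<zero>)) (r k l \<oplus> (if k = l then z else \<zero>)) =
    (if j = k then r i l \<oplus> (if i = l then z else \<zero>) else \<zero>) \<ominus>
      (if i = l then r k j \<oplus> (if k = j then z else \<zero>) else \<zero>)" .
qed (use gl_relD(1)[OF r] z in auto)

lemma col_det_hom:
  assumes "calg_hom A B h" and M: "\<And>i j. \<lbrakk>i \<le> n; j \<le> n\<rbrakk> \<Longrightarrow> M i j \<in> carrier A"
  shows "h (col_det A n M) = col_det B n (\<lambda>i j. h (M i j))"
proof -
  interpret calg_hom A B h by fact
  have ple: "p j \<le> n" if "p permutes {0..n}" "j \<le> n" for p j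
    using permutes_in_image[OF that(1), of j] that(2) by simp
  have f: "foldr (\<lambda>j q. M (p j) j \<otimes>\<^bsub>A\<^esub> q) js \<one>\<^bsub>A\<^esub> \<in> carrier A \<and>
     h (foldr (\<lambda>j q. M (p j) j \<otimes>\<^bsub>A\<^esub> q) js \<one>\<^bsub>A\<^esub>) = foldr (\<lambda>j q. h (M (p j) j) \<otimes>\<^bsub>B\<^esub> q) js \<one>\<^bsub>B\<^esub>"
    if "p permutes {0..n}" "\<And>j. j \<in> set js \<Longrightarrow> j \<le> n" for p js
    using that(2) by (induction js) (simp_all add: M ple[OF that(1)])
  let ?Per = "{p. p permutes {0..n}}"
  let ?t = "\<lambda>p. of_int (sign p) \<odot>\<^bsub>A\<^esub> foldr (\<lambda>j q. M (p j) j \<otimes>\<^bsub>A\<^esub> q) [0..<Suc n] \<one>\<^bsub>A\<^esub>"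
  let ?s = "\<lambda>p. of_int (sign p) \<odot>\<^bsub>B\<^esub> foldr (\<lambda>j q. h (M (p j) j) \<otimes>\<^bsub>B\<^esub> q) [0..<Suc n] \<one>\<^bsub>B\<^esub>"
  have tc: "?t p \<in> carrier A \<and> h (?t p) = ?s p" if p: "p permutes {0..n}" for p
  proof -
    have "\<And>j. j \<in> set [0..<Suc n] \<Longrightarrow> j \<le> n" by auto
    from f[OF p this, of "[0..<Suc n]"] show ?thesis by (simp del: upt_Suc)
  qed
  have "h (finsum A ?t ?Per) = finsum B (h \<circ> ?t) ?Per"
    by (rule hom_finsum) (use tc in \<open>simp del: upt_Suc\<close>)
  also have "\<dots> = finsum B ?s ?Per"
  proof (rule B.finsum_cong')
    show "?s \<in> ?Per \<rightarrow> carrier B" using tc hom_closed by (metis (no_types, lifting) Pi_I mem_Collect_eq)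
  qed (use tc in \<open>simp_all del: upt_Suc\<close>)
  finally show ?thesis unfolding col_det_def .
qed

lemma (in calg) col_det_closed:
  assumes M: "\<And>i j. \<lbrakk>i \<le> n; j \<le> n\<rbrakk> \<Longrightarrow> M i j \<in> carrier A"
  shows "col_det A n M \<in> carrier A"
  unfolding col_det_def pl_def[symmetric]
proof (rule finsum_closed, rule Pi_I, rule smult_closed, rule pl_closed)
  fix p j assume "p \<in> {p. p permutes {0..n}}" "j \<in> set [0..<Suc n]"
  then have j: "p permutes {0..n}" "j \<le> n" by auto
  show "M (p j) j \<in> carrier A" using permutes_in_image[OF j(1), of j] j(2) by (intro M) auto
qed

lemma (in calg) col_det_cong:
  assumes M: "\<And>i j. \<lbrakk>i \<le> n; j \<le> n\<rbrakk> \<Longrightarrow> M i j \<in> carrier A"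
    and MN: "\<And>i j. \<lbrakk>i \<le> n; j \<le> n\<rbrakk> \<Longrightarrow> M i j = N i j"
  shows "col_det A n M = col_det A n N"
  unfolding col_det_def pl_def[symmetric]
proof (rule finsum_cong'[OF refl])
  have le: "p j \<le> n" "j \<le> n" if "p permutes {0..n}" "j \<in> set [0..<Suc n]" for p j
  proof -
    show "j \<le> n" using that(2) by auto
    then show "p j \<le> n" using permutes_in_image[OF that(1), of j] by simp
  qed
  have Ncl: "N i j \<in> carrier A" if "i \<le> n" "j \<le> n" for i j using M[OF that] MN[OF that] by simp
  show "(\<lambda>p. of_int (sign p) \<odot> pl (\<lambda>j. N (p j) j) [0..<Suc n]) \<in> {p. p permutes {0..n}} \<rightarrow> carrier A"
    by (rule Pi_I, rule smult_closed, rule pl_closed, rule Ncl) (use le in auto)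
  fix p assume "p \<in> {p. p permutes {0..n}}"
  then have p: "p permutes {0..n}" by simp
  have "pl (\<lambda>j. M (p j) j) [0..<Suc n] = pl (\<lambda>j. N (p j) j) [0..<Suc n]"
    by (rule pl_cong, rule MN) (rule le[OF p]; assumption)+
  then show "of_int (sign p) \<odot> pl (\<lambda>j. M (p j) j) [0..<Suc n] = of_int (sign p) \<odot> pl (\<lambda>j. N (p j) j) [0..<Suc n]"
    by (rule arg_cong)
qed

locale rank =
  fixes n :: nat
  assumes n1: "n \<ge> 1"
begin

sublocale Ul: gl_fin "{0..n}" by unfold_locales simp
sublocale Gl: gl_fin "{1..n}" by unfold_locales simp
sublocale Sl: lie_closed "sl {0..n}" by (rule lie_closed_sl) simp
sublocale TP: calg_pair "Dprime n" "Ugl n"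
  by (intro calg_pair.intro calg_Dprime Gl.U.calg_axioms)

abbreviation "xx a \<equiv> tns n (xop n a) \<one>\<^bsub>Ugl n\<^esub>"
abbreviation "yy b \<equiv> tns n (yop n b) \<one>\<^bsub>Ugl n\<^esub>"
abbreviation "eg i j \<equiv> tns n \<one>\<^bsub>Dprime n\<^esub> (E0 n i j)"

lemma tens_comm_l: "\<lbrakk>a \<in> carrier (Dprime n); b \<in> carrier (Dprime n)\<rbrakk> \<Longrightarrow>
  TP.T.comm (tns n a \<one>\<^bsub>Ugl n\<^esub>) (tns n b \<one>\<^bsub>Ugl n\<^esub>) = tns n (Dp.comm n a b) \<one>\<^bsub>Ugl n\<^esub>"
  unfolding TP.T.comm_def Dp.comm_def
  by (simp only: TP.tens_mult TP.tens_diff_l Dp.m_closed Gl.U.one_closed Gl.U.r_one)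

lemma tens_comm_r: "\<lbrakk>a \<in> carrier (Ugl n); b \<in> carrier (Ugl n)\<rbrakk> \<Longrightarrow>
  TP.T.comm (tns n \<one>\<^bsub>Dprime n\<^esub> a) (tns n \<one>\<^bsub>Dprime n\<^esub> b) = tns n \<one>\<^bsub>Dprime n\<^esub> (Gl.U.comm a b)"
  unfolding TP.T.comm_def Gl.U.comm_def
  by (simp only: TP.tens_mult TP.tens_diff_r Gl.U.m_closed Dp.one_closed Dp.r_one)

lemma tens_comm_lr: "\<lbrakk>a \<in> carrier (Dprime n); b \<in> carrier (Ugl n)\<rbrakk> \<Longrightarrow>
  TP.T.comm (tns n a \<one>\<^bsub>Ugl n\<^esub>) (tns n \<one>\<^bsub>Dprime n\<^esub> b) = \<zero>\<^bsub>Tgt n\<^esub>"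
  by (subst TP.T.comm_zero_iff)
     (simp_all only: TP.tens_mult TP.tens_closed Dp.one_closed Dp.r_one Dp.l_one Gl.U.one_closed Gl.U.r_one Gl.U.l_one)

sublocale R: rho_data "Tgt n" n xx yy eg
proof
  fix a assume "a \<le> n"
  then show "xx a \<in> carrier (Tgt n)" "yy a \<in> carrier (Tgt n)"
    by (simp_all only: TP.tens_closed xop_Dp yop_Dp Gl.U.one_closed)
next
  show "xx 0 = \<one>\<^bsub>Tgt n\<^esub>" by (simp only: TP.tens_one xop_0)
next
  fix a b assume ab: "a \<le> n" "b \<le> n"
  show "TP.T.comm (xx a) (xx b) = \<zero>\<^bsub>Tgt n\<^esub>"
    using ab by (simp only: tens_comm_l xop_Dp Dp_XX TP.tens_zero_l Gl.U.one_closed)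
  show "TP.T.comm (yy b) (xx a) = (if a = b then \<one>\<^bsub>Tgt n\<^esub> else \<zero>\<^bsub>Tgt n\<^esub>) \<ominus>\<^bsub>Tgt n\<^esub> (if b = 0 then xx a else \<zero>\<^bsub>Tgt n\<^esub>)"
  proof -
    have "TP.T.comm (yy b) (xx a) = tns n (if a = b then \<one>\<^bsub>Dprime n\<^esub> else \<zero>\<^bsub>Dprime n\<^esub>) \<one>\<^bsub>Ugl n\<^esub> \<oplus>\<^bsub>Tgt n\<^esub>
       (if b = 0 then - 1 else 0) \<odot>\<^bsub>Tgt n\<^esub> xx a"
      using ab by (simp only: tens_comm_l xop_Dp yop_Dp Dp_YX TP.tens_add_l TP.tens_smult_l Gl.U.one_closed
          Dp.one_closed Dp.zero_closed Dp.smult_closed split: if_split) simp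
    then show ?thesis
      using ab TP.tens_closed[OF xop_Dp[OF ab(1)] Gl.U.one_closed]
      by (simp add: TP.T.minus_eq TP.tens_one[symmetric] TP.tens_zero_l TP.tens_closed xop_Dp)
  qed
next
  fix b c assume bc: "b \<le> n" "c \<le> n"
  have "TP.T.comm (yy b) (yy c) = (if b = 0 then 1 else 0) \<odot>\<^bsub>Tgt n\<^esub> yy c \<oplus>\<^bsub>Tgt n\<^esub> (if c = 0 then - 1 else 0) \<odot>\<^bsub>Tgt n\<^esub> yy b"
    using bc by (simp only: tens_comm_l yop_Dp Dp_YY TP.tens_add_l TP.tens_smult_l Gl.U.one_closed Dp.smult_closed)
  then show "TP.T.comm (yy b) (yy c) = (if b = 0 then yy c else \<zero>\<^bsub>Tgt n\<^esub>) \<ominus>\<^bsub>Tgt n\<^esub> (if c = 0 then yy b else \<zero>\<^bsub>Tgt n\<^esub>)"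
    using bc TP.tens_closed[OF yop_Dp[OF bc(1)] Gl.U.one_closed] TP.tens_closed[OF yop_Dp[OF bc(2)] Gl.U.one_closed]
    by (simp add: TP.T.minus_eq)
next
  show "TP.T.gl_rel {1..n} eg"
    unfolding TP.T.gl_rel_def
  proof (intro conjI ballI)
    fix i j k l assume m: "i \<in> {1..n}" "j \<in> {1..n}" "k \<in> {1..n}" "l \<in> {1..n}"
    have "TP.T.comm (eg i j) (eg k l) = tns n \<one>\<^bsub>Dprime n\<^esub> (Gl.U.comm (E0 n i j) (E0 n k l))"
      using m by (simp only: tens_comm_r Gl.Eg_closed)
    also have "\<dots> = (if j = k then eg i l else \<zero>\<^bsub>Tgt n\<^esub>) \<ominus>\<^bsub>Tgt n\<^esub> (if i = l then eg k j else \<zero>\<^bsub>Tgt n\<^esub>)"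
      using m TP.tens_zero_r[OF Dp.one_closed] by (auto simp: Gl.U.gl_relD(2)[OF Gl.Eg_gl] TP.tens_diff_r)
    finally show "TP.T.comm (eg i j) (eg k l) = (if j = k then eg i l else \<zero>\<^bsub>Tgt n\<^esub>) \<ominus>\<^bsub>Tgt n\<^esub> (if i = l then eg k j else \<zero>\<^bsub>Tgt n\<^esub>)" .
  qed (simp add: TP.tens_closed[OF Dp.one_closed])
next
  fix a i j assume "a \<le> n" "i \<in> {1..n}" "j \<in> {1..n}"
  then show "TP.T.comm (xx a) (eg i j) = \<zero>\<^bsub>Tgt n\<^esub>" "TP.T.comm (yy a) (eg i j) = \<zero>\<^bsub>Tgt n\<^esub>"
    by (simp_all only: tens_comm_lr xop_Dp yop_Dp Gl.Eg_closed)
qed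

lemma P_eq: "\<lbrakk>a \<le> n; b \<le> n\<rbrakk> \<Longrightarrow> R.P a b = tns n (t_partial n a b) \<one>\<^bsub>Ugl n\<^esub>"
  unfolding R.P_def t_partial_eq
  by (simp only: TP.tens_mult xop_Dp yop_Dp Gl.U.one_closed Gl.U.r_one)

lemma Eu_eq: "tns n (euler n) \<one>\<^bsub>Ugl n\<^esub> = R.Eu"
proof -
  have tp: "t_partial n i i \<in> carrier (Dprime n)" if "i \<le> n" for i
    unfolding t_partial_eq[OF that that] using that by (intro Dp.m_closed xop_Dp yop_Dp)
  have "euler n = (\<Oplus>\<^bsub>Dprime n\<^esub>i\<in>{0..n}. t_partial n i i)"
    unfolding euler_def
    using dif.finsum_subalg[OF Dprime_gens, of "\<lambda>i. t_partial n i i" "{0..n}"] tp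
    unfolding Dprime_def[symmetric] by (simp add: Pi_def)
  then have "tns n (euler n) \<one>\<^bsub>Ugl n\<^esub> = (\<Oplus>\<^bsub>Tgt n\<^esub>i\<in>{0..n}. tns n (t_partial n i i) \<one>\<^bsub>Ugl n\<^esub>)"
    using TP.tens_finsum_l[of "{0..n}" "\<lambda>i. t_partial n i i" "\<one>\<^bsub>Ugl n\<^esub>"] tp by (simp add: Pi_def)
  also have "\<dots> = R.Eu"
    unfolding R.Eu_def by (rule TP.T.finsum_cong') (simp_all add: P_eq[symmetric] Pi_iff)
  finally show ?thesis .
qed

abbreviation "trR \<equiv> \<Oplus>\<^bsub>Tgt n\<^esub>i\<in>{0..n}. R.r0 i i"

lemma trR_closed: "trR \<in> carrier (Tgt n)"
  by (rule TP.T.finsum_closed) auto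

lemma R1_eq: "R1 n = (- 1 / (of_nat n + 1)) \<odot>\<^bsub>Tgt n\<^esub> trR"
proof -
  have "tns n \<one>\<^bsub>Dprime n\<^esub> (\<Oplus>\<^bsub>Ugl n\<^esub>i\<in>{1..n}. E0 n i i) = (\<Oplus>\<^bsub>Tgt n\<^esub>i\<in>{1..n}. eg i i)"
    by (rule TP.tens_finsum_r) (auto)
  also have "\<dots> = (\<Oplus>\<^bsub>Tgt n\<^esub>i\<in>{1..n}. R.Q i i)"
    by (rule TP.T.finsum_cong') (auto simp: R.Q_pos)
  also have "\<dots> = (\<Oplus>\<^bsub>Tgt n\<^esub>i\<in>{0..n}. R.Q i i)"
    by (rule TP.T.add.finprod_mono_neutral_cong_left) (auto simp: not_le less_one)
  finally have 1: "tns n \<one>\<^bsub>Dprime n\<^esub> (\<Oplus>\<^bsub>Ugl n\<^esub>i\<in>{1..n}. E0 n i i) = (\<Oplus>\<^bsub>Tgt n\<^esub>i\<in>{0..n}. R.Q i i)" .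
  have "trR = (\<Oplus>\<^bsub>Tgt n\<^esub>i\<in>{0..n}. R.P i i) \<oplus>\<^bsub>Tgt n\<^esub> (\<Oplus>\<^bsub>Tgt n\<^esub>i\<in>{0..n}. R.Q i i)"
    unfolding R.r0_def by (rule TP.T.finsum_addf) auto
  then show ?thesis unfolding R1_def 1 Eu_eq R.Eu_def by simp
qed

lemma R1_closed [simp]: "R1 n \<in> carrier (Tgt n)"
  unfolding R1_eq using trR_closed by simp

lemma R1_r0: "\<lbrakk>a \<le> n; b \<le> n\<rbrakk> \<Longrightarrow> TP.T.comm (R1 n) (R.r0 a b) = \<zero>\<^bsub>Tgt n\<^esub>"
  unfolding R1_eq using TP.T.gl_trace_central[OF R.r0_gl, of a b] trR_closed
  by (simp add: TP.T.comm_smult_l)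

definition "rr i j = R.r0 i j \<oplus>\<^bsub>Tgt n\<^esub> (if i = j then R1 n else \<zero>\<^bsub>Tgt n\<^esub>)"

lemma rr_gl: "TP.T.gl_rel {0..n} rr"
  unfolding rr_def by (rule TP.T.gl_rel_shift[OF R.r0_gl]) (auto simp: R1_r0)

lemma rr_closed [simp]: "\<lbrakk>i \<le> n; j \<le> n\<rbrakk> \<Longrightarrow> rr i j \<in> carrier (Tgt n)"
  by (simp add: rr_def)

lemma rho_conditions:
  "((\<forall>a\<in>{1..n}. \<forall>b\<in>{1..n}. h (E n a b) =
       tns n (t_partial n a b) \<one>\<^bsub>Ugl n\<^esub> \<oplus>\<^bsub>Tgt n\<^esub> tns n \<one>\<^bsub>Dprime n\<^esub> (E0 n a b)
       \<oplus>\<^bsub>Tgt n\<^esub> (if a = b then R1 n else \<zero>\<^bsub>Tgt n\<^esub>)) \<and>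
    (\<forall>a\<in>{1..n}. h (E n a 0) =
       tns n (t_partial n a 0) \<one>\<^bsub>Ugl n\<^esub>
       \<ominus>\<^bsub>Tgt n\<^esub> (\<Oplus>\<^bsub>Tgt n\<^esub>i\<in>{1..n}. tns n (mul_op n (tquot i)) (E0 n a i))) \<and>
    (\<forall>b\<in>{1..n}. h (E n 0 b) = tns n (t_partial n 0 b) \<one>\<^bsub>Ugl n\<^esub>) \<and>
    h (E n 0 0) = tns n (t_partial n 0 0) \<one>\<^bsub>Ugl n\<^esub> \<oplus>\<^bsub>Tgt n\<^esub> R1 n) \<longleftrightarrow>
   (\<forall>i\<in>{0..n}. \<forall>j\<in>{0..n}. h (E n i j) = rr i j)" (is "?A \<and> ?B \<and> ?C \<and> ?D \<longleftrightarrow> ?R")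
proof -
  have v1: "rr a b = tns n (t_partial n a b) \<one>\<^bsub>Ugl n\<^esub> \<oplus>\<^bsub>Tgt n\<^esub> tns n \<one>\<^bsub>Dprime n\<^esub> (E0 n a b)
       \<oplus>\<^bsub>Tgt n\<^esub> (if a = b then R1 n else \<zero>\<^bsub>Tgt n\<^esub>)" if "a \<in> {1..n}" "b \<in> {1..n}" for a b
    using that by (simp add: rr_def R.r0_def P_eq R.Q_pos)
  have q: "tns n (mul_op n (tquot i)) (E0 n a i) = xx i \<otimes>\<^bsub>Tgt n\<^esub> eg a i" if "a \<in> {1..n}" "i \<in> {1..n}" for a i
    using that by (simp only: TP.tens_mult xop_Dp Gl.Eg_closed Dp.one_closed Gl.U.one_closed Dp.r_one Gl.U.l_one atLeastAtMost_iff)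
  have v2: "rr a 0 = tns n (t_partial n a 0) \<one>\<^bsub>Ugl n\<^esub>
       \<ominus>\<^bsub>Tgt n\<^esub> (\<Oplus>\<^bsub>Tgt n\<^esub>i\<in>{1..n}. tns n (mul_op n (tquot i)) (E0 n a i))" if a: "a \<in> {1..n}" for a
  proof -
    have "(\<Oplus>\<^bsub>Tgt n\<^esub>i\<in>{1..n}. tns n (mul_op n (tquot i)) (E0 n a i)) = (\<Oplus>\<^bsub>Tgt n\<^esub>i\<in>{1..n}. xx i \<otimes>\<^bsub>Tgt n\<^esub> eg a i)"
      by (rule TP.T.finsum_cong') (use a q in \<open>auto\<close>)
    then show ?thesis using a R.P_cl[of a 0]
      by (simp add: rr_def R.r0_def P_eq R.Q_col0 TP.T.minus_eq Pi_def del: R.P_cl)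
  qed
  have v3: "rr 0 b = tns n (t_partial n 0 b) \<one>\<^bsub>Ugl n\<^esub>" if "b \<in> {1..n}" for b
    using that R.P_cl[of 0 b] by (simp add: rr_def R.r0_def P_eq)
  have v4: "rr 0 0 = tns n (t_partial n 0 0) \<one>\<^bsub>Ugl n\<^esub> \<oplus>\<^bsub>Tgt n\<^esub> R1 n"
    using R.P_cl[of 0 0] by (simp add: rr_def R.r0_def P_eq)
  show ?thesis
  proof
    assume L: "?A \<and> ?B \<and> ?C \<and> ?D"
    note LA = L[THEN conjunct1] and LB = L[THEN conjunct2, THEN conjunct1]
      and LC = L[THEN conjunct2, THEN conjunct2, THEN conjunct1] and LD = L[THEN conjunct2, THEN conjunct2, THEN conjunct2]
    show ?R
    proof (intro ballI)
      fix i j assume "i \<in> {0..n}" "j \<in> {0..n}"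
      then consider "i \<in> {1..n}" "j \<in> {1..n}" | "i \<in> {1..n}" "j = 0" | "i = 0" "j \<in> {1..n}" | "i = 0" "j = 0"
        by (metis atLeastAtMost_iff less_one linorder_not_less zero_le)
      then show "h (E n i j) = rr i j"
      proof cases
        case 1 show ?thesis unfolding v1[OF 1] using LA 1 by blast
      next
        case 2 show ?thesis unfolding \<open>j = 0\<close> v2[OF 2(1)] using LB 2(1) by blast
      next
        case 3 show ?thesis unfolding \<open>i = 0\<close> v3[OF 3(2)] using LC 3(2) by blast
      next
        case 4 show ?thesis unfolding \<open>i = 0\<close> \<open>j = 0\<close> v4 using LD .
      qed
    qed
  next
    assume r: ?R
    show "?A \<and> ?B \<and> ?C \<and> ?D"
    proof (intro conjI ballI)
      fix a assume a: "a \<in> {1..n}"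
      show "h (E n a 0) = tns n (t_partial n a 0) \<one>\<^bsub>Ugl n\<^esub>
       \<ominus>\<^bsub>Tgt n\<^esub> (\<Oplus>\<^bsub>Tgt n\<^esub>i\<in>{1..n}. tns n (mul_op n (tquot i)) (E0 n a i))"
        unfolding v2[OF a, symmetric] by (rule r[rule_format]) (use a in auto)
      show "h (E n 0 a) = tns n (t_partial n 0 a) \<one>\<^bsub>Ugl n\<^esub>"
        unfolding v3[OF a, symmetric] by (rule r[rule_format]) (use a in auto)
      fix b assume b: "b \<in> {1..n}"
      show "h (E n a b) = tns n (t_partial n a b) \<one>\<^bsub>Ugl n\<^esub> \<oplus>\<^bsub>Tgt n\<^esub> tns n \<one>\<^bsub>Dprime n\<^esub> (E0 n a b)
       \<oplus>\<^bsub>Tgt n\<^esub> (if a = b then R1 n else \<zero>\<^bsub>Tgt n\<^esub>)"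
        unfolding v1[OF a b, symmetric] by (rule r[rule_format]) (use a b in auto)
    next
      show "h (E n 0 0) = tns n (t_partial n 0 0) \<one>\<^bsub>Ugl n\<^esub> \<oplus>\<^bsub>Tgt n\<^esub> R1 n"
        unfolding v4[symmetric] by (rule r[rule_format]) auto
    qed
  qed
qed

lemma rho_hom: "rho n \<in> alg_hom (U n) (Tgt n)" and rho_E: "\<lbrakk>i \<le> n; j \<le> n\<rbrakk> \<Longrightarrow> rho n (E n i j) = rr i j"
proof -
  obtain h where h: "h \<in> alg_hom (U n) (Tgt n)" "\<forall>i\<in>{0..n}. \<forall>j\<in>{0..n}. h (E n i j) = rr i j"
    using Ul.gl_hom_exists[OF TP.T.calg_axioms rr_gl] by blast
  have "rho n = h"
    unfolding rho_def rho_conditions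
  proof (rule the_equality)
    fix h' assume "h' \<in> alg_hom (U n) (Tgt n) \<and> (\<forall>i\<in>{0..n}. \<forall>j\<in>{0..n}. h' (E n i j) = rr i j)"
    then show "h' = h" using h by (intro Ul.gl_hom_eqI[OF TP.T.calg_axioms]) auto
  qed (use h in blast)
  with h show "rho n \<in> alg_hom (U n) (Tgt n)" "\<lbrakk>i \<le> n; j \<le> n\<rbrakk> \<Longrightarrow> rho n (E n i j) = rr i j" by auto
qed

sublocale rho: calg_hom "U n" "Tgt n" "rho n"
  by unfold_locales (rule rho_hom)

text \<open>The image of the central variable.\<close>

definition "th = R.Eu \<oplus>\<^bsub>Tgt n\<^esub> R1 n"

lemma th_closed [simp]: "th \<in> carrier (Tgt n)" by (simp add: th_def)

lemma th_rr: "\<lbrakk>i \<le> n; j \<le> n\<rbrakk> \<Longrightarrow> TP.T.comm th (rr i j) = \<zero>\<^bsub>Tgt n\<^esub>"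
proof -
  assume ij: "i \<le> n" "j \<le> n"
  have "TP.T.comm R.Eu (R1 n) = \<zero>\<^bsub>Tgt n\<^esub>"
  proof -
    have "(\<Oplus>\<^bsub>Tgt n\<^esub>i\<in>{0..n}. TP.T.comm R.Eu (R.r0 i i)) = \<zero>\<^bsub>Tgt n\<^esub>"
      by (rule TP.T.add.finprod_one_eqI) (simp add: R.Eu_r0)
    then show ?thesis unfolding R1_eq using trR_closed
      by (simp add: TP.T.comm_smult_r TP.T.comm_finsum_r Pi_def)
  qed
  then show ?thesis using ij
    by (auto simp: th_def rr_def TP.T.comm_add_l TP.T.comm_add_r R.Eu_r0 R1_r0)
qed

lemma comm_closure:
  assumes "calg_hom (U n) B h" "t \<in> carrier B"
    and "\<And>i j. \<lbrakk>i \<le> n; j \<le> n\<rbrakk> \<Longrightarrow> ring.comm B t (h (E n i j)) = \<zero>\<^bsub>B\<^esub>"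
    and u: "u \<in> carrier (U n)"
  shows "t \<otimes>\<^bsub>B\<^esub> h u = h u \<otimes>\<^bsub>B\<^esub> t"
proof -
  interpret h: calg_hom "U n" B h by fact
  have "h.B.comm t (h u) = \<zero>\<^bsub>B\<^esub>" using u
  proof (induction u rule: Ul.uea_induct)
    case (gen a)
    have z: "(\<lambda>i j. 0) = lie_scale (gl1 n) 0 (\<lambda>i j. 0)" "(\<lambda>i j. 0) \<in> carrier (gl1 n)" by (simp_all add: gl_simps)
    show ?case using Ul.finite_I gen
      by (induction a rule: gl_induct)
         (use assms in \<open>simp_all add: Ul.gen_add Ul.gen_scale h.B.comm_add_r h.B.comm_smult_r\<close>,
           subst z(1), simp add: Ul.gen_scale[OF z(2)] z(2))
  qed (use assms(2) in \<open>simp_all add: h.B.comm_add_r h.B.comm_mult_r h.B.comm_smult_r\<close>)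
  then show ?thesis using assms(2) u by (simp add: h.B.comm_zero_iff)
qed

lemma th_rho: "u \<in> carrier (U n) \<Longrightarrow> th \<otimes>\<^bsub>Tgt n\<^esub> rho n u = rho n u \<otimes>\<^bsub>Tgt n\<^esub> th"
  by (rule comm_closure[OF rho.calg_hom_axioms]) (simp_all add: rho_E th_rr)

section \<open>The extension by a root of the characteristic polynomial\<close>

sublocale UP: calg_poly "U n" by unfold_locales

definition "ent i j = cpoly n (E n i j) \<ominus>\<^bsub>UX n\<^esub>
    (if i = j then Xpoly n \<oplus>\<^bsub>UX n\<^esub> of_nat i \<odot>\<^bsub>UX n\<^esub> \<one>\<^bsub>UX n\<^esub> else \<zero>\<^bsub>UX n\<^esub>)"

lemma cpoly_closed: "u \<in> carrier (U n) \<Longrightarrow> cpoly n u \<in> carrier (UX n)"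
  by simp

lemma Xpoly_closed: "Xpoly n \<in> carrier (UX n)"
  by simp

lemma ent_closed: "\<lbrakk>i \<le> n; j \<le> n\<rbrakk> \<Longrightarrow> ent i j \<in> carrier (UX n)"
  unfolding ent_def
  by (intro UP.PA.minus_closed cpoly_closed Ul.Eg_closed)
     (use Xpoly_closed UP.PA.a_closed UP.PA.smult_closed UP.PA.one_closed UP.PA.zero_closed in \<open>simp_all del: poly_alg_simps\<close>)

lemma Cpoly_eq: "Cpoly n = col_det (UX n) n ent"
  unfolding Cpoly_def ent_def [abs_def] ..

lemma Cpoly_closed: "Cpoly n \<in> carrier (UX n)"
  unfolding Cpoly_eq by (rule UP.PA.col_det_closed) (rule ent_closed)

sublocale UpI: calg_ideal "UX n" "Up_ideal n"
  unfolding calg_ideal_def Up_ideal_def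
  using UP.PA.genideal_ideal[of "{Cpoly n}"] Cpoly_closed UP.PA.calg_axioms by blast

sublocale Up: calg "Up n"
  unfolding Up_def by (rule UpI.calg_quot)

abbreviation "cls p \<equiv> Up_ideal n +>\<^bsub>UX n\<^esub> p"

lemma Up_ops:
  "p \<in> carrier (UX n) \<Longrightarrow> cls p \<in> carrier (Up n)"
  "\<lbrakk>p \<in> carrier (UX n); q \<in> carrier (UX n)\<rbrakk> \<Longrightarrow> cls (p \<otimes>\<^bsub>UX n\<^esub> q) = cls p \<otimes>\<^bsub>Up n\<^esub> cls q"
  "\<lbrakk>p \<in> carrier (UX n); q \<in> carrier (UX n)\<rbrakk> \<Longrightarrow> cls (p \<oplus>\<^bsub>UX n\<^esub> q) = cls p \<oplus>\<^bsub>Up n\<^esub> cls q"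
  "p \<in> carrier (UX n) \<Longrightarrow> cls (c \<odot>\<^bsub>UX n\<^esub> p) = c \<odot>\<^bsub>Up n\<^esub> cls p"
  "cls \<one>\<^bsub>UX n\<^esub> = \<one>\<^bsub>Up n\<^esub>" "cls \<zero>\<^bsub>UX n\<^esub> = \<zero>\<^bsub>Up n\<^esub>"
  unfolding Up_def
  by (simp_all only: UpI.coset_closed UpI.coset_mult UpI.coset_add UpI.coset_smult UpI.coset_one UpI.coset_zero)

lemma Up_carrierE:
  assumes "z \<in> carrier (Up n)" obtains p where "p \<in> carrier (UX n)" "z = cls p"
  using assms unfolding Up_def UpI.carrier_quot by blast

lemma cls_hom: "restrict (\<lambda>p. cls p) (carrier (UX n)) \<in> alg_hom (UX n) (Up n)"
  by (rule alg_homI) (simp_all add: Up_ops UP.PA.a_closed UP.PA.m_closed UP.PA.smult_closed UP.PA.one_closed del: poly_alg_simps)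

sublocale clsh: calg_hom "UX n" "Up n" "restrict (\<lambda>p. cls p) (carrier (UX n))"
  by unfold_locales (rule cls_hom)

lemma cls_Cpoly: "cls (Cpoly n) = \<zero>\<^bsub>Up n\<^esub>"
proof -
  have "Cpoly n \<in> Up_ideal n"
    unfolding Up_ideal_def using UP.PA.genideal_self'[OF Cpoly_closed] .
  then show ?thesis
    using UP.PA.coset_eq_iff[OF UpI.ideal_I Cpoly_closed UP.PA.zero_closed] Cpoly_closed
    by (simp add: UP.PA.minus_eq Up_ops(6)[symmetric] del: poly_alg_simps UP.poly_minus)
qed

lemma Up_emb_hom: "restrict (Up_emb n) (carrier (U n)) \<in> alg_hom (U n) (Up n)"
proof (rule alg_homI)
  fix u v assume u: "u \<in> carrier (U n)" and v: "v \<in> carrier (U n)"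
  have "cpoly n (u \<oplus>\<^bsub>U n\<^esub> v) = cpoly n u \<oplus>\<^bsub>UX n\<^esub> cpoly n v" using u v by simp
  then show "restrict (Up_emb n) (carrier (U n)) (u \<oplus>\<^bsub>U n\<^esub> v) =
    restrict (Up_emb n) (carrier (U n)) u \<oplus>\<^bsub>Up n\<^esub> restrict (Up_emb n) (carrier (U n)) v"
    using u v by (simp add: Up_emb_def Up_ops(3) cpoly_closed del: poly_alg_simps UP.UPA.monom_add)
  have "cpoly n (u \<otimes>\<^bsub>U n\<^esub> v) = cpoly n u \<otimes>\<^bsub>UX n\<^esub> cpoly n v" using u v UP.UPA.monom_mult[of u v 0 0] by simp
  then show "restrict (Up_emb n) (carrier (U n)) (u \<otimes>\<^bsub>U n\<^esub> v) =
    restrict (Up_emb n) (carrier (U n)) u \<otimes>\<^bsub>Up n\<^esub> restrict (Up_emb n) (carrier (U n)) v"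
    using u v by (simp add: Up_emb_def Up_ops(2) cpoly_closed del: poly_alg_simps UP.UPA.monom_mult)
next
  fix c u assume u: "u \<in> carrier (U n)"
  have "cpoly n (c \<odot>\<^bsub>U n\<^esub> u) = c \<odot>\<^bsub>UX n\<^esub> cpoly n u" using u by (simp add: UP.mon_smult)
  then show "restrict (Up_emb n) (carrier (U n)) (c \<odot>\<^bsub>U n\<^esub> u) = c \<odot>\<^bsub>Up n\<^esub> restrict (Up_emb n) (carrier (U n)) u"
    using u by (simp add: Up_emb_def Up_ops(4) cpoly_closed del: poly_alg_simps)
next
  show "restrict (Up_emb n) (carrier (U n)) \<one>\<^bsub>U n\<^esub> = \<one>\<^bsub>Up n\<^esub>"
    using Up_ops(5) by (simp add: Up_emb_def)
qed (simp_all add: Up_emb_def Up_ops(1) del: poly_alg_simps add: cpoly_closed)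

sublocale emb: calg_hom "U n" "Up n" "restrict (Up_emb n) (carrier (U n))"
  by unfold_locales (rule Up_emb_hom)

lemma Up_emb_closed: "u \<in> carrier (U n) \<Longrightarrow> Up_emb n u \<in> carrier (Up n)"
  using emb.hom_closed[of u] by simp

lemma Up_X_closed: "Up_X n \<in> carrier (Up n)"
  unfolding Up_X_def by (rule Up_ops(1)[OF Xpoly_closed])

lemma Up_X_comm: "u \<in> carrier (U n) \<Longrightarrow> Up_X n \<otimes>\<^bsub>Up n\<^esub> Up_emb n u = Up_emb n u \<otimes>\<^bsub>Up n\<^esub> Up_X n"
  unfolding Up_emb_def Up_X_def
  by (simp only: Up_ops(2)[symmetric] cpoly_closed Xpoly_closed) (simp add: UP.X_comm del: UP.UPA.monom_mult)

lemma cls_mon: "u \<in> carrier (U n) \<Longrightarrow> cls (up_ring.monom (UP (U n)) u i) = Up_emb n u \<otimes>\<^bsub>Up n\<^esub> Up_X n [^]\<^bsub>Up n\<^esub> i"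
proof -
  assume u: "u \<in> carrier (U n)"
  have p: "cls (up_ring.monom (UP (U n)) \<one>\<^bsub>U n\<^esub> i) = Up_X n [^]\<^bsub>Up n\<^esub> i"
  proof (induction i)
    case 0 then show ?case using Up_ops(5) by simp
  next
    case (Suc i)
    have "up_ring.monom (UP (U n)) \<one>\<^bsub>U n\<^esub> (Suc i) = up_ring.monom (UP (U n)) \<one>\<^bsub>U n\<^esub> i \<otimes>\<^bsub>UX n\<^esub> Xpoly n"
      using UP.UPA.monom_mult[of "\<one>\<^bsub>U n\<^esub>" "\<one>\<^bsub>U n\<^esub>" i 1] by (simp add: Suc_eq_plus1)
    then have "cls (up_ring.monom (UP (U n)) \<one>\<^bsub>U n\<^esub> (Suc i)) = cls (up_ring.monom (UP (U n)) \<one>\<^bsub>U n\<^esub> i) \<otimes>\<^bsub>Up n\<^esub> cls (Xpoly n)"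
      using Up_ops(2)[of "up_ring.monom (UP (U n)) \<one>\<^bsub>U n\<^esub> i" "Xpoly n"] by simp
    then show ?case by (simp only: Suc Up_X_def[symmetric]) simp
  qed
  have "cls (up_ring.monom (UP (U n)) u i) = cls (cpoly n u \<otimes>\<^bsub>UX n\<^esub> up_ring.monom (UP (U n)) \<one>\<^bsub>U n\<^esub> i)"
    by (subst UP.mon_eq[OF u, of i]) (simp only: poly_alg_simps)
  also have "\<dots> = cls (cpoly n u) \<otimes>\<^bsub>Up n\<^esub> cls (up_ring.monom (UP (U n)) \<one>\<^bsub>U n\<^esub> i)"
    by (rule Up_ops(2)) (use u in simp_all)
  finally show ?thesis unfolding p by (simp add: Up_emb_def)
qed

lemma Up_hom_eqI:
  assumes "calg B" "h \<in> alg_hom (Up n) B" "h' \<in> alg_hom (Up n) B"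
    and "\<And>u. u \<in> carrier (U n) \<Longrightarrow> h (Up_emb n u) = h' (Up_emb n u)" "h (Up_X n) = h' (Up_X n)"
  shows "h = h'"
proof (rule alg_hom_eqI[OF assms(2,3)])
  interpret h: calg_hom "Up n" B h using Up.calg_axioms assms by (simp add: calg_hom_def calg_hom_axioms_def)
  interpret h': calg_hom "Up n" B h' using Up.calg_axioms assms by (simp add: calg_hom_def calg_hom_axioms_def)
  fix z assume "z \<in> carrier (Up n)"
  then obtain p where p: "p \<in> carrier (UP (U n))" "z = cls p" by (rule Up_carrierE) simp
  have pw: "h (Up_X n [^]\<^bsub>Up n\<^esub> (i::nat)) = h' (Up_X n [^]\<^bsub>Up n\<^esub> i)" for i
    by (induction i) (simp_all add: Up_X_closed assms(5))
  have "h (cls p) = h' (cls p)" using p(1)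
  proof (induction p rule: UP.poly_induct)
    case (mon u i) then show ?case by (simp add: cls_mon Up_emb_closed Up_X_closed assms(4) pw)
  next
    case (add p q)
    have "cls (p \<oplus>\<^bsub>UP (U n)\<^esub> q) = cls p \<oplus>\<^bsub>Up n\<^esub> cls q" using Up_ops(3)[of p q] add by simp
    then show ?case using add Up_ops(1)[of p] Up_ops(1)[of q] by simp
  qed
  with p show "h z = h' z" by simp
qed

text \<open>Evaluation at \<open>T\<close> sends the characteristic polynomial to the column determinant on the left of the last assumption.\<close>

lemma Up_hom_exists:
  assumes "calg_hom (U n) B f" and T: "T \<in> carrier B"
    and comm: "\<And>u. u \<in> carrier (U n) \<Longrightarrow> T \<otimes>\<^bsub>B\<^esub> f u = f u \<otimes>\<^bsub>B\<^esub> T"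
    and det: "col_det B n (\<lambda>i j. f (E n i j) \<ominus>\<^bsub>B\<^esub> (if i = j then T \<oplus>\<^bsub>B\<^esub> of_nat i \<odot>\<^bsub>B\<^esub> \<one>\<^bsub>B\<^esub> else \<zero>\<^bsub>B\<^esub>)) = \<zero>\<^bsub>B\<^esub>"
  shows "\<exists>h\<in>alg_hom (Up n) B. (\<forall>u\<in>carrier (U n). h (Up_emb n u) = f u) \<and> h (Up_X n) = T"
proof -
  interpret f: calg_hom "U n" B f by fact
  obtain H where H: "H \<in> alg_hom (UX n) B"
    and Hm: "\<And>u i. u \<in> carrier (U n) \<Longrightarrow> H (up_ring.monom (UP (U n)) u i) = f u \<otimes>\<^bsub>B\<^esub> T [^]\<^bsub>B\<^esub> i"
    using UP.poly_hom_exists[OF assms(1-3)] by blast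
  interpret H: calg_hom "UX n" B H by unfold_locales (rule H)
  have Hc: "H (cpoly n u) = f u" if "u \<in> carrier (U n)" for u
    using Hm[OF that, of 0] that by simp
  have HX: "H (Xpoly n) = T" using Hm[of "\<one>\<^bsub>U n\<^esub>" 1] T by simp
  have He: "H (ent i j) = f (E n i j) \<ominus>\<^bsub>B\<^esub> (if i = j then T \<oplus>\<^bsub>B\<^esub> of_nat i \<odot>\<^bsub>B\<^esub> \<one>\<^bsub>B\<^esub> else \<zero>\<^bsub>B\<^esub>)"
    if "i \<le> n" "j \<le> n" for i j
  proof -
    have c: "cpoly n (E n i j) \<in> carrier (UX n)" using that by (intro cpoly_closed Ul.Eg_closed) auto
    have d: "(if i = j then Xpoly n \<oplus>\<^bsub>UX n\<^esub> of_nat i \<odot>\<^bsub>UX n\<^esub> \<one>\<^bsub>UX n\<^esub> else \<zero>\<^bsub>UX n\<^esub>) \<in> carrier (UX n)"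
      using Xpoly_closed by (simp add: UP.PA.a_closed UP.PA.smult_closed UP.PA.one_closed UP.PA.zero_closed del: poly_alg_simps)
    have e: "H (if i = j then Xpoly n \<oplus>\<^bsub>UX n\<^esub> of_nat i \<odot>\<^bsub>UX n\<^esub> \<one>\<^bsub>UX n\<^esub> else \<zero>\<^bsub>UX n\<^esub>) =
      (if i = j then T \<oplus>\<^bsub>B\<^esub> of_nat i \<odot>\<^bsub>B\<^esub> \<one>\<^bsub>B\<^esub> else \<zero>\<^bsub>B\<^esub>)"
      using Xpoly_closed by (simp add: UP.PA.smult_closed UP.PA.one_closed HX del: poly_alg_simps)
    show ?thesis unfolding ent_def H.hom_diff[OF c d] e using that by (simp add: Hc)
  qed
  have "H (Cpoly n) = col_det B n (\<lambda>i j. H (ent i j))"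
    unfolding Cpoly_eq by (rule col_det_hom[OF H.calg_hom_axioms]) (rule ent_closed)
  also have "\<dots> = col_det B n (\<lambda>i j. f (E n i j) \<ominus>\<^bsub>B\<^esub> (if i = j then T \<oplus>\<^bsub>B\<^esub> of_nat i \<odot>\<^bsub>B\<^esub> \<one>\<^bsub>B\<^esub> else \<zero>\<^bsub>B\<^esub>))"
    by (rule f.B.col_det_cong, rule H.hom_closed, rule ent_closed, assumption+, rule He)
  also note det
  finally have "Cpoly n \<in> a_kernel (UX n) B H"
    using Cpoly_closed unfolding a_kernel_def' by blast
  then have "Up_ideal n \<subseteq> a_kernel (UX n) B H"
    unfolding Up_ideal_def by (intro UP.PA.genideal_minimal[OF H.kernel_is_ideal]) blast
  then have ker: "\<And>r. r \<in> Up_ideal n \<Longrightarrow> H r = \<zero>\<^bsub>B\<^esub>" unfolding a_kernel_def' by blast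
  obtain h where h: "h \<in> alg_hom (Up n) B" "\<And>p. p \<in> carrier (UX n) \<Longrightarrow> h (cls p) = H p"
    using UpI.quot_hom_exists[OF H.calg_hom_axioms ker] unfolding Up_def by blast
  show ?thesis
  proof (intro bexI[OF _ h(1)] conjI ballI)
    fix u assume u: "u \<in> carrier (U n)"
    show "h (Up_emb n u) = f u" unfolding Up_emb_def h(2)[OF cpoly_closed[OF u]] by (rule Hc[OF u])
  next
    show "h (Up_X n) = T" unfolding Up_X_def h(2)[OF Xpoly_closed] by (rule HX)
  qed
qed

subsection \<open>Vanishing of the column determinant in the target\<close>

sublocale Cap: capelli "Tgt n" n R.r0 R.Eu
  by unfold_locales (simp_all only: R.r0_gl R.Eu_cl R.Eu_r0)

text \<open>Here the shift in the last position, \<open>n\<close>, meets the number \<open>n\<close> from \<open>col_sum\<close>.\<close>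

lemma xx_null:
  assumes a: "a \<le> n"
  shows "(\<Oplus>\<^bsub>Tgt n\<^esub>b\<in>{0..n}. Cap.M n a b \<otimes>\<^bsub>Tgt n\<^esub> xx b) = \<zero>\<^bsub>Tgt n\<^esub>"
proof -
  let ?u = "R.Eu \<oplus>\<^bsub>Tgt n\<^esub> of_nat n \<odot>\<^bsub>Tgt n\<^esub> \<one>\<^bsub>Tgt n\<^esub>"
  have "(\<Oplus>\<^bsub>Tgt n\<^esub>b\<in>{0..n}. Cap.M n a b \<otimes>\<^bsub>Tgt n\<^esub> xx b) =
     (\<Oplus>\<^bsub>Tgt n\<^esub>b\<in>{0..n}. R.r0 a b \<otimes>\<^bsub>Tgt n\<^esub> xx b \<oplus>\<^bsub>Tgt n\<^esub> (if a = b then \<ominus>\<^bsub>Tgt n\<^esub> (?u \<otimes>\<^bsub>Tgt n\<^esub> xx b) else \<zero>\<^bsub>Tgt n\<^esub>))"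
    by (rule TP.T.finsum_cong') (use a in \<open>simp_all add: Pi_iff Cap.M_def TP.T.minus_eq TP.T.l_distr TP.T.l_minus\<close>)
  also have "\<dots> = (\<Oplus>\<^bsub>Tgt n\<^esub>b\<in>{0..n}. R.r0 a b \<otimes>\<^bsub>Tgt n\<^esub> xx b) \<oplus>\<^bsub>Tgt n\<^esub>
      (\<Oplus>\<^bsub>Tgt n\<^esub>b\<in>{0..n}. (if a = b then \<ominus>\<^bsub>Tgt n\<^esub> (?u \<otimes>\<^bsub>Tgt n\<^esub> xx b) else \<zero>\<^bsub>Tgt n\<^esub>))"
    by (rule TP.T.finsum_addf) (use a in \<open>simp_all add: Pi_iff\<close>)
  also have "(\<Oplus>\<^bsub>Tgt n\<^esub>b\<in>{0..n}. (if a = b then \<ominus>\<^bsub>Tgt n\<^esub> (?u \<otimes>\<^bsub>Tgt n\<^esub> xx b) else \<zero>\<^bsub>Tgt n\<^esub>)) = \<ominus>\<^bsub>Tgt n\<^esub> (?u \<otimes>\<^bsub>Tgt n\<^esub> xx a)"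
    by (subst TP.T.finsum_single_if[of _ a]) (use a in simp_all)
  also have "?u \<otimes>\<^bsub>Tgt n\<^esub> xx a = xx a \<otimes>\<^bsub>Tgt n\<^esub> ?u"
    using R.Eu_X[OF a] a by (simp add: TP.T.comm_zero_iff TP.T.l_distr TP.T.r_distr TP.T.smult_mult_l TP.T.smult_mult_r)
  finally show ?thesis unfolding R.col_sum[OF a] using a by (simp add: TP.T.r_neg)
qed

lemma rho'_hom: "rho' n \<in> alg_hom (Up n) (Tgt n)"
  and rho'_emb: "u \<in> carrier (U n) \<Longrightarrow> rho' n (Up_emb n u) = rho n u"
  and rho'_X: "rho' n (Up_X n) = th"
proof -
  have Mcl: "Cap.M j i j \<in> carrier (Tgt n)" if "i \<le> n" "j \<le> n" for i j using that by simp
  have ent: "rho n (E n i j) \<ominus>\<^bsub>Tgt n\<^esub> (if i = j then th \<oplus>\<^bsub>Tgt n\<^esub> of_nat i \<odot>\<^bsub>Tgt n\<^esub> \<one>\<^bsub>Tgt n\<^esub> else \<zero>\<^bsub>Tgt n\<^esub>) = Cap.M j i j"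
    if "i \<le> n" "j \<le> n" for i j
    using that by (simp add: rho_E rr_def th_def Cap.M_def TP.T.minus_eq TP.T.minus_add TP.T.a_ac TP.T.r_neg TP.T.r_neg1 TP.T.r_neg2)
  have "col_det (Tgt n) n (\<lambda>i j. rho n (E n i j) \<ominus>\<^bsub>Tgt n\<^esub> (if i = j then th \<oplus>\<^bsub>Tgt n\<^esub> of_nat i \<odot>\<^bsub>Tgt n\<^esub> \<one>\<^bsub>Tgt n\<^esub> else \<zero>\<^bsub>Tgt n\<^esub>)) =
     col_det (Tgt n) n (\<lambda>i j. Cap.M j i j)"
    by (rule TP.T.col_det_cong) (simp_all only: ent Mcl)
  also have "\<dots> = Cap.D (\<lambda>j. j)"
    unfolding col_det_def Cap.D_def Cap.T_def TP.T.pl_def ..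
  also have "\<dots> = \<zero>\<^bsub>Tgt n\<^esub>"
    by (rule Cap.D_null[OF n1, of xx]) (simp_all only: R.X_cl R.X0 xx_null)
  finally obtain h where h: "h \<in> alg_hom (Up n) (Tgt n)" "\<forall>u\<in>carrier (U n). h (Up_emb n u) = rho n u" "h (Up_X n) = th"
    using Up_hom_exists[OF rho.calg_hom_axioms th_closed th_rho] by blast
  have "rho' n = h"
    unfolding rho'_def Eu_eq th_def[symmetric]
  proof (rule the_equality)
    fix h' assume h': "h' \<in> alg_hom (Up n) (Tgt n) \<and> (\<forall>w\<in>carrier (U n). h' (Up_emb n w) = rho n w) \<and> h' (Up_X n) = th"
    show "h' = h" by (rule Up_hom_eqI[OF TP.T.calg_axioms]) (use h h' in simp_all)
  qed (use h in blast)
  with h show "rho' n \<in> alg_hom (Up n) (Tgt n)" "u \<in> carrier (U n) \<Longrightarrow> rho' n (Up_emb n u) = rho n u"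
    "rho' n (Up_X n) = th" by simp_all
qed

sublocale rho': calg_hom "Up n" "Tgt n" "rho' n"
  by unfold_locales (rule rho'_hom)

end

section \<open>A representation that sees leading symbols\<close>

definition rs :: "'p set \<Rightarrow> ('p \<Rightarrow> complex) \<Rightarrow> ('p \<Rightarrow> complex)"
  where "rs V F = (\<lambda>p. if p \<in> V then F p else 0)"

text \<open>Multiplication is composition in reverse order: operators on Laurent polynomials act on functions of the exponents by transposition, which reverses products. Functions are normalised to vanish outside \<open>V\<close>, and the unit is this normalisation.\<close>

definition op_alg :: "'p set \<Rightarrow> (complex, ('p \<Rightarrow> complex) \<Rightarrow> ('p \<Rightarrow> complex)) module"
  where "op_alg V = \<lparr>
    carrier = {T. (\<forall>F G. T (\<lambda>p. F p + G p) = (\<lambda>p. T F p + T G p)) \<and>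
      (\<forall>c F. T (\<lambda>p. c * F p) = (\<lambda>p. c * T F p)) \<and> (\<forall>F. T (rs V F) = T F) \<and> (\<forall>F. rs V (T F) = T F)},
    monoid.mult = (\<lambda>S T F. T (S F)),
    monoid.one = rs V,
    ring.zero = (\<lambda>F p. 0),
    ring.add = (\<lambda>S T F p. S F p + T F p),
    module.smult = (\<lambda>c T F p. c * T F p)\<rparr>"

lemma op_simps:
  "monoid.mult (op_alg V) = (\<lambda>S T F. T (S F))"
  "\<one>\<^bsub>op_alg V\<^esub> = rs V" "\<zero>\<^bsub>op_alg V\<^esub> = (\<lambda>F p. 0)"
  "ring.add (op_alg V) = (\<lambda>S T F p. S F p + T F p)"
  "module.smult (op_alg V) = (\<lambda>c T F p. c * T F p)"
  by (simp_all add: op_alg_def)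

lemma op_carrier:
  "T \<in> carrier (op_alg V) \<longleftrightarrow> (\<forall>F G. T (\<lambda>p. F p + G p) = (\<lambda>p. T F p + T G p)) \<and>
      (\<forall>c F. T (\<lambda>p. c * F p) = (\<lambda>p. c * T F p)) \<and> (\<forall>F. T (rs V F) = T F) \<and> (\<forall>F. rs V (T F) = T F)"
  by (simp add: op_alg_def)

lemma rs_add: "rs V (\<lambda>p. F p + G p) = (\<lambda>p. rs V F p + rs V G p)"
  and rs_scale: "rs V (\<lambda>p. c * F p) = (\<lambda>p. c * rs V F p)"
  and rs_idem: "rs V (rs V F) = rs V F"
  and rs_zero: "rs V (\<lambda>p. 0) = (\<lambda>p. 0)"
  by (auto simp: rs_def fun_eq_iff)

lemma op_closed:
  "rs V \<in> carrier (op_alg V)" "(\<lambda>F p. 0) \<in> carrier (op_alg V)"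
  "\<lbrakk>S \<in> carrier (op_alg V); T \<in> carrier (op_alg V)\<rbrakk> \<Longrightarrow> (\<lambda>F. T (S F)) \<in> carrier (op_alg V)"
  "\<lbrakk>S \<in> carrier (op_alg V); T \<in> carrier (op_alg V)\<rbrakk> \<Longrightarrow> (\<lambda>F p. S F p + T F p) \<in> carrier (op_alg V)"
  "T \<in> carrier (op_alg V) \<Longrightarrow> (\<lambda>F p. c * T F p) \<in> carrier (op_alg V)"
  unfolding op_carrier by (simp_all add: rs_add rs_scale rs_idem rs_zero algebra_simps)

lemma opD:
  assumes "T \<in> carrier (op_alg V)"
  shows "T (\<lambda>p. F p + G p) = (\<lambda>p. T F p + T G p)" "T (\<lambda>p. c * F p) = (\<lambda>p. c * T F p)"
    "T (rs V F) = T F" "rs V (T F) = T F"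
  using assms unfolding op_carrier by blast+

lemma calg_op: "calg (op_alg V)"
proof -
  have neg: "\<exists>y\<in>carrier (op_alg V). (\<lambda>F p. y F p + x F p) = (\<lambda>F p. 0)" if "x \<in> carrier (op_alg V)" for x
    by (rule bexI[OF _ op_closed(5)[OF that, of "-1"]]) simp
  have neg': "\<exists>y\<in>carrier (op_alg V). (\<lambda>F p. x F p + y F p) = (\<lambda>F p. 0)" if "x \<in> carrier (op_alg V)" for x
    by (rule bexI[OF _ op_closed(5)[OF that, of "-1"]]) simp
  have "ring (op_alg V)"
    by (intro ringI abelian_groupI monoidI; (simp only: op_simps)?)
       (simp_all add: op_closed neg neg' opD add_ac)
  then show ?thesis
    by (intro calg.intro calg_axioms.intro; (simp only: op_simps)?)
       (simp_all add: op_closed algebra_simps opD)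
qed

interpretation Op: calg "op_alg V" for V by (rule calg_op)

lemma op_uminus: "T \<in> carrier (op_alg V) \<Longrightarrow> (\<ominus>\<^bsub>op_alg V\<^esub> T) = (\<lambda>F p. - T F p)"
  using Op.smult_minus1[of T V] by (simp add: op_simps)

lemma op_minus: "\<lbrakk>S \<in> carrier (op_alg V); T \<in> carrier (op_alg V)\<rbrakk> \<Longrightarrow>
    S \<ominus>\<^bsub>op_alg V\<^esub> T = (\<lambda>F p. S F p - T F p)"
  by (simp add: a_minus_def op_uminus op_simps)

lemma op_comm: "\<lbrakk>S \<in> carrier (op_alg V); T \<in> carrier (op_alg V)\<rbrakk> \<Longrightarrow>
    Op.comm V S T = (\<lambda>F p. T (S F) p - S (T F) p)"
  using op_minus[of "\<lambda>F. T (S F)" V "\<lambda>F. S (T F)"] op_closed(3)[of S V T] op_closed(3)[of T V S]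
  by (simp add: Op.comm_def op_simps)

subsection \<open>The action of differential operators\<close>

type_synonym pt = "(nat \<Rightarrow>\<^sub>0 int) \<times> (nat \<Rightarrow> nat \<Rightarrow> complex)"

definition VV :: "nat \<Rightarrow> pt set" where "VV n = {p. vexp n (fst p)}"

text \<open>The linear functional with value \<open>F (e, g)\<close> on the monomial with exponent \<open>e\<close>.\<close>

definition pair :: "(pt \<Rightarrow> complex) \<Rightarrow> laur \<Rightarrow> (nat \<Rightarrow> nat \<Rightarrow> complex) \<Rightarrow> complex"
  where "pair F f g = (\<Sum>e\<in>Poly_Mapping.keys f. lk f e * F (e, g))"

lemma pair_supset:
  assumes "finite S" "Poly_Mapping.keys f \<subseteq> S"
  shows "pair F f g = (\<Sum>e\<in>S. lk f e * F (e, g))"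
  unfolding pair_def by (rule sum.mono_neutral_left) (use assms in \<open>auto simp: in_keys_iff\<close>)

lemma pair_add: "pair F (f + f') g = pair F f g + pair F f' g"
proof -
  let ?S = "Poly_Mapping.keys f \<union> Poly_Mapping.keys f'"
  have "Poly_Mapping.keys (f + f') \<subseteq> ?S" "finite ?S" using keys_add[of f f'] by auto
  then show ?thesis by (simp add: pair_supset[of ?S] lookup_add algebra_simps sum.distrib)
qed

lemma pair_scale: "pair F (pm_scale c f) g = c * pair F f g"
  using keys_pm_scale[of c f] by (simp add: pair_supset[of "Poly_Mapping.keys f"] sum_distrib_left mult_ac)

lemma pair_single [simp]: "pair F (sg e c) g = c * F (e, g)"
  by (simp add: pair_supset[of "{e}"])

lemma pair_zero [simp]: "pair F 0 g = 0" by (simp add: pair_def)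

lemma pair_lin: "pair (\<lambda>p. F p + G p) f g = pair F f g + pair G f g" "pair (\<lambda>p. c * F p) f g = c * pair F f g"
  by (simp_all add: pair_def algebra_simps sum.distrib sum_distrib_left)

lemma pair_rs: "f \<in> laurent n \<Longrightarrow> pair (rs (VV n) F) f g = pair F f g"
  unfolding pair_def by (rule sum.cong) (auto simp: rs_def VV_def laurent_eq)

definition dact :: "nat \<Rightarrow> (laur \<Rightarrow> laur) \<Rightarrow> (pt \<Rightarrow> complex) \<Rightarrow> pt \<Rightarrow> complex"
  where "dact n D F p = (if vexp n (fst p) then pair F (D (sg (fst p) 1)) (snd p) else 0)"

lemma dact_closed: "D \<in> carrier (lin_ops n) \<Longrightarrow> dact n D \<in> carrier (op_alg (VV n))"
  unfolding op_carrier
  by (auto simp: dact_def fun_eq_iff pair_lin pair_rs[of _ n] lin_opsD(1) laurent_single, auto simp: rs_def VV_def dact_def)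

lemma dact_pair:
  assumes D: "D \<in> carrier (lin_ops n)" and f: "f \<in> laurent n"
  shows "pair (dact n D F) f g = pair F (D f) g"
  using f
proof (induction f rule: laurent_induct)
  case zero then show ?case by (simp add: lin_ops_zero[OF D])
next
  case (single e c)
  have "D (sg e c) = pm_scale c (D (sg e 1))"
    using lin_opsD(3)[OF D laurent_single[OF single], of c 1] by simp
  then show ?case using single by (simp add: dact_def pair_scale)
next
  case (add f f') then show ?case by (simp add: pair_add lin_opsD(2)[OF D])
qed

lemma dact_hom: "restrict (dact n) (carrier (Dprime n)) \<in> alg_hom (Dprime n) (op_alg (VV n))"
proof (rule alg_homI)
  fix D D' assume D: "D \<in> carrier (Dprime n)" and D': "D' \<in> carrier (Dprime n)"
  note L = Dprime_sub[OF D] Dprime_sub[OF D']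
  have "dact n (D \<oplus>\<^bsub>Dprime n\<^esub> D') = dact n D \<oplus>\<^bsub>op_alg (VV n)\<^esub> dact n D'"
    by (auto simp: dact_def fun_eq_iff op_simps Dprime_simps lin_ops_simps laurent_single pair_add)
  then show "restrict (dact n) (carrier (Dprime n)) (D \<oplus>\<^bsub>Dprime n\<^esub> D') =
     restrict (dact n) (carrier (Dprime n)) D \<oplus>\<^bsub>op_alg (VV n)\<^esub> restrict (dact n) (carrier (Dprime n)) D'"
    using D D' Dp.a_closed[OF D D'] by simp
  have "dact n (D \<otimes>\<^bsub>Dprime n\<^esub> D') F p = dact n D' (dact n D F) p" for F p
  proof (cases "vexp n (fst p)")
    case True
    have "(D \<otimes>\<^bsub>Dprime n\<^esub> D') (sg (fst p) 1) = D (D' (sg (fst p) 1))"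
      using laurent_single[OF True] by (simp add: Dprime_simps lin_ops_simps compose_def)
    then have "dact n (D \<otimes>\<^bsub>Dprime n\<^esub> D') F p = pair F (D (D' (sg (fst p) 1))) (snd p)"
      using True by (simp add: dact_def)
    also have "\<dots> = pair (dact n D F) (D' (sg (fst p) 1)) (snd p)"
      using dact_pair[OF L(1) lin_opsD(1)[OF L(2) laurent_single[OF True]]] by simp
    also have "\<dots> = dact n D' (dact n D F) p" using True by (simp add: dact_def[of n D'])
    finally show ?thesis .
  qed (simp add: dact_def)
  then have "dact n (D \<otimes>\<^bsub>Dprime n\<^esub> D') = dact n D \<otimes>\<^bsub>op_alg (VV n)\<^esub> dact n D'"
    by (simp add: op_simps fun_eq_iff)
  then show "restrict (dact n) (carrier (Dprime n)) (D \<otimes>\<^bsub>Dprime n\<^esub> D') =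
     restrict (dact n) (carrier (Dprime n)) D \<otimes>\<^bsub>op_alg (VV n)\<^esub> restrict (dact n) (carrier (Dprime n)) D'"
    using D D' Dp.m_closed[OF D D'] by simp
next
  have "dact n \<one>\<^bsub>Dprime n\<^esub> = \<one>\<^bsub>op_alg (VV n)\<^esub>"
    by (auto simp: dact_def fun_eq_iff op_simps Dprime_simps lin_ops_simps laurent_single rs_def VV_def)
  then show "restrict (dact n) (carrier (Dprime n)) \<one>\<^bsub>Dprime n\<^esub> = \<one>\<^bsub>op_alg (VV n)\<^esub>"
    using Dp.one_closed by simp
next
  fix c D assume D: "D \<in> carrier (Dprime n)"
  have "dact n (c \<odot>\<^bsub>Dprime n\<^esub> D) = c \<odot>\<^bsub>op_alg (VV n)\<^esub> dact n D"
    by (auto simp: dact_def fun_eq_iff op_simps Dprime_simps lin_ops_simps laurent_single pair_scale)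
  then show "restrict (dact n) (carrier (Dprime n)) (c \<odot>\<^bsub>Dprime n\<^esub> D) = c \<odot>\<^bsub>op_alg (VV n)\<^esub> restrict (dact n) (carrier (Dprime n)) D"
    using D Dp.smult_closed[OF D] by simp
qed (auto simp: dact_closed Dprime_sub)

subsection \<open>The action of the general linear algebra\<close>

definition xi :: "nat \<Rightarrow> nat \<Rightarrow> complex" where "xi i k = (if i = k then 2 else 1)"

lemma xi_nz [simp]: "xi i k \<noteq> 0" by (simp add: xi_def)

definition shf :: "nat \<Rightarrow> nat \<Rightarrow> nat \<Rightarrow> (nat \<Rightarrow> nat \<Rightarrow> complex) \<Rightarrow> nat \<Rightarrow> nat \<Rightarrow> complex"
  where "shf i j k g = (\<lambda>a b. g a b + (if a = i \<and> b = k then 1 else 0) - (if a = j \<and> b = k then 1 else 0))"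

text \<open>Up to the constants \<open>xi\<close> this transposes the action of \<open>\<Sum>\<^sub>k x\<^sub>i\<^sub>k \<partial> / \<partial>x\<^sub>j\<^sub>k\<close> on the monomial with exponent matrix \<open>g\<close>. The constants rescale the variables, which preserves the relations. They are chosen so that the limits of these operators fill the whole space of matrices (\<open>gl_symbol_surj\<close>); with all constants equal to one the entries in each column would coincide.\<close>

definition gact :: "nat \<Rightarrow> nat \<Rightarrow> nat \<Rightarrow> (pt \<Rightarrow> complex) \<Rightarrow> pt \<Rightarrow> complex"
  where "gact n i j F p = (if vexp n (fst p) then (\<Sum>k\<in>{1..n}. xi i k / xi j k * snd p j k * F (fst p, shf i j k (snd p))) else 0)"

lemma gact_closed: "gact n i j \<in> carrier (op_alg (VV n))"
  unfolding op_carrier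
  by (auto simp: gact_def fun_eq_iff algebra_simps sum.distrib sum_distrib_left rs_def VV_def)

lemma gact_comm:
  assumes "i \<in> {1..n}" "j \<in> {1..n}" "k \<in> {1..n}" "l \<in> {1..n}"
  shows "gact n k l (gact n i j F) p - gact n i j (gact n k l F) p =
    (if j = k then gact n i l F p else 0) - (if i = l then gact n k j F p else 0)"
proof (cases "vexp n (fst p)")
  case v: True
  obtain e g where p: "p = (e, g)" by (cases p)
  have sw: "shf k l a (shf i j b g) = shf i j b (shf k l a g)" for a b
    by (auto simp: shf_def fun_eq_iff)
  let ?c = "\<lambda>a b. xi k l * 0 + xi k a / xi l a * (xi i b / xi j b)"
  have L: "gact n k l (gact n i j F) p = (\<Sum>a\<in>{1..n}. \<Sum>b\<in>{1..n}. ?c a b * (g l a * shf k l a g j b) * F (e, shf i j b (shf k l a g)))"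
    using v unfolding p by (simp add: gact_def sum_distrib_left mult_ac)
  have "gact n i j (gact n k l F) p = (\<Sum>b\<in>{1..n}. \<Sum>a\<in>{1..n}. ?c a b * (g j b * shf i j b g l a) * F (e, shf i j b (shf k l a g)))"
    using v unfolding p by (simp add: gact_def sum_distrib_left mult_ac sw)
  also have "\<dots> = (\<Sum>a\<in>{1..n}. \<Sum>b\<in>{1..n}. ?c a b * (g j b * shf i j b g l a) * F (e, shf i j b (shf k l a g)))"
    by (rule sum.swap)
  finally have R: "gact n i j (gact n k l F) p = \<dots>" .
  have co: "g l a * shf k l a g j b - g j b * shf i j b g l a =
     (if a = b then (if j = k then g l a else 0) - (if i = l then g j a else 0) else 0)" for a b
    by (auto simp: shf_def algebra_simps)
  have s1: "j = k \<Longrightarrow> shf i j a (shf k l a g) = shf i l a g" for a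
    by (auto simp: shf_def fun_eq_iff)
  have s2: "i = l \<Longrightarrow> shf i j a (shf k l a g) = shf k j a g" for a
    by (auto simp: shf_def fun_eq_iff)
  have "gact n k l (gact n i j F) p - gact n i j (gact n k l F) p =
    (\<Sum>a\<in>{1..n}. \<Sum>b\<in>{1..n}. ?c a b * (g l a * shf k l a g j b - g j b * shf i j b g l a) * F (e, shf i j b (shf k l a g)))"
    unfolding L R sum_subtractf[symmetric] by (simp add: algebra_simps)
  also have "\<dots> = (\<Sum>a\<in>{1..n}. \<Sum>b\<in>{1..n}. if b = a then ?c a a * ((if j = k then g l a else 0) - (if i = l then g j a else 0)) * F (e, shf i j a (shf k l a g)) else 0)"
    unfolding co by (intro sum.cong refl) auto
  also have "\<dots> = (\<Sum>a\<in>{1..n}. ?c a a * ((if j = k then g l a else 0) - (if i = l then g j a else 0)) * F (e, shf i j a (shf k l a g)))"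
    by (intro sum.cong refl) (simp add: sum.delta)
  also have "\<dots> = (\<Sum>a\<in>{1..n}. (if j = k then xi i a / xi l a * g l a * F (e, shf i l a g) else 0) - (if i = l then xi k a / xi j a * g j a * F (e, shf k j a g) else 0))"
    by (intro sum.cong refl) (use s1 s2 in \<open>auto simp: field_simps\<close>)
  also have "\<dots> = (if j = k then gact n i l F p else 0) - (if i = l then gact n k j F p else 0)"
    using v unfolding p by (simp add: gact_def sum_subtractf)
  finally show ?thesis .
qed (simp add: gact_def)

lemma gact_gl: "Op.gl_rel (VV n) {1..n} (gact n)"
  unfolding Op.gl_rel_def
proof (intro conjI ballI)
  fix i j k l assume m: "i \<in> {1..n}" "j \<in> {1..n}" "k \<in> {1..n}" "l \<in> {1..n}"
  have "Op.comm (VV n) (gact n i j) (gact n k l) =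
     (\<lambda>F p. (if j = k then gact n i l F p else 0) - (if i = l then gact n k j F p else 0))"
    unfolding op_comm[OF gact_closed gact_closed] gact_comm[OF m] ..
  also have "\<dots> = (if j = k then gact n i l else \<zero>\<^bsub>op_alg (VV n)\<^esub>) \<ominus>\<^bsub>op_alg (VV n)\<^esub> (if i = l then gact n k j else \<zero>\<^bsub>op_alg (VV n)\<^esub>)"
    by (subst op_minus) (auto simp: gact_closed op_closed op_simps fun_eq_iff)
  finally show "Op.comm (VV n) (gact n i j) (gact n k l) =
    (if j = k then gact n i l else \<zero>\<^bsub>op_alg (VV n)\<^esub>) \<ominus>\<^bsub>op_alg (VV n)\<^esub> (if i = l then gact n k j else \<zero>\<^bsub>op_alg (VV n)\<^esub>)" .
qed (rule gact_closed)

lemma dact_gact_comm: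
  assumes "D \<in> carrier (lin_ops n)"
  shows "Op.comm (VV n) (dact n D) (gact n i j) = \<zero>\<^bsub>op_alg (VV n)\<^esub>"
  unfolding op_comm[OF dact_closed[OF assms] gact_closed]
proof (intro ext)
  fix F and p :: pt
  obtain e g where p: "p = (e, g)" by (cases p)
  have v: "vexp n e'" if "e' \<in> Poly_Mapping.keys (D (sg e 1))" "vexp n e" for e'
    using lin_opsD(1)[OF assms laurent_single[OF that(2)], of 1] that(1) by (auto simp: laurent_eq)
  have "dact n D (gact n i j F) p = gact n i j (dact n D F) p"
  proof (cases "vexp n e")
    case True
    then have "dact n D (gact n i j F) p = (\<Sum>e'\<in>Poly_Mapping.keys (D (sg e 1)). \<Sum>k\<in>{1..n}.
        lk (D (sg e 1)) e' * (xi i k / xi j k * g j k * F (e', shf i j k g)))"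
      unfolding p by (simp add: dact_def pair_def gact_def v sum_distrib_left)
    also have "\<dots> = (\<Sum>k\<in>{1..n}. \<Sum>e'\<in>Poly_Mapping.keys (D (sg e 1)).
        lk (D (sg e 1)) e' * (xi i k / xi j k * g j k * F (e', shf i j k g)))"
      by (rule sum.swap)
    also have "\<dots> = gact n i j (dact n D F) p"
      using True unfolding p by (simp add: dact_def pair_def gact_def sum_distrib_left mult_ac)
    finally show ?thesis .
  qed (simp add: p dact_def gact_def)
  then show "gact n i j (dact n D F) p - dact n D (gact n i j F) p = \<zero>\<^bsub>op_alg (VV n)\<^esub> F p"
    by (simp add: op_simps)
qed

context rank
begin

lemma comm_closure_gl:
  assumes "calg_hom (Ugl n) B h" "t \<in> carrier B"
    and "\<And>i j. \<lbrakk>i \<in> {1..n}; j \<in> {1..n}\<rbrakk> \<Longrightarrow> ring.comm B t (h (E0 n i j)) = \<zero>\<^bsub>B\<^esub>"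
    and u: "u \<in> carrier (Ugl n)"
  shows "t \<otimes>\<^bsub>B\<^esub> h u = h u \<otimes>\<^bsub>B\<^esub> t"
proof -
  interpret h: calg_hom "Ugl n" B h by fact
  have "h.B.comm t (h u) = \<zero>\<^bsub>B\<^esub>" using u
  proof (induction u rule: Gl.uea_induct)
    case (gen a)
    have z: "(\<lambda>i j. 0) = lie_scale (gl0 n) 0 (\<lambda>i j. 0)" "(\<lambda>i j. 0) \<in> carrier (gl0 n)" by (simp_all add: gl_simps)
    show ?case using Gl.finite_I gen
      by (induction a rule: gl_induct)
         (use assms in \<open>simp_all add: Gl.gen_add Gl.gen_scale h.B.comm_add_r h.B.comm_smult_r\<close>,
           subst z(1), simp add: Gl.gen_scale[OF z(2)] z(2))
  qed (use assms(2) in \<open>simp_all add: h.B.comm_add_r h.B.comm_mult_r h.B.comm_smult_r\<close>)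
  then show ?thesis using assms(2) u by (simp add: h.B.comm_zero_iff)
qed

lemma Theta_exists: "\<exists>h\<in>alg_hom (Tgt n) (op_alg (VV n)).
    (\<forall>D\<in>carrier (Dprime n). h (tns n D \<one>\<^bsub>Ugl n\<^esub>) = dact n D) \<and>
    (\<forall>i\<in>{1..n}. \<forall>j\<in>{1..n}. h (eg i j) = gact n i j)"
proof -
  obtain f where f: "f \<in> alg_hom (Ugl n) (op_alg (VV n))" "\<And>i j. \<lbrakk>i \<in> {1..n}; j \<in> {1..n}\<rbrakk> \<Longrightarrow> f (E0 n i j) = gact n i j"
    using Gl.gl_hom_exists[OF calg_op gact_gl] by blast
  interpret f: calg_hom "Ugl n" "op_alg (VV n)" f by unfold_locales (rule f(1))
  interpret d: calg_hom "Dprime n" "op_alg (VV n)" "restrict (dact n) (carrier (Dprime n))" by unfold_locales (rule dact_hom)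
  have comm: "f u \<otimes>\<^bsub>op_alg (VV n)\<^esub> restrict (dact n) (carrier (Dprime n)) D = restrict (dact n) (carrier (Dprime n)) D \<otimes>\<^bsub>op_alg (VV n)\<^esub> f u"
    if D: "D \<in> carrier (Dprime n)" and u: "u \<in> carrier (Ugl n)" for D u
    by (rule comm_closure_gl[OF f.calg_hom_axioms _ _ u, symmetric])
       (use D in \<open>simp_all only: f(2) restrict_apply' dact_gact_comm Dprime_sub dact_closed\<close>)
  obtain h where h: "h \<in> alg_hom (Tgt n) (op_alg (VV n))"
     "\<And>D u. \<lbrakk>D \<in> carrier (Dprime n); u \<in> carrier (Ugl n)\<rbrakk> \<Longrightarrow> h (tns n D u) = restrict (dact n) (carrier (Dprime n)) D \<otimes>\<^bsub>op_alg (VV n)\<^esub> f u"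
    using TP.tensor_hom_exists[OF d.calg_hom_axioms f.calg_hom_axioms comm] by blast
  show ?thesis
  proof (intro bexI[OF _ h(1)] conjI ballI)
    fix D assume D: "D \<in> carrier (Dprime n)"
    show "h (tns n D \<one>\<^bsub>Ugl n\<^esub>) = dact n D"
      using D by (simp add: h(2) dact_closed[OF Dprime_sub])
  next
    fix i j assume "i \<in> {1..n}" "j \<in> {1..n}"
    moreover have "restrict (dact n) (carrier (Dprime n)) \<one>\<^bsub>Dprime n\<^esub> = \<one>\<^bsub>op_alg (VV n)\<^esub>" by (rule d.hom_one)
    ultimately show "h (eg i j) = gact n i j"
      using gact_closed by (simp add: h(2) f(2) del: d.hom_one)
  qed
qed

definition "Th = (SOME h. h \<in> alg_hom (Tgt n) (op_alg (VV n)) \<and>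
    (\<forall>D\<in>carrier (Dprime n). h (tns n D \<one>\<^bsub>Ugl n\<^esub>) = dact n D) \<and>
    (\<forall>i\<in>{1..n}. \<forall>j\<in>{1..n}. h (eg i j) = gact n i j))"

lemma Th_props: "Th \<in> alg_hom (Tgt n) (op_alg (VV n))"
    "D \<in> carrier (Dprime n) \<Longrightarrow> Th (tns n D \<one>\<^bsub>Ugl n\<^esub>) = dact n D"
    "\<lbrakk>i \<in> {1..n}; j \<in> {1..n}\<rbrakk> \<Longrightarrow> Th (eg i j) = gact n i j"
  using someI_ex[OF Theta_exists[unfolded Bex_def]] unfolding Th_def[symmetric] by blast+

sublocale Th: calg_hom "Tgt n" "op_alg (VV n)" Th
  by unfold_locales (rule Th_props)

subsection \<open>Leading symbols\<close>

declare single_one [simp del]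

definition wt :: "(nat \<Rightarrow> complex) \<Rightarrow> (nat \<Rightarrow>\<^sub>0 int) \<Rightarrow> complex"
  where "wt \<tau> e = (\<Prod>i\<in>{0..n}. \<tau> i powi lk e i)"

text \<open>Points that tend to infinity in the direction \<open>(a, c)\<close>.\<close>

definition seqs :: "(nat \<Rightarrow> complex) \<Rightarrow> (nat \<Rightarrow> nat \<Rightarrow> complex) \<Rightarrow> (nat \<Rightarrow> nat \<Rightarrow>\<^sub>0 int) \<Rightarrow> (nat \<Rightarrow> nat \<Rightarrow> nat \<Rightarrow> complex) \<Rightarrow> bool"
  where "seqs a c es gs \<longleftrightarrow> (\<forall>s. vexp n (es s)) \<and> (\<forall>j\<le>n. (\<lambda>s. of_int (lk (es s) j) / of_nat s) \<longlonglongrightarrow> a j) \<and>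
     (\<forall>i k. (\<lambda>s. gs s i k / of_nat s) \<longlonglongrightarrow> c i k)"

text \<open>Along every such sequence \<open>F\<close> grows like \<open>z\<close> times \<open>\<tau>\<^sup>e s\<^sup>d\<close>. Quantifying over all sequences makes the notion stable under the bounded shifts that the operators perform.\<close>

definition lsym where
  "lsym \<tau> a c F d z \<longleftrightarrow> (\<forall>es gs. seqs a c es gs \<longrightarrow>
     (\<lambda>s. F (es s, gs s) / (wt \<tau> (es s) * of_nat s ^ d)) \<longlonglongrightarrow> (z::complex))"

text \<open>An operator of order at most \<open>k\<close> with symbol \<open>\<sigma>'\<close>: it multiplies leading coefficients by \<open>\<sigma>'\<close> and raises the degree of growth by \<open>k\<close>. A symbol of order \<open>k\<close> is zero as a symbol of larger order.\<close>

definition osym where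
  "osym \<tau> a c S k \<sigma>' \<longleftrightarrow> (\<forall>F d z. lsym \<tau> a c F d z \<longrightarrow> lsym \<tau> a c (S F) (d + k) (\<sigma>' * z))"

lemma inv_nat_tendsto: "(\<lambda>s. 1 / of_nat s :: complex) \<longlonglongrightarrow> 0"
  using lim_1_over_n by (simp add: inverse_eq_divide)

lemma const_tendsto: "(\<lambda>s. b / of_nat s :: complex) \<longlonglongrightarrow> 0"
  using tendsto_mult[OF tendsto_const[of b] inv_nat_tendsto] by simp

lemma sym_add: "\<lbrakk>lsym \<tau> a c F d z; lsym \<tau> a c G d w\<rbrakk> \<Longrightarrow> lsym \<tau> a c (\<lambda>p. F p + G p) d (z + w)"
  unfolding lsym_def by (auto simp: add_divide_distrib intro!: tendsto_add)

lemma sym_smult: "lsym \<tau> a c F d z \<Longrightarrow> lsym \<tau> a c (\<lambda>p. b * F p) d (b * z)"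
  unfolding lsym_def
proof (intro allI impI)
  fix es gs assume "\<forall>es gs. seqs a c es gs \<longrightarrow> (\<lambda>s. F (es s, gs s) / (wt \<tau> (es s) * of_nat s ^ d)) \<longlonglongrightarrow> z" "seqs a c es gs"
  then have "(\<lambda>s. b * (F (es s, gs s) / (wt \<tau> (es s) * of_nat s ^ d))) \<longlonglongrightarrow> b * z"
    by (intro tendsto_mult tendsto_const) blast
  then show "(\<lambda>s. b * F (es s, gs s) / (wt \<tau> (es s) * of_nat s ^ d)) \<longlonglongrightarrow> b * z" by simp
qed

lemma sym_zero: "lsym \<tau> a c (\<lambda>p. 0) d 0" by (simp add: lsym_def)

lemma sym_raise: "lsym \<tau> a c F d z \<Longrightarrow> lsym \<tau> a c F (Suc d) 0"
  unfolding lsym_def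
proof (intro allI impI)
  fix es gs assume "\<forall>es gs. seqs a c es gs \<longrightarrow> (\<lambda>s. F (es s, gs s) / (wt \<tau> (es s) * of_nat s ^ d)) \<longlonglongrightarrow> z" "seqs a c es gs"
  then have "(\<lambda>s. F (es s, gs s) / (wt \<tau> (es s) * of_nat s ^ d) * (1 / of_nat s)) \<longlonglongrightarrow> z * 0"
    by (intro tendsto_mult inv_nat_tendsto) blast
  then show "(\<lambda>s. F (es s, gs s) / (wt \<tau> (es s) * of_nat s ^ Suc d)) \<longlonglongrightarrow> 0"
    by (simp add: mult_ac)
qed

lemma osym_add: "\<lbrakk>osym \<tau> a c S k z; osym \<tau> a c T k w\<rbrakk> \<Longrightarrow> osym \<tau> a c (S \<oplus>\<^bsub>op_alg (VV n)\<^esub> T) k (z + w)"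
  unfolding osym_def op_simps by (auto simp: distrib_right intro: sym_add)

lemma osym_smult: "osym \<tau> a c S k z \<Longrightarrow> osym \<tau> a c (b \<odot>\<^bsub>op_alg (VV n)\<^esub> S) k (b * z)"
  unfolding osym_def op_simps by (auto simp: mult.assoc intro: sym_smult)

lemma osym_zero: "osym \<tau> a c \<zero>\<^bsub>op_alg (VV n)\<^esub> k 0"
  unfolding osym_def op_simps by (auto intro: sym_zero)

lemma osym_uminus: "\<lbrakk>S \<in> carrier (op_alg (VV n)); osym \<tau> a c S k z\<rbrakk> \<Longrightarrow> osym \<tau> a c (\<ominus>\<^bsub>op_alg (VV n)\<^esub> S) k (- z)"
  using osym_smult[of \<tau> a c S k z "-1"] by simp

lemma osym_mult: "\<lbrakk>osym \<tau> a c S k z; osym \<tau> a c T l w\<rbrakk> \<Longrightarrow> osym \<tau> a c (S \<otimes>\<^bsub>op_alg (VV n)\<^esub> T) (k + l) (z * w)"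
  unfolding osym_def op_simps
proof (intro allI impI)
  fix F d u assume *: "\<forall>F d y. lsym \<tau> a c F d y \<longrightarrow> lsym \<tau> a c (S F) (d + k) (z * y)"
    "\<forall>F d z. lsym \<tau> a c F d z \<longrightarrow> lsym \<tau> a c (T F) (d + l) (w * z)" "lsym \<tau> a c F d u"
  then have "lsym \<tau> a c (T (S F)) (d + k + l) (w * (z * u))" by blast
  then show "lsym \<tau> a c (T (S F)) (d + (k + l)) (z * w * u)" by (simp add: ac_simps)
qed

lemma osym_raise: "osym \<tau> a c S k z \<Longrightarrow> osym \<tau> a c S (Suc k) 0"
  unfolding osym_def
proof (intro allI impI)
  fix F d u assume "\<forall>F d y. lsym \<tau> a c F d y \<longrightarrow> lsym \<tau> a c (S F) (d + k) (z * y)" "lsym \<tau> a c F d u"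
  then have "lsym \<tau> a c (S F) (d + k) (z * u)" by blast
  from sym_raise[OF this] show "lsym \<tau> a c (S F) (d + Suc k) (0 * u)" by simp
qed

lemma osym_raise': "osym \<tau> a c S k z \<Longrightarrow> k < l \<Longrightarrow> osym \<tau> a c S l 0"
proof (induction l)
  case (Suc l)
  then show ?case using osym_raise by (cases "k = l") auto
qed simp

lemma osym_finsum:
  assumes "finite I" "\<And>i. i \<in> I \<Longrightarrow> S i \<in> carrier (op_alg (VV n))" "\<And>i. i \<in> I \<Longrightarrow> osym \<tau> a c (S i) k (z i)"
  shows "osym \<tau> a c (\<Oplus>\<^bsub>op_alg (VV n)\<^esub>i\<in>I. S i) k (\<Sum>i\<in>I. z i)"
  using assms by (induction I rule: finite_induct) (simp_all add: osym_zero osym_add Pi_iff)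

lemma seqsD:
  assumes "seqs a c es gs"
  shows "vexp n (es s)" "j \<le> n \<Longrightarrow> (\<lambda>s. of_int (lk (es s) j) / of_nat s) \<longlonglongrightarrow> a j"
    "(\<lambda>s. gs s i k / of_nat s) \<longlonglongrightarrow> c i k"
  using assms unfolding seqs_def by blast+

lemma osym_one: "osym \<tau> a c \<one>\<^bsub>op_alg (VV n)\<^esub> 0 1"
  unfolding osym_def op_simps lsym_def
proof (intro allI impI)
  fix F d z es gs
  assume *: "\<forall>es gs. seqs a c es gs \<longrightarrow> (\<lambda>s. F (es s, gs s) / (wt \<tau> (es s) * of_nat s ^ d)) \<longlonglongrightarrow> z" "seqs a c es gs"
  have "rs (VV n) F (es s, gs s) = F (es s, gs s)" for s using seqsD(1)[OF *(2)] by (simp add: rs_def VV_def)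
  then show "(\<lambda>s. rs (VV n) F (es s, gs s) / (wt \<tau> (es s) * of_nat s ^ (d + 0))) \<longlonglongrightarrow> 1 * z" using * by simp
qed

lemma wt_nz: "(\<And>i. i \<le> n \<Longrightarrow> \<tau> i \<noteq> 0) \<Longrightarrow> wt \<tau> e \<noteq> 0"
  by (simp add: wt_def)

lemma wt_shift:
  assumes nz: "\<And>i. i \<le> n \<Longrightarrow> \<tau> i \<noteq> 0" and "x \<le> n" "y \<le> n"
  shows "wt \<tau> (e + dl x - dl y) = wt \<tau> e * (\<tau> x / \<tau> y)"
proof -
  have "wt \<tau> (e + dl x - dl y) = (\<Prod>i\<in>{0..n}. \<tau> i powi lk e i * ((if i = x then \<tau> x else 1) * (if i = y then inverse (\<tau> y) else 1)))"
    unfolding wt_def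
  proof (rule prod.cong[OF refl])
    fix i assume "i \<in> {0..n}"
    then have "\<tau> i \<noteq> 0" using nz by simp
    then show "\<tau> i powi lk (e + dl x - dl y) i = \<tau> i powi lk e i * ((if i = x then \<tau> x else 1) * (if i = y then inverse (\<tau> y) else 1))"
      unfolding lookup_add lookup_minus lk_dl by (auto simp: power_int_add power_int_diff field_simps)
  qed
  also have "\<dots> = wt \<tau> e * (\<tau> x * inverse (\<tau> y))"
    unfolding prod.distrib wt_def using assms by (simp add: prod.delta)
  finally show ?thesis by (simp add: field_simps)
qed

lemma seqs_shift:
  assumes "seqs a c es gs" "\<And>s. es' s = es s \<or> es' s = es s + dl x - dl y" "\<And>s. vexp n (es' s)"
  shows "seqs a c es' gs"
  unfolding seqs_def
proof (intro conjI allI impI assms(3) seqsD(3)[OF assms(1)])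
  fix j assume j: "j \<le> n"
  let ?d = "\<lambda>s. of_int (lk (es' s) j - lk (es s) j) :: complex"
  have "(\<lambda>s. ?d s / of_nat s) \<longlonglongrightarrow> 0"
  proof (rule tendsto_0_le[OF const_tendsto[of 2], where K = 1], rule always_eventually, rule allI)
    fix s
    have "\<bar>lk (es' s) j - lk (es s) j\<bar> \<le> 2" using assms(2)[of s] by (auto simp: lookup_add lookup_minus lk_dl)
    then have "norm (?d s) \<le> 2" unfolding norm_of_int by linarith
    then show "norm (?d s / of_nat s) \<le> norm (2 / of_nat s :: complex) * 1"
      by (simp add: norm_divide divide_right_mono)
  qed
  then have "(\<lambda>s. of_int (lk (es s) j) / of_nat s + ?d s / of_nat s) \<longlonglongrightarrow> a j + 0"
    by (intro tendsto_add seqsD(2)[OF assms(1) j])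
  then show "(\<lambda>s. of_int (lk (es' s) j) / of_nat s) \<longlonglongrightarrow> a j"
    by (simp add: add_divide_distrib[symmetric])
qed

definition "gl_symbol c i j = (\<Sum>k\<in>{1..n}. xi i k / xi j k * c j k)"

definition "Q_symbol \<tau> c i j = (if i = 0 then 0 else if j = 0 then - (\<Sum>k\<in>{1..n}. \<tau> k * gl_symbol c i k) else gl_symbol c i j)"

text \<open>A matrix of rank one plus a matrix that annihilates \<open>\<tau>\<close> when \<open>\<tau> 0 = 1\<close>. Thus \<open>\<tau>\<close> is an eigenvector, with eigenvalue the sum of the \<open>a j\<close>.\<close>

definition "r0_symbol \<tau> a c i j = \<tau> i * (a j / \<tau> j) + Q_symbol \<tau> c i j"

definition "R1_symbol \<tau> a c = - (\<Sum>i\<in>{0..n}. r0_symbol \<tau> a c i i) / (of_nat n + 1)"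

context
  fixes \<tau> :: "nat \<Rightarrow> complex" and a :: "nat \<Rightarrow> complex" and c :: "nat \<Rightarrow> nat \<Rightarrow> complex"
  assumes nz: "\<And>i. i \<le> n \<Longrightarrow> \<tau> i \<noteq> (0::complex)" and t0: "\<tau> 0 = 1"
begin

lemma osym_x:
  assumes x: "x \<le> n"
  shows "osym \<tau> a c (Th (xx x)) 0 (\<tau> x)"
  unfolding osym_def
proof (intro allI impI)
  fix F d z assume F: "lsym \<tau> a c F d z"
  show "lsym \<tau> a c (Th (xx x) F) (d + 0) (\<tau> x * z)"
    unfolding lsym_def
  proof (intro allI impI)
    fix es gs assume S: "seqs a c es gs"
    define es' where "es' s = es s + dl x - dl 0" for s
    have v: "vexp n (es' s)" for s using vexp_shift[OF seqsD(1)[OF S] x] by (simp add: es'_def add_diff_eq)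
    have S': "seqs a c es' gs" by (rule seqs_shift[OF S _ v, where x = x and y = 0]) (simp add: es'_def)
    have "(\<lambda>s. \<tau> x * (F (es' s, gs s) / (wt \<tau> (es' s) * of_nat s ^ d))) \<longlonglongrightarrow> \<tau> x * z"
      using F S' unfolding lsym_def by (intro tendsto_mult tendsto_const) blast
    moreover have "\<tau> x * (F (es' s, gs s) / (wt \<tau> (es' s) * of_nat s ^ d)) = Th (xx x) F (es s, gs s) / (wt \<tau> (es s) * of_nat s ^ (d + 0))" for s
    proof -
      have "Th (xx x) F (es s, gs s) = F (es' s, gs s)"
        using x seqsD(1)[OF S] by (simp add: Th_props(2) dact_def xop_single es'_def)
      then show ?thesis using nz[OF x] wt_nz[of \<tau> "es s"] nz x unfolding es'_def
        by (simp add: wt_shift t0 field_simps)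
    qed
    ultimately show "(\<lambda>s. Th (xx x) F (es s, gs s) / (wt \<tau> (es s) * of_nat s ^ (d + 0))) \<longlonglongrightarrow> \<tau> x * z" by simp
  qed
qed

lemma osym_y:
  assumes y: "y \<le> n"
  shows "osym \<tau> a c (Th (yy y)) 1 (a y / \<tau> y)"
  unfolding osym_def
proof (intro allI impI)
  fix F d z assume F: "lsym \<tau> a c F d z"
  show "lsym \<tau> a c (Th (yy y) F) (d + 1) (a y / \<tau> y * z)"
    unfolding lsym_def
  proof (intro allI impI)
    fix es gs assume S: "seqs a c es gs"
    \<comment> \<open>where the shifted exponent is not admissible, the coefficient vanishes\<close>
    define es' where "es' s = (if vexp n (es s + dl 0 - dl y) then es s + dl 0 - dl y else es s)" for s
    have v: "vexp n (es' s)" for s using seqsD(1)[OF S] by (simp add: es'_def)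
    have S': "seqs a c es' gs" by (rule seqs_shift[OF S _ v, where x = 0 and y = y]) (simp add: es'_def)
    have "(\<lambda>s. (of_int (lk (es s) y) / of_nat s) / \<tau> y * (F (es' s, gs s) / (wt \<tau> (es' s) * of_nat s ^ d))) \<longlonglongrightarrow> a y / \<tau> y * z"
      using F S' unfolding lsym_def
      by (intro tendsto_mult tendsto_divide tendsto_const seqsD(2)[OF S y] nz[OF y]) blast
    moreover have "(of_int (lk (es s) y) / of_nat s) / \<tau> y * (F (es' s, gs s) / (wt \<tau> (es' s) * of_nat s ^ d)) = Th (yy y) F (es s, gs s) / (wt \<tau> (es s) * of_nat s ^ (d + 1))" for s
    proof -
      have T: "Th (yy y) F (es s, gs s) = of_int (lk (es s) y) * F (es s + dl 0 - dl y, gs s)"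
        using y seqsD(1)[OF S] by (simp add: Th_props(2) dact_def yop_single')
      show ?thesis
      proof (cases "lk (es s) y = 0")
        case False
        then have e: "es' s = es s + dl 0 - dl y"
          using vexp_t[OF seqsD(1)[OF S] _ y] by (simp add: es'_def)
        have w: "wt \<tau> (es' s) = wt \<tau> (es s) * (1 / \<tau> y)"
          unfolding e using wt_shift[of \<tau> 0 y "es s"] nz y t0 by simp
        show ?thesis unfolding T e[symmetric] w using nz[OF y] wt_nz[of \<tau> "es s", OF nz]
          by (simp add: field_simps power_add)
      qed (simp add: T)
    qed
    ultimately show "(\<lambda>s. Th (yy y) F (es s, gs s) / (wt \<tau> (es s) * of_nat s ^ (d + 1))) \<longlonglongrightarrow> a y / \<tau> y * z" by simp
  qed
qed

lemma osym_e:
  assumes i: "i \<in> {1..n}" "j \<in> {1..n}"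
  shows "osym \<tau> a c (Th (eg i j)) 1 (gl_symbol c i j)"
  unfolding osym_def
proof (intro allI impI)
  fix F d z assume F: "lsym \<tau> a c F d z"
  show "lsym \<tau> a c (Th (eg i j) F) (d + 1) (gl_symbol c i j * z)"
    unfolding lsym_def
  proof (intro allI impI)
    fix es gs assume S: "seqs a c es gs"
    have S': "seqs a c es (\<lambda>s. shf i j k (gs s))" for k
      unfolding seqs_def
    proof (intro conjI allI impI seqsD[OF S])
      fix p q
      let ?e = "(if p = i \<and> q = k then 1 else 0) - (if p = j \<and> q = k then 1 else 0) :: complex"
      have "(\<lambda>s. gs s p q / of_nat s + ?e / of_nat s) \<longlonglongrightarrow> c p q + 0"
        by (intro tendsto_add seqsD(3)[OF S] const_tendsto)
      then show "(\<lambda>s. shf i j k (gs s) p q / of_nat s) \<longlonglongrightarrow> c p q"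
        by (simp add: shf_def add_divide_distrib[symmetric] algebra_simps)
    qed
    have "(\<lambda>s. \<Sum>k\<in>{1..n}. xi i k / xi j k * (gs s j k / of_nat s) * (F (es s, shf i j k (gs s)) / (wt \<tau> (es s) * of_nat s ^ d)))
      \<longlonglongrightarrow> (\<Sum>k\<in>{1..n}. xi i k / xi j k * c j k * z)"
      using F S' unfolding lsym_def
      by (intro tendsto_sum tendsto_mult tendsto_const seqsD(3)[OF S]) blast
    moreover have "(\<Sum>k\<in>{1..n}. xi i k / xi j k * c j k * z) = gl_symbol c i j * z"
      by (simp add: gl_symbol_def sum_distrib_right)
    moreover have "(\<Sum>k\<in>{1..n}. xi i k / xi j k * (gs s j k / of_nat s) * (F (es s, shf i j k (gs s)) / (wt \<tau> (es s) * of_nat s ^ d)))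
      = Th (eg i j) F (es s, gs s) / (wt \<tau> (es s) * of_nat s ^ (d + 1))" for s
      using i seqsD(1)[OF S] by (simp add: Th_props(3) gact_def sum_divide_distrib power_add mult_ac)
    ultimately show "(\<lambda>s. Th (eg i j) F (es s, gs s) / (wt \<tau> (es s) * of_nat s ^ (d + 1))) \<longlonglongrightarrow> gl_symbol c i j * z"
      by simp
  qed
qed

lemma osym_P: "\<lbrakk>i \<le> n; j \<le> n\<rbrakk> \<Longrightarrow> osym \<tau> a c (Th (R.P i j)) 1 (\<tau> i * (a j / \<tau> j))"
  using osym_mult[OF osym_x osym_y, of i j] by (simp add: R.P_def)

lemma osym_Q:
  assumes "i \<le> n" "j \<le> n"
  shows "osym \<tau> a c (Th (R.Q i j)) 1 (Q_symbol \<tau> c i j)"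
proof -
  consider "i = 0" | "1 \<le> i" "j = 0" | "1 \<le> i" "1 \<le> j" by linarith
  then show ?thesis
  proof cases
    case 1 then show ?thesis using osym_zero by (simp add: Q_symbol_def)
  next
    case 2
    have "Th (R.Q i 0) = \<ominus>\<^bsub>op_alg (VV n)\<^esub> (\<Oplus>\<^bsub>op_alg (VV n)\<^esub>k\<in>{1..n}. Th (xx k \<otimes>\<^bsub>Tgt n\<^esub> eg i k))"
      using 2 assms by (simp add: R.Q_col0 Pi_iff comp_def del: Th.hom_mult)
    moreover have "osym \<tau> a c (Th (xx k \<otimes>\<^bsub>Tgt n\<^esub> eg i k)) 1 (\<tau> k * gl_symbol c i k)" if "k \<in> {1..n}" for k
      using osym_mult[OF osym_x osym_e, of k i k] that 2 assms by simp
    ultimately show ?thesis using 2 assms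
      by (auto simp: Q_symbol_def intro!: osym_uminus osym_finsum Op.finsum_closed simp del: Th.hom_mult)
  next
    case 3 then show ?thesis using assms osym_e[of i j] by (simp add: R.Q_pos Q_symbol_def)
  qed
qed

lemma osym_r0: "\<lbrakk>i \<le> n; j \<le> n\<rbrakk> \<Longrightarrow> osym \<tau> a c (Th (R.r0 i j)) 1 (r0_symbol \<tau> a c i j)"
  using osym_add[OF osym_P osym_Q, of i j i j] by (simp add: R.r0_def r0_symbol_def)

lemma osym_R1: "osym \<tau> a c (Th (R1 n)) 1 (R1_symbol \<tau> a c)"
proof -
  have "Th (R1 n) = (- 1 / (of_nat n + 1)) \<odot>\<^bsub>op_alg (VV n)\<^esub> (\<Oplus>\<^bsub>op_alg (VV n)\<^esub>i\<in>{0..n}. Th (R.r0 i i))"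
    unfolding R1_eq using trR_closed by (simp add: Pi_iff comp_def)
  moreover have "osym \<tau> a c (\<Oplus>\<^bsub>op_alg (VV n)\<^esub>i\<in>{0..n}. Th (R.r0 i i)) 1 (\<Sum>i\<in>{0..n}. r0_symbol \<tau> a c i i)"
    by (rule osym_finsum) (simp_all add: osym_r0)
  ultimately show ?thesis using osym_smult[of \<tau> a c _ 1 "\<Sum>i\<in>{0..n}. r0_symbol \<tau> a c i i" "- 1 / (of_nat n + 1)"]
    by (simp add: R1_symbol_def)
qed

lemma osym_rr: "\<lbrakk>i \<le> n; j \<le> n\<rbrakk> \<Longrightarrow> osym \<tau> a c (Th (rr i j)) 1 (r0_symbol \<tau> a c i j + (if i = j then R1_symbol \<tau> a c else 0))"
  using osym_add[OF osym_r0 osym_R1, of i j] osym_r0[of i j] by (cases "i = j") (simp_all add: rr_def)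

lemma osym_th: "osym \<tau> a c (Th th) 1 ((\<Sum>j\<in>{0..n}. a j) + R1_symbol \<tau> a c)"
proof -
  have "Th R.Eu = (\<Oplus>\<^bsub>op_alg (VV n)\<^esub>i\<in>{0..n}. Th (R.P i i))"
    unfolding R.Eu_def by (simp add: Pi_iff comp_def)
  moreover have "osym \<tau> a c (\<Oplus>\<^bsub>op_alg (VV n)\<^esub>i\<in>{0..n}. Th (R.P i i)) 1 (\<Sum>i\<in>{0..n}. \<tau> i * (a i / \<tau> i))"
    by (rule osym_finsum; (rule osym_P)?; simp)
  moreover have "(\<Sum>i\<in>{0..n}. \<tau> i * (a i / \<tau> i)) = (\<Sum>i\<in>{0..n}. a i)"
    by (rule sum.cong) (use nz in auto)
  ultimately have "osym \<tau> a c (Th R.Eu) 1 (\<Sum>i\<in>{0..n}. a i)" by simp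
  then show ?thesis using osym_add[OF _ osym_R1] by (simp add: th_def)
qed

end

text \<open>The function \<open>\<tau>\<^sup>e\<close> has leading coefficient one, and the multiples of a vector of natural numbers are admissible exponents, so that there is a sequence along which to compare.\<close>

lemma osym_unique:
  assumes nz: "\<And>i. i \<le> n \<Longrightarrow> \<tau> i \<noteq> (0::complex)"
    and a: "\<And>j. a j = of_nat (N j)" and S: "osym \<tau> a c \<zero>\<^bsub>op_alg (VV n)\<^esub> k z"
  shows "z = 0"
proof -
  define es where "es s = (\<Sum>j\<in>{0..n}. sg j (int (s * N j)))" for s :: nat
  define gs where "gs s i k = of_nat s * c i k" for s :: nat and i k
  have lkes: "lk (es s) j = (if j \<le> n then int (s * N j) else 0)" for s j
    unfolding es_def by (simp add: lookup_sum lookup_single when_def sum.delta)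
  have v: "vexp n (es s)" for s
    by (auto simp: vexp_def lkes in_keys_iff split: if_splits)
  have ev: "(\<lambda>s. of_nat s * (b::complex) / of_nat s) \<longlonglongrightarrow> b" for b
    by (rule tendsto_eventually, rule eventually_sequentiallyI[of 1]) simp
  have seq: "seqs a c es gs"
    unfolding seqs_def gs_def lkes a using v ev by simp
  have one: "lsym \<tau> a c (\<lambda>p. wt \<tau> (fst p)) 0 1"
    unfolding lsym_def using wt_nz[of \<tau>] nz by simp
  then have "lsym \<tau> a c (\<lambda>p. 0) (0 + k) (z * 1)"
    using S unfolding osym_def op_simps by blast
  then have "(\<lambda>s. 0) \<longlonglongrightarrow> z" using seq unfolding lsym_def by fastforce
  then show ?thesis by (simp add: LIMSEQ_const_iff)
qed

end

section \<open>Vanishing criteria and perturbed eigenvectors\<close>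

text \<open>Functions that are polynomial in each variable separately. They are closed under sums and products, and a zero in each of infinitely many places can be used one variable at a time.\<close>

definition seppoly :: "(('i \<Rightarrow> complex) \<Rightarrow> complex) \<Rightarrow> bool"
  where "seppoly g \<longleftrightarrow> (\<forall>v j. \<exists>p. \<forall>z. g (v(j := z)) = poly p z)"

lemma seppoly_const: "seppoly (\<lambda>v. c)"
  unfolding seppoly_def by (auto intro!: exI[of _ "[:c:]"])

lemma seppoly_var: "seppoly (\<lambda>v. v i)"
  unfolding seppoly_def
proof (intro allI)
  fix v :: "'a \<Rightarrow> complex" and j
  show "\<exists>p. \<forall>z. (v(j := z)) i = poly p z"
  proof (cases "i = j")
    case True then show ?thesis by (intro exI[of _ "[:0, 1:]"]) simp
  next
    case False then show ?thesis by (intro exI[of _ "[:v i:]"]) simp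
  qed
qed

lemma seppoly_add: "\<lbrakk>seppoly f; seppoly g\<rbrakk> \<Longrightarrow> seppoly (\<lambda>v. f v + g v)"
  unfolding seppoly_def by (metis poly_add)

lemma seppoly_mult: "\<lbrakk>seppoly f; seppoly g\<rbrakk> \<Longrightarrow> seppoly (\<lambda>v. f v * g v)"
  unfolding seppoly_def by (metis poly_mult)

lemma seppoly_uminus: "seppoly f \<Longrightarrow> seppoly (\<lambda>v. - f v)"
  unfolding seppoly_def by (metis poly_minus)

lemma seppoly_sum: "(\<And>i. i \<in> I \<Longrightarrow> seppoly (f i)) \<Longrightarrow> seppoly (\<lambda>v. \<Sum>i\<in>I. f i v)"
  by (induction I rule: infinite_finite_induct) (auto intro: seppoly_const seppoly_add)

lemma seppoly_power: "seppoly f \<Longrightarrow> seppoly (\<lambda>v. f v ^ k)"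
  by (induction k) (auto intro: seppoly_const seppoly_mult)

lemma seppoly_prod_list: "(\<And>i. i \<in> set xs \<Longrightarrow> seppoly (f i)) \<Longrightarrow> seppoly (\<lambda>v. prod_list (map (\<lambda>i. f i v) xs))"
  by (induction xs) (auto intro: seppoly_const seppoly_mult)

lemma poly_vanish: "\<lbrakk>infinite S; \<And>z. z \<in> S \<Longrightarrow> poly p z = 0\<rbrakk> \<Longrightarrow> p = (0 :: complex poly)"
proof (rule ccontr)
  assume S: "infinite S" "\<And>z. z \<in> S \<Longrightarrow> poly p z = 0" and "p \<noteq> 0"
  then have "finite {z. poly p z = 0}" by (simp add: poly_roots_finite)
  moreover have "S \<subseteq> {z. poly p z = 0}" using S by auto
  ultimately show False using S(1) finite_subset by blast
qed

text \<open>The restriction to \<open>S j\<close> is removed for one variable after the other, since a polynomial with infinitely many zeros is zero.\<close>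

lemma seppoly_vanish:
  assumes g: "seppoly g" and J: "finite J" and S: "\<And>j. j \<in> J \<Longrightarrow> infinite (S j)"
    and z: "\<And>v. \<lbrakk>\<And>j. j \<in> J \<Longrightarrow> v j \<in> S j; \<And>j. j \<notin> J \<Longrightarrow> v j = w j\<rbrakk> \<Longrightarrow> g v = 0"
  shows "g w = 0"
proof -
  have "K \<subseteq> J \<Longrightarrow> \<forall>v. (\<forall>j\<in>J - K. v j \<in> S j) \<and> (\<forall>j. j \<notin> J \<longrightarrow> v j = w j) \<longrightarrow> g v = 0" if "finite K" for K
    using that
  proof (induction K rule: finite_induct)
    case empty then show ?case using z by auto
  next
    case (insert k K)
    show ?case
    proof (intro allI impI)
      fix v assume v: "(\<forall>j\<in>J - insert k K. v j \<in> S j) \<and> (\<forall>j. j \<notin> J \<longrightarrow> v j = w j)"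
      obtain p where p: "\<And>y. g (v(k := y)) = poly p y" using g unfolding seppoly_def by metis
      have "poly p y = 0" if "y \<in> S k" for y
      proof -
        have "g (v(k := y)) = 0"
          using insert v that by (intro insert.IH[rule_format]) (auto split: if_splits)
        then show ?thesis using p by simp
      qed
      then have "p = 0" using S insert by (intro poly_vanish[of "S k"]) auto
      then show "g v = 0" using p[of "v k"] by simp
    qed
  qed
  from this[OF J] show ?thesis by auto
qed

subsection \<open>Perturbation of a bidiagonal matrix\<close>

text \<open>The eigenvalues are \<open>0, \<dots>, n\<close>, and the superdiagonal forces an eigenvector with first entry zero to vanish. Both properties persist under small perturbations.\<close>

definition bidiag :: "nat \<Rightarrow> nat \<Rightarrow> real"
  where "bidiag i j = (if i = j then of_nat i else if j = Suc i then 1 else 0)"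

definition pencil :: "nat \<Rightarrow> (nat \<Rightarrow> nat \<Rightarrow> real) \<Rightarrow> real \<Rightarrow> real \<Rightarrow> real mat"
  where "pencil n B z x = mat (Suc n) (Suc n) (\<lambda>(i, j). bidiag i j + z * B i j - (if i = j then x else 0))"

lemma pencil_carrier [simp]: "pencil n B z x \<in> carrier_mat (Suc n) (Suc n)"
  by (simp add: pencil_def)

lemma det_pencil_0: "det (pencil n B 0 x) = (\<Prod>i\<in>{0..n}. of_nat i - x)"
proof -
  have "upper_triangular (pencil n B 0 x)"
    by (auto simp: upper_triangular_def pencil_def bidiag_def)
  then have "det (pencil n B 0 x) = prod_list (diag_mat (pencil n B 0 x))"
    by (rule det_upper_triangular[OF _ pencil_carrier])
  also have "diag_mat (pencil n B 0 x) = map (\<lambda>i. of_nat i - x) [0..<Suc n]"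
    unfolding diag_mat_def by (auto simp: pencil_def bidiag_def simp del: upt_Suc)
  also have "prod_list \<dots> = (\<Prod>i\<in>{0..n}. of_nat i - x)"
    by (subst prod.distinct_set_conv_list[symmetric]) (auto simp: atLeastLessThanSuc_atLeastAtMost simp del: upt_Suc)
  finally show ?thesis .
qed

lemma det_pencil: "det (pencil n B z x) = (\<Sum>p\<in>{p. p permutes {0..<Suc n}}.
    signof p * (\<Prod>i\<in>{0..<Suc n}. bidiag i (p i) + z * B i (p i) - (if i = p i then x else 0)))"
  unfolding det_def'[OF pencil_carrier]
proof (intro sum.cong refl arg_cong2[where f = "(*)"] prod.cong)
  fix p i assume "p \<in> {p. p permutes {0..<Suc n}}" "i \<in> {0..<Suc n}"
  then have "p i < Suc n" "i < Suc n" using permutes_in_image[of p "{0..<Suc n}" i] by auto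
  then show "pencil n B z x $$ (i, p i) = bidiag i (p i) + z * B i (p i) - (if i = p i then x else 0)"
    by (simp add: pencil_def)
qed

lemma det_pencil_cont: "continuous_on UNIV (\<lambda>z. det (pencil n B z x))" "continuous_on UNIV (\<lambda>x. det (pencil n B z x))"
proof -
  have c: "continuous_on UNIV (\<lambda>x. if P then x else 0 :: real)" for P by (cases P) (auto intro!: continuous_intros)
  show "continuous_on UNIV (\<lambda>z. det (pencil n B z x))" "continuous_on UNIV (\<lambda>x. det (pencil n B z x))"
    unfolding det_pencil by (intro continuous_intros c)+
qed

text \<open>The characteristic polynomial of the unperturbed matrix alternates in sign at the half-integers, which separate the eigenvalues.\<close>

lemma sign_pattern:
  "k \<le> Suc n \<Longrightarrow> (- 1) ^ k * (\<Prod>i\<in>{0..n}. of_nat i - (of_nat k - 1/2)) > (0::real)"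
proof -
  assume k: "k \<le> Suc n"
  have "(\<Prod>i\<in>{0..n}. of_nat i - (of_nat k - 1/2 :: real)) = (\<Prod>i\<in>{0..<k}. of_nat i - (of_nat k - 1/2)) * (\<Prod>i\<in>{k..n}. of_nat i - (of_nat k - 1/2))"
  proof -
    have eq: "{0..n} = {0..<k} \<union> {k..n}" and disj: "{0..<k} \<inter> {k..n} = {}" using k by auto
    show ?thesis unfolding eq by (rule prod.union_disjoint) (use disj in auto)
  qed
  also have "(\<Prod>i\<in>{0..<k}. of_nat i - (of_nat k - 1/2 :: real)) = (\<Prod>i\<in>{0..<k}. (- 1) * ((of_nat k - 1/2) - of_nat i))"
    by (rule prod.cong) auto
  also have "\<dots> = (- 1) ^ k * (\<Prod>i\<in>{0..<k}. (of_nat k - 1/2) - of_nat i)"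
    by (subst prod.distrib) simp
  finally have "(- 1) ^ k * (\<Prod>i\<in>{0..n}. of_nat i - (of_nat k - 1/2 :: real)) =
     (\<Prod>i\<in>{0..<k}. (of_nat k - 1/2) - of_nat i) * (\<Prod>i\<in>{k..n}. of_nat i - (of_nat k - 1/2))"
    by (simp add: mult.assoc[symmetric] power_mult_distrib[symmetric])
  also have "\<dots> > 0"
  proof (intro mult_pos_pos prod_pos)
    fix a assume "a \<in> {0..<k}"
    then have "real (Suc a) \<le> real k" by (simp only: of_nat_le_iff) auto
    then show "0 < real k - 1 / 2 - real a" by simp
  qed auto
  finally show ?thesis .
qed

lemma roots_exist:
  "\<exists>e>0. \<forall>z. \<bar>z\<bar> < e \<longrightarrow> (\<forall>k\<le>n. \<exists>x. of_nat k - 1/2 < x \<and> x < of_nat k + 1/2 \<and> det (pencil n B z x) = 0)"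
proof -
  define s where "s k z = (- 1) ^ k * det (pencil n B z (of_nat k - 1/2))" for k z
  have "\<exists>e>0. \<forall>z. \<bar>z\<bar> < e \<longrightarrow> s k z > 0" if k: "k \<le> Suc n" for k
  proof -
    have "continuous_on UNIV (s k)" unfolding s_def
      by (intro continuous_on_mult continuous_on_const det_pencil_cont)
    then have "isCont (s k) 0" by (simp add: continuous_on_eq_continuous_at)
    moreover have "s k 0 > 0" unfolding s_def det_pencil_0 by (rule sign_pattern[OF k])
    ultimately have "\<forall>\<^sub>F z in at 0. s k z > 0"
      unfolding isCont_def by (rule order_tendstoD)
    then obtain e where "e > 0" "\<And>z. z \<noteq> 0 \<Longrightarrow> \<bar>z\<bar> < e \<Longrightarrow> s k z > 0"
      unfolding eventually_at by (auto simp: dist_real_def)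
    then show ?thesis using \<open>s k 0 > 0\<close> by metis
  qed
  then obtain e where e: "\<And>k. k \<le> Suc n \<Longrightarrow> e k > 0 \<and> (\<forall>z. \<bar>z\<bar> < e k \<longrightarrow> s k z > 0)" by metis
  define E where "E = Min (e ` {0..Suc n})"
  have "E > 0" unfolding E_def using e by (subst Min_gr_iff) auto
  have El: "E \<le> e k" if "k \<le> Suc n" for k unfolding E_def using that by (intro Min_le) auto
  show ?thesis
  proof (rule exI[of _ E], intro conjI allI impI)
    show "E > 0" by fact
  next
    fix z k assume z: "\<bar>z\<bar> < E" and k: "k \<le> n"
    have s: "s k z > 0" "s (Suc k) z > 0" using e[of k] e[of "Suc k"] El[of k] El[of "Suc k"] z k by auto
    define f where "f x = (- 1) ^ k * det (pencil n B z x)" for x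
    have f: "f (of_nat k - 1/2) > 0" "f (of_nat k + 1/2) < 0"
      using s unfolding f_def s_def by (simp_all add: field_simps)
    have "continuous_on {of_nat k - 1/2..of_nat k + 1/2} f" unfolding f_def
      by (intro continuous_on_mult continuous_on_const continuous_on_subset[OF det_pencil_cont(2)]) auto
    then obtain x where x: "of_nat k - 1/2 \<le> x" "x \<le> of_nat k + 1/2" "f x = 0"
      using IVT2'[of f "of_nat k + 1/2" 0 "of_nat k - 1/2"] f by auto
    have "x \<noteq> of_nat k - 1/2" "x \<noteq> of_nat k + 1/2" using f x(3) by auto
    then show "\<exists>x. of_nat k - 1/2 < x \<and> x < of_nat k + 1/2 \<and> det (pencil n B z x) = 0"
      using x by (intro exI[of _ x]) (auto simp: f_def)
  qed
qed

text \<open>If the first entry is zero, row \<open>i\<close> bounds entry \<open>i + 1\<close> by a constant times entry \<open>i\<close> plus the size of the perturbation. Hence all entries would be small compared with the largest one.\<close>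

lemma eigvec_first:
  assumes B: "\<And>i j. i \<le> n \<Longrightarrow> j \<le> n \<Longrightarrow> \<bar>B i j\<bar> \<le> b" and b: "b \<ge> 0"
    and v: "\<And>i. i \<le> n \<Longrightarrow> (\<Sum>j\<in>{0..n}. (bidiag i j + z * B i j) * v j) = x * v i"
    and x: "\<bar>x\<bar> \<le> of_nat n + 1" and nz: "\<exists>i\<le>n. v i \<noteq> 0"
    and z: "\<bar>z\<bar> * b * (of_nat n + 1) * (2 * of_nat n + 2) ^ n < 1 / 2"
  shows "v 0 \<noteq> 0"
proof
  assume v0: "v 0 = 0"
  define m where "m = Max ((\<lambda>i. \<bar>v i\<bar>) ` {0..n})"
  have mle: "\<bar>v i\<bar> \<le> m" if "i \<le> n" for i unfolding m_def using that by (intro Max_ge) auto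
  have "m \<in> (\<lambda>i. \<bar>v i\<bar>) ` {0..n}" unfolding m_def by (rule Max_in) auto
  then obtain i0 where i0: "i0 \<le> n" "\<bar>v i0\<bar> = m" by auto
  have mpos: "m > 0" using nz mle by (metis abs_le_zero_iff less_eq_real_def not_less order_trans abs_ge_zero)
  define d where "d = \<bar>z\<bar> * b * (of_nat n + 1) * m"
  define q where "q = (2 * of_nat n + 2 :: real)"
  have dnn: "d \<ge> 0" unfolding d_def using b mpos by simp
  have q1: "q \<ge> 2" unfolding q_def by simp
  have pert: "\<bar>\<Sum>j\<in>{0..n}. z * B i j * v j\<bar> \<le> d" if i: "i \<le> n" for i
  proof -
    have "\<bar>\<Sum>j\<in>{0..n}. z * B i j * v j\<bar> \<le> (\<Sum>j\<in>{0..n}. \<bar>z * B i j * v j\<bar>)" by (rule sum_abs)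
    also have "\<dots> \<le> (\<Sum>j\<in>{0..n}. \<bar>z\<bar> * b * m)"
      by (rule sum_mono) (use B mle i b in \<open>auto simp: abs_mult intro!: mult_mono\<close>)
    also have "\<dots> = d" by (simp add: d_def algebra_simps)
    finally show ?thesis .
  qed
  have step: "\<bar>v (Suc i)\<bar> \<le> q * \<bar>v i\<bar> + d" if i: "Suc i \<le> n" for i
  proof -
    have "(\<Sum>j\<in>{0..n}. (bidiag i j + z * B i j) * v j) = (\<Sum>j\<in>{0..n}. bidiag i j * v j) + (\<Sum>j\<in>{0..n}. z * B i j * v j)"
      by (simp add: algebra_simps sum.distrib)
    also have "(\<Sum>j\<in>{0..n}. bidiag i j * v j) = (\<Sum>j\<in>{i, Suc i}. bidiag i j * v j)"
      by (rule sum.mono_neutral_right) (use i in \<open>auto simp: bidiag_def\<close>)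
    also have "\<dots> = of_nat i * v i + v (Suc i)" by (simp add: bidiag_def)
    finally have "v (Suc i) = (x - of_nat i) * v i - (\<Sum>j\<in>{0..n}. z * B i j * v j)"
      using v[of i] i by (simp add: algebra_simps)
    then have "\<bar>v (Suc i)\<bar> \<le> \<bar>x - of_nat i\<bar> * \<bar>v i\<bar> + d"
      using pert[of i] i abs_triangle_ineq4[of "(x - of_nat i) * v i" "\<Sum>j\<in>{0..n}. z * B i j * v j"] by (simp add: abs_mult)
    also have "\<bar>x - of_nat i\<bar> \<le> q" using x i unfolding q_def by (simp add: abs_le_iff)
    finally show ?thesis by (simp add: mult_right_mono)
  qed
  have bound: "i \<le> n \<Longrightarrow> \<bar>v i\<bar> \<le> d * (q ^ i - 1)" for i
  proof (induction i)
    case 0 then show ?case using v0 by simp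
  next
    case (Suc i)
    have "\<bar>v (Suc i)\<bar> \<le> q * \<bar>v i\<bar> + d" using step[of i] Suc.prems by simp
    also have "\<dots> \<le> q * (d * (q ^ i - 1)) + d" using Suc q1 by simp
    also have "\<dots> \<le> d * (q ^ Suc i - 1)"
    proof -
      have "d * (2 - q) \<le> 0" using dnn q1 by (simp add: mult_nonneg_nonpos)
      then show ?thesis by (simp add: algebra_simps)
    qed
    finally show ?case .
  qed
  have "m \<le> d * (q ^ i0 - 1)" using bound[OF i0(1)] i0(2) by simp
  also have "\<dots> \<le> d * q ^ n"
  proof (rule mult_left_mono[OF _ dnn])
    show "q ^ i0 - 1 \<le> q ^ n" using q1 power_increasing[OF i0(1), of q] by linarith
  qed
  also have "\<dots> = (\<bar>z\<bar> * b * (of_nat n + 1) * (2 * of_nat n + 2) ^ n) * m" by (simp add: d_def q_def mult_ac)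
  also have "\<dots> < 1/2 * m" using z mpos by (intro mult_strict_right_mono)
  finally show False using mpos by simp
qed

text \<open>The intermediate value theorem gives the eigenvalues, \<open>eigvec_first\<close> the normalisation of the eigenvectors.\<close>

lemma eigen_pairs:
  fixes B :: "nat \<Rightarrow> nat \<Rightarrow> real"
  shows "\<exists>e>0. \<forall>z. \<bar>z\<bar> < e \<longrightarrow> (\<exists>S. card S = Suc n \<and> (\<forall>x\<in>S. \<exists>v. v 0 = 1 \<and>
     (\<forall>i\<le>n. (\<Sum>j\<in>{0..n}. (bidiag i j + z * B i j) * v j) = x * v i)))"
proof -
  obtain e1 where e1: "e1 > 0" "\<And>z k. \<bar>z\<bar> < e1 \<Longrightarrow> k \<le> n \<Longrightarrow>
      \<exists>x. of_nat k - 1/2 < x \<and> x < of_nat k + 1/2 \<and> det (pencil n B z x) = 0"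
    using roots_exist by blast
  \<comment> \<open>a common bound for the entries of the perturbation\<close>
  define b where "b = (\<Sum>i\<in>{0..n}. \<Sum>j\<in>{0..n}. \<bar>B i j\<bar>)"
  have b: "b \<ge> 0" unfolding b_def by (intro sum_nonneg) auto
  have Bb: "\<bar>B i j\<bar> \<le> b" if "i \<le> n" "j \<le> n" for i j
  proof -
    have "\<bar>B i j\<bar> \<le> (\<Sum>j\<in>{0..n}. \<bar>B i j\<bar>)" by (rule member_le_sum) (use that in auto)
    also have "\<dots> \<le> b" unfolding b_def
      by (rule member_le_sum[of i "{0..n}" "\<lambda>i. \<Sum>j\<in>{0..n}. \<bar>B i j\<bar>"]) (use that in \<open>auto intro: sum_nonneg\<close>)
    finally show ?thesis .
  qed
  define K where "K = b * (of_nat n + 1) * (2 * of_nat n + 2) ^ n + 1"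
  have K: "K > 0" unfolding K_def using b by (simp add: add_nonneg_pos)
  define e where "e = min e1 (1 / (2 * K))"
  show ?thesis
  proof (rule exI[of _ e], intro conjI allI impI)
    show "e > 0" using e1 K by (simp add: e_def)
    fix z assume z: "\<bar>z\<bar> < e"
    have "\<bar>z\<bar> * K < 1 / 2" using z K by (simp add: e_def field_simps)
    moreover have "\<bar>z\<bar> * b * (of_nat n + 1) * (2 * of_nat n + 2) ^ n \<le> \<bar>z\<bar> * K"
      by (simp add: K_def algebra_simps)
    ultimately have zb: "\<bar>z\<bar> * b * (of_nat n + 1) * (2 * of_nat n + 2) ^ n < 1 / 2" by linarith
    obtain x where x: "\<And>k. k \<le> n \<Longrightarrow> of_nat k - 1/2 < x k \<and> x k < of_nat k + 1/2 \<and> det (pencil n B z (x k)) = 0"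
      using e1(2)[of z] z unfolding e_def by (metis min_less_iff_conj)
    have inj: "inj_on x {0..n}"
    proof (rule inj_onI)
      fix k l assume kl: "k \<in> {0..n}" "l \<in> {0..n}" "x k = x l"
      then have "\<bar>real k - real l\<bar> < 1" using x[of k] x[of l] by (auto simp: abs_less_iff)
      then show "k = l" by linarith
    qed
    show "\<exists>S. card S = Suc n \<and> (\<forall>x\<in>S. \<exists>v. v 0 = 1 \<and>
     (\<forall>i\<le>n. (\<Sum>j\<in>{0..n}. (bidiag i j + z * B i j) * v j) = x * v i))"
    proof (intro exI[of _ "x ` {0..n}"] conjI ballI)
      show "card (x ` {0..n}) = Suc n" using inj by (simp add: card_image)
      fix y assume "y \<in> x ` {0..n}"
      then obtain k where k: "k \<le> n" "y = x k" by auto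
      obtain u where u: "u \<in> carrier_vec (Suc n)" "u \<noteq> 0\<^sub>v (Suc n)" "pencil n B z y *\<^sub>v u = 0\<^sub>v (Suc n)"
        using det_0_iff_vec_prod_zero_field[OF pencil_carrier] x[OF k(1)] k(2) by metis
      define v where "v i = (if i \<le> n then u $ i else 0)" for i
      have eq: "(\<Sum>j\<in>{0..n}. (bidiag i j + z * B i j) * v j) = y * v i" if i: "i \<le> n" for i
      proof -
        have "(pencil n B z y *\<^sub>v u) $ i = 0" using u i by simp
        then have "(\<Sum>j\<in>{0..<Suc n}. (bidiag i j + z * B i j - (if i = j then y else 0)) * u $ j) = 0"
          using i u(1) by (simp add: pencil_def scalar_prod_def)
        moreover have "(\<Sum>j\<in>{0..<Suc n}. (bidiag i j + z * B i j - (if i = j then y else 0)) * u $ j) =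
          (\<Sum>j\<in>{0..n}. (bidiag i j + z * B i j) * v j) - (\<Sum>j\<in>{0..n}. if i = j then y * v j else 0)"
          unfolding sum_subtractf[symmetric] atLeastLessThanSuc_atLeastAtMost
          by (rule sum.cong) (auto simp: v_def algebra_simps)
        moreover have "(\<Sum>j\<in>{0..n}. if i = j then y * v j else 0) = y * v i" using i by (simp add: sum.delta)
        ultimately show ?thesis by simp
      qed
      have nz: "\<exists>i\<le>n. v i \<noteq> 0"
      proof (rule ccontr)
        assume "\<not> ?thesis"
        then have "u $ i = 0" if "i \<le> n" for i using that by (auto simp: v_def)
        then have "u = 0\<^sub>v (Suc n)" using u(1) by (intro eq_vecI) auto
        then show False using u(2) by simp
      qed
      have "\<bar>y\<bar> \<le> of_nat n + 1" using x[OF k(1)] k by (auto simp: abs_le_iff)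
      from eigvec_first[OF Bb b eq this nz zb] have v0: "v 0 \<noteq> 0" .
      show "\<exists>v. v 0 = 1 \<and> (\<forall>i\<le>n. (\<Sum>j\<in>{0..n}. (bidiag i j + z * B i j) * v j) = y * v i)"
      proof (intro exI[of _ "\<lambda>i. v i / v 0"] conjI allI impI)
        show "v 0 / v 0 = 1" using v0 by simp
        fix i assume "i \<le> n"
        from eq[OF this] show "(\<Sum>j\<in>{0..n}. (bidiag i j + z * B i j) * (v j / v 0)) = y * (v i / v 0)"
          by (simp add: sum_divide_distrib[symmetric])
      qed
    qed
  qed
qed

section \<open>Ordered monomials in enveloping algebras\<close>

context lie_closed
begin

definition "wrd bs = U.pl (uea_gen g) bs"

lemma wrd_closed: "set bs \<subseteq> carrier g \<Longrightarrow> wrd bs \<in> carrier (uea g)"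
  unfolding wrd_def by (rule U.pl_closed) auto

lemma wrd_append: "\<lbrakk>set as \<subseteq> carrier g; set bs \<subseteq> carrier g\<rbrakk> \<Longrightarrow> wrd (as @ bs) = wrd as \<otimes>\<^bsub>uea g\<^esub> wrd bs"
  unfolding wrd_def by (rule U.pl_append) auto

lemma wrd_single: "a \<in> carrier g \<Longrightarrow> wrd [a] = uea_gen g a"
  by (simp add: wrd_def U.pl_def)

lemma wrd_Nil: "wrd [] = \<one>\<^bsub>uea g\<^esub>"
  by (simp add: wrd_def U.pl_def)

text \<open>Spanned by the words of length less than \<open>d\<close>. With the strict bound the bottom step is zero, where the final induction starts.\<close>

inductive_set fil :: "nat \<Rightarrow> ('a list \<Rightarrow>\<^sub>0 complex) set set" for d
  where fil_zero: "\<zero>\<^bsub>uea g\<^esub> \<in> fil d"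
  | fil_step: "\<lbrakk>u \<in> fil d; length bs < d; set bs \<subseteq> carrier g\<rbrakk> \<Longrightarrow> u \<oplus>\<^bsub>uea g\<^esub> c \<odot>\<^bsub>uea g\<^esub> wrd bs \<in> fil d"

lemma fil_closed: "u \<in> fil d \<Longrightarrow> u \<in> carrier (uea g)"
  by (induction rule: fil.induct) (simp_all add: wrd_closed)

lemma fil_add:
  assumes "v \<in> fil d" "u \<in> fil d" shows "u \<oplus>\<^bsub>uea g\<^esub> v \<in> fil d"
  using assms
proof (induction rule: fil.induct)
  case fil_zero
  then show ?case using fil_closed by simp
next
  case (fil_step v bs c)
  have "u \<oplus>\<^bsub>uea g\<^esub> (v \<oplus>\<^bsub>uea g\<^esub> c \<odot>\<^bsub>uea g\<^esub> wrd bs) = (u \<oplus>\<^bsub>uea g\<^esub> v) \<oplus>\<^bsub>uea g\<^esub> c \<odot>\<^bsub>uea g\<^esub> wrd bs"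
    using fil_step fil_closed wrd_closed by (simp add: U.a_assoc)
  then show ?case using fil.fil_step fil_step by simp
qed

lemma fil_wrd: "\<lbrakk>length bs < d; set bs \<subseteq> carrier g\<rbrakk> \<Longrightarrow> wrd bs \<in> fil d"
  using fil_step[OF fil_zero, of bs d 1] wrd_closed by simp

lemma fil_smult: "u \<in> fil d \<Longrightarrow> a \<odot>\<^bsub>uea g\<^esub> u \<in> fil d"
proof (induction rule: fil.induct)
  case fil_zero
  then show ?case using fil.fil_zero by simp
next
  case (fil_step u bs c)
  then show ?case using fil.fil_step[OF fil_step(4,2,3), of "a * c"] fil_closed wrd_closed
    by (simp add: U.smult_r_distr U.smult_assoc)
qed

lemma fil_mono: "\<lbrakk>u \<in> fil d; d \<le> d'\<rbrakk> \<Longrightarrow> u \<in> fil d'"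
  by (induction rule: fil.induct) (auto intro: fil.intros)

lemma fil_0: "u \<in> fil 0 \<Longrightarrow> u = \<zero>\<^bsub>uea g\<^esub>"
  by (induction rule: fil.induct) auto

lemma fil_sandwich:
  assumes "u \<in> fil d" "set as \<subseteq> carrier g" "set cs \<subseteq> carrier g"
  shows "wrd as \<otimes>\<^bsub>uea g\<^esub> u \<otimes>\<^bsub>uea g\<^esub> wrd cs \<in> fil (length as + d + length cs)"
  using assms(1)
proof (induction rule: fil.induct)
  case fil_zero
  then show ?case using assms wrd_closed fil.fil_zero by simp
next
  case (fil_step u bs c)
  note cl = wrd_closed[OF assms(2)] wrd_closed[OF assms(3)] wrd_closed[OF fil_step(3)] fil_closed[OF fil_step(1)]
  have "wrd as \<otimes>\<^bsub>uea g\<^esub> (u \<oplus>\<^bsub>uea g\<^esub> c \<odot>\<^bsub>uea g\<^esub> wrd bs) \<otimes>\<^bsub>uea g\<^esub> wrd cs =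
     wrd as \<otimes>\<^bsub>uea g\<^esub> u \<otimes>\<^bsub>uea g\<^esub> wrd cs \<oplus>\<^bsub>uea g\<^esub> c \<odot>\<^bsub>uea g\<^esub> wrd ((as @ bs) @ cs)"
    using cl assms fil_step(3)
    by (simp only: wrd_append set_append Un_subset_iff conj_absorb simp_thms)
       (simp add: U.r_distr U.l_distr U.smult_mult_l U.smult_mult_r)
  then show ?case
    using fil.fil_step[OF fil_step(4), of "(as @ bs) @ cs" c] fil_step(2,3) assms by simp
qed

lemma fil_mult:
  assumes "v \<in> fil e" and u: "u \<in> fil d" shows "u \<otimes>\<^bsub>uea g\<^esub> v \<in> fil (d + e)"
  using assms(1)
proof (induction rule: fil.induct)
  case fil_zero
  then show ?case using fil.fil_zero fil_closed[OF u] by simp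
next
  case (fil_step v bs c)
  have "u \<otimes>\<^bsub>uea g\<^esub> wrd bs \<in> fil (d + length bs)"
    using fil_sandwich[OF u, of "[]" bs] fil_step fil_closed[OF u] by (simp add: wrd_Nil)
  then have "c \<odot>\<^bsub>uea g\<^esub> (u \<otimes>\<^bsub>uea g\<^esub> wrd bs) \<in> fil (d + e)"
    using fil_step(2) by (intro fil_smult) (auto elim: fil_mono)
  from fil_add[OF this fil_step(4)] show ?case
    using fil_closed[OF u] fil_closed[OF fil_step(1)] wrd_closed[OF fil_step(3)]
    by (simp add: U.r_distr U.smult_mult_r)
qed

lemma fil_exhaust: "u \<in> carrier (uea g) \<Longrightarrow> \<exists>d. u \<in> fil d"
proof (induction rule: uea_induct)
  case one
  then show ?case using fil_wrd[of "[]" 1] wrd_Nil by auto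
next
  case (gen a)
  then show ?case using fil_wrd[of "[a]" 2] wrd_single by auto
next
  case (add u v)
  then obtain d e where "u \<in> fil d" "v \<in> fil e" by blast
  then have "u \<in> fil (max d e)" "v \<in> fil (max d e)" using fil_mono by (meson max.cobounded1 max.cobounded2)+
  then show ?case using fil_add by blast
next
  case (mult u v)
  then show ?case using fil_mult by blast
next
  case (smult c u)
  then show ?case using fil_smult by blast
qed

text \<open>The difference is a word in which the two letters are replaced by their bracket.\<close>

lemma wrd_swap:
  assumes "set as \<subseteq> carrier g" "set cs \<subseteq> carrier g" "p \<in> carrier g" "q \<in> carrier g"
  shows "wrd (as @ p # q # cs) \<ominus>\<^bsub>uea g\<^esub> wrd (as @ q # p # cs) \<in> fil (length as + 2 + length cs)"
proof -
  let ?X = "uea_gen g p" and ?Y = "uea_gen g q"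
  have w2: "wrd (as @ a # b # cs) = wrd as \<otimes>\<^bsub>uea g\<^esub> (uea_gen g a \<otimes>\<^bsub>uea g\<^esub> uea_gen g b) \<otimes>\<^bsub>uea g\<^esub> wrd cs"
    if "a \<in> carrier g" "b \<in> carrier g" for a b
  proof -
    have "wrd (as @ a # b # cs) = wrd ((as @ [a, b]) @ cs)" by simp
    also have "\<dots> = wrd as \<otimes>\<^bsub>uea g\<^esub> wrd ([a] @ [b]) \<otimes>\<^bsub>uea g\<^esub> wrd cs"
      using assms that by (subst wrd_append, simp, simp, subst wrd_append) auto
    also have "wrd ([a] @ [b]) = uea_gen g a \<otimes>\<^bsub>uea g\<^esub> uea_gen g b"
      using that by (subst wrd_append) (auto simp: wrd_single)
    finally show ?thesis .
  qed
  have cl: "wrd as \<in> carrier (uea g)" "wrd cs \<in> carrier (uea g)" "?X \<in> carrier (uea g)" "?Y \<in> carrier (uea g)"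
    using assms wrd_closed by auto
  have "wrd (as @ p # q # cs) \<ominus>\<^bsub>uea g\<^esub> wrd (as @ q # p # cs) =
     wrd as \<otimes>\<^bsub>uea g\<^esub> uea_gen g (lie_bracket g p q) \<otimes>\<^bsub>uea g\<^esub> wrd cs"
    unfolding w2[OF assms(3,4)] w2[OF assms(4,3)] gen_bracket[OF assms(3,4)]
    using cl by (simp add: U.minus_eq U.r_distr U.l_distr U.l_minus U.r_minus)
  also have "uea_gen g (lie_bracket g p q) = wrd [lie_bracket g p q]"
    using assms closed by (simp add: wrd_single)
  also have "wrd as \<otimes>\<^bsub>uea g\<^esub> \<dots> \<otimes>\<^bsub>uea g\<^esub> wrd cs \<in> fil (length as + 2 + length cs)"
    by (rule fil_sandwich[OF fil_wrd]) (use assms closed in auto)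
  finally show ?thesis .
qed

end

text \<open>A finite family that spans the Lie algebra, indexed by numbers so that words in it can be sorted.\<close>

locale lie_basis = lie_closed g for g :: "'a lie_algebra" +
  fixes b :: "nat \<Rightarrow> 'a" and J :: "nat set"
  assumes J: "finite J" and b: "\<And>i. i \<in> J \<Longrightarrow> b i \<in> carrier g"
    and span: "\<And>a. a \<in> carrier g \<Longrightarrow> \<exists>\<beta>. uea_gen g a = (\<Oplus>\<^bsub>uea g\<^esub>i\<in>J. \<beta> i \<odot>\<^bsub>uea g\<^esub> uea_gen g (b i))"
begin

definition "bw is = wrd (map b is)"

lemma b_sub: "set is \<subseteq> J \<Longrightarrow> set (map b is) \<subseteq> carrier g"
  using b by auto

lemma bw_closed: "set is \<subseteq> J \<Longrightarrow> bw is \<in> carrier (uea g)"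
  unfolding bw_def by (rule wrd_closed[OF b_sub])

definition "cong_mod d u v \<longleftrightarrow> u \<in> carrier (uea g) \<and> v \<in> carrier (uea g) \<and> u \<ominus>\<^bsub>uea g\<^esub> v \<in> fil d"

lemma cong_trans: "\<lbrakk>cong_mod d u v; cong_mod d v w\<rbrakk> \<Longrightarrow> cong_mod d u w"
proof -
  assume *: "cong_mod d u v" "cong_mod d v w"
  have "u \<ominus>\<^bsub>uea g\<^esub> w = (u \<ominus>\<^bsub>uea g\<^esub> v) \<oplus>\<^bsub>uea g\<^esub> (v \<ominus>\<^bsub>uea g\<^esub> w)"
    using * by (simp add: cong_mod_def U.minus_eq U.a_assoc U.r_neg1)
  then show ?thesis using * fil_add unfolding cong_mod_def by simp
qed

lemma cong_refl: "u \<in> carrier (uea g) \<Longrightarrow> cong_mod d u u"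
  using fil_zero by (simp add: cong_mod_def U.minus_eq U.r_neg)

lemma bw_Cons: "i \<in> J \<Longrightarrow> set is \<subseteq> J \<Longrightarrow> bw (i # is) = uea_gen g (b i) \<otimes>\<^bsub>uea g\<^esub> bw is"
  using wrd_append[of "[b i]" "map b is"] b b_sub by (simp add: bw_def wrd_single)

lemma cong_Cons:
  assumes "i \<in> J" "set is \<subseteq> J" "set js \<subseteq> J" "cong_mod d (bw is) (bw js)"
  shows "cong_mod (Suc d) (bw (i # is)) (bw (i # js))"
proof -
  have "uea_gen g (b i) \<in> fil 2" using fil_wrd[of "[b i]" 2] b[OF assms(1)] by (simp add: wrd_single)
  have f: "wrd [b i] \<otimes>\<^bsub>uea g\<^esub> (bw is \<ominus>\<^bsub>uea g\<^esub> bw js) \<otimes>\<^bsub>uea g\<^esub> wrd [] \<in> fil (length [b i] + d + length ([] :: 'a list))"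
    by (rule fil_sandwich) (use assms b in \<open>auto simp: cong_mod_def\<close>)
  have "bw (i # is) \<ominus>\<^bsub>uea g\<^esub> bw (i # js) = wrd [b i] \<otimes>\<^bsub>uea g\<^esub> (bw is \<ominus>\<^bsub>uea g\<^esub> bw js) \<otimes>\<^bsub>uea g\<^esub> wrd []"
    using assms b bw_closed by (simp add: bw_Cons wrd_single wrd_Nil U.minus_eq U.r_distr U.r_minus)
  then show ?thesis using f assms b bw_closed by (simp add: cong_mod_def bw_Cons)
qed

lemma cong_insort:
  assumes "i \<in> J" "set is \<subseteq> J"
  shows "cong_mod (Suc (length is)) (bw (i # is)) (bw (insort i is))"
  using assms
proof (induction "is")
  case Nil
  then show ?case using bw_closed[of "[i]"] by (simp add: cong_refl)
next
  case (Cons j js)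
  show ?case
  proof (cases "i \<le> j")
    case True
    then show ?thesis using Cons.prems bw_closed[of "i # j # js"] by (simp add: cong_refl)
  next
    case False
    have 1: "cong_mod (Suc (length (j # js))) (bw (i # j # js)) (bw (j # i # js))"
      using wrd_swap[of "[]" "map b js" "b i" "b j"] Cons.prems b b_sub[of js] bw_closed[of "i # j # js"] bw_closed[of "j # i # js"]
      by (simp add: cong_mod_def bw_def)
    have "cong_mod (Suc (length js)) (bw (i # js)) (bw (insort i js))" using Cons by simp
    then have 2: "cong_mod (Suc (Suc (length js))) (bw (j # i # js)) (bw (j # insort i js))"
      using Cons.prems by (intro cong_Cons) (auto simp: set_insort_key)
    from cong_trans[OF 1] 2 show ?thesis using False by simp
  qed
qed

lemma cong_sort: "set is \<subseteq> J \<Longrightarrow> cong_mod (length is) (bw is) (bw (sort is))"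
proof (induction "is")
  case Nil
  then show ?case using bw_closed[of "[]"] by (simp add: cong_refl)
next
  case (Cons i js)
  have 1: "cong_mod (Suc (length js)) (bw (i # js)) (bw (i # sort js))"
    using Cons by (intro cong_Cons) auto
  have 2: "cong_mod (Suc (length (sort js))) (bw (i # sort js)) (bw (insort i (sort js)))"
    by (rule cong_insort) (use Cons.prems in auto)
  from cong_trans[OF 1] 2 show ?case by simp
qed

definition "sorted_words d = {is. sorted is \<and> length is = d \<and> set is \<subseteq> J}"

lemma finite_sorted_words: "finite (sorted_words d)"
proof (rule finite_subset)
  show "sorted_words d \<subseteq> {is. set is \<subseteq> J \<and> length is = d}" by (auto simp: sorted_words_def)
qed (rule finite_lists_length_eq[OF J])

definition "lead d \<kappa> = (\<Oplus>\<^bsub>uea g\<^esub>m\<in>sorted_words d. \<kappa> m \<odot>\<^bsub>uea g\<^esub> bw m)"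

lemma lead_closed [simp]: "lead d \<kappa> \<in> carrier (uea g)"
  unfolding lead_def by (rule U.finsum_closed) (auto simp: sorted_words_def bw_closed)

definition "has_lead d u \<longleftrightarrow> (\<exists>\<kappa>. cong_mod d u (lead d \<kappa>))"

lemma has_lead_add: "\<lbrakk>has_lead d u; has_lead d v\<rbrakk> \<Longrightarrow> has_lead d (u \<oplus>\<^bsub>uea g\<^esub> v)"
proof -
  assume "has_lead d u" "has_lead d v"
  then obtain \<kappa> \<mu> where k: "cong_mod d u (lead d \<kappa>)" "cong_mod d v (lead d \<mu>)" by (auto simp: has_lead_def)
  have l: "lead d (\<lambda>m. \<kappa> m + \<mu> m) = lead d \<kappa> \<oplus>\<^bsub>uea g\<^esub> lead d \<mu>"
  proof -
    have "lead d (\<lambda>m. \<kappa> m + \<mu> m) = (\<Oplus>\<^bsub>uea g\<^esub>m\<in>sorted_words d. \<kappa> m \<odot>\<^bsub>uea g\<^esub> bw m \<oplus>\<^bsub>uea g\<^esub> \<mu> m \<odot>\<^bsub>uea g\<^esub> bw m)"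
      unfolding lead_def by (rule U.finsum_cong') (auto simp: sorted_words_def bw_closed U.smult_l_distr)
    also have "\<dots> = lead d \<kappa> \<oplus>\<^bsub>uea g\<^esub> lead d \<mu>"
      unfolding lead_def by (rule U.finsum_addf) (auto simp: sorted_words_def bw_closed)
    finally show ?thesis .
  qed
  have "(u \<oplus>\<^bsub>uea g\<^esub> v) \<ominus>\<^bsub>uea g\<^esub> (lead d \<kappa> \<oplus>\<^bsub>uea g\<^esub> lead d \<mu>) = (u \<ominus>\<^bsub>uea g\<^esub> lead d \<kappa>) \<oplus>\<^bsub>uea g\<^esub> (v \<ominus>\<^bsub>uea g\<^esub> lead d \<mu>)"
    using k by (simp add: cong_mod_def U.minus_eq U.minus_add U.a_ac)
  then have "cong_mod d (u \<oplus>\<^bsub>uea g\<^esub> v) (lead d (\<lambda>m. \<kappa> m + \<mu> m))"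
    using k fil_add unfolding cong_mod_def l by simp
  then show ?thesis by (auto simp: has_lead_def)
qed

lemma has_lead_smult: "has_lead d u \<Longrightarrow> has_lead d (c \<odot>\<^bsub>uea g\<^esub> u)"
proof -
  assume "has_lead d u"
  then obtain \<kappa> where k: "cong_mod d u (lead d \<kappa>)" by (auto simp: has_lead_def)
  have l: "lead d (\<lambda>m. c * \<kappa> m) = c \<odot>\<^bsub>uea g\<^esub> lead d \<kappa>"
  proof -
    have "lead d (\<lambda>m. c * \<kappa> m) = (\<Oplus>\<^bsub>uea g\<^esub>m\<in>sorted_words d. c \<odot>\<^bsub>uea g\<^esub> (\<kappa> m \<odot>\<^bsub>uea g\<^esub> bw m))"
      unfolding lead_def by (rule U.finsum_cong') (auto simp: sorted_words_def bw_closed U.smult_assoc)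
    also have "\<dots> = c \<odot>\<^bsub>uea g\<^esub> lead d \<kappa>"
      unfolding lead_def by (rule U.smult_finsum[symmetric]) (auto simp: sorted_words_def bw_closed finite_sorted_words)
    finally show ?thesis .
  qed
  have "cong_mod d (c \<odot>\<^bsub>uea g\<^esub> u) (lead d (\<lambda>m. c * \<kappa> m))"
    using k fil_smult[of "u \<ominus>\<^bsub>uea g\<^esub> lead d \<kappa>" d c] unfolding cong_mod_def l by (simp add: U.smult_diff)
  then show ?thesis by (auto simp: has_lead_def)
qed

lemma has_lead_fil: "u \<in> fil d \<Longrightarrow> has_lead d u"
proof -
  assume u: "u \<in> fil d"
  have "lead d (\<lambda>m. 0) = \<zero>\<^bsub>uea g\<^esub>"
    unfolding lead_def by (rule U.add.finprod_one_eqI) (auto simp: sorted_words_def bw_closed)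
  then have "cong_mod d u (lead d (\<lambda>m. 0))"
    using u fil_closed[OF u] by (simp add: cong_mod_def U.minus_eq)
  then show ?thesis by (auto simp: has_lead_def)
qed

lemma has_lead_cong: "\<lbrakk>cong_mod d u v; has_lead d v\<rbrakk> \<Longrightarrow> has_lead d u"
  unfolding has_lead_def using cong_trans by blast

lemma has_lead_bw: "set is \<subseteq> J \<Longrightarrow> has_lead (length is) (bw is)"
proof (rule has_lead_cong[OF cong_sort])
  assume i: "set is \<subseteq> J"
  have m: "sort is \<in> sorted_words (length is)" using i by (simp add: sorted_words_def)
  have "lead (length is) (\<lambda>m. if m = sort is then 1 else 0) = bw (sort is)"
    unfolding lead_def
    by (subst U.finsum_single_if[OF finite_sorted_words m]) (use i bw_closed in \<open>auto simp: sorted_words_def\<close>)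
  then show "has_lead (length is) (bw (sort is))"
    unfolding has_lead_def using cong_refl[OF bw_closed[of "sort is"]] i by (metis set_sort)
qed

lemma has_lead_finsum:
  assumes "finite I" "\<And>i. i \<in> I \<Longrightarrow> has_lead d (f i)"
  shows "has_lead d (\<Oplus>\<^bsub>uea g\<^esub>i\<in>I. f i)"
  using assms
proof (induction I rule: finite_induct)
  case empty
  then show ?case using has_lead_fil[OF fil_zero] by simp
next
  case (insert i I)
  have "f j \<in> carrier (uea g)" if "j \<in> insert i I" for j
    using insert.prems[OF that] by (auto simp: has_lead_def cong_mod_def)
  then show ?case using insert has_lead_add by (simp add: Pi_iff)
qed

lemma has_lead_wrd:
  "\<lbrakk>set is \<subseteq> J; set bs \<subseteq> carrier g\<rbrakk> \<Longrightarrow> has_lead (length is + length bs) (wrd (map b is @ bs))"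
proof (induction bs arbitrary: "is")
  case Nil
  then show ?case using has_lead_bw[of "is"] by (simp add: bw_def)
next
  case (Cons a bs)
  obtain \<beta> where \<beta>: "uea_gen g a = (\<Oplus>\<^bsub>uea g\<^esub>i\<in>J. \<beta> i \<odot>\<^bsub>uea g\<^esub> uea_gen g (b i))"
    using span[of a] Cons.prems by auto
  have spl: "wrd (map b is @ c # bs) = wrd (map b is) \<otimes>\<^bsub>uea g\<^esub> uea_gen g c \<otimes>\<^bsub>uea g\<^esub> wrd bs" if "c \<in> carrier g" for c
  proof -
    have "wrd (map b is @ c # bs) = wrd ((map b is @ [c]) @ bs)" by simp
    also have "\<dots> = wrd (map b is @ [c]) \<otimes>\<^bsub>uea g\<^esub> wrd bs"
      by (rule wrd_append) (use Cons.prems b_sub that in auto)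
    also have "wrd (map b is @ [c]) = wrd (map b is) \<otimes>\<^bsub>uea g\<^esub> wrd [c]"
      by (rule wrd_append) (use Cons.prems b_sub that in auto)
    finally show ?thesis using that by (simp add: wrd_single)
  qed
  have cl: "wrd (map b is) \<in> carrier (uea g)" "wrd bs \<in> carrier (uea g)"
    using Cons.prems b_sub wrd_closed by auto
  have "wrd (map b is @ a # bs) = wrd (map b is) \<otimes>\<^bsub>uea g\<^esub> (\<Oplus>\<^bsub>uea g\<^esub>i\<in>J. \<beta> i \<odot>\<^bsub>uea g\<^esub> uea_gen g (b i)) \<otimes>\<^bsub>uea g\<^esub> wrd bs"
    using spl[of a] Cons.prems \<beta> by simp
  also have "\<dots> = (\<Oplus>\<^bsub>uea g\<^esub>i\<in>J. wrd (map b is) \<otimes>\<^bsub>uea g\<^esub> (\<beta> i \<odot>\<^bsub>uea g\<^esub> uea_gen g (b i)) \<otimes>\<^bsub>uea g\<^esub> wrd bs)"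
    using cl b J by (subst U.finsum_rdistr, simp, simp, simp add: Pi_iff, subst U.finsum_ldistr) (auto simp: Pi_iff)
  also have "\<dots> = (\<Oplus>\<^bsub>uea g\<^esub>i\<in>J. \<beta> i \<odot>\<^bsub>uea g\<^esub> wrd (map b (is @ [i]) @ bs))"
    by (rule U.finsum_cong') (use cl b spl in \<open>auto simp: U.smult_mult_l U.smult_mult_r\<close>)
  finally have eq: "wrd (map b is @ a # bs) = \<dots>" .
  have "has_lead (length (is @ [i]) + length bs) (wrd (map b (is @ [i]) @ bs))" if "i \<in> J" for i
    using Cons.IH[of "is @ [i]"] Cons.prems that by simp
  then show ?case unfolding eq using J by (intro has_lead_finsum has_lead_smult) auto
qed

text \<open>The spanning half of the Poincare-Birkhoff-Witt theorem: modulo shorter words, letters may be expanded in the spanning family and exchanged, so every word can be sorted.\<close>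

theorem fil_has_lead: "u \<in> fil (Suc d) \<Longrightarrow> \<exists>\<kappa>. \<exists>r\<in>fil d. u = lead d \<kappa> \<oplus>\<^bsub>uea g\<^esub> r"
proof -
  assume "u \<in> fil (Suc d)"
  then have "has_lead d u"
  proof (induction rule: fil.induct)
    case fil_zero
    show ?case by (rule has_lead_fil[OF fil.fil_zero])
  next
    case (fil_step u bs c)
    have "has_lead d (wrd bs)"
    proof (cases "length bs = d")
      case True
      then show ?thesis using has_lead_wrd[of "[]" bs] fil_step by simp
    next
      case False
      then show ?thesis using fil_wrd[of bs d] fil_step by (intro has_lead_fil) auto
    qed
    then show ?case by (intro has_lead_add has_lead_smult fil_step)
  qed
  then obtain \<kappa> where k: "cong_mod d u (lead d \<kappa>)" by (auto simp: has_lead_def)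
  then have "u = lead d \<kappa> \<oplus>\<^bsub>uea g\<^esub> (u \<ominus>\<^bsub>uea g\<^esub> lead d \<kappa>)"
    by (simp add: cong_mod_def U.minus_eq U.a_comm[of u] U.r_neg1 U.r_neg2)
  then show ?thesis using k unfolding cong_mod_def by blast
qed

end

section \<open>Polynomial identities between leading symbols\<close>

lemma Kronecker_code_bound:
  fixes K :: nat
  assumes "\<And>i. i \<in> set m \<Longrightarrow> i \<le> x"  "K \<ge> 1"
  shows "sum_list (map ((^) K) m) \<le> length m * K ^ x"
  using assms(1)
proof (induction m)
  case (Cons i m)
  have "K ^ i \<le> K ^ x" using Cons.prems[of i] assms(2) by (intro power_increasing) auto
  then show ?case using Cons by simp
qed simp

text \<open>A sorted word of length less than \<open>K\<close> is given by its multiplicities, and these are the digits of the code in base \<open>K\<close>.\<close>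

lemma Kronecker_code_inj:
  fixes K :: nat
  assumes "sorted m" "sorted m'" "length m = length m'" "length m < K"
    and "sum_list (map ((^) K) m) = sum_list (map ((^) K) m')"
  shows "m = m'"
  using assms
proof (induction m arbitrary: m' rule: rev_induct)
  case Nil
  then show ?case by simp
next
  case (snoc x m)
  then obtain y l where m': "m' = l @ [y]" by (metis length_0_conv rev_exhaust snoc_eq_iff_butlast)
  have K: "K \<ge> 1" using snoc by simp
  have less: False if "u < v" "sorted (r @ [u])" "length (r @ [u]) < K"
    "sum_list (map ((^) K) (r @ [u])) = sum_list (map ((^) K) (q @ [v]))" for u v r q
  proof -
    have "sum_list (map ((^) K) (r @ [u])) \<le> length (r @ [u]) * K ^ u"
      using that(2) by (intro Kronecker_code_bound K) (auto simp: sorted_append)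
    also have "\<dots> < K * K ^ u" using that(3) K by (intro mult_strict_right_mono) auto
    also have "\<dots> = K ^ Suc u" by simp
    also have "\<dots> \<le> K ^ v" using that(1) K by (intro power_increasing) auto
    also have "\<dots> \<le> sum_list (map ((^) K) (q @ [v]))" by simp
    finally show False using that(4) by simp
  qed
  have "x = y"
  proof (rule ccontr)
    assume "x \<noteq> y"
    then consider "x < y" | "y < x" by linarith
    then show False
    proof cases
      case 1 show False by (rule less[OF 1, of m l]) (use snoc.prems m' in auto)
    next
      case 2 show False by (rule less[OF 2, of l m]) (use snoc.prems m' in auto)
    qed
  qed
  moreover have "m = l"
    by (rule snoc.IH) (use snoc.prems m' \<open>x = y\<close> in \<open>auto simp: sorted_append\<close>)
  ultimately show ?case using m' by simp
qed

lemma powers_vanish: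
  fixes c :: "nat \<Rightarrow> complex"
  assumes "card S = Suc n" "\<And>x. x \<in> S \<Longrightarrow> (\<Sum>k\<in>{0..n}. c k * x ^ k) = 0" "k \<le> n"
  shows "c k = 0"
proof -
  define p where "p = (\<Sum>k\<in>{0..n}. monom (c k) k)"
  have ev: "poly p x = (\<Sum>k\<in>{0..n}. c k * x ^ k)" for x
    unfolding p_def by (simp add: poly_sum poly_monom)
  have co: "coeff p k = (if k \<le> n then c k else 0)" for k
    unfolding p_def by (simp add: coeff_sum sum.delta)
  have "p = 0"
  proof (rule ccontr)
    assume "p \<noteq> 0"
    have "degree p \<le> n" by (rule degree_le) (simp add: co)
    moreover have "card {x. poly p x = 0} \<le> degree p" using \<open>p \<noteq> 0\<close> by (rule card_poly_roots_bound)
    moreover have "card S \<le> card {x. poly p x = 0}"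
      using assms ev by (intro card_mono[OF poly_roots_finite[OF \<open>p \<noteq> 0\<close>]]) auto
    ultimately show False using assms(1) by simp
  qed
  then show ?thesis using co[of k] assms(3) by simp
qed

context rank
begin

definition "mat_pair B A = (\<Sum>i\<in>{0..n}. \<Sum>j\<in>{0..n}. B i j * (A i j :: complex))"

definition pair_code :: "nat \<times> nat \<Rightarrow> nat" where "pair_code pq = fst pq * Suc n + snd pq"

definition "index_pairs = {0..n} \<times> {0..n} - {(0, 0)}"

definition "sl_index = pair_code ` index_pairs"

definition sl_basis :: "nat \<Rightarrow> cmat"
  where "sl_basis i = (let p = i div Suc n; q = i mod Suc n in
    if p = q then (\<lambda>k l. emat p p k l - emat 0 0 k l) else emat p q)"

lemma pair_code_decode: "q \<le> n \<Longrightarrow> pair_code (p, q) div Suc n = p \<and> pair_code (p, q) mod Suc n = q"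
  by (simp add: pair_code_def div_mult_self3 del: mult_Suc_right)

lemma pair_code_inj: "inj_on pair_code index_pairs"
proof (rule inj_onI)
  fix u v assume "u \<in> index_pairs" "v \<in> index_pairs" "pair_code u = pair_code v"
  then have "snd u \<le> n" "snd v \<le> n" "pair_code (fst u, snd u) = pair_code (fst v, snd v)" by (auto simp: index_pairs_def)
  then have "fst u = fst v" "snd u = snd v"
    using pair_code_decode[of "snd u" "fst u"] pair_code_decode[of "snd v" "fst v"] by simp_all
  then show "u = v" by (rule prod_eqI)
qed

lemma sl_basis_code: "q \<le> n \<Longrightarrow> sl_basis (pair_code (p, q)) = (if p = q then (\<lambda>k l. emat p p k l - emat 0 0 k l) else emat p q)"
  by (simp add: sl_basis_def pair_code_decode Let_def)

lemma finite_sl_index: "finite sl_index" by (simp add: sl_index_def index_pairs_def)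

lemma sl_basis_closed: "i \<in> sl_index \<Longrightarrow> sl_basis i \<in> carrier (sl1 n)"
proof -
  assume "i \<in> sl_index"
  then obtain pq where "i = pair_code pq" "pq \<in> {0..n} \<times> {0..n}" by (auto simp: sl_index_def index_pairs_def)
  then obtain p q where pq: "i = pair_code (p, q)" "p \<le> n" "q \<le> n" by (cases pq) simp
  show ?thesis
  proof (cases "p = q")
    case True
    have "(\<Sum>k\<in>{0..n}. emat q q k k - emat 0 0 k k) = (\<Sum>k\<in>{0..n}. if k = q then 1 else 0) - (\<Sum>k\<in>{0..n}. if k = 0 then 1 else (0::complex))"
      unfolding sum_subtractf[symmetric] by (rule sum.cong) (auto simp: emat_def)
    also have "\<dots> = 0" using pq by simp
    finally have "(\<Sum>k\<in>{0..n}. emat q q k k - emat 0 0 k k) = 0" .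
    then show ?thesis using pq True
      by (auto simp: sl_basis_code sl_simps gl_simps mtrace_def emat_def split: if_splits)
  next
    case False
    have "(\<Sum>k\<in>{0..n}. emat p q k k) = 0" using False by (intro sum.neutral) (auto simp: emat_def)
    then show ?thesis using pq False
      by (auto simp: sl_basis_code sl_simps gl_simps mtrace_def emat_def split: if_splits)
  qed
qed

lemma sl_expand:
  assumes "a \<in> carrier (sl1 n)"
  shows "a = (\<lambda>k l. \<Sum>i\<in>sl_index. a (i div Suc n) (i mod Suc n) * sl_basis i k l)"
proof (intro ext)
  fix k l
  have z: "a i j = 0" if "i > n \<or> j > n" for i j
    using that assms by (simp add: sl_simps gl_simps) (meson not_le)
  have tr: "(\<Sum>i\<in>{0..n}. a i i) = 0" using assms by (simp add: sl_simps mtrace_def)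
  have "(\<Sum>i\<in>sl_index. a (i div Suc n) (i mod Suc n) * sl_basis i k l) = (\<Sum>pq\<in>index_pairs. a (fst pq) (snd pq) * sl_basis (pair_code pq) k l)"
    unfolding sl_index_def using pair_code_inj pair_code_decode
    by (subst sum.reindex) (auto simp: index_pairs_def intro!: sum.cong)
  also have "\<dots> = (\<Sum>pq\<in>{0..n} \<times> {0..n}. a (fst pq) (snd pq) * sl_basis (pair_code pq) k l)"
    by (rule sum.mono_neutral_left) (auto simp: index_pairs_def sl_basis_code)
  also have "\<dots> = (\<Sum>p\<in>{0..n}. \<Sum>q\<in>{0..n}. a p q * sl_basis (pair_code (p, q)) k l)"
    by (simp add: sum.cartesian_product split_def)
  also have "\<dots> = (\<Sum>p\<in>{0..n}. \<Sum>q\<in>{0..n}. a p q * emat p q k l - (if q = p then a p p * emat 0 0 k l else 0))"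
    by (intro sum.cong refl) (auto simp: sl_basis_code algebra_simps)
  also have "\<dots> = (\<Sum>p\<in>{0..n}. \<Sum>q\<in>{0..n}. a p q * emat p q k l) - (\<Sum>p\<in>{0..n}. a p p * emat 0 0 k l)"
    by (simp add: sum_subtractf sum.delta)
  also have "(\<Sum>p\<in>{0..n}. a p p * emat 0 0 k l) = 0" using tr by (simp add: sum_distrib_right[symmetric])
  also have "(\<Sum>p\<in>{0..n}. \<Sum>q\<in>{0..n}. a p q * emat p q k l) = a k l"
  proof (cases "k \<le> n \<and> l \<le> n")
    case True
    have "(\<Sum>p\<in>{0..n}. \<Sum>q\<in>{0..n}. a p q * emat p q k l) = (\<Sum>p\<in>{0..n}. \<Sum>q\<in>{0..n}. if q = l then (if p = k then a k l else 0) else 0)"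
      by (intro sum.cong refl) (auto simp: emat_def)
    then show ?thesis using True by (simp add: sum.delta)
  next
    case False
    then have "(\<Sum>p\<in>{0..n}. \<Sum>q\<in>{0..n}. a p q * emat p q k l) = 0"
      by (intro sum.neutral ballI) (auto simp: emat_def)
    then show ?thesis using False z[of k l] by auto
  qed
  finally show "a k l = (\<Sum>i\<in>sl_index. a (i div Suc n) (i mod Suc n) * sl_basis i k l)" by simp
qed

lemma sl_gen_sum:
  assumes "finite S" "S \<subseteq> sl_index"
  shows "(\<lambda>k l. \<Sum>i\<in>S. \<beta> i * sl_basis i k l) \<in> carrier (sl1 n) \<and>
    uea_gen (sl1 n) (\<lambda>k l. \<Sum>i\<in>S. \<beta> i * sl_basis i k l) = (\<Oplus>\<^bsub>Us n\<^esub>i\<in>S. \<beta> i \<odot>\<^bsub>Us n\<^esub> uea_gen (sl1 n) (sl_basis i))"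
  using assms
proof (induction S rule: finite_induct)
  case empty
  have z: "(\<lambda>k l. 0) \<in> carrier (sl1 n)" by (simp add: sl_simps gl_simps mtrace_def)
  have "uea_gen (sl1 n) (lie_scale (sl1 n) 0 (\<lambda>k l. 0)) = \<zero>\<^bsub>Us n\<^esub>"
    unfolding Sl.gen_scale[OF z] using z by simp
  then show ?case using z by (simp add: sl_simps gl_simps)
next
  case (insert i S)
  have bi: "sl_basis i \<in> carrier (sl1 n)" using insert sl_basis_closed by simp
  have eq: "(\<lambda>k l. \<Sum>i\<in>insert i S. \<beta> i * sl_basis i k l) =
    lie_add (sl1 n) (lie_scale (sl1 n) (\<beta> i) (sl_basis i)) (\<lambda>k l. \<Sum>i\<in>S. \<beta> i * sl_basis i k l)"
    using insert by (simp add: sl_simps gl_simps)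
  have "sl_basis j \<in> carrier (sl1 n)" if "j \<in> S" for j using insert that sl_basis_closed by auto
  then show ?case unfolding eq using insert bi Sl.closed
    by (simp add: Sl.gen_add Sl.gen_scale Pi_iff)
qed

sublocale Sb: lie_basis "sl1 n" sl_basis sl_index
proof
  show "finite sl_index" by (rule finite_sl_index)
  show "\<And>i. i \<in> sl_index \<Longrightarrow> sl_basis i \<in> carrier (sl1 n)" by (rule sl_basis_closed)
  fix a assume a: "a \<in> carrier (sl1 n)"
  have "uea_gen (sl1 n) a = uea_gen (sl1 n) (\<lambda>k l. \<Sum>i\<in>sl_index. a (i div Suc n) (i mod Suc n) * sl_basis i k l)"
    using sl_expand[OF a] by (rule arg_cong)
  also have "\<dots> = (\<Oplus>\<^bsub>Us n\<^esub>i\<in>sl_index. a (i div Suc n) (i mod Suc n) \<odot>\<^bsub>Us n\<^esub> uea_gen (sl1 n) (sl_basis i))"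
    using sl_gen_sum[OF finite_sl_index order_refl, of "\<lambda>i. a (i div Suc n) (i mod Suc n)"] by blast
  finally show "\<exists>\<beta>. uea_gen (sl1 n) a = (\<Oplus>\<^bsub>Us n\<^esub>i\<in>sl_index. \<beta> i \<odot>\<^bsub>Us n\<^esub> uea_gen (sl1 n) (sl_basis i))"
    by (rule exI[of _ "\<lambda>i. a (i div Suc n) (i mod Suc n)"])
qed

text \<open>The symbol of \<open>lead d \<kappa>\<close>, as a function of the matrix formed by the symbols of the matrix units.\<close>

definition "lead_poly d \<kappa> A = (\<Sum>m\<in>Sb.sorted_words d. \<kappa> m * prod_list (map (\<lambda>i. mat_pair (sl_basis i) A) m))"

definition "trace_shift A = - (\<Sum>i\<in>{0..n}. A i i :: complex) / (of_nat n + 1)"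

subsection \<open>Matrices with a prescribed eigenvector\<close>

text \<open>For \<open>v 0 = 1\<close> this is the general matrix with eigenvector \<open>v\<close>; its row with index zero is \<open>p\<close>, and \<open>M\<close> is free.\<close>

definition "eigen_mat v p M i j = v i * p j + (if i = 0 then 0 else if j = 0 then - (\<Sum>k\<in>{1..n}. v k * M i k) else (M i j :: complex))"

lemma mat_pair_cong: "(\<And>i j. i \<le> n \<Longrightarrow> j \<le> n \<Longrightarrow> A i j = A' i j) \<Longrightarrow> mat_pair B A = mat_pair B A'"
  unfolding mat_pair_def by (intro sum.cong) auto

lemma lead_poly_cong: "(\<And>i j. i \<le> n \<Longrightarrow> j \<le> n \<Longrightarrow> A i j = A' i j) \<Longrightarrow> lead_poly d \<kappa> A = lead_poly d \<kappa> A'"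
  unfolding lead_poly_def using mat_pair_cong[of A A'] by simp

lemma trace_shift_cong: "(\<And>i j. i \<le> n \<Longrightarrow> j \<le> n \<Longrightarrow> A i j = A' i j) \<Longrightarrow> trace_shift A = trace_shift A'"
  unfolding trace_shift_def by (intro arg_cong2[where f = "(/)"] arg_cong[where f = uminus] sum.cong) auto

lemma seppoly_lead_poly:
  assumes "\<And>i j. \<lbrakk>i \<le> n; j \<le> n\<rbrakk> \<Longrightarrow> seppoly (\<lambda>w. A w i j)"
  shows "seppoly (\<lambda>w. lead_poly d \<kappa> (A w))"
  unfolding lead_poly_def mat_pair_def
  by (intro seppoly_sum seppoly_mult seppoly_const seppoly_prod_list assms) auto

lemma seppoly_trace_shift:
  assumes "\<And>i j. \<lbrakk>i \<le> n; j \<le> n\<rbrakk> \<Longrightarrow> seppoly (\<lambda>w. A w i j)"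
  shows "seppoly (\<lambda>w. trace_shift (A w))"
proof -
  have "seppoly (\<lambda>w. (- (1 / (of_nat n + 1))) * (\<Sum>i\<in>{0..n}. A w i i))"
    by (intro seppoly_sum seppoly_mult seppoly_const assms) auto
  then show ?thesis unfolding trace_shift_def by simp
qed

text \<open>With \<open>c j k = xi j k * (M k j - s j)\<close> the constants reduce the system to one scalar equation for each \<open>s j\<close>.\<close>

lemma gl_symbol_surj: "\<exists>c. \<forall>i\<in>{1..n}. \<forall>j\<in>{1..n}. gl_symbol c i j = M i j"
proof -
  define s where "s j = (\<Sum>i\<in>{1..n}. M i j) / (of_nat n + 1)" for j
  define c where "c j k = xi j k * (M k j - s j)" for j k
  have n0: "(of_nat n + 1 :: complex) \<noteq> 0" using of_nat_neq_0[of n] by (simp add: add.commute)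
  have "gl_symbol c i j = M i j" if i: "i \<in> {1..n}" for i j
  proof -
    have "gl_symbol c i j = (\<Sum>k\<in>{1..n}. (M k j - s j) + (if k = i then M i j - s j else 0))"
      unfolding gl_symbol_def c_def by (rule sum.cong) (auto simp: xi_def)
    also have "\<dots> = (\<Sum>k\<in>{1..n}. M k j) - of_nat n * s j + (M i j - s j)"
      using i by (simp add: sum.distrib sum_subtractf sum.delta)
    also have "(\<Sum>k\<in>{1..n}. M k j) = (of_nat n + 1) * s j" using n0 by (simp add: s_def)
    finally show ?thesis by (simp add: algebra_simps)
  qed
  then show ?thesis by blast
qed

text \<open>The assumption expresses that a combination of powers of the symbol of \<open>th\<close>, with the leading forms given by \<open>\<kappa>\<close> as coefficients, vanishes for all symbols that occur. It is extended to all matrices in steps.\<close>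

context
  fixes d :: nat and \<kappa> :: "nat \<Rightarrow> nat list \<Rightarrow> complex"
  assumes hyp: "\<And>\<tau> N c. \<lbrakk>\<And>i. i \<le> n \<Longrightarrow> \<tau> i \<noteq> 0; \<tau> 0 = 1\<rbrakk> \<Longrightarrow>
    (\<Sum>k\<in>{0..n}. (if k \<le> d then lead_poly (d - k) (\<kappa> k) (r0_symbol \<tau> (\<lambda>j. of_nat (N j)) c) else 0) *
       ((\<Sum>j\<in>{0..n}. of_nat (N j)) + R1_symbol \<tau> (\<lambda>j. of_nat (N j)) c) ^ k) = 0"
begin

text \<open>The left side of the assumption with free parameters in place of the eigenvector, the row with index zero and the remaining block.\<close>

definition "symbol_poly v p M = (\<Sum>k\<in>{0..n}. (if k \<le> d then lead_poly (d - k) (\<kappa> k) (eigen_mat v p M) else 0) *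
       ((\<Sum>j\<in>{0..n}. v j * p j) + trace_shift (eigen_mat v p M)) ^ k)"

lemma symbol_poly_nat:
  assumes v: "\<And>i. i \<le> n \<Longrightarrow> v i \<noteq> 0" "v 0 = 1" and p: "\<And>j. j \<le> n \<Longrightarrow> p j = of_nat (N j) / v j"
  shows "symbol_poly v p M = 0"
proof -
  obtain c where c: "\<And>i j. i \<in> {1..n} \<Longrightarrow> j \<in> {1..n} \<Longrightarrow> gl_symbol c i j = M i j" using gl_symbol_surj by blast
  have A: "eigen_mat v p M i j = r0_symbol v (\<lambda>j. of_nat (N j)) c i j" if "i \<le> n" "j \<le> n" for i j
  proof -
    have "(\<Sum>k\<in>{1..n}. v k * M i k) = (\<Sum>k\<in>{1..n}. v k * gl_symbol c i k)" if "i \<noteq> 0"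
      by (rule sum.cong) (use c that \<open>i \<le> n\<close> in auto)
    then show ?thesis using that p[OF that(2)] c[of i j]
      by (auto simp: eigen_mat_def r0_symbol_def Q_symbol_def)
  qed
  have s: "(\<Sum>j\<in>{0..n}. v j * p j) = (\<Sum>j\<in>{0..n}. of_nat (N j))"
    by (rule sum.cong) (use v p in auto)
  have t: "trace_shift (eigen_mat v p M) = R1_symbol v (\<lambda>j. of_nat (N j)) c"
    unfolding trace_shift_def R1_symbol_def using A by simp
  have f: "lead_poly d \<kappa> (eigen_mat v p M) = lead_poly d \<kappa> (r0_symbol v (\<lambda>j. of_nat (N j)) c)" for d \<kappa> by (rule lead_poly_cong[OF A])
  show ?thesis unfolding symbol_poly_def s t f by (rule hyp) (use v in auto)
qed

text \<open>The identity is polynomial in the row \<open>p\<close>, and natural exponents provide infinitely many values of each entry.\<close>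

lemma symbol_poly_zero_nz:
  assumes v: "\<And>i. i \<le> n \<Longrightarrow> v i \<noteq> 0" "v 0 = 1"
  shows "symbol_poly v p M = 0"
proof (rule seppoly_vanish[where g = "\<lambda>p. symbol_poly v p M" and J = "{0..n}" and S = "\<lambda>j. range (\<lambda>N. of_nat N / v j)"])
  show "seppoly (\<lambda>p. symbol_poly v p M)"
  proof -
    have A: "seppoly (\<lambda>p. eigen_mat v p M i j)" for i j
      unfolding eigen_mat_def by (intro seppoly_add seppoly_mult seppoly_const seppoly_var)
    have "seppoly (\<lambda>p. if k \<le> d then lead_poly (d - k) (\<kappa> k) (eigen_mat v p M) else 0)" for k
      by (cases "k \<le> d") (simp_all add: seppoly_const seppoly_lead_poly A)
    then show ?thesis unfolding symbol_poly_def
      by (intro seppoly_sum seppoly_mult seppoly_power seppoly_add seppoly_const seppoly_var seppoly_trace_shift A)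
  qed
  fix j assume "j \<in> {0..n}"
  then have "inj (\<lambda>N::nat. of_nat N / v j)" using v by (intro injI) auto
  then show "infinite (range (\<lambda>N::nat. of_nat N / v j))" by (rule range_inj_infinite)
next
  fix q assume "\<And>j. j \<in> {0..n} \<Longrightarrow> q j \<in> range (\<lambda>N::nat. of_nat N / v j)"
  then have ex: "\<exists>k::nat. q j = of_nat k / v j" if "j \<in> {0..n}" for j using that by blast
  define N where "N j = (SOME k::nat. q j = of_nat k / v j)" for j
  have "q j = of_nat (N j) / v j" if "j \<in> {0..n}" for j
    unfolding N_def using someI_ex[OF ex[OF that]] .
  then show "symbol_poly v q M = 0" by (intro symbol_poly_nat[where N = N]) (use v in auto)
qed simp

text \<open>The identity is also polynomial in \<open>v\<close>, so entries equal to zero may be admitted.\<close>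

lemma symbol_poly_zero: "v 0 = 1 \<Longrightarrow> symbol_poly v p M = 0"
proof (rule seppoly_vanish[where g = "\<lambda>v. symbol_poly v p M" and J = "{1..n}" and S = "\<lambda>j. - {0}"])
  show "seppoly (\<lambda>v. symbol_poly v p M)"
  proof -
    have A: "seppoly (\<lambda>v. eigen_mat v p M i j)" for i j
    proof -
      have "seppoly (\<lambda>v. if i = 0 then 0 else if j = 0 then - (\<Sum>k\<in>{1..n}. v k * M i k) else M i j)"
        by (cases "i = 0"; cases "j = 0") (simp_all add: seppoly_const seppoly_uminus seppoly_sum seppoly_mult seppoly_var)
      then show ?thesis unfolding eigen_mat_def by (intro seppoly_add seppoly_mult seppoly_const seppoly_var)
    qed
    have "seppoly (\<lambda>v. if k \<le> d then lead_poly (d - k) (\<kappa> k) (eigen_mat v p M) else 0)" for k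
      by (cases "k \<le> d") (simp_all add: seppoly_const seppoly_lead_poly A)
    then show ?thesis unfolding symbol_poly_def
      by (intro seppoly_sum seppoly_mult seppoly_power seppoly_add seppoly_const seppoly_var seppoly_trace_shift A)
  qed
  show "infinite (- {0 :: complex})" by (simp add: infinite_UNIV_char_0 Diff_infinite_finite[of "{0}" UNIV] Compl_eq_Diff_UNIV)
next
  fix u assume v0: "v 0 = 1" and u: "\<And>j. j \<in> {1..n} \<Longrightarrow> u j \<in> - {0}" "\<And>j. j \<notin> {1..n} \<Longrightarrow> u j = v j"
  have "u 0 = 1" using u(2)[of 0] v0 by simp
  moreover have "u i \<noteq> 0" if "i \<le> n" for i using u(1)[of i] that \<open>u 0 = 1\<close> by (cases "i = 0") auto
  ultimately show "symbol_poly u p M = 0" by (intro symbol_poly_zero_nz)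
qed simp

text \<open>Subtracting the product of \<open>v\<close> with the row of index zero leaves a matrix that kills \<open>v\<close>, which shows that the matrix has the form \<open>eigen_mat\<close>.\<close>

lemma eigen_identity:
  fixes A :: "nat \<Rightarrow> nat \<Rightarrow> complex"
  assumes v: "v 0 = 1" and ev: "\<And>i. i \<le> n \<Longrightarrow> (\<Sum>j\<in>{0..n}. A i j * v j) = x * v i"
  shows "(\<Sum>k\<in>{0..n}. (if k \<le> d then lead_poly (d - k) (\<kappa> k) A else 0) * (x + trace_shift A) ^ k) = 0"
proof -
  \<comment> \<open>row 0 of this matrix vanishes because \<open>v 0 = 1\<close>\<close>
  define M where "M i j = A i j - v i * A 0 j" for i j
  have split: "(\<Sum>j\<in>{0..n}. f j) = f 0 + (\<Sum>j\<in>{1..n}. f j)" for f :: "nat \<Rightarrow> complex"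
    by (simp add: sum.atLeast_Suc_atMost One_nat_def)
  have A: "eigen_mat v (A 0) M i j = A i j" if ij: "i \<le> n" "j \<le> n" for i j
  proof -
    consider "i = 0" | "i \<noteq> 0" "j = 0" | "i \<noteq> 0" "j \<noteq> 0" by blast
    then show ?thesis
    proof cases
      case 1 then show ?thesis using v by (simp add: eigen_mat_def)
    next
      case 2
      have "(\<Sum>k\<in>{1..n}. v k * M i k) = (\<Sum>k\<in>{1..n}. A i k * v k) - v i * (\<Sum>k\<in>{1..n}. A 0 k * v k)"
        by (simp add: M_def algebra_simps sum_subtractf sum_distrib_left)
      also have "(\<Sum>k\<in>{1..n}. A i k * v k) = x * v i - A i 0" using ev[OF ij(1)] v unfolding split by (simp add: algebra_simps)
      also have "(\<Sum>k\<in>{1..n}. A 0 k * v k) = x - A 0 0" using ev[of 0] v unfolding split by (simp add: algebra_simps)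
      finally show ?thesis using 2 by (simp add: eigen_mat_def algebra_simps)
    next
      case 3 then show ?thesis by (simp add: eigen_mat_def M_def)
    qed
  qed
  have s: "(\<Sum>j\<in>{0..n}. v j * A 0 j) = x" using ev[of 0] v by (simp add: mult.commute)
  have f: "lead_poly d \<kappa> (eigen_mat v (A 0) M) = lead_poly d \<kappa> A" for d \<kappa> by (rule lead_poly_cong[OF A])
  have t: "trace_shift (eigen_mat v (A 0) M) = trace_shift A" by (rule trace_shift_cong[OF A])
  show ?thesis using symbol_poly_zero[of v "A 0" M] v unfolding symbol_poly_def f t s by simp
qed

text \<open>On the segment from the bidiagonal matrix, a polynomial of degree at most \<open>n\<close> in the eigenvalue has \<open>n + 1\<close> zeros for small parameters. Its coefficients are polynomial in the parameter and vanish on an interval, hence also at the end of the segment.\<close>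

lemma lead_poly_line:
  fixes B :: "nat \<Rightarrow> nat \<Rightarrow> real"
  assumes "k \<le> n" "k \<le> d"
  shows "lead_poly (d - k) (\<kappa> k) (\<lambda>i j. of_real (bidiag i j + B i j)) = 0"
proof -
  define g where "g z = lead_poly (d - k) (\<kappa> k) (\<lambda>i j. of_real (bidiag i j) + z * of_real (B i j))" for z
  obtain e S where e: "e > 0" and S: "\<And>z. \<bar>z\<bar> < e \<Longrightarrow> card (S z) = Suc n \<and> (\<forall>x\<in>S z. \<exists>v. v 0 = 1 \<and>
     (\<forall>i\<le>n. (\<Sum>j\<in>{0..n}. (bidiag i j + z * B i j) * v j) = x * v i))"
    using eigen_pairs[of n B] by metis
  have small: "g (of_real z) = 0" if z: "\<bar>z\<bar> < e" for z
  proof -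
    let ?A = "\<lambda>i j. of_real (bidiag i j) + of_real z * of_real (B i j) :: complex"
    let ?S = "(\<lambda>x. of_real x + trace_shift ?A) ` S z"
    have "card ?S = Suc n" using S[OF z] by (subst card_image) (auto intro: inj_onI)
    moreover have "(\<Sum>k\<in>{0..n}. (if k \<le> d then lead_poly (d - k) (\<kappa> k) ?A else 0) * y ^ k) = 0" if "y \<in> ?S" for y
    proof -
      have "\<exists>x\<in>S z. y = of_real x + trace_shift ?A" using that unfolding image_iff .
      then obtain x where x: "x \<in> S z" "y = of_real x + trace_shift ?A" by (rule bexE)
      obtain v where v: "v 0 = 1" "\<And>i. i \<le> n \<Longrightarrow> (\<Sum>j\<in>{0..n}. (bidiag i j + z * B i j) * v j) = x * v i"
        using S[OF z] x(1) by blast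
      have "(\<Sum>j\<in>{0..n}. ?A i j * of_real (v j)) = of_real x * of_real (v i)" if "i \<le> n" for i
        using arg_cong[OF v(2)[OF that], of complex_of_real] by simp
      then show ?thesis unfolding x(2) by (intro eigen_identity[where v = "\<lambda>i. of_real (v i)"]) (simp_all add: v)
    qed
    ultimately have "(if k \<le> d then lead_poly (d - k) (\<kappa> k) ?A else 0) = 0"
      using assms(1) by (rule powers_vanish)
    then show ?thesis using assms by (simp add: g_def)
  qed
  have sp: "seppoly (\<lambda>w :: unit \<Rightarrow> complex. g (w ()))"
    unfolding g_def by (intro seppoly_lead_poly seppoly_add seppoly_mult seppoly_const seppoly_var)
  have inf: "infinite (complex_of_real ` {0<..<e})"
    using e by (simp add: finite_image_iff inj_on_def)
  have "g ((\<lambda>_. 1) ()) = 0"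
    by (rule seppoly_vanish[OF sp, where J = UNIV and S = "\<lambda>_. complex_of_real ` {0<..<e}"])
       (use inf small in auto)
  then show ?thesis by (simp add: g_def)
qed

lemma lead_poly_zero:
  fixes A :: "nat \<Rightarrow> nat \<Rightarrow> real"
  assumes "k \<le> n" "k \<le> d"
  shows "lead_poly (d - k) (\<kappa> k) (\<lambda>i j. of_real (A i j)) = 0"
  using lead_poly_line[OF assms, of "\<lambda>i j. A i j - bidiag i j"] by simp

text \<open>On the matrix with entries \<open>t\<^sup>j\<close>, where \<open>j\<close> is a power of \<open>K\<close> depending on the position, different ordered monomials take the values of different powers of \<open>t\<close>. The entry with index zero on the diagonal is set to zero, so that the diagonal basis elements do not interfere with each other.\<close>

lemma kappa_zero:
  assumes k: "k \<le> n" "k \<le> d" and m: "m \<in> Sb.sorted_words (d - k)"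
  shows "\<kappa> k m = 0"
proof -
  define K where "K = Suc d"
  \<comment> \<open>base \<open>K\<close> exceeds the length of all words involved\<close>
  define code where "code m = sum_list (map ((^) K) m)" for m
  have y: "mat_pair (sl_basis i) (\<lambda>p q. of_real (if p = 0 \<and> q = 0 then 0 else t ^ (K ^ pair_code (p, q)))) = of_real t ^ (K ^ i)"
    if iJ: "i \<in> sl_index" for i t
  proof -
    obtain pq where "i = pair_code pq" "pq \<in> {0..n} \<times> {0..n}" "pq \<noteq> (0, 0)" using iJ unfolding sl_index_def index_pairs_def by blast
    then obtain p q where pq: "i = pair_code (p, q)" "p \<le> n" "q \<le> n" "(p, q) \<noteq> (0, 0)" by (cases pq) simp
    let ?A = "\<lambda>p q. complex_of_real (if p = 0 \<and> q = 0 then 0 else t ^ (K ^ pair_code (p, q)))"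
    have em: "mat_pair (emat p q) ?A = ?A p q" if "p \<le> n" "q \<le> n" for p q
    proof -
      have "mat_pair (emat p q) ?A = (\<Sum>i\<in>{0..n}. \<Sum>j\<in>{0..n}. if j = q then (if i = p then ?A p q else 0) else 0)"
        unfolding mat_pair_def by (intro sum.cong refl) (auto simp: emat_def)
      then show ?thesis using that by (simp add: sum.delta)
    qed
    have df: "mat_pair (\<lambda>k l. emat p p k l - emat 0 0 k l) ?A = mat_pair (emat p p) ?A - mat_pair (emat 0 0) ?A"
      by (simp add: mat_pair_def algebra_simps sum_subtractf)
    show ?thesis
    proof (cases "p = q")
      case True then show ?thesis using pq em[of q q] em[of 0 0] df by (auto simp: sl_basis_code)
    next
      case False then show ?thesis using pq em[of p q] by (auto simp: sl_basis_code)
    qed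
  qed
  define P where "P = (\<Sum>m\<in>Sb.sorted_words (d - k). monom (\<kappa> k m) (code m))"
  have ev: "poly P (of_real t) = 0" for t
  proof -
    have "prod_list (map (\<lambda>i. mat_pair (sl_basis i) (\<lambda>p q. of_real (if p = 0 \<and> q = 0 then 0 else t ^ (K ^ pair_code (p, q))))) m) = of_real t ^ code m"
      if "set m \<subseteq> sl_index" for m
      using that by (induction m) (simp_all add: y code_def power_add)
    then have "lead_poly (d - k) (\<kappa> k) (\<lambda>p q. of_real (if p = 0 \<and> q = 0 then 0 else t ^ (K ^ pair_code (p, q)))) = poly P (of_real t)"
      unfolding lead_poly_def P_def poly_sum poly_monom by (intro sum.cong refl) (simp add: Sb.sorted_words_def)
    then show ?thesis using lead_poly_zero[OF k, of "\<lambda>p q. if p = 0 \<and> q = 0 then 0 else t ^ (K ^ pair_code (p, q))"] by simp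
  qed
  have "P = 0"
  proof (rule poly_vanish)
    show "infinite (range complex_of_real)" by (simp add: finite_image_iff inj_on_def infinite_UNIV_char_0)
  qed (use ev in auto)
  moreover have "coeff P (code m) = \<kappa> k m"
  proof -
    have "coeff P (code m) = (\<Sum>m'\<in>Sb.sorted_words (d - k). if m' = m then \<kappa> k m else 0)"
      unfolding P_def coeff_sum
    proof (rule sum.cong[OF refl])
      fix m' assume m': "m' \<in> Sb.sorted_words (d - k)"
      have "code m' = code m \<Longrightarrow> m' = m"
        unfolding code_def by (rule Kronecker_code_inj[of m' m K]) (use m m' in \<open>auto simp: Sb.sorted_words_def K_def\<close>)
      then show "coeff (monom (\<kappa> k m') (code m')) (code m) = (if m' = m then \<kappa> k m else 0)" by auto
    qed
    then show ?thesis using m Sb.finite_sorted_words by (simp add: sum.delta)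
  qed
  ultimately show ?thesis by simp
qed

end

end

section \<open>Linear independence of the powers of the image of $X$\<close>

context rank
begin

lemma incl_hom: "Us_incl n \<in> alg_hom (Us n) (U n)"
  and incl_gen: "\<And>B. B \<in> carrier (sl1 n) \<Longrightarrow> Us_incl n (uea_gen (sl1 n) B) = uea_gen (gl1 n) B"
proof -
  have "\<exists>h\<in>alg_hom (Us n) (U n). \<forall>B\<in>carrier (sl1 n). h (uea_gen (sl1 n) B) = uea_gen (gl1 n) B"
    by (rule Sl.uea_hom_exists[OF Ul.U.calg_axioms])
       (simp_all add: sl_simps Ul.gen_add Ul.gen_scale Ul.gen_bracket)
  then obtain h where h: "h \<in> alg_hom (Us n) (U n)" "\<forall>B\<in>carrier (sl1 n). h (uea_gen (sl1 n) B) = uea_gen (gl1 n) B"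
    by blast
  have "Us_incl n = h"
    unfolding Us_incl_def
  proof (rule the_equality)
    fix h' assume "h' \<in> alg_hom (Us n) (U n) \<and> (\<forall>B\<in>carrier (sl1 n). h' (uea_gen (sl1 n) B) = uea_gen (gl1 n) B)"
    then show "h' = h" using h by (intro Sl.uea_hom_eqI[OF Ul.U.calg_axioms]) simp_all
  qed (use h in blast)
  with h show "Us_incl n \<in> alg_hom (Us n) (U n)"
    and "\<And>B. B \<in> carrier (sl1 n) \<Longrightarrow> Us_incl n (uea_gen (sl1 n) B) = uea_gen (gl1 n) B" by simp_all
qed

sublocale incl: calg_hom "Us n" "U n" "Us_incl n"
  by unfold_locales (rule incl_hom)

sublocale rs: calg_hom "Us n" "Tgt n" "rho_s n"
  unfolding rho_s_def by (rule calg_hom_comp[OF incl.calg_hom_axioms rho.calg_hom_axioms])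

lemma rho_s_eq: "u \<in> carrier (Us n) \<Longrightarrow> rho_s n u = rho n (Us_incl n u)"
  by (simp add: rho_s_def compose_def)

lemma gl_gen_zero: "uea_gen (gl1 n) (\<lambda>i j. 0) = \<zero>\<^bsub>U n\<^esub>"
proof -
  have z: "(\<lambda>i j. 0) \<in> carrier (gl1 n)" by (simp add: gl_simps)
  have "uea_gen (gl1 n) (lie_scale (gl1 n) 0 (\<lambda>i j. 0)) = \<zero>\<^bsub>U n\<^esub>"
    unfolding Ul.gen_scale[OF z] using z by simp
  then show ?thesis by (simp add: gl_simps)
qed

lemma mat_pair_emat: "i \<le> n \<Longrightarrow> j \<le> n \<Longrightarrow> mat_pair (emat i j) A = A i j"
proof -
  assume ij: "i \<le> n" "j \<le> n"
  have "mat_pair (emat i j) A = (\<Sum>p\<in>{0..n}. \<Sum>q\<in>{0..n}. if q = j then (if p = i then A i j else 0) else 0)"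
    unfolding mat_pair_def by (intro sum.cong refl) (auto simp: emat_def)
  then show ?thesis using ij by (simp add: sum.delta)
qed

lemma mat_pair_lin: "mat_pair (lie_add (gl1 n) B C) A = mat_pair B A + mat_pair C A" "mat_pair (lie_scale (gl1 n) b B) A = b * mat_pair B A"
  by (simp_all add: mat_pair_def gl_simps distrib_right sum.distrib sum_distrib_left mult.assoc)

lemma mtrace_lin: "mtrace {0..n} (lie_add (gl1 n) B C) = mtrace {0..n} B + mtrace {0..n} C"
  "mtrace {0..n} (lie_scale (gl1 n) b B) = b * mtrace {0..n} B"
  by (simp_all add: mtrace_def gl_simps sum.distrib sum_distrib_left)

lemma mtrace_emat: "i \<le> n \<Longrightarrow> mtrace {0..n} (emat i j) = (if i = j then 1 else 0)"
proof -
  assume i: "i \<le> n"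
  have "mtrace {0..n} (emat i j) = (\<Sum>p\<in>{0..n}. if p = i then (if i = j then 1 else 0) else 0)"
    unfolding mtrace_def by (rule sum.cong) (auto simp: emat_def)
  then show ?thesis using i by (simp add: sum.delta)
qed

context
  fixes \<tau> :: "nat \<Rightarrow> complex" and a :: "nat \<Rightarrow> complex" and c :: "nat \<Rightarrow> nat \<Rightarrow> complex"
  assumes nz: "\<And>i. i \<le> n \<Longrightarrow> \<tau> i \<noteq> (0::complex)" and t0: "\<tau> 0 = 1"
begin

lemma osym_gen:
  assumes "B \<in> carrier (gl1 n)"
  shows "osym \<tau> a c (Th (rho n (uea_gen (gl1 n) B))) 1 (mat_pair B (r0_symbol \<tau> a c) + mtrace {0..n} B * R1_symbol \<tau> a c)"
  using Ul.finite_I assms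
proof (induction B rule: gl_induct)
  case zero
  show ?case using osym_zero by (simp add: gl_gen_zero mat_pair_def mtrace_def)
next
  case (emat i j)
  then show ?case using osym_rr[of \<tau>, OF nz t0, of i j a c] by (auto simp: rho_E mat_pair_emat mtrace_emat)
next
  case (add B C)
  then show ?case using osym_add[OF add(3,4)] by (simp add: Ul.gen_add mat_pair_lin mtrace_lin algebra_simps)
next
  case (scale b B)
  then show ?case using osym_smult[OF scale(2), of b] by (simp add: Ul.gen_scale mat_pair_lin mtrace_lin algebra_simps)
qed

lemma osym_sgen: "B \<in> carrier (sl1 n) \<Longrightarrow> osym \<tau> a c (Th (rho_s n (uea_gen (sl1 n) B))) 1 (mat_pair B (r0_symbol \<tau> a c))"
  using osym_gen[of B] by (simp add: rho_s_eq incl_gen sl_simps)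

lemma osym_wrd: "set bs \<subseteq> carrier (sl1 n) \<Longrightarrow>
  osym \<tau> a c (Th (rho_s n (Sl.wrd bs))) (length bs) (prod_list (map (\<lambda>B. mat_pair B (r0_symbol \<tau> a c)) bs))"
proof (induction bs)
  case Nil
  then show ?case using osym_one by (simp add: Sl.wrd_Nil)
next
  case (Cons B bs)
  have B: "B \<in> carrier (sl1 n)" and bs: "set bs \<subseteq> carrier (sl1 n)" using Cons.prems by auto
  have "Sl.wrd (B # bs) = uea_gen (sl1 n) B \<otimes>\<^bsub>Us n\<^esub> Sl.wrd bs"
    using Sl.wrd_append[of "[B]" bs] B bs by (simp add: Sl.wrd_single)
  then show ?case using osym_mult[OF osym_sgen[OF B] Cons.IH[OF bs]] Sl.wrd_closed[OF bs] B by (simp add: plus_1_eq_Suc)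
qed

lemma osym_lead: "osym \<tau> a c (Th (rho_s n (Sb.lead d \<kappa>))) d (lead_poly d \<kappa> (r0_symbol \<tau> a c))"
proof -
  have cl: "Sb.bw m \<in> carrier (Us n)" if "m \<in> Sb.sorted_words d" for m
    using that by (intro Sb.bw_closed) (simp add: Sb.sorted_words_def)
  have "Th (rho_s n (Sb.lead d \<kappa>)) = (\<Oplus>\<^bsub>op_alg (VV n)\<^esub>m\<in>Sb.sorted_words d. Th (rho_s n (\<kappa> m \<odot>\<^bsub>Us n\<^esub> Sb.bw m)))"
    unfolding Sb.lead_def using cl by (simp add: Pi_iff comp_def del: rs.hom_smult Th.hom_smult)
  moreover have "osym \<tau> a c \<dots> d (lead_poly d \<kappa> (r0_symbol \<tau> a c))"
    unfolding lead_poly_def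
  proof (rule osym_finsum[OF Sb.finite_sorted_words])
    fix m assume m: "m \<in> Sb.sorted_words d"
    have "set (map sl_basis m) \<subseteq> carrier (sl1 n)" using m Sb.b_sub by (simp add: Sb.sorted_words_def)
    from osym_smult[OF osym_wrd[OF this], of "\<kappa> m"]
    show "osym \<tau> a c (Th (rho_s n (\<kappa> m \<odot>\<^bsub>Us n\<^esub> Sb.bw m))) d (\<kappa> m * prod_list (map (\<lambda>i. mat_pair (sl_basis i) (r0_symbol \<tau> a c)) m))"
      using cl[OF m] m by (simp add: Sb.bw_def Sb.sorted_words_def comp_def)
    show "Th (rho_s n (\<kappa> m \<odot>\<^bsub>Us n\<^esub> Sb.bw m)) \<in> carrier (op_alg (VV n))" using cl[OF m] by simp
  qed
  ultimately show ?thesis by simp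
qed

lemma osym_fil: "u \<in> Sl.fil d \<Longrightarrow> osym \<tau> a c (Th (rho_s n u)) d 0"
proof (induction rule: Sl.fil.induct)
  case fil_zero
  show ?case using osym_zero by simp
next
  case (fil_step u bs b)
  have "osym \<tau> a c (Th (rho_s n (Sl.wrd bs))) d 0" using osym_raise'[OF osym_wrd] fil_step by blast
  from osym_add[OF fil_step(4) osym_smult[OF this, of b]]
  show ?case using Sl.fil_closed[OF fil_step(1)] Sl.wrd_closed[OF fil_step(3)] by simp
qed

lemma osym_th_pow: "osym \<tau> a c (Th (th [^]\<^bsub>Tgt n\<^esub> (k::nat))) k (((\<Sum>j\<in>{0..n}. a j) + R1_symbol \<tau> a c) ^ k)"
proof (induction k)
  case 0
  show ?case using osym_one by simp
next
  case (Suc k)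
  from osym_mult[OF Suc osym_th[of \<tau>, OF nz t0]] show ?case by (simp add: mult.commute flip: Suc_eq_plus1)
qed

end

text \<open>The element \<open>v k\<close> has order \<open>d - k\<close>, so all summands have order \<open>d\<close> and their symbols add up to zero. By \<open>kappa_zero\<close> the leading forms vanish and \<open>d\<close> decreases.\<close>

lemma filtered_independence:
  "\<lbrakk>\<forall>k\<le>n. v k \<in> Sl.fil (d - k); (\<Oplus>\<^bsub>Tgt n\<^esub>k\<in>{0..n}. rho_s n (v k) \<otimes>\<^bsub>Tgt n\<^esub> th [^]\<^bsub>Tgt n\<^esub> k) = \<zero>\<^bsub>Tgt n\<^esub>\<rbrakk>
   \<Longrightarrow> \<forall>k\<le>n. v k = \<zero>\<^bsub>Us n\<^esub>"
proof (induction d)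
  case 0
  then show ?case using Sl.fil_0 by simp
next
  case (Suc d)
  have "\<exists>\<kappa>. \<exists>r\<in>Sl.fil (d - k). v k = Sb.lead (d - k) \<kappa> \<oplus>\<^bsub>Us n\<^esub> r" if "k \<le> n" "k \<le> d" for k
  proof (rule Sb.fil_has_lead)
    show "v k \<in> Sl.fil (Suc (d - k))" using Suc.prems(1)[rule_format, OF that(1)] that by (simp only: Suc_diff_le)
  qed
  then obtain \<kappa> r where kr: "\<And>k. k \<le> n \<Longrightarrow> k \<le> d \<Longrightarrow> r k \<in> Sl.fil (d - k)"
      "\<And>k. k \<le> n \<Longrightarrow> k \<le> d \<Longrightarrow> v k = Sb.lead (d - k) (\<kappa> k) \<oplus>\<^bsub>Us n\<^esub> r k"
    by metis
  have v0: "v k = \<zero>\<^bsub>Us n\<^esub>" if "k \<le> n" "\<not> k \<le> d" for k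
  proof (rule Sl.fil_0)
    have "Suc d - k = 0" using that by simp
    then show "v k \<in> Sl.fil 0" using Suc.prems(1)[rule_format, OF that(1)] by simp
  qed
  have vc: "v k \<in> carrier (Us n)" if "k \<le> n" for k using Suc.prems(1) that Sl.fil_closed by blast
  have \<kappa>0: "\<kappa> k m = 0" if "k \<le> n" "k \<le> d" "m \<in> Sb.sorted_words (d - k)" for k m
  proof (rule kappa_zero[OF _ that])
    fix \<tau> :: "nat \<Rightarrow> complex" and N :: "nat \<Rightarrow> nat" and c :: "nat \<Rightarrow> nat \<Rightarrow> complex"
    assume \<tau>: "\<And>i. i \<le> n \<Longrightarrow> \<tau> i \<noteq> 0" and t0: "\<tau> 0 = 1"
    define a :: "nat \<Rightarrow> complex" where "a = (\<lambda>j. of_nat (N j))"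
    let ?z = "\<lambda>k. (if k \<le> d then lead_poly (d - k) (\<kappa> k) (r0_symbol \<tau> a c) else 0) * ((\<Sum>j\<in>{0..n}. a j) + R1_symbol \<tau> a c) ^ k"
    have S: "osym \<tau> a c (Th (rho_s n (v k) \<otimes>\<^bsub>Tgt n\<^esub> th [^]\<^bsub>Tgt n\<^esub> k)) d (?z k)" if k: "k \<le> n" for k
    proof (cases "k \<le> d")
      case True
      have "osym \<tau> a c (Th (rho_s n (v k))) (d - k) (lead_poly (d - k) (\<kappa> k) (r0_symbol \<tau> a c) + 0)"
        using osym_add[OF osym_lead[of \<tau>, OF \<tau> t0] osym_fil[of \<tau>, OF \<tau> t0 kr(1)[OF k True]]]
          Sl.fil_closed[OF kr(1)[OF k True]] by (simp add: kr(2)[OF k True])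
      from osym_mult[OF this osym_th_pow[of \<tau> a c k, OF \<tau> t0]] show ?thesis using True vc[OF k] by simp
    next
      case False
      then show ?thesis using osym_zero by (simp add: v0[OF k])
    qed
    have "Th (\<Oplus>\<^bsub>Tgt n\<^esub>k\<in>{0..n}. rho_s n (v k) \<otimes>\<^bsub>Tgt n\<^esub> th [^]\<^bsub>Tgt n\<^esub> k)
       = (\<Oplus>\<^bsub>op_alg (VV n)\<^esub>k\<in>{0..n}. Th (rho_s n (v k) \<otimes>\<^bsub>Tgt n\<^esub> th [^]\<^bsub>Tgt n\<^esub> k))"
      using vc by (simp add: Pi_iff comp_def del: Th.hom_mult)
    moreover have "osym \<tau> a c (\<Oplus>\<^bsub>op_alg (VV n)\<^esub>k\<in>{0..n}. Th (rho_s n (v k) \<otimes>\<^bsub>Tgt n\<^esub> th [^]\<^bsub>Tgt n\<^esub> k)) d (\<Sum>k\<in>{0..n}. ?z k)"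
      by (rule osym_finsum) (use S vc in simp_all)
    ultimately have "osym \<tau> a c \<zero>\<^bsub>op_alg (VV n)\<^esub> d (\<Sum>k\<in>{0..n}. ?z k)" using Suc.prems(2) by simp
    then have "(\<Sum>k\<in>{0..n}. ?z k) = 0" by (rule osym_unique[of \<tau> a N, rotated 2]) (simp_all add: a_def \<tau>)
    then show "(\<Sum>k\<in>{0..n}. (if k \<le> d then lead_poly (d - k) (\<kappa> k) (r0_symbol \<tau> (\<lambda>j. of_nat (N j)) c) else 0) *
       ((\<Sum>j\<in>{0..n}. of_nat (N j)) + R1_symbol \<tau> (\<lambda>j. of_nat (N j)) c) ^ k) = 0" unfolding a_def .
  qed
  have "v k \<in> Sl.fil (d - k)" if k: "k \<le> n" for k
  proof (cases "k \<le> d")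
    case True
    have "Sb.lead (d - k) (\<kappa> k) = \<zero>\<^bsub>Us n\<^esub>"
      unfolding Sb.lead_def using \<kappa>0[OF k True]
      by (intro Sl.U.add.finprod_one_eqI) (simp add: Sb.bw_closed Sb.sorted_words_def)
    then show ?thesis using kr(1)[OF k True] Sl.fil_closed[OF kr(1)[OF k True]] by (simp add: kr(2)[OF k True])
  next
    case False
    then show ?thesis using Sl.fil.fil_zero by (simp add: v0[OF k])
  qed
  then show ?case using Suc.IH Suc.prems(2) by blast
qed

theorem power_independence:
  assumes v: "\<And>k. k \<le> n \<Longrightarrow> v k \<in> carrier (Us n)"
    and z: "(\<Oplus>\<^bsub>Tgt n\<^esub>k\<in>{0..n}. rho_s n (v k) \<otimes>\<^bsub>Tgt n\<^esub> th [^]\<^bsub>Tgt n\<^esub> k) = \<zero>\<^bsub>Tgt n\<^esub>"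
    and k: "k \<le> n"
  shows "v k = \<zero>\<^bsub>Us n\<^esub>"
proof -
  define D where "D k = (SOME d. v k \<in> Sl.fil d)" for k
  have D: "v k \<in> Sl.fil (D k)" if "k \<le> n" for k
    unfolding D_def by (rule someI_ex[OF Sl.fil_exhaust[OF v[OF that]]])
  have "v k \<in> Sl.fil ((\<Sum>k\<in>{0..n}. D k) + n - k)" if "k \<le> n" for k
  proof (rule Sl.fil_mono[OF D[OF that]])
    have "D k \<le> (\<Sum>k\<in>{0..n}. D k)" by (rule member_le_sum) (use that in auto)
    then show "D k \<le> (\<Sum>k\<in>{0..n}. D k) + n - k" using that by simp
  qed
  then show ?thesis using filtered_independence z k by blast
qed

end

section \<open>The projection onto the special linear part\<close>

context rank
begin

definition "traceless B = (\<lambda>i j. B i j - mtrace {0..n} B / (of_nat n + 1) * idmat {0..n} i j)"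

lemma n1_nz: "(of_nat n + 1 :: complex) \<noteq> 0"
  using of_nat_neq_0[of n] by (simp add: add.commute)

lemma idmat_closed: "S \<subseteq> {0..n} \<Longrightarrow> idmat S \<in> carrier (gl1 n)"
  by (auto simp: gl_simps idmat_def)

lemma mtrace_idmat: "mtrace {0..n} (idmat {0..n}) = of_nat n + 1"
  by (simp add: mtrace_def idmat_def add.commute)

lemma traceless_eq: "traceless B = lie_add (gl1 n) B (lie_scale (gl1 n) (- (mtrace {0..n} B / (of_nat n + 1))) (idmat {0..n}))"
  by (simp add: traceless_def gl_simps fun_eq_iff)

lemma traceless_closed: "B \<in> carrier (gl1 n) \<Longrightarrow> traceless B \<in> carrier (sl1 n)"
proof -
  assume B: "B \<in> carrier (gl1 n)"
  have "mtrace {0..n} (traceless B) = 0"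
    unfolding traceless_eq mtrace_lin mtrace_idmat using n1_nz by simp
  moreover have "traceless B \<in> carrier (gl1 n)"
    unfolding traceless_eq by (intro gl_add_closed gl_scale_closed B idmat_closed order_refl)
  ultimately show ?thesis by (simp add: sl_simps)
qed

text \<open>Multiples of the identity matrix are central.\<close>

lemma bracket_shift:
  assumes C: "C \<in> carrier (gl1 n)"
  shows "lie_bracket (gl1 n) (\<lambda>i j. B i j - s * idmat {0..n} i j) C = lie_bracket (gl1 n) B C"
    and "lie_bracket (gl1 n) C (\<lambda>i j. B i j - s * idmat {0..n} i j) = lie_bracket (gl1 n) C B"
proof -
  have z: "C i j = 0" if "\<not> i \<le> n \<or> \<not> j \<le> n" for i j using that C by (auto simp: gl_simps)
  have l: "(\<Sum>k\<in>{0..n}. (B i k - s * idmat {0..n} i k) * C k j) = (\<Sum>k\<in>{0..n}. B i k * C k j) - s * C i j" for i j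
  proof -
    have "(\<Sum>k\<in>{0..n}. (B i k - s * idmat {0..n} i k) * C k j) = (\<Sum>k\<in>{0..n}. B i k * C k j) - (\<Sum>k\<in>{0..n}. if k = i then s * C i j else 0)"
      unfolding sum_subtractf[symmetric] by (rule sum.cong) (auto simp: idmat_def algebra_simps)
    then show ?thesis using z[of i j] by (cases "i \<le> n") (simp_all add: sum.delta)
  qed
  have r: "(\<Sum>k\<in>{0..n}. C i k * (B k j - s * idmat {0..n} k j)) = (\<Sum>k\<in>{0..n}. C i k * B k j) - s * C i j" for i j
  proof -
    have "(\<Sum>k\<in>{0..n}. C i k * (B k j - s * idmat {0..n} k j)) = (\<Sum>k\<in>{0..n}. C i k * B k j) - (\<Sum>k\<in>{0..n}. if k = j then s * C i j else 0)"
      unfolding sum_subtractf[symmetric] by (rule sum.cong) (auto simp: idmat_def algebra_simps)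
    then show ?thesis using z[of i j] by (cases "j \<le> n") (simp_all add: sum.delta)
  qed
  show "lie_bracket (gl1 n) (\<lambda>i j. B i j - s * idmat {0..n} i j) C = lie_bracket (gl1 n) B C"
    and "lie_bracket (gl1 n) C (\<lambda>i j. B i j - s * idmat {0..n} i j) = lie_bracket (gl1 n) C B"
    unfolding gl_simps l r by simp_all
qed

lemma traceless_bracket:
  assumes "B \<in> carrier (gl1 n)" "C \<in> carrier (gl1 n)"
  shows "traceless (lie_bracket (gl1 n) B C) = lie_bracket (sl1 n) (traceless B) (traceless C)"
proof -
  have pC: "traceless C \<in> carrier (gl1 n)" using traceless_closed[OF assms(2)] by (simp add: sl_simps)
  have "lie_bracket (gl1 n) (traceless B) (traceless C) = lie_bracket (gl1 n) B (traceless C)"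
    unfolding traceless_def[of B] by (rule bracket_shift(1)[OF pC])
  also have "\<dots> = lie_bracket (gl1 n) B C"
    unfolding traceless_def by (rule bracket_shift(2)[OF assms(1)])
  finally show ?thesis by (simp add: sl_simps traceless_def mtrace_bracket)
qed

lemma traceless_lin: "traceless (lie_add (gl1 n) B C) = lie_add (sl1 n) (traceless B) (traceless C)"
    "traceless (lie_scale (gl1 n) c B) = lie_scale (sl1 n) c (traceless B)"
  unfolding traceless_def mtrace_lin by (simp_all add: sl_simps gl_simps add_divide_distrib algebra_simps)

lemma pi_g_hom: "pi_g n \<in> alg_hom (U n) (Us n)"
  and pi_g_gen: "\<And>B. B \<in> carrier (gl1 n) \<Longrightarrow> pi_g n (uea_gen (gl1 n) B) = uea_gen (sl1 n) (traceless B)"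
proof -
  have "\<exists>h\<in>alg_hom (U n) (Us n). \<forall>B\<in>carrier (gl1 n). h (uea_gen (gl1 n) B) = uea_gen (sl1 n) (traceless B)"
    by (rule Ul.uea_hom_exists[OF Sl.U.calg_axioms])
       (simp_all only: traceless_closed Sl.gen_closed traceless_lin traceless_bracket Sl.gen_add Sl.gen_scale Sl.gen_bracket)
  then obtain h where h: "h \<in> alg_hom (U n) (Us n)" "\<forall>B\<in>carrier (gl1 n). h (uea_gen (gl1 n) B) = uea_gen (sl1 n) (traceless B)"
    by blast
  have "pi_g n = h"
    unfolding pi_g_def traceless_def[symmetric]
  proof (rule the_equality)
    fix h' assume "h' \<in> alg_hom (U n) (Us n) \<and> (\<forall>B\<in>carrier (gl1 n). h' (uea_gen (gl1 n) B) = uea_gen (sl1 n) (traceless B))"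
    then show "h' = h" using h by (intro Ul.uea_hom_eqI[OF Sl.U.calg_axioms]) simp_all
  qed (use h in blast)
  with h show "pi_g n \<in> alg_hom (U n) (Us n)"
    and "\<And>B. B \<in> carrier (gl1 n) \<Longrightarrow> pi_g n (uea_gen (gl1 n) B) = uea_gen (sl1 n) (traceless B)" by simp_all
qed

sublocale pg: calg_hom "U n" "Us n" "pi_g n"
  by unfold_locales (rule pi_g_hom)

lemma gen_idmat:
  assumes "finite S" "S \<subseteq> {0..n}"
  shows "uea_gen (gl1 n) (idmat S) = (\<Oplus>\<^bsub>U n\<^esub>i\<in>S. E n i i)"
  using assms
proof (induction S rule: finite_induct)
  case empty
  then show ?case using gl_gen_zero by (simp add: idmat_def)
next
  case (insert i S)
  have eq: "idmat (insert i S) = lie_add (gl1 n) (emat i i) (idmat S)"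
    using insert.hyps by (auto simp: idmat_def emat_def gl_simps fun_eq_iff)
  have m: "emat j j \<in> carrier (gl1 n)" if "j \<in> insert i S" for j using insert.prems that by (intro emat_closed) auto
  show ?case unfolding eq using insert m idmat_closed[of S] by (simp add: Ul.gen_add Pi_iff)
qed

lemma G1_eq: "G1 n = uea_gen (gl1 n) (idmat {0..n})"
  unfolding G1_def by (rule gen_idmat[symmetric]) simp_all

lemma G1_closed: "G1 n \<in> carrier (U n)"
  unfolding G1_eq by (rule Ul.gen_closed[OF idmat_closed[OF order_refl]])

lemma pi_g_G1: "pi_g n (G1 n) = \<zero>\<^bsub>Us n\<^esub>"
proof -
  have "traceless (idmat {0..n}) = lie_scale (gl1 n) 0 (idmat {0..n})"
    unfolding traceless_def mtrace_idmat using n1_nz by (simp add: gl_simps)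
  then have "traceless (idmat {0..n}) = lie_scale (sl1 n) 0 (traceless (idmat {0..n}))"
    by (simp add: gl_simps sl_simps)
  then have "uea_gen (sl1 n) (traceless (idmat {0..n})) = \<zero>\<^bsub>Us n\<^esub>"
    using Sl.gen_scale[OF traceless_closed[OF idmat_closed[OF order_refl]], of 0] traceless_closed[OF idmat_closed[OF order_refl]] by simp
  then show ?thesis unfolding G1_eq by (simp add: pi_g_gen idmat_closed)
qed

lemma incl_pi_gen:
  assumes B: "B \<in> carrier (gl1 n)"
  shows "Us_incl n (pi_g n (uea_gen (gl1 n) B)) =
    uea_gen (gl1 n) B \<ominus>\<^bsub>U n\<^esub> (mtrace {0..n} B / (of_nat n + 1)) \<odot>\<^bsub>U n\<^esub> G1 n"
proof -
  have "Us_incl n (pi_g n (uea_gen (gl1 n) B)) = uea_gen (gl1 n) (traceless B)"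
    using B traceless_closed by (simp add: pi_g_gen incl_gen)
  then show ?thesis
    unfolding traceless_eq using B idmat_closed[OF order_refl] G1_closed
    by (simp add: Ul.gen_add Ul.gen_scale gl_scale_closed G1_eq[symmetric] Ul.U.minus_eq Ul.U.smult_uminus_l)
qed

lemma pi_incl: "u \<in> carrier (Us n) \<Longrightarrow> pi_g n (Us_incl n u) = u"
proof -
  assume u: "u \<in> carrier (Us n)"
  have h: "compose (carrier (Us n)) (pi_g n) (Us_incl n) \<in> alg_hom (Us n) (Us n)"
    using calg_hom.hom[OF calg_hom_comp[OF incl.calg_hom_axioms pg.calg_hom_axioms]] .
  have i: "(\<lambda>u\<in>carrier (Us n). u) \<in> alg_hom (Us n) (Us n)"
    by (rule alg_homI) simp_all
  have "compose (carrier (Us n)) (pi_g n) (Us_incl n) = (\<lambda>u\<in>carrier (Us n). u)"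
  proof (rule Sl.uea_hom_eqI[OF Sl.U.calg_axioms h i])
    fix B assume B: "B \<in> carrier (sl1 n)"
    then have "B \<in> carrier (gl1 n)" "traceless B = B" by (simp_all add: sl_simps traceless_def)
    then show "compose (carrier (Us n)) (pi_g n) (Us_incl n) (uea_gen (sl1 n) B) = (\<lambda>u\<in>carrier (Us n). u) (uea_gen (sl1 n) B)"
      using B by (simp add: compose_def incl_gen pi_g_gen)
  qed
  from fun_cong[OF this, of u] show ?thesis using u by (simp add: compose_def)
qed

lemma rho_G1: "rho n (G1 n) = \<zero>\<^bsub>Tgt n\<^esub>"
proof -
  have cl: "R.r0 i i \<in> carrier (Tgt n)" if "i \<in> {0..n}" for i using that by simp
  have "rho n (G1 n) = (\<Oplus>\<^bsub>Tgt n\<^esub>i\<in>{0..n}. rho n (E n i i))"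
    unfolding G1_def by (simp add: Pi_iff comp_def)
  also have "\<dots> = (\<Oplus>\<^bsub>Tgt n\<^esub>i\<in>{0..n}. R.r0 i i \<oplus>\<^bsub>Tgt n\<^esub> 1 \<odot>\<^bsub>Tgt n\<^esub> R1 n)"
    by (rule TP.T.finsum_cong') (simp_all add: rho_E rr_def)
  also have "\<dots> = trR \<oplus>\<^bsub>Tgt n\<^esub> (\<Oplus>\<^bsub>Tgt n\<^esub>i\<in>{0..n}. 1 \<odot>\<^bsub>Tgt n\<^esub> R1 n)"
    by (rule TP.T.finsum_addf) simp_all
  also have "(\<Oplus>\<^bsub>Tgt n\<^esub>i\<in>{0..n}. 1 \<odot>\<^bsub>Tgt n\<^esub> R1 n) = (\<Sum>i\<in>{0..n}. 1) \<odot>\<^bsub>Tgt n\<^esub> R1 n"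
    by (rule TP.T.finsum_smult_scalar) simp_all
  also have "\<dots> = \<ominus>\<^bsub>Tgt n\<^esub> trR"
    unfolding R1_eq using trR_closed n1_nz by (simp add: TP.T.smult_assoc add.commute)
  finally show ?thesis using trR_closed by (simp add: TP.T.r_neg)
qed

text \<open>On generators the difference is a multiple of the image of \<open>G1\<close>, and congruence modulo an ideal is compatible with all operations. The homomorphism \<open>h\<close> makes this available in \<open>U\<close>, in its extension and in the target.\<close>

lemma proj_mod:
  assumes "calg_hom (U n) B h" "ideal I B" "h (G1 n) \<in> I" "u \<in> carrier (U n)"
  shows "h u \<ominus>\<^bsub>B\<^esub> h (Us_incl n (pi_g n u)) \<in> I"
proof -
  interpret h: calg_hom "U n" B h by fact
  interpret I: ideal I B by fact
  show ?thesis using assms(4)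
  proof (induction u rule: Ul.uea_induct)
    case one
    show ?case using I.zero_closed by (simp add: h.B.minus_eq h.B.r_neg)
  next
    case (gen a)
    let ?c = "mtrace {0..n} a / (of_nat n + 1)"
    have "h (uea_gen (gl1 n) a) \<ominus>\<^bsub>B\<^esub> h (Us_incl n (pi_g n (uea_gen (gl1 n) a))) = ?c \<odot>\<^bsub>B\<^esub> h (G1 n)"
      unfolding incl_pi_gen[OF gen] using gen G1_closed
      by (simp add: h.hom_diff h.B.minus_eq h.B.minus_add h.B.r_neg2)
    then show ?case using h.B.ideal_smult_closed[OF assms(2,3)] by simp
  next
    case (add u v)
    have "h (u \<oplus>\<^bsub>U n\<^esub> v) \<ominus>\<^bsub>B\<^esub> h (Us_incl n (pi_g n (u \<oplus>\<^bsub>U n\<^esub> v))) =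
      (h u \<ominus>\<^bsub>B\<^esub> h (Us_incl n (pi_g n u))) \<oplus>\<^bsub>B\<^esub> (h v \<ominus>\<^bsub>B\<^esub> h (Us_incl n (pi_g n v)))"
      using add by (simp add: h.B.minus_eq h.B.minus_add h.B.a_ac)
    then show ?case using I.a_closed add by simp
  next
    case (mult u v)
    have "h (u \<otimes>\<^bsub>U n\<^esub> v) \<ominus>\<^bsub>B\<^esub> h (Us_incl n (pi_g n (u \<otimes>\<^bsub>U n\<^esub> v))) =
      (h u \<ominus>\<^bsub>B\<^esub> h (Us_incl n (pi_g n u))) \<otimes>\<^bsub>B\<^esub> h v \<oplus>\<^bsub>B\<^esub> h (Us_incl n (pi_g n u)) \<otimes>\<^bsub>B\<^esub> (h v \<ominus>\<^bsub>B\<^esub> h (Us_incl n (pi_g n v)))"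
      using mult by (simp add: h.B.minus_eq h.B.l_distr h.B.r_distr h.B.l_minus h.B.r_minus h.B.a_assoc h.B.r_neg1)
    then show ?case using I.a_closed I.I_l_closed I.I_r_closed mult by simp
  next
    case (smult c u)
    have "h (c \<odot>\<^bsub>U n\<^esub> u) \<ominus>\<^bsub>B\<^esub> h (Us_incl n (pi_g n (c \<odot>\<^bsub>U n\<^esub> u))) =
      c \<odot>\<^bsub>B\<^esub> (h u \<ominus>\<^bsub>B\<^esub> h (Us_incl n (pi_g n u)))"
      using smult by (simp add: h.B.smult_diff)
    then show ?case using h.B.ideal_smult_closed[OF assms(2)] smult by simp
  qed
qed

lemma rho_pi: "u \<in> carrier (U n) \<Longrightarrow> rho n u = rho_s n (pi_g n u)"
proof -
  assume u: "u \<in> carrier (U n)"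
  have "rho n u \<ominus>\<^bsub>Tgt n\<^esub> rho n (Us_incl n (pi_g n u)) \<in> {\<zero>\<^bsub>Tgt n\<^esub>}"
    by (rule proj_mod[OF rho.calg_hom_axioms TP.T.zeroideal _ u]) (simp add: rho_G1)
  then show ?thesis using u by (simp add: rho_s_eq TP.T.diff_zero_iff)
qed

lemma G1_central: "u \<in> carrier (U n) \<Longrightarrow> G1 n \<otimes>\<^bsub>U n\<^esub> u = u \<otimes>\<^bsub>U n\<^esub> G1 n"
proof -
  assume u: "u \<in> carrier (U n)"
  have i: "calg_hom (U n) (U n) (\<lambda>u\<in>carrier (U n). u)"
    by unfold_locales (rule alg_homI; simp)
  have "G1 n \<otimes>\<^bsub>U n\<^esub> (\<lambda>u\<in>carrier (U n). u) u = (\<lambda>u\<in>carrier (U n). u) u \<otimes>\<^bsub>U n\<^esub> G1 n"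
  proof (rule comm_closure[OF i G1_closed _ u])
    fix i j assume "i \<le> n" "j \<le> n"
    then show "ring.comm (U n) (G1 n) ((\<lambda>u\<in>carrier (U n). u) (E n i j)) = \<zero>\<^bsub>U n\<^esub>"
      unfolding G1_def using Ul.U.gl_trace_central[OF Ul.Eg_gl, of i j] by simp
  qed
  then show ?thesis using u by simp
qed

section \<open>The projection of the extension\<close>

lemma cls_diff: "\<lbrakk>p \<in> carrier (UX n); q \<in> carrier (UX n)\<rbrakk> \<Longrightarrow> cls (p \<ominus>\<^bsub>UX n\<^esub> q) = cls p \<ominus>\<^bsub>Up n\<^esub> cls q"
  using clsh.hom_diff[of p q] UP.PA.minus_closed[of p q] by (simp del: poly_alg_simps UP.poly_minus)

lemma cls_ent: "\<lbrakk>i \<le> n; j \<le> n\<rbrakk> \<Longrightarrow> cls (ent i j) =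
  Up_emb n (E n i j) \<ominus>\<^bsub>Up n\<^esub> (if i = j then Up_X n \<oplus>\<^bsub>Up n\<^esub> of_nat i \<odot>\<^bsub>Up n\<^esub> \<one>\<^bsub>Up n\<^esub> else \<zero>\<^bsub>Up n\<^esub>)"
proof -
  assume ij: "i \<le> n" "j \<le> n"
  have c: "cpoly n (E n i j) \<in> carrier (UX n)" using ij by (intro cpoly_closed Ul.Eg_closed) auto
  have o: "of_nat i \<odot>\<^bsub>UX n\<^esub> \<one>\<^bsub>UX n\<^esub> \<in> carrier (UX n)" by (intro UP.PA.smult_closed UP.PA.one_closed)
  have d: "(if i = j then Xpoly n \<oplus>\<^bsub>UX n\<^esub> of_nat i \<odot>\<^bsub>UX n\<^esub> \<one>\<^bsub>UX n\<^esub> else \<zero>\<^bsub>UX n\<^esub>) \<in> carrier (UX n)"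
    by (split if_split) (use UP.PA.a_closed[OF Xpoly_closed o] UP.PA.zero_closed in blast)
  have e: "cls (if i = j then Xpoly n \<oplus>\<^bsub>UX n\<^esub> of_nat i \<odot>\<^bsub>UX n\<^esub> \<one>\<^bsub>UX n\<^esub> else \<zero>\<^bsub>UX n\<^esub>) =
    (if i = j then Up_X n \<oplus>\<^bsub>Up n\<^esub> of_nat i \<odot>\<^bsub>Up n\<^esub> \<one>\<^bsub>Up n\<^esub> else \<zero>\<^bsub>Up n\<^esub>)"
    unfolding if_distrib[of "\<lambda>p. cls p"] Up_ops(3)[OF Xpoly_closed o] Up_ops(4)[OF UP.PA.one_closed] Up_ops(5,6) Up_X_def ..
  show ?thesis unfolding ent_def cls_diff[OF c d] e Up_emb_def ..
qed

lemma col_det_Up: "col_det (Up n) n (\<lambda>i j. cls (ent i j)) = \<zero>\<^bsub>Up n\<^esub>"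
proof -
  have "restrict (\<lambda>p. cls p) (carrier (UX n)) (Cpoly n) = col_det (Up n) n (\<lambda>i j. restrict (\<lambda>p. cls p) (carrier (UX n)) (ent i j))"
    unfolding Cpoly_eq by (rule col_det_hom[OF clsh.calg_hom_axioms ent_closed])
  also have "\<dots> = col_det (Up n) n (\<lambda>i j. cls (ent i j))"
    by (rule Up.col_det_cong) (simp_all add: ent_closed Up_ops(1) del: poly_alg_simps)
  finally show ?thesis using cls_Cpoly Cpoly_closed by (simp del: poly_alg_simps)
qed

abbreviation "cG \<equiv> (1 / (of_nat n + 1)) \<odot>\<^bsub>Up n\<^esub> Up_emb n (G1 n)"

lemma cG_closed: "cG \<in> carrier (Up n)"
  using Up_emb_closed[OF G1_closed] by simp

text \<open>The projection subtracts the same central element from the diagonal entries and from the variable. The matrix of the characteristic polynomial is therefore unchanged, and so is its determinant.\<close>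

lemma pi_g'_hom: "pi_g' n \<in> alg_hom (Up n) (Up n)"
  and pi_g'_emb: "\<And>u. u \<in> carrier (U n) \<Longrightarrow> pi_g' n (Up_emb n u) = Up_emb n (Us_incl n (pi_g n u))"
  and pi_g'_X: "pi_g' n (Up_X n) = Up_X n \<ominus>\<^bsub>Up n\<^esub> cG"
proof -
  let ?f = "compose (carrier (U n)) (restrict (Up_emb n) (carrier (U n))) (compose (carrier (U n)) (Us_incl n) (pi_g n))"
  let ?T = "Up_X n \<ominus>\<^bsub>Up n\<^esub> cG"
  have f: "calg_hom (U n) (Up n) ?f"
    by (rule calg_hom_comp[OF calg_hom_comp[OF pg.calg_hom_axioms incl.calg_hom_axioms] emb.calg_hom_axioms])
  have fv: "?f u = Up_emb n (Us_incl n (pi_g n u))" if "u \<in> carrier (U n)" for u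
    using that by (simp add: compose_def)
  have T: "?T \<in> carrier (Up n)" by (intro Up.minus_closed Up_X_closed cG_closed)
  have comm: "?T \<otimes>\<^bsub>Up n\<^esub> ?f u = ?f u \<otimes>\<^bsub>Up n\<^esub> ?T" if u: "u \<in> carrier (U n)" for u
  proof -
    let ?u = "Us_incl n (pi_g n u)"
    have uc: "?u \<in> carrier (U n)" using u by simp
    have "Up_emb n (G1 n) \<otimes>\<^bsub>Up n\<^esub> Up_emb n ?u = Up_emb n ?u \<otimes>\<^bsub>Up n\<^esub> Up_emb n (G1 n)"
      using emb.hom_mult[OF G1_closed uc] emb.hom_mult[OF uc G1_closed] G1_central[OF uc] G1_closed uc by simp
    then show ?thesis
      unfolding fv[OF u] using Up_X_comm[OF uc] Up_X_closed Up_emb_closed[OF uc] Up_emb_closed[OF G1_closed]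
      by (simp add: Up.minus_eq Up.l_distr Up.r_distr Up.l_minus Up.r_minus Up.smult_mult_l Up.smult_mult_r)
  qed
  have ent: "?f (E n i j) \<ominus>\<^bsub>Up n\<^esub> (if i = j then ?T \<oplus>\<^bsub>Up n\<^esub> of_nat i \<odot>\<^bsub>Up n\<^esub> \<one>\<^bsub>Up n\<^esub> else \<zero>\<^bsub>Up n\<^esub>) = cls (ent i j)"
    if ij: "i \<le> n" "j \<le> n" for i j
  proof -
    have Ec: "E n i j \<in> carrier (U n)" using ij by (intro Ul.Eg_closed) auto
    let ?c = "(if i = j then 1 else 0) / (of_nat n + 1) :: complex"
    have "?f (E n i j) = Up_emb n (E n i j \<ominus>\<^bsub>U n\<^esub> ?c \<odot>\<^bsub>U n\<^esub> G1 n)"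
      using incl_pi_gen[of "emat i j"] ij emat_closed[of i "{0..n}" j] fv[OF Ec] by (simp add: mtrace_emat)
    also have "\<dots> = Up_emb n (E n i j) \<ominus>\<^bsub>Up n\<^esub> ?c \<odot>\<^bsub>Up n\<^esub> Up_emb n (G1 n)"
      using emb.hom_diff[OF Ec Ul.U.smult_closed[OF G1_closed], of ?c] emb.hom_smult[OF G1_closed, of ?c] Ec G1_closed
      by (simp add: Ul.U.minus_closed)
    finally have fe: "?f (E n i j) = Up_emb n (E n i j) \<ominus>\<^bsub>Up n\<^esub> ?c \<odot>\<^bsub>Up n\<^esub> Up_emb n (G1 n)" .
    show ?thesis
    proof (cases "i = j")
      case True
      then show ?thesis unfolding fe cls_ent[OF ij] using Up_X_closed cG_closed Up_emb_closed[OF Ec]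
        by (simp add: Up.minus_eq Up.minus_add Up.a_ac Up.r_neg Up.r_neg1 Up.r_neg2)
    next
      case False
      then show ?thesis unfolding fe cls_ent[OF ij] using Up_emb_closed[OF Ec] Up_emb_closed[OF G1_closed]
        by (simp add: Up.minus_eq)
    qed
  qed
  have "col_det (Up n) n (\<lambda>i j. ?f (E n i j) \<ominus>\<^bsub>Up n\<^esub> (if i = j then ?T \<oplus>\<^bsub>Up n\<^esub> of_nat i \<odot>\<^bsub>Up n\<^esub> \<one>\<^bsub>Up n\<^esub> else \<zero>\<^bsub>Up n\<^esub>)) =
      col_det (Up n) n (\<lambda>i j. cls (ent i j))"
    by (rule Up.col_det_cong) (simp_all only: ent Up_ops(1) ent_closed)
  also note col_det_Up
  finally obtain h where h: "h \<in> alg_hom (Up n) (Up n)" "\<forall>u\<in>carrier (U n). h (Up_emb n u) = ?f u" "h (Up_X n) = ?T"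
    using Up_hom_exists[OF f T comm] by blast
  have h2: "\<forall>w\<in>carrier (U n). h (Up_emb n w) = Up_emb n (Us_incl n (pi_g n w))" using h(2) fv by simp
  have "pi_g' n = h"
    unfolding pi_g'_def
  proof (rule the_equality)
    fix h' assume h': "h' \<in> alg_hom (Up n) (Up n) \<and>
      (\<forall>w\<in>carrier (U n). h' (Up_emb n w) = Up_emb n (Us_incl n (pi_g n w))) \<and> h' (Up_X n) = ?T"
    show "h' = h" by (rule Up_hom_eqI[OF Up.calg_axioms]) (use h h2 h' in simp_all)
  qed (use h h2 in blast)
  with h h2 show "pi_g' n \<in> alg_hom (Up n) (Up n)"
    "\<And>u. u \<in> carrier (U n) \<Longrightarrow> pi_g' n (Up_emb n u) = Up_emb n (Us_incl n (pi_g n u))"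
    "pi_g' n (Up_X n) = Up_X n \<ominus>\<^bsub>Up n\<^esub> cG" by simp_all
qed

sublocale pg': calg_hom "Up n" "Up n" "pi_g' n"
  by unfold_locales (rule pi_g'_hom)

lemma Up_emb_zero: "Up_emb n \<zero>\<^bsub>U n\<^esub> = \<zero>\<^bsub>Up n\<^esub>"
  using emb.hom_zero by simp

lemma pi_g'_G1: "pi_g' n (Up_emb n (G1 n)) = \<zero>\<^bsub>Up n\<^esub>"
  by (simp add: pi_g'_emb G1_closed pi_g_G1 Up_emb_zero)

lemma pi_g'_idem: "z \<in> carrier (Up n) \<Longrightarrow> pi_g' n (pi_g' n z) = pi_g' n z"
proof -
  assume z: "z \<in> carrier (Up n)"
  have "compose (carrier (Up n)) (pi_g' n) (pi_g' n) = pi_g' n"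
  proof (rule Up_hom_eqI[OF Up.calg_axioms calg_hom.hom[OF calg_hom_comp[OF pg'.calg_hom_axioms pg'.calg_hom_axioms]] pi_g'_hom])
    fix u assume "u \<in> carrier (U n)"
    then show "compose (carrier (Up n)) (pi_g' n) (pi_g' n) (Up_emb n u) = pi_g' n (Up_emb n u)"
      by (simp add: compose_def Up_emb_closed pi_g'_emb pi_incl)
  next
    show "compose (carrier (Up n)) (pi_g' n) (pi_g' n) (Up_X n) = pi_g' n (Up_X n)"
      using Up_X_closed cG_closed Up_emb_closed[OF G1_closed]
      by (simp add: compose_def pi_g'_X pg'.hom_diff pi_g'_G1) (simp add: Up.minus_eq)
  qed
  from fun_cong[OF this, of z] show ?thesis using z by (simp add: compose_def)
qed

end

section \<open>Reduction modulo the characteristic polynomial\<close>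

context rank
begin

text \<open>Generated by adding one monomial at a time, so that closure properties follow by induction; \<open>Up_normal_form\<close> collects the coefficients.\<close>

inductive_set below :: "nat \<Rightarrow> Upelem set" for m
  where below_zero: "\<zero>\<^bsub>Up n\<^esub> \<in> below m"
  | below_step: "\<lbrakk>z \<in> below m; k < m; u \<in> carrier (U n)\<rbrakk> \<Longrightarrow>
      z \<oplus>\<^bsub>Up n\<^esub> Up_emb n u \<otimes>\<^bsub>Up n\<^esub> Up_X n [^]\<^bsub>Up n\<^esub> k \<in> below m"

lemma X_pow_closed: "Up_X n [^]\<^bsub>Up n\<^esub> (k::nat) \<in> carrier (Up n)"
  by (rule Up.nat_pow_closed[OF Up_X_closed])

lemma mono_closed: "u \<in> carrier (U n) \<Longrightarrow> Up_emb n u \<otimes>\<^bsub>Up n\<^esub> Up_X n [^]\<^bsub>Up n\<^esub> (k::nat) \<in> carrier (Up n)"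
  by (intro Up.m_closed Up_emb_closed X_pow_closed)

lemma below_closed: "z \<in> below m \<Longrightarrow> z \<in> carrier (Up n)"
  by (induction rule: below.induct) (simp_all add: mono_closed)

lemma below_add: "\<lbrakk>w \<in> below m; z \<in> below m\<rbrakk> \<Longrightarrow> z \<oplus>\<^bsub>Up n\<^esub> w \<in> below m"
proof (induction rule: below.induct)
  case below_zero
  then show ?case using below_closed by simp
next
  case (below_step w k u)
  have "z \<oplus>\<^bsub>Up n\<^esub> (w \<oplus>\<^bsub>Up n\<^esub> Up_emb n u \<otimes>\<^bsub>Up n\<^esub> Up_X n [^]\<^bsub>Up n\<^esub> k) =
    (z \<oplus>\<^bsub>Up n\<^esub> w) \<oplus>\<^bsub>Up n\<^esub> Up_emb n u \<otimes>\<^bsub>Up n\<^esub> Up_X n [^]\<^bsub>Up n\<^esub> k"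
    using below_step below_closed mono_closed by (simp add: Up.a_assoc)
  then show ?case using below.below_step below_step by simp
qed

lemma below_mono: "\<lbrakk>z \<in> below m; m \<le> m'\<rbrakk> \<Longrightarrow> z \<in> below m'"
  by (induction rule: below.induct) (auto intro: below.intros)

lemma below_monomial: "\<lbrakk>k < m; u \<in> carrier (U n)\<rbrakk> \<Longrightarrow> Up_emb n u \<otimes>\<^bsub>Up n\<^esub> Up_X n [^]\<^bsub>Up n\<^esub> k \<in> below m"
  using below_step[OF below_zero, of k m u] mono_closed by simp

lemma emb_mult: "\<lbrakk>u \<in> carrier (U n); v \<in> carrier (U n)\<rbrakk> \<Longrightarrow> Up_emb n (u \<otimes>\<^bsub>U n\<^esub> v) = Up_emb n u \<otimes>\<^bsub>Up n\<^esub> Up_emb n v"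
  using emb.hom_mult[of u v] by simp

lemma emb_smult: "u \<in> carrier (U n) \<Longrightarrow> Up_emb n (c \<odot>\<^bsub>U n\<^esub> u) = c \<odot>\<^bsub>Up n\<^esub> Up_emb n u"
  using emb.hom_smult[of u c] by simp

lemma emb_add: "\<lbrakk>u \<in> carrier (U n); v \<in> carrier (U n)\<rbrakk> \<Longrightarrow> Up_emb n (u \<oplus>\<^bsub>U n\<^esub> v) = Up_emb n u \<oplus>\<^bsub>Up n\<^esub> Up_emb n v"
  using emb.hom_add[of u v] by simp

lemma emb_one: "Up_emb n \<one>\<^bsub>U n\<^esub> = \<one>\<^bsub>Up n\<^esub>"
  using emb.hom_one by simp

lemma below_emb_mult: "\<lbrakk>z \<in> below m; u \<in> carrier (U n)\<rbrakk> \<Longrightarrow> Up_emb n u \<otimes>\<^bsub>Up n\<^esub> z \<in> below m"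
proof (induction rule: below.induct)
  case below_zero
  then show ?case using below.below_zero Up_emb_closed by simp
next
  case (below_step z k v)
  have "Up_emb n u \<otimes>\<^bsub>Up n\<^esub> (z \<oplus>\<^bsub>Up n\<^esub> Up_emb n v \<otimes>\<^bsub>Up n\<^esub> Up_X n [^]\<^bsub>Up n\<^esub> k) =
    Up_emb n u \<otimes>\<^bsub>Up n\<^esub> z \<oplus>\<^bsub>Up n\<^esub> Up_emb n (u \<otimes>\<^bsub>U n\<^esub> v) \<otimes>\<^bsub>Up n\<^esub> Up_X n [^]\<^bsub>Up n\<^esub> k"
    using below_step below_closed[OF below_step(1)] X_pow_closed Up_emb_closed by (simp add: emb_mult Up.r_distr Up.m_assoc)
  then show ?case using below.below_step[of _ m k "u \<otimes>\<^bsub>U n\<^esub> v"] below_step by simp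
qed

lemma below_smult: "z \<in> below m \<Longrightarrow> c \<odot>\<^bsub>Up n\<^esub> z \<in> below m"
  using below_emb_mult[of z m "c \<odot>\<^bsub>U n\<^esub> \<one>\<^bsub>U n\<^esub>"] below_closed[of z m]
  by (simp add: emb_smult emb_one Up.smult_mult_l)

lemma X_mono: "u \<in> carrier (U n) \<Longrightarrow> Up_X n \<otimes>\<^bsub>Up n\<^esub> (Up_emb n u \<otimes>\<^bsub>Up n\<^esub> Up_X n [^]\<^bsub>Up n\<^esub> (k::nat)) =
  Up_emb n u \<otimes>\<^bsub>Up n\<^esub> Up_X n [^]\<^bsub>Up n\<^esub> Suc k"
proof -
  assume u: "u \<in> carrier (U n)"
  have "Up_X n \<otimes>\<^bsub>Up n\<^esub> (Up_emb n u \<otimes>\<^bsub>Up n\<^esub> Up_X n [^]\<^bsub>Up n\<^esub> k) = Up_emb n u \<otimes>\<^bsub>Up n\<^esub> (Up_X n \<otimes>\<^bsub>Up n\<^esub> Up_X n [^]\<^bsub>Up n\<^esub> k)"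
    using Up_X_comm[OF u] Up_X_closed X_pow_closed Up_emb_closed[OF u] by (simp add: Up.m_assoc[symmetric])
  then show ?thesis using Up.nat_pow_Suc2[OF Up_X_closed] by simp
qed

lemma below_X: "z \<in> below m \<Longrightarrow> Up_X n \<otimes>\<^bsub>Up n\<^esub> z \<in> below (Suc m)"
proof (induction rule: below.induct)
  case below_zero
  then show ?case using below.below_zero Up_X_closed by simp
next
  case (below_step z k u)
  have "Up_X n \<otimes>\<^bsub>Up n\<^esub> (z \<oplus>\<^bsub>Up n\<^esub> Up_emb n u \<otimes>\<^bsub>Up n\<^esub> Up_X n [^]\<^bsub>Up n\<^esub> k) =
    Up_X n \<otimes>\<^bsub>Up n\<^esub> z \<oplus>\<^bsub>Up n\<^esub> Up_emb n u \<otimes>\<^bsub>Up n\<^esub> Up_X n [^]\<^bsub>Up n\<^esub> Suc k"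
    using below_closed[OF below_step(1)] mono_closed[OF below_step(3)] Up_X_closed by (simp only: Up.r_distr X_mono[OF below_step(3)])
  then show ?case using below.below_step[OF below_step(4), of "Suc k" u] below_step(2,3) by simp
qed

lemma Up_expand:
  assumes cl: "a \<in> carrier (Up n)" "x \<in> carrier (Up n)" "q \<in> carrier (Up n)" "w \<in> carrier (Up n)"
  shows "(a \<oplus>\<^bsub>Up n\<^esub> d \<odot>\<^bsub>Up n\<^esub> x) \<otimes>\<^bsub>Up n\<^esub> (e \<odot>\<^bsub>Up n\<^esub> q \<oplus>\<^bsub>Up n\<^esub> w) =
    (d * e) \<odot>\<^bsub>Up n\<^esub> (x \<otimes>\<^bsub>Up n\<^esub> q) \<oplus>\<^bsub>Up n\<^esub> (a \<otimes>\<^bsub>Up n\<^esub> (e \<odot>\<^bsub>Up n\<^esub> q \<oplus>\<^bsub>Up n\<^esub> w) \<oplus>\<^bsub>Up n\<^esub> d \<odot>\<^bsub>Up n\<^esub> (x \<otimes>\<^bsub>Up n\<^esub> w))"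
proof -
  let ?r = "e \<odot>\<^bsub>Up n\<^esub> q \<oplus>\<^bsub>Up n\<^esub> w"
  have r: "?r \<in> carrier (Up n)" using cl by simp
  have "(a \<oplus>\<^bsub>Up n\<^esub> d \<odot>\<^bsub>Up n\<^esub> x) \<otimes>\<^bsub>Up n\<^esub> ?r = a \<otimes>\<^bsub>Up n\<^esub> ?r \<oplus>\<^bsub>Up n\<^esub> d \<odot>\<^bsub>Up n\<^esub> (x \<otimes>\<^bsub>Up n\<^esub> ?r)"
    by (simp only: Up.l_distr Up.smult_mult_l Up.smult_closed cl r)
  also have "d \<odot>\<^bsub>Up n\<^esub> (x \<otimes>\<^bsub>Up n\<^esub> ?r) = (d * e) \<odot>\<^bsub>Up n\<^esub> (x \<otimes>\<^bsub>Up n\<^esub> q) \<oplus>\<^bsub>Up n\<^esub> d \<odot>\<^bsub>Up n\<^esub> (x \<otimes>\<^bsub>Up n\<^esub> w)"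
    by (simp only: Up.r_distr Up.smult_mult_r Up.smult_r_distr Up.smult_assoc Up.smult_closed Up.m_closed cl)
  finally show ?thesis
    using Up.a_lcomm Up.m_closed[OF cl(1) r] Up.m_closed[OF cl(2,3)] Up.m_closed[OF cl(2,4)] by (simp only: Up.smult_closed)
qed

text \<open>Only diagonal entries contain the variable, each with coefficient minus one, so the top power arises from the choice of all diagonal entries.\<close>

lemma column_product:
  assumes p: "\<And>j. j \<in> set js \<Longrightarrow> j \<le> n \<and> p j \<le> n"
  shows "\<exists>w\<in>below (length js). foldr (\<lambda>j q. cls (ent (p j) j) \<otimes>\<^bsub>Up n\<^esub> q) js \<one>\<^bsub>Up n\<^esub> =
    (if \<forall>j\<in>set js. p j = j then (- 1) ^ length js else 0) \<odot>\<^bsub>Up n\<^esub> Up_X n [^]\<^bsub>Up n\<^esub> length js \<oplus>\<^bsub>Up n\<^esub> w"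
  using p
proof (induction js)
  case Nil
  show ?case by (rule bexI[OF _ below_zero]) simp
next
  case (Cons j js)
  let ?l = "length js" and ?e = "(if \<forall>j\<in>set js. p j = j then (- 1) ^ length js else 0) :: complex"
  let ?d = "(if p j = j then - 1 else 0) :: complex"
  obtain w where w: "w \<in> below ?l" "foldr (\<lambda>j q. cls (ent (p j) j) \<otimes>\<^bsub>Up n\<^esub> q) js \<one>\<^bsub>Up n\<^esub> =
      ?e \<odot>\<^bsub>Up n\<^esub> Up_X n [^]\<^bsub>Up n\<^esub> ?l \<oplus>\<^bsub>Up n\<^esub> w"
    using Cons by auto
  have traceless: "j \<le> n" "p j \<le> n" using Cons.prems by auto
  define u where "u = E n (p j) j \<oplus>\<^bsub>U n\<^esub> (?d * of_nat j) \<odot>\<^bsub>U n\<^esub> \<one>\<^bsub>U n\<^esub>"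
  have Ec: "E n (p j) j \<in> carrier (U n)" using traceless by (intro Ul.Eg_closed) auto
  have u: "u \<in> carrier (U n)" unfolding u_def using Ec by simp
  note cl = Up_emb_closed[OF u] Up_X_closed X_pow_closed[of ?l] below_closed[OF w(1)]
  have en: "cls (ent (p j) j) = Up_emb n u \<oplus>\<^bsub>Up n\<^esub> ?d \<odot>\<^bsub>Up n\<^esub> Up_X n"
    unfolding cls_ent[OF traceless(2,1)] u_def using Ec Up_emb_closed[OF Ec] Up_X_closed
    by (cases "p j = j") (simp_all add: emb_add emb_smult emb_one Up.minus_eq Up.minus_add Up.a_ac Up.smult_uminus_l)
  let ?w = "(Up_emb n u \<otimes>\<^bsub>Up n\<^esub> (?e \<odot>\<^bsub>Up n\<^esub> Up_X n [^]\<^bsub>Up n\<^esub> ?l \<oplus>\<^bsub>Up n\<^esub> w)) \<oplus>\<^bsub>Up n\<^esub> ?d \<odot>\<^bsub>Up n\<^esub> (Up_X n \<otimes>\<^bsub>Up n\<^esub> w)"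
  have "foldr (\<lambda>j q. cls (ent (p j) j) \<otimes>\<^bsub>Up n\<^esub> q) (j # js) \<one>\<^bsub>Up n\<^esub> =
     (Up_emb n u \<oplus>\<^bsub>Up n\<^esub> ?d \<odot>\<^bsub>Up n\<^esub> Up_X n) \<otimes>\<^bsub>Up n\<^esub> (?e \<odot>\<^bsub>Up n\<^esub> Up_X n [^]\<^bsub>Up n\<^esub> ?l \<oplus>\<^bsub>Up n\<^esub> w)"
    using w(2) en by simp
  also have "\<dots> = (?d * ?e) \<odot>\<^bsub>Up n\<^esub> (Up_X n \<otimes>\<^bsub>Up n\<^esub> Up_X n [^]\<^bsub>Up n\<^esub> ?l) \<oplus>\<^bsub>Up n\<^esub> ?w"
    by (rule Up_expand) (use cl in simp_all)
  also have "Up_X n \<otimes>\<^bsub>Up n\<^esub> Up_X n [^]\<^bsub>Up n\<^esub> ?l = Up_X n [^]\<^bsub>Up n\<^esub> length (j # js)"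
    using Up.nat_pow_Suc2[OF Up_X_closed] by simp
  also have "?d * ?e = (if \<forall>j\<in>set (j # js). p j = j then (- 1) ^ length (j # js) else 0)"
    by auto
  finally have eq: "foldr (\<lambda>j q. cls (ent (p j) j) \<otimes>\<^bsub>Up n\<^esub> q) (j # js) \<one>\<^bsub>Up n\<^esub> =
    (if \<forall>j\<in>set (j # js). p j = j then (- 1) ^ length (j # js) else 0) \<odot>\<^bsub>Up n\<^esub> Up_X n [^]\<^bsub>Up n\<^esub> length (j # js) \<oplus>\<^bsub>Up n\<^esub> ?w" .
  have pw: "?e \<odot>\<^bsub>Up n\<^esub> Up_X n [^]\<^bsub>Up n\<^esub> ?l \<in> below (Suc ?l)"
    using below_smult[OF below_monomial[of ?l "Suc ?l" "\<one>\<^bsub>U n\<^esub>"], of ?e] X_pow_closed by (simp add: emb_one)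
  have "?w \<in> below (Suc ?l)"
    by (intro below_add below_emb_mult[OF _ u] below_smult below_X pw below_mono[OF w(1)] w(1)) simp
  then show ?case using eq by (intro bexI) simp_all
qed

text \<open>In the determinant the top power comes from the identity permutation only and has coefficient one up to sign, so it can be solved for.\<close>

lemma X_top: "Up_X n [^]\<^bsub>Up n\<^esub> Suc n \<in> below (Suc n)"
proof -
  let ?S = "{p. p permutes {0..n}}"
  define t where "t p = of_int (sign p) \<odot>\<^bsub>Up n\<^esub> foldr (\<lambda>j q. cls (ent (p j) j) \<otimes>\<^bsub>Up n\<^esub> q) [0..<Suc n] \<one>\<^bsub>Up n\<^esub>" for p
  let ?e = "\<lambda>p. (if p = id then (- 1) ^ Suc n else 0) :: complex"
  let ?P = "Up_X n [^]\<^bsub>Up n\<^esub> Suc n"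
  have ex: "\<exists>w\<in>below (Suc n). t p = ?e p \<odot>\<^bsub>Up n\<^esub> ?P \<oplus>\<^bsub>Up n\<^esub> w" if p: "p \<in> ?S" for p
  proof -
    have le: "p j \<le> n" if "j \<le> n" for j using p permutes_in_image[of p "{0..n}" j] that by simp
    have "\<exists>w\<in>below (length [0..<Suc n]). foldr (\<lambda>j q. cls (ent (p j) j) \<otimes>\<^bsub>Up n\<^esub> q) [0..<Suc n] \<one>\<^bsub>Up n\<^esub> =
      (if \<forall>j\<in>set [0..<Suc n]. p j = j then (- 1) ^ length [0..<Suc n] else 0) \<odot>\<^bsub>Up n\<^esub> Up_X n [^]\<^bsub>Up n\<^esub> length [0..<Suc n] \<oplus>\<^bsub>Up n\<^esub> w"
    proof (rule column_product[of "[0..<Suc n]" p])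
      fix j assume "j \<in> set [0..<Suc n]"
      then have "j \<le> n" by (simp only: set_upt atLeastLessThan_iff less_Suc_eq_le)
      with le show "j \<le> n \<and> p j \<le> n" by blast
    qed
    then obtain w where w: "w \<in> below (Suc n)" "foldr (\<lambda>j q. cls (ent (p j) j) \<otimes>\<^bsub>Up n\<^esub> q) [0..<Suc n] \<one>\<^bsub>Up n\<^esub> =
      (if \<forall>j\<in>{0..<Suc n}. p j = j then (- 1) ^ Suc n else 0) \<odot>\<^bsub>Up n\<^esub> ?P \<oplus>\<^bsub>Up n\<^esub> w"
      unfolding length_upt diff_zero set_upt by (rule bexE)
    have "(\<forall>j\<in>{0..<Suc n}. p j = j) \<longleftrightarrow> p = id"
    proof
      assume fx: "\<forall>j\<in>{0..<Suc n}. p j = j"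
      show "p = id"
      proof
        fix j show "p j = id j" using fx permutes_not_in[of p "{0..n}" j] p by (cases "j \<le> n") auto
      qed
    qed simp
    then have "t p = of_int (sign p) \<odot>\<^bsub>Up n\<^esub> (?e p \<odot>\<^bsub>Up n\<^esub> ?P \<oplus>\<^bsub>Up n\<^esub> w)"
      unfolding t_def w(2) by simp
    also have "\<dots> = (of_int (sign p) * ?e p) \<odot>\<^bsub>Up n\<^esub> ?P \<oplus>\<^bsub>Up n\<^esub> of_int (sign p) \<odot>\<^bsub>Up n\<^esub> w"
      using X_pow_closed[of "Suc n"] below_closed[OF w(1)] by (simp only: Up.smult_r_distr Up.smult_assoc Up.smult_closed)
    also have "of_int (sign p) * ?e p = ?e p" by (simp add: sign_id)
    finally show ?thesis using below_smult[OF w(1)] by blast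
  qed
  define w where "w p = (SOME w. w \<in> below (Suc n) \<and> t p = ?e p \<odot>\<^bsub>Up n\<^esub> ?P \<oplus>\<^bsub>Up n\<^esub> w)" for p
  have w: "w p \<in> below (Suc n)" "t p = ?e p \<odot>\<^bsub>Up n\<^esub> ?P \<oplus>\<^bsub>Up n\<^esub> w p" if "p \<in> ?S" for p
    using someI_ex[OF ex[OF that, unfolded Bex_def]] unfolding w_def by blast+
  have fin: "finite ?S" by (simp add: finite_permutations)
  have sum_lo: "(\<Oplus>\<^bsub>Up n\<^esub>p\<in>T. w p) \<in> below (Suc n)" if "finite T" "T \<subseteq> ?S" for T
    using that
  proof (induction T rule: finite_induct)
    case empty
    then show ?case using below_zero by simp
  next
    case (insert p T)
    have "w q \<in> carrier (Up n)" if "q \<in> insert p T" for q using w(1)[of q] below_closed insert.prems that by blast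
    then show ?case using insert w(1)[of p] below_add by (simp add: Pi_iff)
  qed
  have wc: "w p \<in> carrier (Up n)" if "p \<in> ?S" for p using w(1)[OF that] by (rule below_closed)
  have "\<zero>\<^bsub>Up n\<^esub> = (\<Oplus>\<^bsub>Up n\<^esub>p\<in>?S. t p)"
    unfolding col_det_Up[symmetric] col_det_def t_def ..
  also have "\<dots> = (\<Oplus>\<^bsub>Up n\<^esub>p\<in>?S. ?e p \<odot>\<^bsub>Up n\<^esub> ?P \<oplus>\<^bsub>Up n\<^esub> w p)"
    by (rule Up.finsum_cong') (use w(2) wc X_pow_closed[of "Suc n"] in \<open>simp_all del: Up.nat_pow_Suc\<close>)
  also have "\<dots> = (\<Oplus>\<^bsub>Up n\<^esub>p\<in>?S. ?e p \<odot>\<^bsub>Up n\<^esub> ?P) \<oplus>\<^bsub>Up n\<^esub> (\<Oplus>\<^bsub>Up n\<^esub>p\<in>?S. w p)"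
    by (rule Up.finsum_addf) (use wc X_pow_closed[of "Suc n"] in \<open>simp_all del: Up.nat_pow_Suc\<close>)
  also have "(\<Oplus>\<^bsub>Up n\<^esub>p\<in>?S. ?e p \<odot>\<^bsub>Up n\<^esub> ?P) = (\<Sum>p\<in>?S. ?e p) \<odot>\<^bsub>Up n\<^esub> ?P"
    by (rule Up.finsum_smult_scalar[OF fin X_pow_closed])
  also have "(\<Sum>p\<in>?S. ?e p) = (- 1) ^ Suc n" using fin permutes_id by (simp add: sum.delta)
  finally have z: "\<zero>\<^bsub>Up n\<^esub> = (- 1) ^ Suc n \<odot>\<^bsub>Up n\<^esub> ?P \<oplus>\<^bsub>Up n\<^esub> (\<Oplus>\<^bsub>Up n\<^esub>p\<in>?S. w p)" .
  have W: "(\<Oplus>\<^bsub>Up n\<^esub>p\<in>?S. w p) \<in> below (Suc n)" by (rule sum_lo[OF fin order_refl])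
  have "(- 1) ^ Suc n \<odot>\<^bsub>Up n\<^esub> ?P = \<ominus>\<^bsub>Up n\<^esub> (\<Oplus>\<^bsub>Up n\<^esub>p\<in>?S. w p)"
    by (rule Up.minus_equality[symmetric]) (use z below_closed[OF W] X_pow_closed[of "Suc n"] in \<open>simp_all only: Up.smult_closed\<close>)
  then have "(- 1) ^ Suc n \<odot>\<^bsub>Up n\<^esub> ((- 1) ^ Suc n \<odot>\<^bsub>Up n\<^esub> ?P) = (- 1) ^ Suc n \<odot>\<^bsub>Up n\<^esub> ((- 1) \<odot>\<^bsub>Up n\<^esub> (\<Oplus>\<^bsub>Up n\<^esub>p\<in>?S. w p))"
    using below_closed[OF W] by (simp only: Up.smult_minus1)
  moreover have "(- 1) ^ Suc n \<odot>\<^bsub>Up n\<^esub> ((- 1) ^ Suc n \<odot>\<^bsub>Up n\<^esub> ?P) = ?P"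
    unfolding Up.smult_assoc[OF X_pow_closed] power_mult_distrib[symmetric]
    using X_pow_closed[of "Suc n"] by (simp del: Up.nat_pow_Suc)
  ultimately have "?P = (- 1) ^ Suc n \<odot>\<^bsub>Up n\<^esub> ((- 1) \<odot>\<^bsub>Up n\<^esub> (\<Oplus>\<^bsub>Up n\<^esub>p\<in>?S. w p))"
    by (rule trans[OF sym, rotated])
  then show ?thesis by (rule ssubst) (rule below_smult[OF below_smult[OF W]])
qed

lemma all_below: "z \<in> carrier (Up n) \<Longrightarrow> z \<in> below (Suc n)"
proof -
  have X: "Up_X n \<otimes>\<^bsub>Up n\<^esub> y \<in> below (Suc n)" if "y \<in> below (Suc n)" for y
    using that
  proof (induction rule: below.induct)
    case below_zero
    then show ?case using below.below_zero Up_X_closed by simp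
  next
    case (below_step y k u)
    have "Up_emb n u \<otimes>\<^bsub>Up n\<^esub> Up_X n [^]\<^bsub>Up n\<^esub> Suc k \<in> below (Suc n)"
    proof (cases "k = n")
      case True
      then show ?thesis using below_emb_mult[OF X_top below_step(3)] by simp
    next
      case False
      then show ?thesis using below_step by (intro below_monomial) auto
    qed
    moreover have "Up_X n \<otimes>\<^bsub>Up n\<^esub> (y \<oplus>\<^bsub>Up n\<^esub> Up_emb n u \<otimes>\<^bsub>Up n\<^esub> Up_X n [^]\<^bsub>Up n\<^esub> k) =
      Up_X n \<otimes>\<^bsub>Up n\<^esub> y \<oplus>\<^bsub>Up n\<^esub> Up_emb n u \<otimes>\<^bsub>Up n\<^esub> Up_X n [^]\<^bsub>Up n\<^esub> Suc k"
      using below_closed[OF below_step(1)] mono_closed[OF below_step(3)] Up_X_closed by (simp only: Up.r_distr X_mono[OF below_step(3)])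
    ultimately show ?case using below_add below_step(4) by simp
  qed
  have m: "Up_emb n u \<otimes>\<^bsub>Up n\<^esub> Up_X n [^]\<^bsub>Up n\<^esub> (i::nat) \<in> below (Suc n)" if u: "u \<in> carrier (U n)" for u i
  proof (induction i)
    case 0
    show ?case by (rule below_monomial[OF _ u]) simp
  next
    case (Suc i)
    show ?case using X[OF Suc] unfolding X_mono[OF u] .
  qed
  assume "z \<in> carrier (Up n)"
  then obtain p where p: "p \<in> carrier (UP (U n))" "z = cls p" by (rule Up_carrierE) simp
  have "cls p \<in> below (Suc n)" using p(1)
  proof (induction p rule: UP.poly_induct)
    case (mon u i)
    then show ?case using m by (simp only: cls_mon)
  next
    case (add p q)
    have "cls (p \<oplus>\<^bsub>UP (U n)\<^esub> q) = cls p \<oplus>\<^bsub>Up n\<^esub> cls q" using Up_ops(3)[of p q] add by simp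
    then show ?case using add below_add by simp
  qed
  with p show ?thesis by simp
qed

lemma Up_normal_form:
  assumes "z \<in> carrier (Up n)"
  shows "\<exists>u. (\<forall>k. u k \<in> carrier (U n)) \<and> z = (\<Oplus>\<^bsub>Up n\<^esub>k\<in>{0..n}. Up_emb n (u k) \<otimes>\<^bsub>Up n\<^esub> Up_X n [^]\<^bsub>Up n\<^esub> k)"
  using all_below[OF assms]
proof (induction rule: below.induct)
  case below_zero
  have "(\<Oplus>\<^bsub>Up n\<^esub>k\<in>{0..n}. Up_emb n \<zero>\<^bsub>U n\<^esub> \<otimes>\<^bsub>Up n\<^esub> Up_X n [^]\<^bsub>Up n\<^esub> k) = \<zero>\<^bsub>Up n\<^esub>"
    by (rule Up.add.finprod_one_eqI) (simp add: Up_emb_zero X_pow_closed)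
  then show ?case by (intro exI[of _ "\<lambda>k. \<zero>\<^bsub>U n\<^esub>"]) simp
next
  case (below_step z k v)
  then obtain u where u: "\<And>k. u k \<in> carrier (U n)" "z = (\<Oplus>\<^bsub>Up n\<^esub>k\<in>{0..n}. Up_emb n (u k) \<otimes>\<^bsub>Up n\<^esub> Up_X n [^]\<^bsub>Up n\<^esub> k)" by blast
  let ?m = "\<lambda>u i. Up_emb n u \<otimes>\<^bsub>Up n\<^esub> Up_X n [^]\<^bsub>Up n\<^esub> (i::nat)"
  let ?u = "\<lambda>i. if k = i then u i \<oplus>\<^bsub>U n\<^esub> v else u i"
  have "(\<Oplus>\<^bsub>Up n\<^esub>i\<in>{0..n}. ?m (?u i) i) = (\<Oplus>\<^bsub>Up n\<^esub>i\<in>{0..n}. ?m (u i) i \<oplus>\<^bsub>Up n\<^esub> (if k = i then ?m v i else \<zero>\<^bsub>Up n\<^esub>))"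
  proof (rule Up.finsum_cong'[OF refl])
    show "(\<lambda>i. ?m (u i) i \<oplus>\<^bsub>Up n\<^esub> (if k = i then ?m v i else \<zero>\<^bsub>Up n\<^esub>)) \<in> {0..n} \<rightarrow> carrier (Up n)"
      using u(1) below_step(3) mono_closed by simp
    fix i
    show "?m (?u i) i = ?m (u i) i \<oplus>\<^bsub>Up n\<^esub> (if k = i then ?m v i else \<zero>\<^bsub>Up n\<^esub>)"
      using u(1)[of i] below_step(3) mono_closed[OF u(1), of i] Up_emb_closed[OF u(1), of i] Up_emb_closed[OF below_step(3)] X_pow_closed[of i]
      by (simp add: emb_add Up.l_distr)
  qed
  also have "\<dots> = (\<Oplus>\<^bsub>Up n\<^esub>i\<in>{0..n}. ?m (u i) i) \<oplus>\<^bsub>Up n\<^esub> (\<Oplus>\<^bsub>Up n\<^esub>i\<in>{0..n}. if k = i then ?m v i else \<zero>\<^bsub>Up n\<^esub>)"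
    by (rule Up.finsum_addf) (use u(1) below_step(3) mono_closed in simp_all)
  also have "(\<Oplus>\<^bsub>Up n\<^esub>i\<in>{0..n}. if k = i then ?m v i else \<zero>\<^bsub>Up n\<^esub>) = ?m v k"
    by (rule Up.add.finprod_singleton) (use below_step(2,3) mono_closed in simp_all)
  finally have "z \<oplus>\<^bsub>Up n\<^esub> ?m v k = (\<Oplus>\<^bsub>Up n\<^esub>i\<in>{0..n}. ?m (?u i) i)" using u(2) by simp
  then show ?case using u(1) below_step(3) by (intro exI[of _ ?u]) simp
qed

section \<open>The kernels\<close>

lemma a_kernel_iff: "x \<in> a_kernel R S h \<longleftrightarrow> x \<in> carrier R \<and> h x = \<zero>\<^bsub>S\<^esub>"
  by (simp add: a_kernel_def')

lemma finsum_ideal: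
  assumes "ideal I (Up n)" "finite K" "\<And>k. k \<in> K \<Longrightarrow> f k \<in> I"
  shows "(\<Oplus>\<^bsub>Up n\<^esub>k\<in>K. f k) \<in> I"
proof -
  interpret I: ideal I "Up n" by fact
  show ?thesis using assms(2,3)
  proof (induction K rule: finite_induct)
    case empty
    then show ?case using I.zero_closed by simp
  next
    case (insert k K)
    have "f i \<in> carrier (Up n)" if "i \<in> insert k K" for i using I.a_Hcarr insert.prems[OF that] .
    then show ?case using insert I.a_closed by (simp add: Pi_iff)
  qed
qed

lemma rho_s_inj: "\<lbrakk>u \<in> carrier (Us n); rho_s n u = \<zero>\<^bsub>Tgt n\<^esub>\<rbrakk> \<Longrightarrow> u = \<zero>\<^bsub>Us n\<^esub>"
proof -
  assume u: "u \<in> carrier (Us n)" "rho_s n u = \<zero>\<^bsub>Tgt n\<^esub>"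
  let ?v = "\<lambda>k::nat. if k = 0 then u else \<zero>\<^bsub>Us n\<^esub>"
  have "(\<Oplus>\<^bsub>Tgt n\<^esub>k\<in>{0..n}. rho_s n (?v k) \<otimes>\<^bsub>Tgt n\<^esub> th [^]\<^bsub>Tgt n\<^esub> k) = \<zero>\<^bsub>Tgt n\<^esub>"
    by (rule TP.T.add.finprod_one_eqI) (simp add: u)
  then have "?v 0 = \<zero>\<^bsub>Us n\<^esub>" by (rule power_independence[rotated]) (use u in auto)
  then show ?thesis by simp
qed

lemma ker_rho': "a_kernel (Up n) (Tgt n) (rho' n) = Idl\<^bsub>Up n\<^esub> {Up_emb n (G1 n)}"
proof
  let ?I = "Idl\<^bsub>Up n\<^esub> {Up_emb n (G1 n)}"
  have I: "ideal ?I (Up n)" by (rule Up.genideal_ideal) (simp add: Up_emb_closed G1_closed)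
  have G: "Up_emb n (G1 n) \<in> ?I" by (rule Up.genideal_self') (simp add: Up_emb_closed G1_closed)
  show "?I \<subseteq> a_kernel (Up n) (Tgt n) (rho' n)"
    by (rule Up.genideal_minimal[OF rho'.kernel_is_ideal])
       (simp only: insert_subset empty_subsetI a_kernel_iff rho'_emb[OF G1_closed] rho_G1 Up_emb_closed[OF G1_closed] simp_thms)
  show "a_kernel (Up n) (Tgt n) (rho' n) \<subseteq> ?I"
  proof
    fix z assume "z \<in> a_kernel (Up n) (Tgt n) (rho' n)"
    then have z: "z \<in> carrier (Up n)" "rho' n z = \<zero>\<^bsub>Tgt n\<^esub>" by (simp_all only: a_kernel_iff simp_thms)
    obtain u where u: "\<And>k. u k \<in> carrier (U n)" and zu: "z = (\<Oplus>\<^bsub>Up n\<^esub>k\<in>{0..n}. Up_emb n (u k) \<otimes>\<^bsub>Up n\<^esub> Up_X n [^]\<^bsub>Up n\<^esub> k)"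
      using Up_normal_form[OF z(1)] by blast
    have pw: "rho' n (Up_X n [^]\<^bsub>Up n\<^esub> (k::nat)) = th [^]\<^bsub>Tgt n\<^esub> k" for k
      by (induction k) (simp_all add: Up_X_closed rho'_X)
    have "rho' n z = (\<Oplus>\<^bsub>Tgt n\<^esub>k\<in>{0..n}. rho' n (Up_emb n (u k) \<otimes>\<^bsub>Up n\<^esub> Up_X n [^]\<^bsub>Up n\<^esub> k))"
      unfolding zu using mono_closed[OF u] by (simp add: Pi_iff comp_def del: rho'.hom_mult)
    also have "\<dots> = (\<Oplus>\<^bsub>Tgt n\<^esub>k\<in>{0..n}. rho_s n (pi_g n (u k)) \<otimes>\<^bsub>Tgt n\<^esub> th [^]\<^bsub>Tgt n\<^esub> k)"
      by (rule TP.T.finsum_cong') (use u in \<open>simp_all add: pw X_pow_closed Up_emb_closed rho'_emb rho_pi\<close>)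
    finally have s: "(\<Oplus>\<^bsub>Tgt n\<^esub>k\<in>{0..n}. rho_s n (pi_g n (u k)) \<otimes>\<^bsub>Tgt n\<^esub> th [^]\<^bsub>Tgt n\<^esub> k) = \<zero>\<^bsub>Tgt n\<^esub>"
      using z(2) by simp
    have "Up_emb n (u k) \<otimes>\<^bsub>Up n\<^esub> Up_X n [^]\<^bsub>Up n\<^esub> k \<in> ?I" if k: "k \<in> {0..n}" for k
    proof (rule ideal.I_r_closed[OF I _ X_pow_closed])
      have "pi_g n (u k) = \<zero>\<^bsub>Us n\<^esub>"
        by (rule power_independence[OF _ s]) (use u k in auto)
      then show "Up_emb n (u k) \<in> ?I"
        using proj_mod[OF emb.calg_hom_axioms I _ u[of k]] G G1_closed u[of k] Up_emb_closed[OF u[of k]]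
        by (simp add: Up_emb_zero Up.minus_eq)
    qed
    then show "z \<in> ?I" unfolding zu by (intro finsum_ideal[OF I]) simp_all
  qed
qed

lemma ker_rho: "a_kernel (U n) (Tgt n) (rho n) = Idl\<^bsub>U n\<^esub> {G1 n}"
proof
  let ?I = "Idl\<^bsub>U n\<^esub> {G1 n}"
  have I: "ideal ?I (U n)" by (rule Ul.U.genideal_ideal) (simp add: G1_closed)
  have G: "G1 n \<in> ?I" by (rule Ul.U.genideal_self'[OF G1_closed])
  show "?I \<subseteq> a_kernel (U n) (Tgt n) (rho n)"
    by (rule Ul.U.genideal_minimal[OF rho.kernel_is_ideal]) (simp only: insert_subset empty_subsetI a_kernel_iff G1_closed rho_G1 simp_thms)
  show "a_kernel (U n) (Tgt n) (rho n) \<subseteq> ?I"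
  proof
    fix u assume "u \<in> a_kernel (U n) (Tgt n) (rho n)"
    then have u: "u \<in> carrier (U n)" "rho n u = \<zero>\<^bsub>Tgt n\<^esub>" by (simp_all only: a_kernel_iff simp_thms)
    have 0: "pi_g n u = \<zero>\<^bsub>Us n\<^esub>" by (rule rho_s_inj) (use u rho_pi in simp_all)
    have i: "calg_hom (U n) (U n) (\<lambda>u\<in>carrier (U n). u)"
      by unfold_locales (rule alg_homI; simp)
    show "u \<in> ?I"
      using proj_mod[OF i I _ u(1)] G G1_closed u(1) by (simp add: 0 Ul.U.minus_eq)
  qed
qed

lemma ker_rho_s: "a_kernel (Us n) (Tgt n) (rho_s n) = Idl\<^bsub>Us n\<^esub> {\<zero>\<^bsub>Us n\<^esub>}"
  unfolding Sl.U.genideal_zero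
proof (intro equalityI subsetI)
  fix u assume "u \<in> a_kernel (Us n) (Tgt n) (rho_s n)"
  then show "u \<in> {\<zero>\<^bsub>Us n\<^esub>}" using rho_s_inj by (simp only: a_kernel_iff singleton_iff)
next
  fix u assume "u \<in> {\<zero>\<^bsub>Us n\<^esub>}"
  then show "u \<in> a_kernel (Us n) (Tgt n) (rho_s n)"
    by (simp only: a_kernel_iff singleton_iff rs.hom_zero Sl.U.zero_closed simp_thms)
qed

text \<open>An element of the image of the projection is fixed by it; if it lies in the kernel, it belongs to the ideal of \<open>G1\<close>, which the projection kills.\<close>

lemma ker_rho_s': "a_kernel (Usp n) (Tgt n) (rho_s' n) = Idl\<^bsub>Usp n\<^esub> {\<zero>\<^bsub>Usp n\<^esub>}"
proof -
  have ring: "ring (Usp n)" unfolding Usp_def by (rule pg'.img_is_ring)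
  have c: "carrier (Usp n) = pi_g' n ` carrier (Up n)" "\<zero>\<^bsub>Usp n\<^esub> = \<zero>\<^bsub>Up n\<^esub>" by (simp_all add: Usp_def)
  have inj: "z = \<zero>\<^bsub>Up n\<^esub>" if zs: "z \<in> carrier (Usp n)" "rho_s' n z = \<zero>\<^bsub>Tgt n\<^esub>" for z
  proof -
    obtain y where y: "y \<in> carrier (Up n)" "z = pi_g' n y" using zs(1) unfolding c(1) by blast
    then have zc: "z \<in> carrier (Up n)" by simp
    have "z \<in> a_kernel (Up n) (Tgt n) (rho' n)"
      unfolding a_kernel_iff using zs zc by (simp add: rho_s'_def)
    also have "\<dots> \<subseteq> a_kernel (Up n) (Up n) (pi_g' n)" unfolding ker_rho'
      by (rule Up.genideal_minimal[OF pg'.kernel_is_ideal]) (simp only: insert_subset empty_subsetI a_kernel_iff pi_g'_G1 Up_emb_closed[OF G1_closed] simp_thms)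
    finally have "pi_g' n z = \<zero>\<^bsub>Up n\<^esub>" by (simp only: a_kernel_iff)
    then show ?thesis using y pi_g'_idem[OF y(1)] by simp
  qed
  have zero: "\<zero>\<^bsub>Usp n\<^esub> \<in> carrier (Usp n)" "rho_s' n \<zero>\<^bsub>Usp n\<^esub> = \<zero>\<^bsub>Tgt n\<^esub>"
    using ring.ring_simprules(2)[OF ring] by (simp_all add: rho_s'_def) (simp add: c(2))
  show ?thesis
    unfolding ring.genideal_zero[OF ring]
  proof (intro equalityI subsetI)
    fix z assume "z \<in> a_kernel (Usp n) (Tgt n) (rho_s' n)"
    then show "z \<in> {\<zero>\<^bsub>Usp n\<^esub>}" using inj[of z] unfolding a_kernel_iff c(2) by blast
  next
    fix z assume "z \<in> {\<zero>\<^bsub>Usp n\<^esub>}"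
    then show "z \<in> a_kernel (Usp n) (Tgt n) (rho_s' n)" using zero unfolding a_kernel_iff by blast
  qed
qed

end

theorem theorem6p13:
  fixes n :: nat
  assumes "n \<ge> 1"
  shows "(a_kernel (Up n) (Tgt n) (rho' n) = Idl\<^bsub>Up n\<^esub> {Up_emb n (G1 n)} \<and>
          a_kernel (U n) (Tgt n) (rho n) = Idl\<^bsub>U n\<^esub> {G1 n}) \<and>
         (a_kernel (Usp n) (Tgt n) (rho_s' n) = Idl\<^bsub>Usp n\<^esub> {\<zero>\<^bsub>Usp n\<^esub>} \<and>
          a_kernel (Us n) (Tgt n) (rho_s n) = Idl\<^bsub>Us n\<^esub> {\<zero>\<^bsub>Us n\<^esub>})"
proof -
  interpret rank n by unfold_locales (rule assms)
  show ?thesis using ker_rho' ker_rho ker_rho_s' ker_rho_s by blast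
qed

end
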